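(* Let $K$ be a finite extension of $\mathbb{Q}_\ell$ or a finite field, $L/K$ a Galois extension, $G$ a finite or compact topological group, and let $[\rho]\in \mathrm{GLReps}_n(G,L/K)$ or $[\rho]\in\mathrm{GSpReps}_n(G,L/K)$ (with $n$ even in the latter case). Let $$I_{[\rho]}:=\bigcap_{\epsilon\in\mathcal{E}\text{ s.t. }\exists (\gamma,\epsilon)\in\mathcal{G}_{[\rho]}}\ker(\epsilon)\subseteq G,$$ and assume that the restriction of $\rho$ to $I_{[\rho]}$ is (residually) absolutely irreducible. Then the equivalence class of $\rho^{\mathrm{proj}}$ has a member that factors through $\mathrm{PGL}_n(K_{[\rho]})$ (if $[\rho]\in\mathrm{GLReps}_n(G,L/K)$), respectively through $\mathrm{PGSp}_n(K_{[\rho]})$ (if $[\rho]\in\mathrm{GSpReps}_n(G,L/K)$). Moreover, $K_{[\rho]}$ is the smallest field $\tilde K$ with $K\subseteq\tilde K\subseteq L$ having this property (i.e. such that the equivalence class of $\rho^{\mathrm{proj}}$ has a member factoring through $\mathrm{PGL}_n(\tilde K)$, respectively $\mathrm{PGSp}_n(\tilde K)$).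
   Context: All representations and characters are continuous. $K$ is a finite extension of $\mathbb{Q}_\ell$ ($\ell$ prime, $\ell$-adic topology) or a finite field (discrete topology); $L/K$ is a (possibly infinite) Galois extension and $\Gamma=\mathrm{Gal}(L/K)$ with the Krull topology. "(Residually) absolutely irreducible" means residually absolutely irreducible if $K$ is $\ell$-adic, and absolutely irreducible if $K$ is finite. $\mathcal{E}$ is the group of characters $\epsilon:G\to L^\times$; $\Gamma$ acts on it by ${}^\gamma\epsilon=\gamma\circ\epsilon$. $\mathcal{G}=\mathcal{E}\rtimes\Gamma$, with elements written $(\gamma,\epsilon)$ and product $(\gamma_1,\epsilon_1)(\gamma_2,\epsilon_2)=(\gamma_1\gamma_2,({}^{\gamma_1}\epsilon_2)\epsilon_1)$. $\mathrm{GLReps}_n(G,L/K)$ is the set of equivalence classes $[\rho]$ of representations $\rho:G\to\mathrm{GL}_n(L)$ under conjugation by $\mathrm{GL}_n(L)$. For $n$ even, $\mathrm{GSpReps}_n(G,L/K)$ is the set of equivalence classes $[\rho]$ of representations $\rho:G\to\mathrm{GSp}_n(L)$ (standard symplectic pairing) under conjugation by $\mathrm{GSp}_n(L)$; (absolute) irreducibility refers to the underlying linear representation. Equivalence is denoted $\sim$. For $\gamma\in\Gamma$, ${}^\gamma\rho$ is obtained by applying $\gamma$ to matrix entries. $\mathcal{G}$ acts on both sets by $(\gamma,\epsilon).[\rho]=[({}^\gamma\rho)\otimes\epsilon^{-1}]$, and $\mathcal{G}_{[\rho]}$ is the stabiliser of $[\rho]$; so $(\gamma,\epsilon)\in\mathcal{G}_{[\rho]}$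 iff ${}^\gamma\rho\sim\rho\otimes\epsilon$. $\Gamma_{[\rho]}\subseteq\Gamma$ is the image of $\mathcal{G}_{[\rho]}$ under $(\gamma,\epsilon)\mapsto\gamma$, and $K_{[\rho]}:=L^{\Gamma_{[\rho]}}$. $\rho^{\mathrm{proj}}$ is the composition of $\rho$ with $\mathrm{GL}_n(L)\to\mathrm{PGL}_n(L)$ (resp. $\mathrm{GSp}_n(L)\to\mathrm{PGSp}_n(L)$). Two projective (symplectic) representations are equivalent if they are conjugate by the class modulo scalars of a matrix in $\mathrm{GL}_n(L)$ (resp. $\mathrm{GSp}_n(L)$). *)

theory Defs
  imports
    "HOL-Analysis.Abstract_Metric_Spaces"
    "HOL-Algebra.Algebraic_Closure_Type"
    "HOL-Algebra.Multiplicative_Group"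
    "HOL-Computational_Algebra.Polynomial"
    "HOL-Computational_Algebra.Primes"
    "Jordan_Normal_Form.Determinant"
    "Jordan_Normal_Form.VS_Connect"
begin

text \<open>
  The big field L is the whole of a type of class field; its subfields are subsets of that
  type. Its HOL-Algebra record is \<^const>\<open>class_ring\<close>.
\<close>

section \<open>Galois extensions and Galois groups\<close>

definition poly_over :: "'l::field set \<Rightarrow> 'l poly set" where
  "poly_over K = {p. set (coeffs p) \<subseteq> K}"

definition irreducible_over :: "'l::field set \<Rightarrow> 'l poly \<Rightarrow> bool" where
  "irreducible_over K p \<longleftrightarrow> p \<in> poly_over K \<and> degree p > 0 \<and>
     (\<forall>q\<in>poly_over K. \<forall>r\<in>poly_over K. p = q * r \<longrightarrow> degree q = 0 \<or> degree r = 0)"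

text \<open>
  L/K is algebraic, normal and separable: the last conjunct says that an irreducible polynomial
  over K with a root in L is a product of pairwise distinct linear factors over L.
\<close>
definition galois_extension :: "'l::field set \<Rightarrow> bool" where
  "galois_extension K \<longleftrightarrow>
     subfield K (class_ring :: 'l ring) \<and>
     (\<forall>x. \<exists>p\<in>poly_over K. p \<noteq> 0 \<and> poly p x = 0) \<and>
     (\<forall>p. irreducible_over K p \<and> (\<exists>x. poly p x = 0) \<longrightarrow>
        (\<exists>c A. finite A \<and> p = smult c (\<Prod>a\<in>A. [:- a, 1:])))"

definition Gal :: "'l::field set \<Rightarrow> ('l \<Rightarrow> 'l) set" where
  "Gal K = {\<gamma> \<in> ring_iso class_ring class_ring. \<forall>x\<in>K. \<gamma> x = x}"

section \<open>Finite extensions of the l-adic numbers\<close>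

definition nonarch_abs :: "('l::field \<Rightarrow> real) \<Rightarrow> bool" where
  "nonarch_abs v \<longleftrightarrow> (\<forall>x. 0 \<le> v x) \<and> (\<forall>x. v x = 0 \<longleftrightarrow> x = 0) \<and>
     (\<forall>x y. v (x * y) = v x * v y) \<and> (\<forall>x y. v (x + y) \<le> max (v x) (v y))"

definition abs_topology :: "('l::field \<Rightarrow> real) \<Rightarrow> 'l topology" where
  "abs_topology v = Metric_space.mtopology UNIV (\<lambda>x y. v (x - y))"

text \<open>
  The subfield Q, with the restriction of v, is the completion of the field of rational numbers
  with respect to the l-adic absolute value. (The first conjunct forces characteristic 0.)
\<close>
definition is_ladic_field :: "nat \<Rightarrow> ('l::field \<Rightarrow> real) \<Rightarrow> 'l set \<Rightarrow> bool" where
  "is_ladic_field l v Q \<longleftrightarrow>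
     (\<forall>m::int. m \<noteq> 0 \<longrightarrow> v (of_int m) = inverse (real l ^ multiplicity (int l) m)) \<and>
     subfield Q (class_ring :: 'l ring) \<and>
     Metric_space.mcomplete Q (\<lambda>x y. v (x - y)) \<and>
     Q \<subseteq> abs_topology v closure_of {of_int a / of_int b | a b. b \<noteq> 0}"

text \<open>
  Here v is an absolute value on all of L, extending the l-adic one. If L is algebraic over K
  there is exactly one such v, and it induces the l-adic topology on L.
\<close>
definition finite_ext_of_ladic :: "nat \<Rightarrow> ('l::field \<Rightarrow> real) \<Rightarrow> 'l set \<Rightarrow> bool" where
  "finite_ext_of_ladic l v K \<longleftrightarrow> nonarch_abs v \<and>
     (\<exists>Q. is_ladic_field l v Q \<and> Q \<subseteq> K \<and> subfield K (class_ring :: 'l ring) \<and>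
          ring.finite_dimension (class_ring :: 'l ring) Q K)"

text \<open>
  The map r, restricted to the valuation ring of v, is the reduction map onto the residue field
  of L, which is the type of class field that r maps to. Values of r outside the valuation ring
  are irrelevant.
\<close>
definition residue_map :: "('l::field \<Rightarrow> real) \<Rightarrow> ('l \<Rightarrow> 'k::field) \<Rightarrow> bool" where
  "residue_map v r \<longleftrightarrow> r 1 = 1 \<and>
     (\<forall>x y. v x \<le> 1 \<and> v y \<le> 1 \<longrightarrow> r (x + y) = r x + r y \<and> r (x * y) = r x * r y) \<and>
     r ` {x. v x \<le> 1} = UNIV \<and> (\<forall>x. v x \<le> 1 \<longrightarrow> (r x = 0 \<longleftrightarrow> v x < 1))"

definition coeff_topology :: "'l::field set \<Rightarrow> ('l \<Rightarrow> real) \<Rightarrow> 'l topology" where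
  "coeff_topology K v = (if finite K then discrete_topology UNIV else abs_topology v)"

section \<open>Matrix groups over subfields of L\<close>

definition GL :: "nat \<Rightarrow> 'l::field set \<Rightarrow> 'l mat set" where
  "GL n F = {A \<in> carrier_mat n n. elements_mat A \<subseteq> F \<and> det A \<noteq> 0}"

text \<open>Gram matrix of the standard symplectic pairing in dimension n = 2m.\<close>
definition symp_mat :: "nat \<Rightarrow> 'l::field mat" where
  "symp_mat n = (let m = n div 2 in four_block_mat (0\<^sub>m m m) (1\<^sub>m m) (- 1\<^sub>m m) (0\<^sub>m m m))"

definition GSp :: "nat \<Rightarrow> 'l::field set \<Rightarrow> 'l mat set" where
  "GSp n F = {A \<in> GL n F. \<exists>c\<in>F - {0}. transpose_mat A * symp_mat n * A = c \<cdot>\<^sub>m symp_mat n}"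

definition mat_group :: "nat \<Rightarrow> 'l::field mat set \<Rightarrow> 'l mat monoid" where
  "mat_group n S = \<lparr>carrier = S, monoid.mult = (*), one = 1\<^sub>m n\<rparr>"

definition mat_topology :: "'l topology \<Rightarrow> nat \<Rightarrow> 'l mat set \<Rightarrow> 'l mat topology" where
  "mat_topology TL n S = pullback_topology S (\<lambda>A. \<lambda>p\<in>{..<n} \<times> {..<n}. A $$ p)
     (product_topology (\<lambda>_. TL) ({..<n} \<times> {..<n}))"

definition scalar_mats :: "nat \<Rightarrow> 'l::field set \<Rightarrow> 'l mat set" where
  "scalar_mats n F = {c \<cdot>\<^sub>m 1\<^sub>m n | c. c \<in> F - {0}}"

text \<open>
  From here on M stands for the matrix group functor in question, \<open>GL n\<close> or \<open>GSp n\<close>, assigning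
  to a subfield F of L the group of F-rational matrices; \<open>proj_group n M F\<close> is then PGL(F),
  respectively PGSp(F).
\<close>
definition proj_group :: "nat \<Rightarrow> ('l::field set \<Rightarrow> 'l mat set) \<Rightarrow> 'l set \<Rightarrow> 'l mat set monoid" where
  "proj_group n M F = mat_group n (M F) Mod scalar_mats n F"

definition proj_class :: "nat \<Rightarrow> ('l::field set \<Rightarrow> 'l mat set) \<Rightarrow> 'l set \<Rightarrow> 'l mat \<Rightarrow> 'l mat set" where
  "proj_class n M F A = scalar_mats n F #>\<^bsub>mat_group n (M F)\<^esub> A"

definition quot_topology :: "'a topology \<Rightarrow> ('a \<Rightarrow> 'b) \<Rightarrow> 'b topology" where
  "quot_topology Y f =
     topology (\<lambda>U. U \<subseteq> f ` topspace Y \<and> openin Y {x \<in> topspace Y. f x \<in> U})"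

lemma openin_quot_topology:
  "openin (quot_topology Y f) U \<longleftrightarrow> U \<subseteq> f ` topspace Y \<and> openin Y {x \<in> topspace Y. f x \<in> U}"
proof -
  have "istopology (\<lambda>U. U \<subseteq> f ` topspace Y \<and> openin Y {x \<in> topspace Y. f x \<in> U})"
    unfolding istopology_def
  proof (intro conjI allI impI)
    fix S T assume *: "S \<subseteq> f ` topspace Y \<and> openin Y {x \<in> topspace Y. f x \<in> S}"
      "T \<subseteq> f ` topspace Y \<and> openin Y {x \<in> topspace Y. f x \<in> T}"
    have "{x \<in> topspace Y. f x \<in> S \<inter> T}
        = {x \<in> topspace Y. f x \<in> S} \<inter> {x \<in> topspace Y. f x \<in> T}" by auto
    then show "openin Y {x \<in> topspace Y. f x \<in> S \<inter> T}" using * by (simp add: openin_Int)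
  next
    fix \<K> assume *: "\<forall>S\<in>\<K>. S \<subseteq> f ` topspace Y \<and> openin Y {x \<in> topspace Y. f x \<in> S}"
    have "{x \<in> topspace Y. f x \<in> \<Union>\<K>} = (\<Union>S\<in>\<K>. {x \<in> topspace Y. f x \<in> S})" by auto
    then show "openin Y {x \<in> topspace Y. f x \<in> \<Union>\<K>}" using * by auto
  qed auto
  then show ?thesis by (simp add: quot_topology_def topology_inverse')
qed

definition proj_topology ::
  "'l topology \<Rightarrow> nat \<Rightarrow> ('l::field set \<Rightarrow> 'l mat set) \<Rightarrow> 'l set \<Rightarrow> 'l mat set topology" where
  "proj_topology TL n M F = quot_topology (mat_topology TL n (M F)) (proj_class n M F)"

section \<open>Representations, characters and twists\<close>

text \<open>No separation axiom is required. A finite group carries the discrete topology.\<close>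
definition topological_group :: "'g monoid \<Rightarrow> 'g topology \<Rightarrow> bool" where
  "topological_group G T \<longleftrightarrow> group G \<and> topspace T = carrier G \<and>
     continuous_map (prod_topology T T) T (\<lambda>(x, y). x \<otimes>\<^bsub>G\<^esub> y) \<and>
     continuous_map T T (m_inv G)"

definition representation ::
  "'g monoid \<Rightarrow> 'g topology \<Rightarrow> 'l topology \<Rightarrow> nat \<Rightarrow> ('l::field set \<Rightarrow> 'l mat set) \<Rightarrow> ('g \<Rightarrow> 'l mat) \<Rightarrow> bool"
  where "representation G T TL n M \<rho> \<longleftrightarrow>
     \<rho> \<in> hom G (mat_group n (M UNIV)) \<and> continuous_map T (mat_topology TL n (M UNIV)) \<rho>"

definition rep_equiv ::
  "'g monoid \<Rightarrow> nat \<Rightarrow> ('l::field set \<Rightarrow> 'l mat set) \<Rightarrow> ('g \<Rightarrow> 'l mat) \<Rightarrow> ('g \<Rightarrow> 'l mat) \<Rightarrow> bool"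
  where "rep_equiv G n M \<rho> \<rho>' \<longleftrightarrow>
     (\<exists>A\<in>M UNIV. \<forall>g\<in>carrier G. \<rho>' g = A * \<rho> g * inv\<^bsub>mat_group n (M UNIV)\<^esub> A)"

definition rep_class ::
  "'g monoid \<Rightarrow> 'g topology \<Rightarrow> 'l topology \<Rightarrow> nat \<Rightarrow> ('l::field set \<Rightarrow> 'l mat set) \<Rightarrow> ('g \<Rightarrow> 'l mat)
     \<Rightarrow> ('g \<Rightarrow> 'l mat) set"
  where "rep_class G T TL n M \<rho> = {\<rho>'. representation G T TL n M \<rho>' \<and> rep_equiv G n M \<rho> \<rho>'}"

definition chars :: "'g monoid \<Rightarrow> 'g topology \<Rightarrow> 'l::field topology \<Rightarrow> ('g \<Rightarrow> 'l) set" where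
  "chars G T TL = {\<epsilon> \<in> hom G (mult_of class_ring). continuous_map T TL \<epsilon>}"

text \<open>A representative of \<open>(\<gamma>, \<epsilon>).[\<rho>]\<close>.\<close>
definition twist :: "('l::field \<Rightarrow> 'l) \<Rightarrow> ('g \<Rightarrow> 'l) \<Rightarrow> ('g \<Rightarrow> 'l mat) \<Rightarrow> ('g \<Rightarrow> 'l mat)" where
  "twist \<gamma> \<epsilon> \<rho> = (\<lambda>g. inverse (\<epsilon> g) \<cdot>\<^sub>m map_mat \<gamma> (\<rho> g))"

definition stab ::
  "'g monoid \<Rightarrow> 'g topology \<Rightarrow> 'l topology \<Rightarrow> 'l set \<Rightarrow> nat \<Rightarrow> ('l::field set \<Rightarrow> 'l mat set)
     \<Rightarrow> ('g \<Rightarrow> 'l mat) \<Rightarrow> (('l \<Rightarrow> 'l) \<times> ('g \<Rightarrow> 'l)) set"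
  where "stab G T TL K n M \<rho> = {(\<gamma>, \<epsilon>) \<in> Gal K \<times> chars G T TL.
     rep_class G T TL n M (twist \<gamma> \<epsilon> \<rho>) = rep_class G T TL n M \<rho>}"

definition I_group ::
  "'g monoid \<Rightarrow> 'g topology \<Rightarrow> 'l topology \<Rightarrow> 'l set \<Rightarrow> nat \<Rightarrow> ('l::field set \<Rightarrow> 'l mat set)
     \<Rightarrow> ('g \<Rightarrow> 'l mat) \<Rightarrow> 'g set"
  where "I_group G T TL K n M \<rho> =
     {g \<in> carrier G. \<forall>\<epsilon>. (\<exists>\<gamma>. (\<gamma>, \<epsilon>) \<in> stab G T TL K n M \<rho>) \<longrightarrow> \<epsilon> g = 1}"

definition Gamma_rep ::
  "'g monoid \<Rightarrow> 'g topology \<Rightarrow> 'l topology \<Rightarrow> 'l set \<Rightarrow> nat \<Rightarrow> ('l::field set \<Rightarrow> 'l mat set)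
     \<Rightarrow> ('g \<Rightarrow> 'l mat) \<Rightarrow> ('l \<Rightarrow> 'l) set"
  where "Gamma_rep G T TL K n M \<rho> = fst ` stab G T TL K n M \<rho>"

definition K_rep ::
  "'g monoid \<Rightarrow> 'g topology \<Rightarrow> 'l topology \<Rightarrow> 'l set \<Rightarrow> nat \<Rightarrow> ('l::field set \<Rightarrow> 'l mat set)
     \<Rightarrow> ('g \<Rightarrow> 'l mat) \<Rightarrow> 'l set"
  where "K_rep G T TL K n M \<rho> = {x. \<forall>\<gamma>\<in>Gamma_rep G T TL K n M \<rho>. \<gamma> x = x}"

section \<open>(Residual) absolute irreducibility\<close>

text \<open>In this section H is the group, a subset of the domain of \<open>\<rho>\<close>, to which \<open>\<rho>\<close> is restricted.\<close>

definition irreducible_rep :: "nat \<Rightarrow> 'g set \<Rightarrow> ('g \<Rightarrow> 'a::field mat) \<Rightarrow> bool" where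
  "irreducible_rep n H \<rho> \<longleftrightarrow> n > 0 \<and>
     (\<forall>W. VectorSpace.subspace (class_ring :: 'a ring) W (module_vec TYPE('a) n) \<and>
          (\<forall>h\<in>H. \<forall>w\<in>W. \<rho> h *\<^sub>v w \<in> W)
        \<longrightarrow> W = {0\<^sub>v n} \<or> W = carrier_vec n)"

definition abs_irreducible :: "nat \<Rightarrow> 'g set \<Rightarrow> ('g \<Rightarrow> 'a::field mat) \<Rightarrow> bool" where
  "abs_irreducible n H \<rho> \<longleftrightarrow> irreducible_rep n H (\<lambda>h. map_mat to_ac (\<rho> h))"

text \<open>
  After a suitable conjugation (that is, the choice of a stable lattice) \<open>\<rho>\<close> takes values in
  GL(O), for O the valuation ring of v, and its reduction is absolutely irreducible. As H is a
  group, integrality of the matrices themselves implies that of their inverses.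
\<close>
definition resid_abs_irreducible ::
  "('l::field \<Rightarrow> real) \<Rightarrow> ('l \<Rightarrow> 'k::field) \<Rightarrow> nat \<Rightarrow> 'g set \<Rightarrow> ('g \<Rightarrow> 'l mat) \<Rightarrow> bool" where
  "resid_abs_irreducible v r n H \<rho> \<longleftrightarrow>
     (\<exists>A\<in>GL n UNIV. let \<rho>' = (\<lambda>h. A * \<rho> h * inv\<^bsub>mat_group n (GL n UNIV)\<^esub> A) in
        (\<forall>h\<in>H. elements_mat (\<rho>' h) \<subseteq> {x. v x \<le> 1}) \<and>
        abs_irreducible n H (\<lambda>h. map_mat r (\<rho>' h)))"

section \<open>Projective representations\<close>

definition proj_rep ::
  "'g monoid \<Rightarrow> 'g topology \<Rightarrow> 'l topology \<Rightarrow> nat \<Rightarrow> ('l::field set \<Rightarrow> 'l mat set) \<Rightarrow> 'l set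
     \<Rightarrow> ('g \<Rightarrow> 'l mat set) \<Rightarrow> bool"
  where "proj_rep G T TL n M F \<tau> \<longleftrightarrow>
     \<tau> \<in> hom G (proj_group n M F) \<and> continuous_map T (proj_topology TL n M F) \<tau>"

definition proj_equiv ::
  "'g monoid \<Rightarrow> nat \<Rightarrow> ('l::field set \<Rightarrow> 'l mat set) \<Rightarrow> ('g \<Rightarrow> 'l mat set) \<Rightarrow> ('g \<Rightarrow> 'l mat set) \<Rightarrow> bool"
  where "proj_equiv G n M \<tau> \<tau>' \<longleftrightarrow> (\<exists>A\<in>M UNIV. \<forall>g\<in>carrier G.
     \<tau>' g = proj_class n M UNIV A \<otimes>\<^bsub>proj_group n M UNIV\<^esub> \<tau> g
              \<otimes>\<^bsub>proj_group n M UNIV\<^esub> inv\<^bsub>proj_group n M UNIV\<^esub> (proj_class n M UNIV A))"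

text \<open>
  The natural map PGL(F) \<open>\<rightarrow>\<close> PGL(L), respectively PGSp(F) \<open>\<rightarrow>\<close> PGSp(L), multiplies a coset of
  the F-rational scalars by the set of all scalars.
\<close>
definition proj_incl :: "nat \<Rightarrow> ('l::field set \<Rightarrow> 'l mat set) \<Rightarrow> 'l mat set \<Rightarrow> 'l mat set" where
  "proj_incl n M C = scalar_mats n UNIV <#>\<^bsub>mat_group n (M UNIV)\<^esub> C"

definition factors_through ::
  "'g monoid \<Rightarrow> 'g topology \<Rightarrow> 'l topology \<Rightarrow> nat \<Rightarrow> ('l::field set \<Rightarrow> 'l mat set) \<Rightarrow> 'l set
     \<Rightarrow> ('g \<Rightarrow> 'l mat set) \<Rightarrow> bool"
  where "factors_through G T TL n M F \<tau> \<longleftrightarrow>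
     (\<exists>\<sigma>. proj_rep G T TL n M F \<sigma> \<and> (\<forall>g\<in>carrier G. \<tau> g = proj_incl n M (\<sigma> g)))"

text \<open>
  The equivalence class of the projectivisation of \<open>\<rho>\<close> has a member that factors through
  PGL(F), respectively PGSp(F).
\<close>
definition proj_descends_to ::
  "'g monoid \<Rightarrow> 'g topology \<Rightarrow> 'l topology \<Rightarrow> nat \<Rightarrow> ('l::field set \<Rightarrow> 'l mat set)
     \<Rightarrow> ('g \<Rightarrow> 'l mat) \<Rightarrow> 'l set \<Rightarrow> bool"
  where "proj_descends_to G T TL n M \<rho> F \<longleftrightarrow>
     (\<exists>\<tau>. proj_rep G T TL n M UNIV \<tau> \<and>
          proj_equiv G n M (\<lambda>g. proj_class n M UNIV (\<rho> g)) \<tau> \<and>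
          factors_through G T TL n M F \<tau>)"

end

(*
  Both statements come down to Hilbert 90 type descent. If (\<gamma>, \<epsilon>) stabilises [\<rho>], then
  some C intertwines \<rho> \<otimes> \<epsilon> with its \<gamma>-conjugate; on I the twist disappears, so C is unique
  up to scalars there. It is enough to find one P with \<gamma>(P) = c C P for all these pairs: then
  R = P^-1 \<rho> P satisfies \<gamma>(R) = \<epsilon> R, and R divided by one of its nonzero entries is fixed by
  all the \<gamma>, that is, has entries in K_rep.

  The integral X with \<gamma>(X) = C X C^-1 reduce to a set of matrices over the residue field
  that is nondegenerate by Burnside's theorem and whose determinants lie in a smaller field.
  Chevalley-Warning (triviality of the Brauer group) yields a rank one idempotent in it. A lift of
  this idempotent has a unit eigenvalue that is simple modulo the maximal ideal, hence a canonical
  eigenline, and the images of an eigenvector under \<rho>(I) are the columns of P. In the symplectic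
  case the form P^T J P is fixed up to scalars, so it has a symplectic basis over K_rep.

  Conversely let \<rho> descend projectively to F. Every \<gamma> fixing F then acts on a suitable
  conjugate of \<rho> by scalars \<epsilon>(g), which puts (\<gamma>, \<epsilon>) into the stabiliser; as Gal(L/F) fixes only F,
  K_rep is contained in F.

  A finite K carries the trivial absolute value, so that both kinds of K are treated alike.
*)
theory Submission
  imports Defs "Jordan_Normal_Form.Char_Poly"
begin

unbundle no vec_syntax
unbundle no inner_syntax
no_notation fps_nth (infixl \<open>$\<close> 75)

section \<open>Subfields as sets\<close>

text \<open>The intertwiners C are known up to scalars only, so the search for P meets an
  obstruction in the Brauer group of the fixed field, which need not vanish over an l-adic field.
  The residual hypothesis on I removes it: the matrices \<rho>(h), h in I, lie in the twisted matrix
  algebra and stay independent enough modulo the maximal ideal, so the integral twisted matrices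
  form an order without ramification and the obstruction can be read off over the residue field.
  Each pair (\<gamma>, C) is treated on its own, without composing pairs: one eigenvector of one
  matrix U meets all conditions at once because its eigenline is unique. L may have infinite degree
  over K. It need not be complete and its residue field need not be finite; instead every finite
  subset of L lies in a complete subfield and every finite subset of the residue field in a finite
  one, so the constructions involve finitely many elements at a time. Spans are encoded dually, by
  the functionals that kill a set: infinite families such as \<rho>(I) then need no bases.\<close>

definition subfield_set :: "'a::field set \<Rightarrow> bool" where
  "subfield_set F \<longleftrightarrow> 0 \<in> F \<and> 1 \<in> F \<and> (\<forall>x\<in>F. \<forall>y\<in>F. x + y \<in> F \<and> x * y \<in> F) \<and>
     (\<forall>x\<in>F. - x \<in> F \<and> inverse x \<in> F)"

lemma subfield_setD:
  assumes "subfield_set F"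
  shows "0 \<in> F" "1 \<in> F" "x \<in> F \<Longrightarrow> y \<in> F \<Longrightarrow> x + y \<in> F" "x \<in> F \<Longrightarrow> y \<in> F \<Longrightarrow> x * y \<in> F"
    "x \<in> F \<Longrightarrow> - x \<in> F" "x \<in> F \<Longrightarrow> inverse x \<in> F" "x \<in> F \<Longrightarrow> y \<in> F \<Longrightarrow> x - y \<in> F"
    "x \<in> F \<Longrightarrow> y \<in> F \<Longrightarrow> x / y \<in> F"
  using assms unfolding subfield_set_def diff_conv_add_uminus divide_inverse by blast+

lemma subfield_set_sum:
  "subfield_set F \<Longrightarrow> (\<And>i. i \<in> I \<Longrightarrow> f i \<in> F) \<Longrightarrow> sum f I \<in> F"
  by (induction I rule: infinite_finite_induct) (auto intro: subfield_setD)

lemma subfield_set_prod: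
  "subfield_set F \<Longrightarrow> (\<And>i. i \<in> I \<Longrightarrow> f i \<in> F) \<Longrightarrow> prod f I \<in> F"
  by (induction I rule: infinite_finite_induct) (auto intro: subfield_setD)

lemma subfield_set_power: "subfield_set F \<Longrightarrow> x \<in> F \<Longrightarrow> x ^ k \<in> F"
  by (induction k) (auto intro: subfield_setD)

lemma subfield_set_Int: "subfield_set F \<Longrightarrow> subfield_set F' \<Longrightarrow> subfield_set (F \<inter> F')"
  by (auto simp: subfield_set_def)

lemma subfield_set_signof: "subfield_set F \<Longrightarrow> signof p \<in> F"
  by (auto simp: sign_def intro: subfield_setD)

lemma subfield_set_det:
  assumes F: "subfield_set F" and A: "A \<in> carrier_mat n n"
    and el: "\<And>i j. i < n \<Longrightarrow> j < n \<Longrightarrow> A $$ (i, j) \<in> F"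
  shows "det A \<in> F"
  unfolding det_def'[OF A]
  by (intro subfield_set_sum[OF F] subfield_setD(4)[OF F] subfield_set_signof[OF F] subfield_set_prod[OF F] el)
    (auto simp: permutes_in_image)

section \<open>Linear algebra over a field\<close>

text \<open>Elimination for t homogeneous equations in more than t unknowns never leaves the field
  of the coefficients. The solution over \<open>F\<close> is what later turns the linear dependence
  of powers into a polynomial relation over the base field.\<close>

lemma exists_annihilator_over:
  fixes s :: "nat \<Rightarrow> 'i \<Rightarrow> 'a::field"
  assumes "subfield_set F" "finite J" "t < card J" "\<And>i j. i \<in> J \<Longrightarrow> j < t \<Longrightarrow> s j i \<in> F"
  shows "\<exists>f. (\<forall>i\<in>J. f i \<in> F) \<and> (\<exists>i\<in>J. f i \<noteq> 0) \<and> (\<forall>j<t. (\<Sum>i\<in>J. f i * s j i) = 0)"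
  using assms(2-)
proof (induction t arbitrary: J s)
  case 0
  then have "J \<noteq> {}" by auto
  then show ?case using subfield_setD(2)[OF assms(1)] by (intro exI[of _ "\<lambda>_. 1"]) auto
next
  case (Suc t)
  show ?case
  proof (cases "\<forall>i\<in>J. s t i = 0")
    case True
    obtain f where "\<forall>i\<in>J. f i \<in> F" "\<exists>i\<in>J. f i \<noteq> 0" "\<forall>j<t. (\<Sum>i\<in>J. f i * s j i) = 0"
      using Suc.IH[of J s] Suc.prems by auto
    then show ?thesis using True by (intro exI[of _ f]) (auto simp: less_Suc_eq)
  next
    case False
    then obtain k where k: "k \<in> J" "s t k \<noteq> 0" by auto
    \<comment> \<open>Equation t is solved for its pivot unknown k; t equations remain for the
      unknowns in \<open>Y\<close>.\<close>
    define Y where "Y = J - {k}"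
    have Y: "finite Y" "t < card Y" "k \<notin> Y" "J = insert k Y"
      using Suc.prems k by (auto simp: Y_def)
    have sF: "s j i \<in> F" if "i \<in> J" "j < Suc t" for i j using Suc.prems(3) that by blast
    have "s j i - s j k / s t k * s t i \<in> F" if "i \<in> Y" "j < t" for i j
      using that Y(4) by (intro subfield_setD(4,7,8)[OF assms(1)] sF) auto
    then obtain f where f: "\<forall>i\<in>Y. f i \<in> F" "\<exists>i\<in>Y. f i \<noteq> 0"
        "\<forall>j<t. (\<Sum>i\<in>Y. f i * (s j i - s j k / s t k * s t i)) = 0"
      using Suc.IH[of Y "\<lambda>j i. s j i - s j k / s t k * s t i"] Y by auto
    \<comment> \<open>Back substitution: this value at k makes equation t hold.\<close>
    define b where "b = - (\<Sum>i\<in>Y. f i * s t i) / s t k"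
    have bF: "b \<in> F" unfolding b_def using f(1) Y(4)
      by (intro subfield_setD(5,8)[OF assms(1)] subfield_set_sum[OF assms(1)] subfield_setD(4)[OF assms(1)] sF) auto
    have sum: "(\<Sum>i\<in>J. (f(k := b)) i * s j i) = b * s j k + (\<Sum>i\<in>Y. f i * s j i)" for j
    proof -
      have "(\<Sum>i\<in>Y. (f(k := b)) i * s j i) = (\<Sum>i\<in>Y. f i * s j i)"
        using Y by (intro sum.cong) auto
      then show ?thesis using Y by simp
    qed
    have "(\<Sum>i\<in>J. (f(k := b)) i * s j i) = 0" if "j < Suc t" for j
    proof (cases "j = t")
      case True
      then show ?thesis unfolding sum using k by (simp add: b_def)
    next
      case False
      then have "(\<Sum>i\<in>Y. f i * (s j i - s j k / s t k * s t i)) = 0" using f that by auto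
      then have "(\<Sum>i\<in>Y. f i * s j i) = (s j k / s t k) * (\<Sum>i\<in>Y. f i * s t i)"
        by (simp add: right_diff_distrib sum_subtractf sum_distrib_left mult_ac)
      then show ?thesis unfolding sum by (simp add: b_def)
    qed
    moreover have "\<exists>i\<in>J. (f(k := b)) i \<noteq> 0" using f(2) Y by auto
    moreover have "\<forall>i\<in>J. (f(k := b)) i \<in> F" using f(1) bF Y by auto
    ultimately show ?thesis by blast
  qed
qed

lemma exists_annihilator:
  fixes s :: "nat \<Rightarrow> 'i \<Rightarrow> 'a::field"
  assumes "finite J" "t < card J"
  shows "\<exists>f. (\<exists>i\<in>J. f i \<noteq> 0) \<and> (\<forall>j<t. (\<Sum>i\<in>J. f i * s j i) = 0)"
  using exists_annihilator_over[of UNIV J t s] assms by (simp add: subfield_set_def)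

text \<open>The dual way of saying that \<open>S\<close> spans the functions on \<open>J\<close>:
  only the zero functional kills it. \<open>S\<close> may be infinite, no basis of it is named, and
  the condition descends along field embeddings.\<close>

definition nondegenerate :: "'i set \<Rightarrow> ('i \<Rightarrow> 'a::field) set \<Rightarrow> bool" where
  "nondegenerate J S \<longleftrightarrow>
     (\<forall>f. (\<forall>s\<in>S. (\<Sum>i\<in>J. f i * s i) = 0) \<longrightarrow> (\<forall>i\<in>J. f i = 0))"

lemma nondegenerateD:
  "nondegenerate J S \<Longrightarrow> (\<And>s. s \<in> S \<Longrightarrow> (\<Sum>i\<in>J. f i * s i) = 0) \<Longrightarrow> i \<in> J \<Longrightarrow> f i = 0"
  unfolding nondegenerate_def by blast

lemma nondegenerate_mono: "nondegenerate J S \<Longrightarrow> S \<subseteq> S' \<Longrightarrow> nondegenerate J S'"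
  unfolding nondegenerate_def by blast

text \<open>Greedy choice: fewer than \<open>card J\<close> vectors are all killed by some nonzero
  functional, and a z in \<open>S\<close> that it does not kill is independent of them.\<close>

lemma independent_selection:
  fixes S :: "('i \<Rightarrow> 'a::field) set"
  assumes "finite J" "nondegenerate J S" "t \<le> card J"
  shows "\<exists>s. (\<forall>j<t. s j \<in> S) \<and>
    (\<forall>c. (\<forall>i\<in>J. (\<Sum>j<t. c j * s j i) = 0) \<longrightarrow> (\<forall>j<t. c j = 0))"
  using assms(3)
proof (induction t)
  case 0
  then show ?case by auto
next
  case (Suc t)
  then obtain s where s: "\<And>j. j < t \<Longrightarrow> s j \<in> S"
      "\<And>c j. \<forall>i\<in>J. (\<Sum>j<t. c j * s j i) = 0 \<Longrightarrow> j < t \<Longrightarrow> c j = 0" by (metis Suc_leD)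
  obtain f where f: "\<exists>i\<in>J. f i \<noteq> 0" "\<And>j. j < t \<Longrightarrow> (\<Sum>i\<in>J. f i * s j i) = 0"
    using exists_annihilator[of J t s] assms(1) Suc.prems by auto
  then obtain z where z: "z \<in> S" "(\<Sum>i\<in>J. f i * z i) \<noteq> 0"
    using nondegenerateD[OF assms(2), of f] by blast
  define s' where "s' = s(t := z)"
  have "c j = 0" if c: "\<forall>i\<in>J. (\<Sum>j<Suc t. c j * s' j i) = 0" and j: "j < Suc t" for c j
  proof -
    have eq: "(\<Sum>j<t. c j * s j i) + c t * z i = 0" if "i \<in> J" for i
      using c that by (simp add: s'_def)
    \<comment> \<open>Applying f to the relation removes the old vectors and isolates the
      coefficient of z.\<close>
    have "(\<Sum>i\<in>J. f i * ((\<Sum>j<t. c j * s j i) + c t * z i)) = 0" using eq by simp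
    moreover have "(\<Sum>i\<in>J. f i * (\<Sum>j<t. c j * s j i)) = (\<Sum>j<t. c j * (\<Sum>i\<in>J. f i * s j i))"
      by (simp add: sum_distrib_left mult_ac sum.swap[of _ J])
    moreover have "\<dots> = 0" using f(2) by simp
    ultimately have "c t * (\<Sum>i\<in>J. f i * z i) = 0"
      by (simp add: distrib_left sum.distrib sum_distrib_left mult_ac)
    then have "c t = 0" using z by simp
    moreover then have "j < t \<Longrightarrow> c j = 0" using eq s(2) by simp
    ultimately show ?thesis using j less_Suc_eq by blast
  qed
  moreover have "s' j \<in> S" if "j < Suc t" for j using s(1) z that by (auto simp: s'_def less_Suc_eq)
  ultimately show ?case by blast
qed

section \<open>Matrix products and factorisations of minimal rank\<close>

lemma index_mult_mat_sum:
  assumes "A \<in> carrier_mat n m" "B \<in> carrier_mat m k" "i < n" "j < k"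
  shows "(A * B) $$ (i, j) = (\<Sum>l<m. A $$ (i, l) * B $$ (l, j))"
  using assms by (auto simp: scalar_prod_def lessThan_atLeast0 intro!: sum.cong)

lemma index_mult_mat_vec_sum:
  assumes "A \<in> carrier_mat n m" "w \<in> carrier_vec m" "i < n"
  shows "(A *\<^sub>v w) $ i = (\<Sum>l<m. A $$ (i, l) * w $ l)"
  using assms by (auto simp: scalar_prod_def lessThan_atLeast0 intro!: sum.cong)

lemma mat_assoc:
  fixes A B C :: "'a::semiring_0 mat"
  assumes "dim_col A = dim_row B" "dim_col B = dim_row C"
  shows "A * B * C = A * (B * C)"
  by (rule assoc_mult_mat[of _ "dim_row A" "dim_row B" _ "dim_row C" _ "dim_col C"])
    (use assms in \<open>auto intro!: carrier_matI\<close>)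

lemma factor_through_smaller:
  fixes P :: "'a::field mat"
  assumes P: "P \<in> carrier_mat n r" and u: "u \<in> carrier_vec r" "u \<noteq> 0\<^sub>v r" "P *\<^sub>v u = 0\<^sub>v n"
  shows "\<exists>P1\<in>carrier_mat n (r - 1). \<exists>Q1\<in>carrier_mat (r - 1) r. P = P1 * Q1"
proof -
  from u obtain k where k: "k < r" "u $ k \<noteq> 0" by (metis eq_vecI index_zero_vec carrier_vecD)
  \<comment> \<open>\<open>insert_index k\<close> enumerates the r - 1 indices other than k.\<close>
  define \<iota> where "\<iota> = insert_index k"
  have im: "\<iota> ` {..<r - 1} = {..<r} - {k}" and inj: "inj_on \<iota> {..<r - 1}"
    using insert_index_image[of k "r - 1"] insert_index_inj_on k
    by (auto simp: \<iota>_def lessThan_atLeast0)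
  define P1 where "P1 = mat n (r - 1) (\<lambda>(i, a). P $$ (i, \<iota> a))"
  define Q1 where "Q1 = mat (r - 1) r
    (\<lambda>(a, l). if l = k then - u $ \<iota> a / u $ k else if \<iota> a = l then 1 else 0)"
  have "P $$ (i, l) = (P1 * Q1) $$ (i, l)" if il: "i < n" "l < r" for i l
  proof -
    have "(P1 * Q1) $$ (i, l) = (\<Sum>a<r - 1. P $$ (i, \<iota> a) *
        (if l = k then - u $ \<iota> a / u $ k else if \<iota> a = l then 1 else 0))"
      using il by (subst index_mult_mat_sum[of _ n "r - 1" _ r]) (auto simp: P1_def Q1_def)
    also have "\<dots> = (\<Sum>b\<in>{..<r} - {k}. P $$ (i, b) *
        (if l = k then - u $ b / u $ k else if b = l then 1 else 0))"
      unfolding im[symmetric] by (subst sum.reindex[OF inj]) simp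
    also have "\<dots> = P $$ (i, l)"
    proof (cases "l = k")
      case False
      then show ?thesis using il by (simp add: sum.delta if_distrib cong: if_cong)
    next
      case True
      have "0 = (\<Sum>b<r. P $$ (i, b) * u $ b)"
        using index_mult_mat_vec_sum[OF P u(1) il(1)] u(3) il by simp
      also have "\<dots> = P $$ (i, k) * u $ k + (\<Sum>b\<in>{..<r} - {k}. P $$ (i, b) * u $ b)"
        using k by (subst sum.remove[of _ k]) auto
      finally have "P $$ (i, k) = - (\<Sum>b\<in>{..<r} - {k}. P $$ (i, b) * u $ b) / u $ k"
        using k by (simp add: field_simps eq_neg_iff_add_eq_0)
      then show ?thesis using True by (simp add: sum_negf sum_divide_distrib)
    qed
    finally show ?thesis by simp
  qed
  then have "P = P1 * Q1" using P by (intro eq_matI) (auto simp: P1_def Q1_def)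
  moreover have "P1 \<in> carrier_mat n (r - 1)" "Q1 \<in> carrier_mat (r - 1) r"
    by (auto simp: P1_def Q1_def)
  ultimately show ?thesis by blast
qed

text \<open>\<open>P * Q\<close> is a nonzero element of \<open>B\<close> of least rank r. Then P
  and the transpose of Q have trivial kernels, or the rank would drop, and a singular M gives an
  element \<open>P * M * Q\<close> factoring through r - 1, hence 0. For a ring \<open>B\<close>
  this is a corner where, as in Schur's lemma, nonzero elements are invertible.\<close>

lemma minimal_factorization:
  fixes B :: "'a::field mat set"
  assumes B: "B \<subseteq> carrier_mat n n" and e: "e \<in> B" "e \<noteq> 0\<^sub>m n n"
  obtains r P Q where "r > 0" "P \<in> carrier_mat n r" "Q \<in> carrier_mat r n" "P * Q \<in> B"
    "\<And>M. M \<in> carrier_mat r r \<Longrightarrow> P * M * Q = 0\<^sub>m n n \<Longrightarrow> M = 0\<^sub>m r r"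
    "\<And>M. M \<in> carrier_mat r r \<Longrightarrow> P * M * Q \<in> B \<Longrightarrow> det M = 0 \<Longrightarrow> M = 0\<^sub>m r r"
proof -
  define fac where "fac r \<longleftrightarrow> (\<exists>P\<in>carrier_mat n r. \<exists>Q\<in>carrier_mat r n.
    P * Q \<in> B \<and> P * Q \<noteq> 0\<^sub>m n n)" for r
  have "fac n"
    unfolding fac_def using e B by (intro bexI[of _ e] bexI[of _ "1\<^sub>m n"]) auto
  define r where "r = (LEAST r. fac r)"
  have "fac r" and min: "\<And>r'. r' < r \<Longrightarrow> \<not> fac r'"
    unfolding r_def using \<open>fac n\<close> by (auto intro: LeastI dest: not_less_Least)
  then obtain P Q where P: "P \<in> carrier_mat n r" and Q: "Q \<in> carrier_mat r n"
    and PQ: "P * Q \<in> B" "P * Q \<noteq> 0\<^sub>m n n" unfolding fac_def by blast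
  have r0: "r > 0"
  proof (rule ccontr)
    assume "\<not> r > 0"
    then have "P * Q = 0\<^sub>m n n"
      using P Q by (intro eq_matI) (auto simp: scalar_prod_def)
    with PQ show False by simp
  qed
  have Pinj: "u = 0\<^sub>v r" if u: "u \<in> carrier_vec r" "P *\<^sub>v u = 0\<^sub>v n" for u
  proof (rule ccontr)
    assume "u \<noteq> 0\<^sub>v r"
    then obtain P1 Q1 where 1: "P1 \<in> carrier_mat n (r - 1)" "Q1 \<in> carrier_mat (r - 1) r" "P = P1 * Q1"
      using factor_through_smaller[OF P] u by blast
    then have "P * Q = P1 * (Q1 * Q)" using Q by (simp add: assoc_mult_mat)
    then have "fac (r - 1)" unfolding fac_def using 1 Q PQ
      by (metis mult_carrier_mat)
    then show False using min r0 by simp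
  qed
  have Qinj: "u = 0\<^sub>v r" if u: "u \<in> carrier_vec r" "Q\<^sup>T *\<^sub>v u = 0\<^sub>v n" for u
  proof (rule ccontr)
    assume "u \<noteq> 0\<^sub>v r"
    then obtain P1 Q1 where 1: "P1 \<in> carrier_mat n (r - 1)" "Q1 \<in> carrier_mat (r - 1) r" "Q\<^sup>T = P1 * Q1"
      using factor_through_smaller[of "Q\<^sup>T" n r, OF _ u(1) _ u(2)] Q by auto
    have "Q = (Q\<^sup>T)\<^sup>T" by simp
    also have "\<dots> = Q1\<^sup>T * P1\<^sup>T" unfolding 1(3) using 1 by (simp add: transpose_mult[of _ n "r - 1" _ r])
    finally have "P * Q = (P * Q1\<^sup>T) * P1\<^sup>T" using P 1 
      by (metis assoc_mult_mat transpose_carrier_mat)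
    moreover have "P * Q1\<^sup>T \<in> carrier_mat n (r - 1)" "P1\<^sup>T \<in> carrier_mat (r - 1) n"
      using P 1 by auto
    ultimately have "fac (r - 1)" unfolding fac_def using PQ by metis
    then show False using min r0 by simp
  qed
  have inj: "M = 0\<^sub>m r r" if M: "M \<in> carrier_mat r r" and 0: "P * M * Q = 0\<^sub>m n n" for M
  proof -
    have MQ: "M * Q \<in> carrier_mat r n" using M Q by simp
    have "col (M * Q) j = 0\<^sub>v r" if "j < n" for j
    proof -
      have "P *\<^sub>v col (M * Q) j = col (P * (M * Q)) j"
        using MQ P that by (intro eq_vecI) auto
      also have "\<dots> = 0\<^sub>v n" using 0 that assoc_mult_mat[OF P M Q] by simp
      finally show ?thesis by (rule Pinj[rotated]) (use M in \<open>auto intro: carrier_vecI\<close>)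
    qed
    then have MQ0: "M * Q = 0\<^sub>m r n" using MQ
      by (intro eq_matI) (auto, metis index_col index_zero_vec(1) carrier_matD index_mult_mat(1-3))
    have "row M i = 0\<^sub>v r" if "i < r" for i
    proof -
      have "Q\<^sup>T *\<^sub>v row M i = row (M * Q) i"
        using M Q that by (intro eq_vecI) (auto simp: scalar_prod_def mult.commute)
      also have "\<dots> = 0\<^sub>v n" using MQ0 that by simp
      finally show ?thesis by (rule Qinj[rotated]) (use M in \<open>auto intro: carrier_vecI\<close>)
    qed
    then show ?thesis using M
      by (intro eq_matI) (auto, metis index_row(1) index_zero_vec(1) carrier_matD)
  qed
  have "M = 0\<^sub>m r r" if M: "M \<in> carrier_mat r r" and PMQ: "P * M * Q \<in> B" and det: "det M = 0" for M
  proof -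
    obtain u where u: "u \<in> carrier_vec r" "u \<noteq> 0\<^sub>v r" "M *\<^sub>v u = 0\<^sub>v r"
      using det det_0_iff_vec_prod_zero_field[OF M] by blast
    then obtain P1 Q1 where 1: "P1 \<in> carrier_mat r (r - 1)" "Q1 \<in> carrier_mat (r - 1) r" "M = P1 * Q1"
      using factor_through_smaller[OF M] by blast
    have "P * M * Q = (P * P1) * (Q1 * Q)"
      using P Q 1 by (auto simp: mat_assoc)
    moreover have "P * P1 \<in> carrier_mat n (r - 1)" "Q1 * Q \<in> carrier_mat (r - 1) n" using P Q 1 by auto
    moreover have "\<not> fac (r - 1)" using min r0 by simp
    ultimately have "P * M * Q = 0\<^sub>m n n" using PMQ unfolding fac_def by metis
    then show ?thesis using inj M by simp
  qed
  with r0 P Q PQ inj show thesis by (intro that)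
qed

section \<open>Spans of matrix semigroups and Burnside's theorem\<close>

lemma sum_matrix_entries:
  "(\<Sum>p\<in>{..<n} \<times> {..<m}. f p * A $$ p) = (\<Sum>i<n. \<Sum>j<m. f (i, j) * A $$ (i, j))"
  by (simp add: sum.cartesian_product split_def)

text \<open>A functional of a product is a functional of either factor. These two adjoints allow one
  factor to be treated at a time.\<close>

lemma sum_functional_mult:
  fixes A B :: "'a::comm_semiring_1 mat"
  assumes A: "A \<in> carrier_mat n m" and B: "B \<in> carrier_mat m k"
  shows "(\<Sum>p\<in>{..<n} \<times> {..<k}. f p * (A * B) $$ p)
      = (\<Sum>p\<in>{..<n} \<times> {..<m}. (\<Sum>j<k. f (fst p, j) * B $$ (snd p, j)) * A $$ p)"
    and "(\<Sum>p\<in>{..<n} \<times> {..<k}. f p * (A * B) $$ p)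
      = (\<Sum>p\<in>{..<m} \<times> {..<k}. (\<Sum>i<n. f (i, snd p) * A $$ (i, fst p)) * B $$ p)"
proof -
  have eq: "(\<Sum>p\<in>{..<n} \<times> {..<k}. f p * (A * B) $$ p)
      = (\<Sum>i<n. \<Sum>j<k. \<Sum>l<m. f (i, j) * A $$ (i, l) * B $$ (l, j))"
    unfolding sum_matrix_entries
    by (intro sum.cong refl) (simp add: index_mult_mat_sum[OF A B] sum_distrib_left mult.assoc del: index_mult_mat)
  show "(\<Sum>p\<in>{..<n} \<times> {..<k}. f p * (A * B) $$ p)
      = (\<Sum>p\<in>{..<n} \<times> {..<m}. (\<Sum>j<k. f (fst p, j) * B $$ (snd p, j)) * A $$ p)"
    unfolding eq unfolding sum_matrix_entries
    by (rule sum.cong[OF refl], subst sum.swap) (simp add: sum_distrib_left mult_ac)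
  show "(\<Sum>p\<in>{..<n} \<times> {..<k}. f p * (A * B) $$ p)
      = (\<Sum>p\<in>{..<m} \<times> {..<k}. (\<Sum>i<n. f (i, snd p) * A $$ (i, fst p)) * B $$ p)"
    unfolding eq unfolding sum_matrix_entries
  proof -
    have "(\<Sum>i<n. \<Sum>j<k. \<Sum>l<m. f (i, j) * A $$ (i, l) * B $$ (l, j))
        = (\<Sum>i<n. \<Sum>l<m. \<Sum>j<k. f (i, j) * A $$ (i, l) * B $$ (l, j))"
      by (intro sum.cong refl sum.swap)
    also have "\<dots> = (\<Sum>l<m. \<Sum>i<n. \<Sum>j<k. f (i, j) * A $$ (i, l) * B $$ (l, j))"
      by (rule sum.swap)
    also have "\<dots> = (\<Sum>l<m. \<Sum>j<k. \<Sum>i<n. f (i, j) * A $$ (i, l) * B $$ (l, j))"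
      by (intro sum.cong refl sum.swap)
    finally show "(\<Sum>i<n. \<Sum>j<k. \<Sum>l<m. f (i, j) * A $$ (i, l) * B $$ (l, j))
        = (\<Sum>l<m. \<Sum>j<k. (\<Sum>i<n. f (i, snd (l, j)) * A $$ (i, fst (l, j))) * B $$ (l, j))"
      by (simp add: sum_distrib_right)
  qed
qed

text \<open>The linear span of R, as the double annihilator for the pairing of matrices with functionals.\<close>
definition mat_span :: "nat \<Rightarrow> 'a::field mat set \<Rightarrow> 'a mat set" where
  "mat_span n R = {A \<in> carrier_mat n n. \<forall>f. (\<forall>Y\<in>R. (\<Sum>p\<in>{..<n} \<times> {..<n}. f p * Y $$ p) = 0)
     \<longrightarrow> (\<Sum>p\<in>{..<n} \<times> {..<n}. f p * A $$ p) = 0}"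

lemma mat_spanD:
  "A \<in> mat_span n R \<Longrightarrow> (\<And>Y. Y \<in> R \<Longrightarrow> (\<Sum>p\<in>{..<n} \<times> {..<n}. f p * Y $$ p) = 0)
    \<Longrightarrow> (\<Sum>p\<in>{..<n} \<times> {..<n}. f p * A $$ p) = 0"
  unfolding mat_span_def by blast

lemma mat_span_add: "A \<in> mat_span n R \<Longrightarrow> B \<in> mat_span n R \<Longrightarrow> A + B \<in> mat_span n R"
proof -
  assume A: "A \<in> mat_span n R" and B: "B \<in> mat_span n R"
  have "(\<Sum>p\<in>{..<n} \<times> {..<n}. f p * (A + B) $$ p) =
      (\<Sum>p\<in>{..<n} \<times> {..<n}. f p * A $$ p) + (\<Sum>p\<in>{..<n} \<times> {..<n}. f p * B $$ p)" for f
    using A B unfolding sum.distrib[symmetric] by (intro sum.cong) (auto simp: mat_span_def distrib_left)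
  with A B show ?thesis unfolding mat_span_def by auto
qed

lemma mat_span_smult: "A \<in> mat_span n R \<Longrightarrow> c \<cdot>\<^sub>m A \<in> mat_span n R"
proof -
  assume A: "A \<in> mat_span n R"
  have "(\<Sum>p\<in>{..<n} \<times> {..<n}. f p * (c \<cdot>\<^sub>m A) $$ p) = c * (\<Sum>p\<in>{..<n} \<times> {..<n}. f p * A $$ p)" for f
    using A unfolding sum_distrib_left by (intro sum.cong) (auto simp: mat_span_def mult_ac)
  with A show ?thesis unfolding mat_span_def by auto
qed

text \<open>For Y in \<open>R\<close> the functional Z |-> f(Z Y) kills \<open>R\<close>, hence
  kills A; so Z |-> f(A Z) kills \<open>R\<close> as well, hence kills B.\<close>

lemma mat_span_mult:
  assumes R: "R \<subseteq> carrier_mat n n" "\<And>A B. A \<in> R \<Longrightarrow> B \<in> R \<Longrightarrow> A * B \<in> R"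
    and A: "A \<in> mat_span n R" and B: "B \<in> mat_span n R"
  shows "A * B \<in> mat_span n R"
proof -
  have Ac: "A \<in> carrier_mat n n" and Bc: "B \<in> carrier_mat n n" using A B by (auto simp: mat_span_def)
  have "(\<Sum>p\<in>{..<n} \<times> {..<n}. f p * (A * B) $$ p) = 0"
    if f: "\<forall>Y\<in>R. (\<Sum>p\<in>{..<n} \<times> {..<n}. f p * Y $$ p) = 0" for f
  proof -
    have AY: "(\<Sum>p\<in>{..<n} \<times> {..<n}. f p * (A * Y) $$ p) = 0" if "Y \<in> R" for Y
    proof -
      have "(\<Sum>p\<in>{..<n} \<times> {..<n}. (\<Sum>j<n. f (fst p, j) * Y $$ (snd p, j)) * Z $$ p) = 0" if "Z \<in> R" for Z
      proof -
        have 0: "(\<Sum>p\<in>{..<n} \<times> {..<n}. f p * (Z * Y) $$ p) = 0"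
          by (rule f[rule_format]) (rule R(2)[OF that \<open>Y \<in> R\<close>])
        have Zc: "Z \<in> carrier_mat n n" and Yc: "Y \<in> carrier_mat n n"
          using that \<open>Y \<in> R\<close> R(1) by blast+
        show ?thesis by (rule trans[OF sum_functional_mult(1)[OF Zc Yc, of f, symmetric] 0])
      qed
      then have 0: "(\<Sum>p\<in>{..<n} \<times> {..<n}. (\<Sum>j<n. f (fst p, j) * Y $$ (snd p, j)) * A $$ p) = 0"
        by (intro mat_spanD[OF A])
      have Yc: "Y \<in> carrier_mat n n" using that R(1) by blast
      show ?thesis by (rule trans[OF sum_functional_mult(1)[OF Ac Yc, of f] 0])
    qed
    have "(\<Sum>p\<in>{..<n} \<times> {..<n}. (\<Sum>i<n. f (i, snd p) * A $$ (i, fst p)) * Y $$ p) = 0" if "Y \<in> R" for Y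
    proof -
      have Yc: "Y \<in> carrier_mat n n" using that R(1) by blast
      show ?thesis by (rule trans[OF sum_functional_mult(2)[OF Ac Yc, of f, symmetric] AY[OF that]])
    qed
    then have 0: "(\<Sum>p\<in>{..<n} \<times> {..<n}. (\<Sum>i<n. f (i, snd p) * A $$ (i, fst p)) * B $$ p) = 0"
      by (intro mat_spanD[OF B])
    show ?thesis by (rule trans[OF sum_functional_mult(2)[OF Ac Bc, of f] 0])
  qed
  then show ?thesis using Ac Bc unfolding mat_span_def by auto
qed

lemma mat_span_superset: "R \<subseteq> carrier_mat n n \<Longrightarrow> R \<subseteq> mat_span n R"
  unfolding mat_span_def by auto

text \<open>The orbit of u under the span is a subspace stable under \<open>R\<close>, and it
  contains u because \<open>1\<^sub>m n\<close> is in \<open>R\<close>; irreducibility makes it the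
  whole space.\<close>

lemma mat_span_transitive:
  assumes irr: "irreducible_rep n R (\<lambda>A. A)" and R: "R \<subseteq> carrier_mat n n" "1\<^sub>m n \<in> R"
    "\<And>A B. A \<in> R \<Longrightarrow> B \<in> R \<Longrightarrow> A * B \<in> R"
    and u: "u \<in> carrier_vec n" "u \<noteq> 0\<^sub>v n" and z: "z \<in> carrier_vec n"
  obtains A where "A \<in> mat_span n R" "A *\<^sub>v u = z"
proof -
  define W where "W = {A *\<^sub>v u | A. A \<in> mat_span n R}"
  interpret vec_space "TYPE('a)" n .
  have Rs: "R \<subseteq> mat_span n R" by (rule mat_span_superset[OF R(1)])
  have sc: "A \<in> carrier_mat n n" if "A \<in> mat_span n R" for A using that by (auto simp: mat_span_def)
  have "submodule class_ring W (module_vec TYPE('a) n)"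
  proof
    show "W \<subseteq> carrier (module_vec TYPE('a) n)"
      using sc u by (auto simp: W_def module_vec_simps intro!: mult_mat_vec_carrier)
    show "x \<oplus>\<^bsub>module_vec TYPE('a) n\<^esub> y \<in> W" if xy: "x \<in> W" "y \<in> W" for x y
    proof -
      obtain A B where AB: "A \<in> mat_span n R" "x = A *\<^sub>v u" "B \<in> mat_span n R" "y = B *\<^sub>v u"
        using xy by (auto simp: W_def)
      then have "x + y = (A + B) *\<^sub>v u" using sc u by (simp add: add_mult_distrib_mat_vec[of _ n n])
      then show ?thesis using mat_span_add[OF AB(1,3)] unfolding W_def module_vec_simps by blast
    qed
    show "\<zero>\<^bsub>module_vec TYPE('a) n\<^esub> \<in> W"
    proof -
      have "0 \<cdot>\<^sub>m 1\<^sub>m n \<in> mat_span n R" using mat_span_smult R(2) Rs by blast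
      moreover have "(0 \<cdot>\<^sub>m 1\<^sub>m n) *\<^sub>v u = 0\<^sub>v n" using u by (intro eq_vecI) auto
      ultimately show ?thesis unfolding W_def module_vec_simps by force
    qed
    show "c \<odot>\<^bsub>module_vec TYPE('a) n\<^esub> x \<in> W" if x: "x \<in> W" for c x
    proof -
      obtain A where A: "A \<in> mat_span n R" "x = A *\<^sub>v u" using x by (auto simp: W_def)
      then have "c \<cdot>\<^sub>v x = (c \<cdot>\<^sub>m A) *\<^sub>v u" using sc[OF A(1)] u by (intro eq_vecI) auto
      then show ?thesis using mat_span_smult[OF A(1), of c] unfolding W_def module_vec_simps by auto
    qed
  qed
  then have sub: "VectorSpace.subspace class_ring W (module_vec TYPE('a) n)"
    unfolding VectorSpace.subspace_def using vectorspace_axioms by simp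
  have inv: "A *\<^sub>v w \<in> W" if Aw: "A \<in> R" "w \<in> W" for A w
  proof -
    obtain B where B: "B \<in> mat_span n R" "w = B *\<^sub>v u" using Aw by (auto simp: W_def)
    then have "A *\<^sub>v w = (A * B) *\<^sub>v u"
      using sc[OF B(1)] Aw R(1) u by (simp add: assoc_mult_mat_vec[of A n n B n u] subset_iff)
    moreover have "A * B \<in> mat_span n R" using mat_span_mult R(1,3) Aw Rs B by blast
    ultimately show ?thesis by (auto simp: W_def)
  qed
  have "W = {0\<^sub>v n} \<or> W = carrier_vec n"
    using irr sub inv unfolding irreducible_rep_def by blast
  moreover have "u \<in> W" unfolding W_def using R(2) Rs u by force
  ultimately have "z \<in> W" using u z by auto
  then show thesis using that by (auto simp: W_def)
qed

lemma eigenvalue_exists: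
  fixes M :: "'a::alg_closed_field mat"
  assumes M: "M \<in> carrier_mat r r" and "r > 0"
  obtains c where "det (M - c \<cdot>\<^sub>m 1\<^sub>m r) = 0"
proof -
  have "degree (char_poly M) > 0" using degree_monic_char_poly[OF M] assms by simp
  then obtain c where "poly (char_poly M) c = 0" using alg_closed_imp_poly_has_root by blast
  then have "eigenvalue M c" using eigenvalue_root_char_poly[OF M] by simp
  then have "det (M - c \<cdot>\<^sub>m 1\<^sub>m r) = 0"
    using eigenvalue_det[OF M, of c]
  proof -
    have "M - c \<cdot>\<^sub>m 1\<^sub>m r = char_matrix M c" using M by (intro eq_matI) (auto simp: char_matrix_def)
    then show "eigenvalue M c = (det (char_matrix M c) = 0) \<Longrightarrow> eigenvalue M c \<Longrightarrow> ?thesis" by simp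
  qed
  then show thesis by (rule that)
qed

text \<open>Take an element \<open>P * Q\<close> of least rank in the span. Over an algebraically
  closed field every compression \<open>Q * A * P\<close> is scalar, and transitivity then forces
  rank one. Multiplying this element on both sides by the span gives enough rank one matrices to
  detect every functional.\<close>

lemma burnside_alg_closed:
  fixes R :: "'a::alg_closed_field mat set"
  assumes irr: "irreducible_rep n R (\<lambda>A. A)" and R: "R \<subseteq> carrier_mat n n" "1\<^sub>m n \<in> R"
    "\<And>A B. A \<in> R \<Longrightarrow> B \<in> R \<Longrightarrow> A * B \<in> R"
  shows "nondegenerate ({..<n} \<times> {..<n}) (($$) ` R)"
proof -
  let ?S = "mat_span n R"
  have n: "n > 0" using irr by (simp add: irreducible_rep_def)
  have sc: "A \<in> carrier_mat n n" if "A \<in> ?S" for A using that by (auto simp: mat_span_def)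
  have one: "1\<^sub>m n \<in> ?S" using mat_span_superset[OF R(1)] R(2) by blast
  have mult: "A * B \<in> ?S" if "A \<in> ?S" "B \<in> ?S" for A B using mat_span_mult[of R n A B] R that by blast
  have trans: "(\<And>A. A \<in> ?S \<Longrightarrow> A *\<^sub>v u = z \<Longrightarrow> thesis) \<Longrightarrow> thesis"
    if "u \<in> carrier_vec n" "u \<noteq> 0\<^sub>v n" "z \<in> carrier_vec n" for u z thesis
    using mat_span_transitive[of n R u z] irr R that by blast
  have "1\<^sub>m n \<noteq> (0\<^sub>m n n :: 'a mat)" using n by (metis index_one_mat(1) index_zero_mat(1) zero_neq_one)
  then obtain r P Q where r: "r > 0" and P: "P \<in> carrier_mat n r" and Q: "Q \<in> carrier_mat r n"
    and PQ: "P * Q \<in> ?S"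
    and inj: "\<And>M. M \<in> carrier_mat r r \<Longrightarrow> P * M * Q = 0\<^sub>m n n \<Longrightarrow> M = 0\<^sub>m r r"
    and min: "\<And>M. M \<in> carrier_mat r r \<Longrightarrow> P * M * Q \<in> ?S \<Longrightarrow> det M = 0 \<Longrightarrow> M = 0\<^sub>m r r"
    using minimal_factorization[of ?S n "1\<^sub>m n"] sc one by blast
  define E where "E k = mat r r (\<lambda>p. if p = (k, k) then 1 else (0::'a))" for k
  have Enz: "E k \<noteq> 0\<^sub>m r r" if "k < r" for k
    using that by (auto simp: E_def mat_eq_iff)
  have Ec: "E k \<in> carrier_mat r r" for k by (simp add: E_def)
  then have "dim_row (E k) = r" "dim_col (E k) = r" for k by auto
  note Ed = this
  have Eidx: "E k $$ (i, j) = (if i = k \<and> j = k then 1 else 0)" if "i < r" "j < r" for i j k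
    using that by (simp add: E_def)
  have Pnz: "col P 0 \<noteq> 0\<^sub>v n"
  proof
    assume 0: "col P 0 = 0\<^sub>v n"
    have "P $$ (i, 0) = 0" if "i < n" for i using 0 that P r by (metis index_col index_zero_vec(1) carrier_matD)
    then have "P * E 0 = 0\<^sub>m n r"
      using P Ec by (intro eq_matI)
        (auto simp: index_mult_mat_sum[OF P Ec] Eidx simp del: index_mult_mat(1) intro!: sum.neutral)
    then have "P * E 0 * Q = 0\<^sub>m n n" using Q by simp
    then show False using inj[OF Ec] Enz r by blast
  qed
  \<comment> \<open>Subtracting an eigenvalue c leaves a singular matrix, and sandwiched between P
    and Q it still lies in the span, so minimality makes it 0.\<close>
  have scalar: "\<exists>c. Q * A * P = c \<cdot>\<^sub>m 1\<^sub>m r" if A: "A \<in> ?S" for A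
  proof -
    have Ac: "A \<in> carrier_mat n n" by (rule sc[OF A])
    define M where "M = Q * A * P"
    have M: "M \<in> carrier_mat r r" using Q Ac P by (simp add: M_def)
    obtain c where c: "det (M - c \<cdot>\<^sub>m 1\<^sub>m r) = 0" using eigenvalue_exists[OF M r] .
    have "P * (M - c \<cdot>\<^sub>m 1\<^sub>m r) = P * M - c \<cdot>\<^sub>m P"
      using P M mult_smult_distrib[OF P one_carrier_mat, of c] by (simp add: mult_minus_distrib_mat)
    then have "P * (M - c \<cdot>\<^sub>m 1\<^sub>m r) * Q = P * M * Q - c \<cdot>\<^sub>m (P * Q)"
      using P Q M minus_mult_distrib_mat[of "P * M" n r "c \<cdot>\<^sub>m P" Q n]
        mult_smult_assoc_mat[OF P Q, of c] by simp
    also have "P * M * Q = (P * Q) * A * (P * Q)"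
      unfolding M_def using P Q Ac by (simp add: mat_assoc)
    also have "\<dots> - c \<cdot>\<^sub>m (P * Q) = (P * Q) * A * (P * Q) + (- c) \<cdot>\<^sub>m (P * Q)"
      using P Q Ac by (intro eq_matI) auto
    finally have "P * (M - c \<cdot>\<^sub>m 1\<^sub>m r) * Q \<in> ?S"
      using mat_span_add[OF mult[OF mult[OF PQ A] PQ] mat_span_smult[OF PQ]] by simp
    then have "M - c \<cdot>\<^sub>m 1\<^sub>m r = 0\<^sub>m r r"
      by (rule min[rotated]) (use M c in \<open>auto intro!: minus_carrier_mat\<close>)
    then have "M = c \<cdot>\<^sub>m 1\<^sub>m r" using M
      by (auto simp: mat_eq_iff)
    then show ?thesis by (auto simp: M_def)
  qed
  have "r = 1"
  proof (rule ccontr)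
    assume "r \<noteq> 1"
    then have r1: "1 < r" using r by simp
    \<comment> \<open>Move column 0 of P to the j-th unit vector. Entry (1, 0) of the scalar matrix
      \<open>Q * A * P\<close> is then entry (1, j) of Q.\<close>
    have Q1: "Q $$ (1, j) = 0" if j: "j < n" for j
    proof -
      obtain A where A: "A \<in> ?S" "A *\<^sub>v col P 0 = unit_vec n j"
        using trans[of "col P 0" "unit_vec n j"] Pnz P r by auto
      obtain c where c: "Q * A * P = c \<cdot>\<^sub>m 1\<^sub>m r" using scalar[OF A(1)] by blast
      have "Q * A * P = Q * (A * P)" using assoc_mult_mat[OF Q sc[OF A(1)] P] .
      then have "col (Q * A * P) 0 = Q *\<^sub>v (A *\<^sub>v col P 0)"
        using Q P sc[OF A(1)] r by (intro eq_vecI) (auto simp: mult_mat_vec_def)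
      then have "Q *\<^sub>v unit_vec n j = col (c \<cdot>\<^sub>m 1\<^sub>m r) 0" using A c by simp
      then have "(Q *\<^sub>v unit_vec n j) $ 1 = 0" using r1 by simp
      then show ?thesis using Q r1 j by (simp add: row_def)
    qed
    have "E 1 * Q = 0\<^sub>m r n"
      using Q Q1 r1 by (intro eq_matI)
        (auto simp: index_mult_mat_sum[OF Ec Q] Eidx Ed simp del: index_mult_mat(1) intro!: sum.neutral)
    then have "P * E 1 * Q = 0\<^sub>m n n" using P Q Ec assoc_mult_mat[OF P Ec Q] by simp
    then show False using inj[OF Ec] Enz r1 by blast
  qed
  show ?thesis unfolding nondegenerate_def
  proof (intro allI impI ballI)
    fix f ij assume f0: "\<forall>s\<in>($$) ` R. (\<Sum>p\<in>{..<n} \<times> {..<n}. f p * s p) = (0::'a)" and ij: "ij \<in> {..<n} \<times> {..<n}"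
    obtain i j where ij': "ij = (i, j)" "i < n" "j < n" using ij by auto
    have f: "(\<Sum>p\<in>{..<n} \<times> {..<n}. f p * Y $$ p) = 0" if "Y \<in> ?S" for Y
      using that f0 unfolding mat_span_def by auto
    \<comment> \<open>Row i of the functional. If it is nonzero, the span carries column 0 of P to
      unit vector i and w to unit vector l, and f evaluated at A P Q B reads off entry l of the row
      Q.\<close>
    define w where "w = vec n (\<lambda>j. f (i, j))"
    have "w = 0\<^sub>v n"
    proof (rule ccontr)
      assume w: "w \<noteq> 0\<^sub>v n"
      obtain A where A: "A \<in> ?S" "A *\<^sub>v col P 0 = unit_vec n i"
        using trans[of "col P 0" "unit_vec n i"] Pnz P r by auto
      have AP: "(A * P) $$ (k, 0) = (if k = i then 1 else 0)" if "k < n" for k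
      proof -
        have "(A * P) $$ (k, 0) = (A *\<^sub>v col P 0) $ k" using sc[OF A(1)] P r that by simp
        then show ?thesis using A that ij' by (simp add: unit_vec_def)
      qed
      have "Q $$ (0, l) = 0" if l: "l < n" for l
      proof -
        obtain B where B: "B \<in> ?S" "B *\<^sub>v w = unit_vec n l"
          using trans[of w "unit_vec n l"] w by (auto simp: w_def)
        have QB: "Q * B \<in> carrier_mat 1 n" using Q sc[OF B(1)] \<open>r = 1\<close> by simp
        have APc: "A * P \<in> carrier_mat n 1" using P sc[OF A(1)] \<open>r = 1\<close> by simp
        have "A * (P * Q) * B = (A * P) * (Q * B)"
          using sc[OF A(1)] sc[OF B(1)] P Q by (simp add: mat_assoc)
        then have "(A * P) * (Q * B) \<in> ?S" using mult A B PQ by metis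
        from f[OF this] have "0 = (\<Sum>k<n. \<Sum>m<n. f (k, m) * ((A * P) * (Q * B)) $$ (k, m))"
          by (simp add: sum_matrix_entries)
        also have "\<dots> = (\<Sum>k<n. \<Sum>m<n. f (k, m) * ((if k = i then 1 else 0) * (Q * B) $$ (0, m)))"
          using index_mult_mat_sum[OF APc QB] AP by (intro sum.cong refl) simp
        also have "\<dots> = (\<Sum>k<n. if k = i then \<Sum>m<n. f (k, m) * (Q * B) $$ (0, m) else 0)"
          by (intro sum.cong refl) auto
        also have "\<dots> = (\<Sum>m<n. f (i, m) * (Q * B) $$ (0, m))" using ij' by simp
        also have "\<dots> = ((Q * B) *\<^sub>v w) $ 0"
          using index_mult_mat_vec_sum[OF QB, of w 0] by (simp add: w_def mult.commute)
        also have "(Q * B) *\<^sub>v w = Q *\<^sub>v unit_vec n l"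
          using B assoc_mult_mat_vec[OF Q sc[OF B(1)], of w] by (simp add: w_def)
        also have "(Q *\<^sub>v unit_vec n l) $ 0 = Q $$ (0, l)" using Q r l by simp
        finally show ?thesis by simp
      qed
      then have "Q = 0\<^sub>m r n" using Q \<open>r = 1\<close> by (intro eq_matI) auto
      then have "P * 1\<^sub>m r * Q = 0\<^sub>m n n" using P by simp
      then have "1\<^sub>m r = (0\<^sub>m r r :: 'a mat)" using inj by simp
      then show False using r by (metis index_one_mat(1) index_zero_mat(1) zero_neq_one)
    qed
    then have "w $ j = 0" using ij' by simp
    then show "f ij = 0" using ij' by (simp add: w_def)
  qed
qed

text \<open>A functional over the small field that kills the matrices also kills them over the
  algebraic closure, where Burnside's theorem applies. Closure under products is stated for the
  matrices, since \<open>H\<close> is a bare set.\<close>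

lemma abs_irreducible_nondegenerate:
  fixes \<rho> :: "'g \<Rightarrow> 'a::field mat"
  assumes irr: "abs_irreducible n H \<rho>" and \<rho>: "\<And>h. h \<in> H \<Longrightarrow> \<rho> h \<in> carrier_mat n n"
    and one: "e \<in> H" "\<rho> e = 1\<^sub>m n"
    and mult: "\<And>h h'. h \<in> H \<Longrightarrow> h' \<in> H \<Longrightarrow> \<exists>h''\<in>H. \<rho> h * \<rho> h' = \<rho> h''"
  shows "nondegenerate ({..<n} \<times> {..<n}) ((\<lambda>h. ($$) (\<rho> h)) ` H)"
proof -
  interpret ac: comm_ring_hom "to_ac :: 'a \<Rightarrow> 'a alg_closure" by unfold_locales auto
  let ?R = "(\<lambda>h. map_mat to_ac (\<rho> h)) ` H"
  have "irreducible_rep n ?R (\<lambda>A. A)"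
    using irr unfolding abs_irreducible_def irreducible_rep_def by simp
  moreover have "?R \<subseteq> carrier_mat n n" using \<rho> by auto
  moreover have "1\<^sub>m n \<in> ?R" using one ac.mat_hom_one by (metis imageI)
  moreover have "A * B \<in> ?R" if AB: "A \<in> ?R" "B \<in> ?R" for A B
  proof -
    obtain h h' where h: "h \<in> H" "A = map_mat to_ac (\<rho> h)" "h' \<in> H" "B = map_mat to_ac (\<rho> h')"
      using AB by auto
    obtain h'' where "h'' \<in> H" "\<rho> h * \<rho> h' = \<rho> h''" using mult h by blast
    then have "A * B = map_mat to_ac (\<rho> h'')"
      using h ac.mat_hom_mult[OF \<rho>[OF h(1)] \<rho>[OF h(3)]] by simp
    then show ?thesis using \<open>h'' \<in> H\<close> by blast
  qed
  ultimately have nd: "nondegenerate ({..<n} \<times> {..<n}) (($$) ` ?R)" by (rule burnside_alg_closed)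
  show ?thesis unfolding nondegenerate_def
  proof (intro allI impI ballI)
    fix f p assume f: "\<forall>s\<in>(\<lambda>h. ($$) (\<rho> h)) ` H. (\<Sum>i\<in>{..<n} \<times> {..<n}. f i * s i) = 0"
      and p: "p \<in> {..<n} \<times> {..<n}"
    have "(\<Sum>i\<in>{..<n} \<times> {..<n}. to_ac (f i) * s i) = 0" if s: "s \<in> ($$) ` ?R" for s
    proof -
      obtain h where h: "h \<in> H" "s = ($$) (map_mat to_ac (\<rho> h))" using s by auto
      have "(\<Sum>i\<in>{..<n} \<times> {..<n}. to_ac (f i) * s i) = to_ac (\<Sum>i\<in>{..<n} \<times> {..<n}. f i * \<rho> h $$ i)"
        unfolding to_ac_sum using h \<rho>[OF h(1)] by (intro sum.cong) auto
      then show ?thesis using f h by auto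
    qed
    from nondegenerateD[OF nd this p] show "f p = 0" by simp
  qed
qed

section \<open>Finite subfields and the Chevalley--Warning argument\<close>

lemma subfield_set_pow_card:
  assumes F: "subfield_set F" "finite F" and x: "x \<in> F" "x \<noteq> 0"
  shows "x ^ (card F - 1) = 1"
proof -
  let ?G = "F - {0}"
  have "bij_betw ((*) x) ?G ?G"
    by (rule bij_betw_byWitness[of _ "(*) (inverse x)"]) (use F x in \<open>auto intro: subfield_setD\<close>)
  then have "(\<Prod>y\<in>?G. y) = (\<Prod>y\<in>?G. x * y)" by (rule prod.reindex_bij_betw[symmetric])
  also have "\<dots> = x ^ card ?G * (\<Prod>y\<in>?G. y)" by (simp add: prod.distrib)
  finally have "(1 - x ^ card ?G) * (\<Prod>y\<in>?G. y) = 0" by (simp add: algebra_simps)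
  moreover have "(\<Prod>y\<in>?G. y) \<noteq> 0" using F by simp
  ultimately show ?thesis using F subfield_setD(1)[OF F(1)] by simp
qed

text \<open>Translation by 1 permutes \<open>F\<close>, so it does not change the sum of the
  elements.\<close>

lemma of_nat_card_subfield_set:
  fixes F :: "'a::field set"
  assumes F: "subfield_set F" "finite F"
  shows "of_nat (card F) = (0 :: 'a)"
proof -
  have "bij_betw (\<lambda>y. y + 1) F F"
    by (rule bij_betw_byWitness[of _ "\<lambda>y. y - 1"]) (use F in \<open>auto intro: subfield_setD\<close>)
  then have "(\<Sum>y\<in>F. y) = (\<Sum>y\<in>F. y + 1)" by (rule sum.reindex_bij_betw[symmetric])
  then show ?thesis by (simp add: sum.distrib)
qed

lemma card_subfield_set_ge_2: "subfield_set F \<Longrightarrow> finite F \<Longrightarrow> 2 \<le> card F"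
  using card_mono[of F "{0, 1}"] subfield_setD(1,2)[of F] by auto

text \<open>Scaling by a nonzero a multiplies the sum by a^e, and some a has a^e distinct from 1
  because X^e - 1 has at most e roots. For e = 0 the convention 0^0 = 1 turns the sum into the
  cardinality, which is 0 in the field.\<close>

lemma subfield_set_power_sum:
  fixes F :: "'a::field set"
  assumes F: "subfield_set F" "finite F" and e: "e < card F - 1"
  shows "(\<Sum>x\<in>F. x ^ e) = 0"
proof (cases "e = 0")
  case True
  then show ?thesis using of_nat_card_subfield_set[OF F] by simp
next
  case False
  have "\<exists>a\<in>F - {0}. a ^ e \<noteq> 1"
  proof (rule ccontr)
    assume "\<not> ?thesis"
    then have sub: "F - {0} \<subseteq> {x. poly (monom 1 e - 1) x = 0}" by (auto simp: poly_monom)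
    have p: "monom 1 e - 1 \<noteq> (0 :: 'a poly)"
      using False by (metis degree_1 degree_monom_eq eq_iff_diff_eq_0 zero_neq_one)
    have "card (F - {0}) \<le> card {x. poly (monom 1 e - 1 :: 'a poly) x = 0}"
      using sub poly_roots_finite[OF p] card_mono by blast
    also have "\<dots> \<le> degree (monom 1 e - 1 :: 'a poly)" by (rule poly_roots_degree[OF p])
    also have "\<dots> \<le> e" by (rule degree_diff_le) (auto simp: degree_monom_le)
    finally show False using e F subfield_setD(1)[OF F(1)] by simp
  qed
  then obtain a where a: "a \<in> F" "a \<noteq> 0" "a ^ e \<noteq> 1" by auto
  have "bij_betw ((*) a) F F"
    by (rule bij_betw_byWitness[of _ "(*) (inverse a)"]) (use F a in \<open>auto intro: subfield_setD\<close>)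
  then have "(\<Sum>y\<in>F. y ^ e) = (\<Sum>y\<in>F. (a * y) ^ e)" by (rule sum.reindex_bij_betw[symmetric])
  also have "\<dots> = a ^ e * (\<Sum>y\<in>F. y ^ e)" by (simp add: power_mult_distrib sum_distrib_left)
  finally have "(1 - a ^ e) * (\<Sum>y\<in>F. y ^ e) = 0" by (simp add: algebra_simps)
  then show ?thesis using a by simp
qed

text \<open>A monomial of degree below N (q - 1) in N variables has an exponent below q - 1, and the
  sum over that variable vanishes. The variables run through \<open>F\<close>, while the
  coefficients may lie outside it.\<close>

lemma sum_prod_linear_forms:
  fixes c :: "'k \<Rightarrow> nat \<Rightarrow> 'a::field"
  assumes F: "subfield_set F" "finite F" and K: "finite K" "card K < N * (card F - 1)"
  shows "(\<Sum>x\<in>{..<N} \<rightarrow>\<^sub>E F. \<Prod>k\<in>K. \<Sum>i<N. c k i * x i) = 0"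
proof -
  \<comment> \<open>h chooses the variable taken from each factor, and \<open>e\<close> counts the
    resulting exponents.\<close>
  have mono: "(\<Sum>x\<in>{..<N} \<rightarrow>\<^sub>E F. \<Prod>k\<in>K. x (h k)) = 0" if h: "h \<in> K \<rightarrow>\<^sub>E {..<N}" for h
  proof -
    define e where "e i = card {k \<in> K. h k = i}" for i
    have "(\<Prod>k\<in>K. x (h k)) = (\<Prod>i<N. x i ^ e i)" for x :: "nat \<Rightarrow> 'a"
    proof -
      have "(\<Prod>k\<in>K. x (h k)) = (\<Prod>i<N. \<Prod>k\<in>{k \<in> K. h k = i}. x (h k))"
        using h by (intro prod.group[symmetric] K) auto
      also have "\<dots> = (\<Prod>i<N. x i ^ e i)" by (intro prod.cong) (auto simp: e_def)
      finally show ?thesis .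
    qed
    then have "(\<Sum>x\<in>{..<N} \<rightarrow>\<^sub>E F. \<Prod>k\<in>K. x (h k)) = (\<Prod>i<N. \<Sum>y\<in>F. y ^ e i)"
      using prod_sum_PiE[of "{..<N}" "\<lambda>_. F" "\<lambda>i y. y ^ e i"] F by simp
    moreover have "\<exists>i<N. e i < card F - 1"
    proof (rule ccontr)
      assume "\<not> ?thesis"
      then have "card F - 1 \<le> e i" if "i \<in> {..<N}" for i using that leI by blast
      from sum_bounded_below[of "{..<N}" "card F - 1" e, OF this]
      have "N * (card F - 1) \<le> (\<Sum>i<N. e i)" by simp
      also have "\<dots> = card K"
        using sum.group[of K "{..<N}" h "\<lambda>_. 1::nat"] h K by (auto simp: e_def)
      finally show False using K by simp
    qed
    ultimately show ?thesis using subfield_set_power_sum[OF F] by auto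
  qed
  have "(\<Sum>x\<in>{..<N} \<rightarrow>\<^sub>E F. \<Prod>k\<in>K. \<Sum>i<N. c k i * x i)
      = (\<Sum>x\<in>{..<N} \<rightarrow>\<^sub>E F. \<Sum>h\<in>K \<rightarrow>\<^sub>E {..<N}. \<Prod>k\<in>K. c k (h k) * x (h k))"
    using K by (intro sum.cong refl prod_sum_PiE) auto
  also have "\<dots> = (\<Sum>h\<in>K \<rightarrow>\<^sub>E {..<N}. (\<Prod>k\<in>K. c k (h k)) * (\<Sum>x\<in>{..<N} \<rightarrow>\<^sub>E F. \<Prod>k\<in>K. x (h k)))"
    by (subst sum.swap) (simp add: prod.distrib sum_distrib_left)
  also have "\<dots> = 0" using mono by (intro sum.neutral) auto
  finally show ?thesis .
qed

text \<open>Without a nontrivial zero, the (q - 1)-st power of the determinant would sum to -1 over all x,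
  but its degree is too small for a nonzero sum.\<close>
lemma chevalley_warning_det:
  fixes D :: "nat \<Rightarrow> nat \<times> nat \<Rightarrow> 'a::field"
  assumes F: "subfield_set F" "finite F" and r: "0 < r" "r < N"
    and det: "\<And>x. x \<in> {..<N} \<rightarrow>\<^sub>E F \<Longrightarrow> det (mat r r (\<lambda>p. \<Sum>i<N. x i * D i p)) \<in> F"
  shows "\<exists>x\<in>{..<N} \<rightarrow>\<^sub>E F. (\<exists>i<N. x i \<noteq> 0) \<and> det (mat r r (\<lambda>p. \<Sum>i<N. x i * D i p)) = 0"
proof (rule ccontr)
  assume neg: "\<not> ?thesis"
  let ?X = "{..<N} \<rightarrow>\<^sub>E F" and ?q = "card F"
  define \<delta> where "\<delta> x = det (mat r r (\<lambda>p. \<Sum>i<N. x i * D i p))" for x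
  have q: "2 \<le> ?q" using card_subfield_set_ge_2 F by blast
  let ?P = "{p. p permutes {0..<r}}"
  have finP: "finite ?P" by (simp add: finite_permutations)
  define z where "z = (\<lambda>i\<in>{..<N}. 0::'a)"
  have z: "z \<in> ?X" using subfield_setD(1)[OF F(1)] by (auto simp: z_def)
  have "mat r r (\<lambda>p. \<Sum>i<N. z i * D i p) = 0\<^sub>m r r" by (intro eq_matI) (auto simp: z_def)
  then have "\<delta> z = 0" using r by (simp add: \<delta>_def)
  \<comment> \<open>The entries need not lie in \<open>F\<close>, but the determinant does, so
    Fermat's identity applies to it.\<close>
  moreover have "\<delta> x ^ (?q - 1) = 1" if x: "x \<in> ?X - {z}" for x
  proof -
    have "\<exists>i<N. x i \<noteq> 0"
    proof (rule ccontr)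
      assume "\<not> ?thesis"
      then have "x = z" using x by (intro ext) (auto simp: z_def PiE_def extensional_def)
      then show False using x by simp
    qed
    then have "\<delta> x \<noteq> 0" using neg x by (auto simp: \<delta>_def)
    then show ?thesis using subfield_set_pow_card[OF F] det x by (simp add: \<delta>_def)
  qed
  ultimately have "(\<Sum>x\<in>?X. \<delta> x ^ (?q - 1)) = of_nat (card ?X - 1)"
    using z q F by (simp add: sum.remove[of ?X z] finite_PiE zero_power)
  also have "of_nat (card ?X - 1) = (of_nat (?q ^ N) - 1 :: 'a)"
    using q by (simp add: card_PiE of_nat_diff)
  also have "\<dots> = - 1" using of_nat_card_subfield_set[OF F] r by (simp add: of_nat_power)
  finally have 1: "(\<Sum>x\<in>?X. \<delta> x ^ (?q - 1)) = - 1" .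
  define L where "L x a b = (\<Sum>i<N. D i (a, b) * x i)" for x a b
  \<comment> \<open>Leibniz expansion of each of the q - 1 factors: h t is the permutation used in
    factor t. What remains are products of r (q - 1) linear forms in x.\<close>
  have "\<delta> x ^ (?q - 1) = (\<Sum>h\<in>{..<?q - 1} \<rightarrow>\<^sub>E ?P. (\<Prod>t<?q - 1. signof (h t)) *
      (\<Prod>(t, a)\<in>{..<?q - 1} \<times> {0..<r}. L x a (h t a)))" for x
  proof -
    have "\<delta> x = (\<Sum>p\<in>?P. signof p * (\<Prod>a = 0..<r. mat r r (\<lambda>p. \<Sum>i<N. x i * D i p) $$ (a, p a)))"
      unfolding \<delta>_def by (subst det_def'[of _ r]) auto
    also have "\<dots> = (\<Sum>p\<in>?P. signof p * (\<Prod>a = 0..<r. L x a (p a)))"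
      by (intro sum.cong refl arg_cong2[of _ _ _ _ "(*)"] prod.cong)
        (auto simp: L_def mult.commute permutes_in_image)
    finally have "\<delta> x ^ (?q - 1) = (\<Prod>t<?q - 1. \<Sum>p\<in>?P. signof p * (\<Prod>a = 0..<r. L x a (p a)))" by simp
    also have "\<dots> = (\<Sum>h\<in>{..<?q - 1} \<rightarrow>\<^sub>E ?P. \<Prod>t<?q - 1. signof (h t) * (\<Prod>a = 0..<r. L x a (h t a)))"
      by (rule prod_sum_PiE) (use finP in auto)
    also have "\<dots> = (\<Sum>h\<in>{..<?q - 1} \<rightarrow>\<^sub>E ?P. (\<Prod>t<?q - 1. signof (h t)) *
      (\<Prod>(t, a)\<in>{..<?q - 1} \<times> {0..<r}. L x a (h t a)))"
      by (simp add: prod.distrib prod.cartesian_product)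
    finally show ?thesis .
  qed
  then have "(\<Sum>x\<in>?X. \<delta> x ^ (?q - 1)) = (\<Sum>h\<in>{..<?q - 1} \<rightarrow>\<^sub>E ?P. (\<Prod>t<?q - 1. signof (h t)) *
      (\<Sum>x\<in>?X. \<Prod>(t, a)\<in>{..<?q - 1} \<times> {0..<r}. L x a (h t a)))"
    by (simp add: sum_distrib_left sum.swap[of _ ?X])
  also have "\<dots> = 0"
  proof (intro sum.neutral ballI)
    fix h
    have "card ({..<?q - 1} \<times> {0..<r}) < N * (?q - 1)" using q r by simp
    from sum_prod_linear_forms[OF F _ this, of "\<lambda>(t, a) i. D i (a, h t a)"]
    show "(\<Prod>t<?q - 1. signof (h t)) * (\<Sum>x\<in>?X. \<Prod>(t, a)\<in>{..<?q - 1} \<times> {0..<r}. L x a (h t a)) = 0"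
      by (simp add: L_def split_def)
  qed
  finally show False using 1 by simp
qed

section \<open>Compressing a matrix ring to rank one\<close>

lemma elements_mat_subset_iff:
  "A \<in> carrier_mat n m \<Longrightarrow> elements_mat A \<subseteq> F \<longleftrightarrow> (\<forall>i<n. \<forall>j<m. A $$ (i, j) \<in> F)"
  by (blast dest: elements_matD)

text \<open>Sylvester's identity: the block matrix with rows (1, A) and (-B, 1) is factored in two
  ways, which leave 1 + A B and 1 + B A respectively on the diagonal.\<close>

lemma det_one_add_mult:
  fixes A :: "'a::idom mat"
  assumes A: "A \<in> carrier_mat n r" and B: "B \<in> carrier_mat r n"
  shows "det (1\<^sub>m n + A * B) = det (1\<^sub>m r + B * A)"
proof -
  let ?L = "four_block_mat (1\<^sub>m n) (0\<^sub>m n r) (- B) (1\<^sub>m r)"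
  let ?M = "four_block_mat (1\<^sub>m n + A * B) A (0\<^sub>m r n) (1\<^sub>m r)"
  let ?N = "four_block_mat (1\<^sub>m n) A (0\<^sub>m r n) (1\<^sub>m r + B * A)"
  have BA: "B * (- A) = - (B * A)" "(- B) * A = - (B * A)" "A * (- B) = - (A * B)" using A B by auto
  have "?M * ?L = four_block_mat (1\<^sub>m n) A (- B) (1\<^sub>m r)"
    using A B BA
    by (subst mult_four_block_mat[of _ n n _ r _ r _ _ n _ r]) (auto intro!: cong_four_block_mat eq_matI)
  moreover have "?L * ?N = four_block_mat (1\<^sub>m n) A (- B) (1\<^sub>m r)"
    using A B BA
    by (subst mult_four_block_mat[of _ n n _ r _ r _ _ n _ r]) (auto intro!: cong_four_block_mat eq_matI)
  ultimately have "?M * ?L = ?L * ?N" by simp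
  moreover have c: "?M \<in> carrier_mat (n + r) (n + r)" "?L \<in> carrier_mat (n + r) (n + r)"
      "?N \<in> carrier_mat (n + r) (n + r)"
    using A B by auto
  ultimately have "det ?M * det ?L = det ?L * det ?N" by (metis det_mult)
  moreover have "det ?L = 1"
    using B by (subst det_four_block_mat_upper_right_zero[of _ n _ r]) auto
  moreover have "det ?M = det (1\<^sub>m n + A * B)"
    using A B by (subst det_four_block_mat_lower_left_zero[of _ n _ r]) auto
  moreover have "det ?N = det (1\<^sub>m r + B * A)"
    using A B by (subst det_four_block_mat_lower_left_zero[of _ n _ r]) auto
  ultimately show ?thesis by simp
qed

text \<open>A functional f on r by r matrices, pulled back to Y, has the entries of
  \<open>P * M * Q\<close> as coefficients up to transposition, where M is the transpose of f. The
  injectivity assumption then brings the vanishing back to f.\<close>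

lemma nondegenerate_compress:
  fixes B :: "'a::field mat set"
  assumes B: "B \<subseteq> carrier_mat n n" "nondegenerate ({..<n} \<times> {..<n}) (($$) ` B)"
    and P: "P \<in> carrier_mat n r" and Q: "Q \<in> carrier_mat r n"
    and inj: "\<And>M. M \<in> carrier_mat r r \<Longrightarrow> P * M * Q = 0\<^sub>m n n \<Longrightarrow> M = 0\<^sub>m r r"
  shows "nondegenerate ({..<r} \<times> {..<r}) ((\<lambda>Y. ($$) (Q * Y * P)) ` B)"
  unfolding nondegenerate_def
proof (intro allI impI ballI)
  fix f ab assume f: "\<forall>s\<in>(\<lambda>Y. ($$) (Q * Y * P)) ` B. (\<Sum>i\<in>{..<r} \<times> {..<r}. f i * s i) = 0"
    and ab: "ab \<in> {..<r} \<times> {..<r}"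
  define f1 where "f1 p = (\<Sum>j<r. f (fst p, j) * P $$ (snd p, j))" for p
  define f2 where "f2 p = (\<Sum>i<r. f1 (i, snd p) * Q $$ (i, fst p))" for p
  have f2: "f2 p = 0" if p: "p \<in> {..<n} \<times> {..<n}" for p
  proof (rule nondegenerateD[OF B(2) _ p])
    fix s assume "s \<in> ($$) ` B"
    then obtain Y where Y: "Y \<in> B" "s = ($$) Y" by auto
    have Yc: "Y \<in> carrier_mat n n" using Y B by auto
    have QY: "Q * Y \<in> carrier_mat r n" using Q Yc by simp
    have "(\<Sum>p\<in>{..<n} \<times> {..<n}. f2 p * Y $$ p) = (\<Sum>p\<in>{..<r} \<times> {..<n}. f1 p * (Q * Y) $$ p)"
      unfolding f2_def by (rule sum_functional_mult(2)[OF Q Yc, symmetric])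
    also have "\<dots> = (\<Sum>p\<in>{..<r} \<times> {..<r}. f p * (Q * Y * P) $$ p)"
      unfolding f1_def by (rule sum_functional_mult(1)[OF QY P, symmetric])
    also have "\<dots> = 0" using f Y by blast
    finally show "(\<Sum>p\<in>{..<n} \<times> {..<n}. f2 p * s p) = 0" using Y by simp
  qed
  define M where "M = mat r r (\<lambda>(b, a). f (a, b))"
  have M: "M \<in> carrier_mat r r" by (simp add: M_def)
  have PM: "P * M \<in> carrier_mat n r" using P M by simp
  have Mij: "M $$ (b, a) = f (a, b)" if "a < r" "b < r" for a b using that by (simp add: M_def)
  have "(P * M * Q) $$ (j, i) = f2 (i, j)" if "i < n" "j < n" for i j
    unfolding f2_def f1_def using that
    by (auto simp: index_mult_mat_sum[OF PM Q] index_mult_mat_sum[OF P M] Mij mult.commute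
        simp del: index_mult_mat(1) intro!: sum.cong)
  then have "P * M * Q = 0\<^sub>m n n" using f2 P M Q by (intro eq_matI) auto
  then have "M = 0\<^sub>m r r" using inj M by blast
  moreover have "f ab = M $$ (snd ab, fst ab)" using ab by (auto simp: M_def)
  ultimately show "f ab = 0" using ab by auto
qed

text \<open>There are finitely many matrices over a finite field, so two powers of A agree. The
  inverse of A thus becomes a power of A, which a set closed only under products can reach.\<close>

lemma invertible_matrix_finite_order:
  fixes A :: "'a::field mat"
  assumes A: "A \<in> carrier_mat r r" "det A \<noteq> 0"
    and F: "subfield_set F" "finite F" "elements_mat A \<subseteq> F"
  obtains k where "A ^\<^sub>m k * A = 1\<^sub>m r"
proof -
  define S where "S = {M \<in> carrier_mat r r. elements_mat M \<subseteq> F}"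
  have pow: "A ^\<^sub>m k \<in> S" for k
  proof (induction k)
    case 0
    then show ?case using A F subfield_setD(1,2)[OF F(1)] by (auto simp: S_def elements_mat_def)
  next
    case (Suc k)
    then have c: "A ^\<^sub>m k \<in> carrier_mat r r" by (simp add: S_def)
    have "(A ^\<^sub>m k) $$ (i, j) \<in> F" "A $$ (i, j) \<in> F" if "i < r" "j < r" for i j
      using that F(3) Suc elements_mat_subset_iff[OF c] elements_mat_subset_iff[OF A(1)] by (auto simp: S_def)
    then have "(A ^\<^sub>m k * A) $$ (i, j) \<in> F" if "i < r" "j < r" for i j
      using that unfolding index_mult_mat_sum[OF c A(1) that]
      by (intro subfield_set_sum[OF F(1)] subfield_setD(4)[OF F(1)]) auto
    moreover have "A ^\<^sub>m Suc k \<in> carrier_mat r r" using mult_carrier_mat[OF c A(1)] by simp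
    ultimately show ?case using elements_mat_subset_iff[of "A ^\<^sub>m Suc k" r r F] by (simp add: S_def)
  qed
  have "finite S"
  proof (rule finite_imageD)
    show "finite ((\<lambda>M. \<lambda>p\<in>{..<r} \<times> {..<r}. M $$ p) ` S)"
    proof (rule finite_subset)
      show "(\<lambda>M. \<lambda>p\<in>{..<r} \<times> {..<r}. M $$ p) ` S \<subseteq> {..<r} \<times> {..<r} \<rightarrow>\<^sub>E F"
      proof (intro image_subsetI PiE_I)
        fix M p assume M: "M \<in> S" and p: "p \<in> {..<r} \<times> {..<r}"
        then show "(\<lambda>p\<in>{..<r} \<times> {..<r}. M $$ p) p \<in> F"
          using elements_mat_subset_iff[of M r r F] by (auto simp: S_def)
      qed auto
      show "finite ({..<r} \<times> {..<r} \<rightarrow>\<^sub>E F)" using F(2) by (intro finite_PiE) auto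
    qed
    show "inj_on (\<lambda>M. \<lambda>p\<in>{..<r} \<times> {..<r}. M $$ p) S"
    proof
      fix M N assume MN: "M \<in> S" "N \<in> S"
        and eq: "(\<lambda>p\<in>{..<r} \<times> {..<r}. M $$ p) = (\<lambda>p\<in>{..<r} \<times> {..<r}. N $$ p)"
      have "M $$ (i, j) = N $$ (i, j)" if "i < r" "j < r" for i j
        using fun_cong[OF eq, of "(i, j)"] that by simp
      then show "M = N" using MN by (intro eq_matI) (auto simp: S_def)
    qed
  qed
  then have "finite (range (\<lambda>k. A ^\<^sub>m k))" by (rule finite_subset[rotated]) (use pow in blast)
  then have "\<not> inj (\<lambda>k::nat. A ^\<^sub>m k)" using finite_imageD infinite_UNIV_nat by blast
  then obtain a b where ab: "a < b" "A ^\<^sub>m a = A ^\<^sub>m b" unfolding inj_def by (metis nat_neq_iff)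
  define k where "k = b - a - 1"
  have k: "b = a + Suc k" using ab(1) by (simp add: k_def)
  have add: "A ^\<^sub>m (a + m) = A ^\<^sub>m a * A ^\<^sub>m m" for m
    using A(1) by (induction m) (auto simp: mat_assoc)
  have c: "A ^\<^sub>m m \<in> carrier_mat r r" for m using A(1) by simp
  have "A ^\<^sub>m a * (A ^\<^sub>m k * A) = A ^\<^sub>m a" using ab k add[of "Suc k"] by simp
  then have "A ^\<^sub>m a * (A ^\<^sub>m k * A - 1\<^sub>m r) = 0\<^sub>m r r"
    using A c by (subst mult_minus_distrib_mat[of _ r r]) (auto intro: minus_r_inv_mat)
  moreover have "det (A ^\<^sub>m a) \<noteq> 0" using A(1,2) by (induction a) (auto simp: det_mult[of _ r])
  then obtain V where V: "V \<in> carrier_mat r r" "V * A ^\<^sub>m a = 1\<^sub>m r"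
    using det_non_zero_imp_unit[OF c] by (auto simp: Units_def ring_mat_def)
  ultimately have "V * (A ^\<^sub>m a * (A ^\<^sub>m k * A - 1\<^sub>m r)) = 0\<^sub>m r r" by simp
  moreover have "V * (A ^\<^sub>m a * (A ^\<^sub>m k * A - 1\<^sub>m r)) = A ^\<^sub>m k * A - 1\<^sub>m r"
    using V A c by (subst mat_assoc[symmetric]) (auto intro!: left_mult_one_mat minus_carrier_mat)
  ultimately have z: "A ^\<^sub>m k * A - 1\<^sub>m r = 0\<^sub>m r r" by simp
  have "(A ^\<^sub>m k * A) $$ (i, j) = (1\<^sub>m r :: 'a mat) $$ (i, j)" if "i < r" "j < r" for i j
    using arg_cong[OF z, of "\<lambda>M. M $$ (i, j)"] that A c by simp
  then have "A ^\<^sub>m k * A = 1\<^sub>m r" using A c by (intro eq_matI) auto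
  then show thesis by (rule that)
qed

text \<open>B contains a product \<open>P * Q\<close> of minimal rank r, and the \<open>Q * Y * P\<close> with Y in B are invertible
  or 0. Among more than r of them Chevalley-Warning finds a nontrivial singular combination, which is
  therefore 0; by nondegeneracy r = 1.\<close>
lemma rank_one_idempotent:
  fixes B :: "'a::field mat set"
  assumes n: "n > 0" and B: "B \<subseteq> carrier_mat n n" "1\<^sub>m n \<in> B"
    "\<And>U Y. U \<in> B \<Longrightarrow> Y \<in> B \<Longrightarrow> U + Y \<in> B" "\<And>U Y. U \<in> B \<Longrightarrow> Y \<in> B \<Longrightarrow> U * Y \<in> B"
    and k: "subfield_set k" "\<And>c U. c \<in> k \<Longrightarrow> U \<in> B \<Longrightarrow> c \<cdot>\<^sub>m U \<in> B"
    and det: "\<And>U. U \<in> B \<Longrightarrow> det U \<in> k"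
    and nd: "nondegenerate ({..<n} \<times> {..<n}) (($$) ` B)"
    and fin: "\<And>S::'a set. finite S \<Longrightarrow> \<exists>F. finite F \<and> subfield_set F \<and> S \<subseteq> F"
  shows "\<exists>p\<in>carrier_vec n. \<exists>q\<in>carrier_vec n. q \<bullet> p = 1 \<and> mat n n (\<lambda>(i, j). p $ i * q $ j) \<in> B"
proof -
  have Bc: "Y \<in> carrier_mat n n" if "Y \<in> B" for Y using that B by auto
  have "1\<^sub>m n \<noteq> (0\<^sub>m n n :: 'a mat)" using n by (metis index_one_mat(1) index_zero_mat(1) zero_neq_one)
  then obtain r P Q where r: "r > 0" and P: "P \<in> carrier_mat n r" and Q: "Q \<in> carrier_mat r n"
    and PQ: "P * Q \<in> B"
    and inj: "\<And>M. M \<in> carrier_mat r r \<Longrightarrow> P * M * Q = 0\<^sub>m n n \<Longrightarrow> M = 0\<^sub>m r r"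
    and min: "\<And>M. M \<in> carrier_mat r r \<Longrightarrow> P * M * Q \<in> B \<Longrightarrow> det M = 0 \<Longrightarrow> M = 0\<^sub>m r r"
    using minimal_factorization[of B n "1\<^sub>m n"] B by blast
  \<comment> \<open>Sandwiching the compression between P and Q gives a product of elements of
    \<open>B\<close>, so minimality applies: each compression is invertible or 0.\<close>
  have min': "Q * Y * P = 0\<^sub>m r r" if Y: "Y \<in> B" and d: "det (Q * Y * P) = 0" for Y
  proof (rule min[OF _ _ d])
    have "P * (Q * Y * P) * Q = (P * Q) * Y * (P * Q)" using P Q Bc[OF Y] by (simp add: mat_assoc)
    then show "P * (Q * Y * P) * Q \<in> B" using B(4)[OF B(4)[OF PQ Y] PQ] by simp
  qed (use P Q Bc[OF Y] in auto)
  have "\<exists>Y\<in>B. Q * Y * P \<noteq> 0\<^sub>m r r"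
  proof (rule ccontr)
    assume "\<not> ?thesis"
    then have "(\<Sum>i\<in>{..<r} \<times> {..<r}. 1 * s i) = 0" if "s \<in> (\<lambda>Y. ($$) (Q * Y * P)) ` B" for s
      using that by (auto intro!: sum.neutral)
    then have "(1::'a) = 0"
      using nondegenerateD[OF nondegenerate_compress[OF B(1) nd P Q inj], of "\<lambda>_. 1" "(0, 0)"] r by blast
    then show False by simp
  qed
  \<comment> \<open>Nondegeneracy supplies a nonzero, hence invertible, compression. Its entries lie
    in a finite subfield, so its inverse V will be a power of it.\<close>
  then obtain Y0 where Y0: "Y0 \<in> B" "Q * Y0 * P \<noteq> 0\<^sub>m r r" by blast
  define M0 where "M0 = Q * Y0 * P"
  have M0: "M0 \<in> carrier_mat r r" using P Q Bc[OF Y0(1)] by (auto simp: M0_def)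
  have detM0: "det M0 \<noteq> 0" using min' Y0 by (auto simp: M0_def)
  have "finite (elements_mat M0)" by (auto simp: elements_mat_def)
  then obtain F0 where F0: "finite F0" "subfield_set F0" "elements_mat M0 \<subseteq> F0" using fin by blast
  obtain m where m: "M0 ^\<^sub>m m * M0 = 1\<^sub>m r"
    using invertible_matrix_finite_order[OF M0 detM0 F0(2,1,3)] .
  have powc: "M0 ^\<^sub>m i \<in> carrier_mat r r" for i using M0 by simp
  define V where "V = M0 ^\<^sub>m m"
  have V: "V \<in> carrier_mat r r" "V * M0 = 1\<^sub>m r" using powc m by (auto simp: V_def)
  \<comment> \<open>With Q' in place of Q the product \<open>P * Q'\<close> is idempotent. It stays
    in \<open>B\<close> because, V being a power of \<open>M0\<close>, it is a power of
    \<open>P * Q * Y0\<close>.\<close>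
  define Q' where "Q' = V * Q * Y0"
  have Q': "Q' \<in> carrier_mat r n" using Q V Bc[OF Y0(1)] by (auto simp: Q'_def)
  have Q'P: "Q' * P = 1\<^sub>m r"
    using V Q Bc[OF Y0(1)] P by (simp add: Q'_def M0_def mat_assoc)
  have pow: "P * (M0 ^\<^sub>m i * Q * Y0) \<in> B" for i
  proof (induction i)
    case 0
    have "P * (M0 ^\<^sub>m 0 * Q * Y0) = P * Q * Y0" using P Q M0 Bc[OF Y0(1)] by (simp add: mat_assoc)
    then show ?case using B(4)[OF PQ Y0(1)] by simp
  next
    case (Suc i)
    have "P * (M0 ^\<^sub>m Suc i * Q * Y0) = P * (M0 ^\<^sub>m i * Q * Y0) * (P * Q * Y0)"
      using P Q powc[of i] Bc[OF Y0(1)] by (simp add: mat_assoc M0_def)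
    then show ?case using B(4)[OF Suc B(4)[OF PQ Y0(1)]] by simp
  qed
  then have PQ': "P * Q' \<in> B" by (simp add: Q'_def V_def)
  have inj': "M = 0\<^sub>m r r" if M: "M \<in> carrier_mat r r" and 0: "P * M * Q' = 0\<^sub>m n n" for M
  proof -
    have "P * M = P * M * Q' * P" using P M Q' Q'P by (simp add: mat_assoc)
    also have "\<dots> = 0\<^sub>m n r" using 0 P by simp
    finally have "P * M * Q = 0\<^sub>m n n" using Q by simp
    then show ?thesis using inj M by blast
  qed
  have min'': "Q' * Y * P = 0\<^sub>m r r" if Y: "Y \<in> B" and d: "det (Q' * Y * P) = 0" for Y
  proof -
    have eq: "Q' * Y * P = V * (Q * (Y0 * Y) * P)"
      using P Q V Bc[OF Y0(1)] Bc[OF Y] by (simp add: Q'_def mat_assoc)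
    have c: "Q * (Y0 * Y) * P \<in> carrier_mat r r" using P Q Bc[OF Y0(1)] Bc[OF Y] by auto
    have "det V * det M0 = 1" using V det_mult[OF V(1) M0] by simp
    then have "det (Q * (Y0 * Y) * P) = 0"
      using d eq det_mult[OF V(1) c] by auto
    then have "Q * (Y0 * Y) * P = 0\<^sub>m r r" using min' B(4)[OF Y0(1) Y] by blast
    then show ?thesis using eq V by simp
  qed
  \<comment> \<open>For the idempotent e = P Q', Sylvester's identity equates the determinant of the
    compression with that of 1 - e + e Y e, which is an element of \<open>B\<close>.\<close>
  have det': "det (Q' * Y * P) \<in> k" if Y: "Y \<in> B" for Y
  proof -
    have Mc: "Q' * Y * P \<in> carrier_mat r r" using Q' P Bc[OF Y] by auto
    define e where "e = P * Q'"
    have e: "e \<in> carrier_mat n n" using P Q' by (simp add: e_def)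
    have "1\<^sub>m n + P * ((Q' * Y * P - 1\<^sub>m r) * Q') = 1\<^sub>m n + (- 1) \<cdot>\<^sub>m e + e * Y * e"
    proof -
      have "(Q' * Y * P - 1\<^sub>m r) * Q' = Q' * Y * P * Q' - Q'"
        using Mc Q' by (subst minus_mult_distrib_mat[of _ r r]) auto
      also have "P * \<dots> = P * (Q' * Y * P * Q') - P * Q'"
        using P Q' Bc[OF Y] by (intro mult_minus_distrib_mat) auto
      also have "P * (Q' * Y * P * Q') = e * Y * e" using P Q' Bc[OF Y] by (simp add: e_def mat_assoc)
      finally show ?thesis using e Bc[OF Y] unfolding e_def[symmetric] by (intro eq_matI) auto
    qed
    moreover have "1\<^sub>m n + (- 1) \<cdot>\<^sub>m e + e * Y * e \<in> B"
      using B(2,3,4) k subfield_setD(2,5)[OF k(1)] PQ' Y by (simp add: e_def)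
    ultimately have "det (1\<^sub>m n + P * ((Q' * Y * P - 1\<^sub>m r) * Q')) \<in> k" using det by simp
    also have "det (1\<^sub>m n + P * ((Q' * Y * P - 1\<^sub>m r) * Q'))
        = det (1\<^sub>m r + (Q' * Y * P - 1\<^sub>m r) * Q' * P)"
      by (rule det_one_add_mult[OF P mult_carrier_mat[OF minus_carrier_mat[OF one_carrier_mat] Q']])
    also have "(Q' * Y * P - 1\<^sub>m r) * Q' * P = Q' * Y * P - 1\<^sub>m r"
      using assoc_mult_mat[OF minus_carrier_mat[OF one_carrier_mat] Q' P]
        right_mult_one_mat[OF minus_carrier_mat[OF one_carrier_mat]] by (simp add: Q'P)
    also have "1\<^sub>m r + (M - 1\<^sub>m r) = M" if "M \<in> carrier_mat r r" for M :: "'a mat"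
      using that by (intro eq_matI) auto
    note this[OF Mc]
    finally show ?thesis .
  qed
  have comb: "mat n n (\<lambda>p. \<Sum>j<N. x j * Y j $$ p) \<in> B"
    if "\<And>j. j < N \<Longrightarrow> x j \<in> k" "\<And>j. j < N \<Longrightarrow> Y j \<in> B" for N :: nat and x Y
    using that
  proof (induction N)
    case 0
    have "mat n n (\<lambda>p. \<Sum>j<0. x j * Y j $$ p) = 0 \<cdot>\<^sub>m 1\<^sub>m n" by (intro eq_matI) auto
    then show ?case using k(2)[OF subfield_setD(1)[OF k(1)] B(2)] by simp
  next
    case (Suc N)
    have "mat n n (\<lambda>p. \<Sum>j<Suc N. x j * Y j $$ p) = mat n n (\<lambda>p. \<Sum>j<N. x j * Y j $$ p) + x N \<cdot>\<^sub>m Y N"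
      using Bc[OF Suc.prems(2)[of N]] by (intro eq_matI) auto
    then show ?case using Suc B(3) k(2) by simp
  qed
  \<comment> \<open>For r at least 2 there are r^2 \<ge> r + 1 independent compressions, one more
    than the degree of the determinant.\<close>
  have "r = 1"
  proof (rule ccontr)
    assume "r \<noteq> 1"
    then have "2 \<le> r" using r by simp
    then have "Suc r \<le> card ({..<r} \<times> {..<r})"
    proof -
      have "Suc r \<le> 2 * r" using \<open>2 \<le> r\<close> by simp
      also have "\<dots> \<le> r * r" using \<open>2 \<le> r\<close> by (rule mult_le_mono1)
      finally show ?thesis by simp
    qed
    then obtain s where s: "\<And>j. j < Suc r \<Longrightarrow> s j \<in> (\<lambda>Y. ($$) (Q' * Y * P)) ` B"
        and ind: "\<And>c. (\<forall>i\<in>{..<r} \<times> {..<r}. (\<Sum>j<Suc r. c j * s j i) = 0) \<Longrightarrow> \<forall>j<Suc r. c j = 0"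
      using independent_selection[OF _ nondegenerate_compress[OF B(1) nd P Q' inj'], of "Suc r"] by blast
    define Y where "Y j = (SOME Y. Y \<in> B \<and> s j = ($$) (Q' * Y * P))" for j
    have Y: "Y j \<in> B" "s j = ($$) (Q' * Y j * P)" if "j < Suc r" for j
    proof -
      have "\<exists>Y. Y \<in> B \<and> s j = ($$) (Q' * Y * P)" using s(1)[OF that] by blast
      from someI_ex[OF this] show "Y j \<in> B" "s j = ($$) (Q' * Y j * P)" unfolding Y_def by blast+
    qed
    have Dc: "Q' * Y j * P \<in> carrier_mat r r" if "j < Suc r" for j using Q' P Bc[OF Y(1)[OF that]] by auto
    define S where "S = (\<Union>j<Suc r. s j ` ({..<r} \<times> {..<r}))"
    have "finite S" by (auto simp: S_def)
    then obtain F1 where F1: "finite F1" "subfield_set F1" "S \<subseteq> F1" using fin by blast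
    \<comment> \<open>Coefficients must lie in \<open>k\<close> so that the combinations stay in
      \<open>B\<close>, and in a finite field for the counting argument. The determinants lie in
      both fields, hence in \<open>F\<close>.\<close>
    define F where "F = k \<inter> F1"
    have F: "subfield_set F" "finite F" using F1 k subfield_set_Int by (auto simp: F_def)
    have block: "mat r r (\<lambda>p. \<Sum>j<Suc r. x j * s j p) = Q' * mat n n (\<lambda>p. \<Sum>j<Suc r. x j * Y j $$ p) * P"
      (is "_ = Q' * ?Z * P") for x
    proof (rule eq_matI)
      fix a b assume "a < dim_row (Q' * ?Z * P)" "b < dim_col (Q' * ?Z * P)"
      then have ab: "a < r" "b < r" using Q' P by auto
      have Zc: "?Z \<in> carrier_mat n n" by simp
      have entry: "(Q' * U * P) $$ (a, b) = (\<Sum>l<n. \<Sum>i<n. Q' $$ (a, i) * U $$ (i, l) * P $$ (l, b))"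
        if U: "U \<in> carrier_mat n n" for U
      proof -
        have "Q' * U \<in> carrier_mat r n" using Q' U by simp
        then show ?thesis using ab
          by (simp add: index_mult_mat_sum[OF _ P] index_mult_mat_sum[OF Q' U] sum_distrib_right del: index_mult_mat(1))
      qed
      have "(Q' * ?Z * P) $$ (a, b) = (\<Sum>l<n. \<Sum>i<n. \<Sum>j<Suc r. x j * (Q' $$ (a, i) * Y j $$ (i, l) * P $$ (l, b)))"
        unfolding entry[OF Zc]
        by (intro sum.cong refl) (simp add: sum_distrib_left sum_distrib_right mult_ac del: sum.lessThan_Suc)
      also have "\<dots> = (\<Sum>j<Suc r. \<Sum>l<n. \<Sum>i<n. x j * (Q' $$ (a, i) * Y j $$ (i, l) * P $$ (l, b)))"
      proof -
        have "(\<Sum>l<n. \<Sum>i<n. \<Sum>j<Suc r. x j * (Q' $$ (a, i) * Y j $$ (i, l) * P $$ (l, b)))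
          = (\<Sum>l<n. \<Sum>j<Suc r. \<Sum>i<n. x j * (Q' $$ (a, i) * Y j $$ (i, l) * P $$ (l, b)))"
          by (rule sum.cong[OF refl sum.swap])
        also have "\<dots> = (\<Sum>j<Suc r. \<Sum>l<n. \<Sum>i<n. x j * (Q' $$ (a, i) * Y j $$ (i, l) * P $$ (l, b)))"
          by (rule sum.swap)
        finally show ?thesis .
      qed
      also have "\<dots> = (\<Sum>j<Suc r. x j * s j (a, b))"
        using Y Bc by (intro sum.cong refl) (simp add: entry sum_distrib_left del: index_mult_mat(1))
      finally show "mat r r (\<lambda>p. \<Sum>j<Suc r. x j * s j p) $$ (a, b) = (Q' * ?Z * P) $$ (a, b)" using ab by simp
    qed (use Q' P in auto)
    have "det (mat r r (\<lambda>p. \<Sum>j<Suc r. x j * s j p)) \<in> F" if x: "x \<in> {..<Suc r} \<rightarrow>\<^sub>E F" for x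
    proof -
      have xk: "x j \<in> k" "x j \<in> F1" if "j < Suc r" for j using x that by (auto simp: F_def)
      have "det (mat r r (\<lambda>p. \<Sum>j<Suc r. x j * s j p)) \<in> k"
        unfolding block by (intro det' comb xk Y(1))
      moreover have "det (mat r r (\<lambda>p. \<Sum>j<Suc r. x j * s j p)) \<in> F1"
      proof (rule subfield_set_det[OF F1(2)])
        fix a b assume ab: "a < r" "b < r"
        have "s j (a, b) \<in> F1" if "j < Suc r" for j using F1(3) ab that unfolding S_def by blast
        then show "mat r r (\<lambda>p. \<Sum>j<Suc r. x j * s j p) $$ (a, b) \<in> F1"
          using ab xk by (auto simp del: sum.lessThan_Suc intro!: subfield_set_sum[OF F1(2)] subfield_setD(4)[OF F1(2)])
      qed simp
      ultimately show ?thesis by (simp add: F_def)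
    qed
    then obtain x where x: "x \<in> {..<Suc r} \<rightarrow>\<^sub>E F" "\<exists>j<Suc r. x j \<noteq> 0"
        "det (mat r r (\<lambda>p. \<Sum>j<Suc r. x j * s j p)) = 0"
      using chevalley_warning_det[OF F r, of "Suc r" s] by blast
    have xk: "x j \<in> k" if "j < Suc r" for j using x(1) that by (auto simp: F_def)
    have "mat r r (\<lambda>p. \<Sum>j<Suc r. x j * s j p) = 0\<^sub>m r r"
      unfolding block by (rule min''[OF comb[OF xk Y(1)]]) (use x(3) block in auto)
    then have "(\<Sum>j<Suc r. x j * s j (a, b)) = 0" if "a < r" "b < r" for a b
      using that by (metis index_mat(1) index_zero_mat(1))
    then have "\<forall>j<Suc r. x j = 0" by (intro ind) auto
    then show False using x(2) by blast
  qed
  define p where "p = col P 0"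
  define q where "q = row Q' 0"
  have "q \<bullet> p = (Q' * P) $$ (0, 0)" using P Q' \<open>r = 1\<close> by (simp add: p_def q_def)
  then have "q \<bullet> p = 1" using Q'P \<open>r = 1\<close> by simp
  moreover have "mat n n (\<lambda>(i, j). p $ i * q $ j) = P * Q'"
    using P Q' \<open>r = 1\<close> by (intro eq_matI)
      (auto simp: index_mult_mat_sum[OF P Q'] p_def q_def simp del: index_mult_mat(1))
  moreover have "p \<in> carrier_vec n" "q \<in> carrier_vec n"
    using P Q' by (auto simp: p_def q_def intro: carrier_vecI)
  ultimately show ?thesis using PQ' by (intro bexI[of _ p] bexI[of _ q] conjI) simp_all
qed

section \<open>Eigenvectors over a complete non-archimedean field\<close>

text \<open>Sequential completeness of a subset, expressed through v alone, because the big field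
  itself may be incomplete.\<close>

definition complete_subset :: "('l::field \<Rightarrow> real) \<Rightarrow> 'l set \<Rightarrow> bool" where
  "complete_subset v E \<longleftrightarrow>
     (\<forall>x :: nat \<Rightarrow> 'l. range x \<subseteq> E \<and> (\<forall>e>0. \<exists>N. \<forall>m\<ge>N. \<forall>k\<ge>N. v (x m - x k) < e)
        \<longrightarrow> (\<exists>l\<in>E. (\<lambda>k. v (x k - l)) \<longlonglongrightarrow> 0))"

locale nonarchimedean =
  fixes v :: "'l::field \<Rightarrow> real"
  assumes nonarch_abs: "nonarch_abs v"
begin

lemma v_nonneg [simp]: "0 \<le> v x" and v_eq_0_iff [simp]: "v x = 0 \<longleftrightarrow> x = 0"
  and v_mult: "v (x * y) = v x * v y" and v_add: "v (x + y) \<le> max (v x) (v y)"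
  using nonarch_abs unfolding nonarch_abs_def by auto

lemma v_0 [simp]: "v 0 = 0" by simp

lemma v_1 [simp]: "v 1 = 1"
  using v_mult[of 1 1] v_eq_0_iff[of 1] by auto

lemma v_minus [simp]: "v (- x) = v x"
proof -
  have "v (- 1) * v (- 1) = 1" using v_mult[of "- 1" "- 1"] by simp
  then have "v (- 1) = 1"
    by (metis abs_of_nonneg real_sqrt_abs2 real_sqrt_one v_nonneg)
  then show ?thesis using v_mult[of "- 1" x] by simp
qed

lemma v_diff: "v (x - y) \<le> max (v x) (v y)"
  using v_add[of x "- y"] by simp

lemma v_diff_commute: "v (x - y) = v (y - x)"
  using v_minus[of "x - y"] by simp

lemma v_inverse: "v (inverse x) = inverse (v x)"
  by (cases "x = 0") (use v_mult[of x "inverse x"] in \<open>auto simp: field_simps\<close>)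

lemma v_divide: "v (x / y) = v x / v y"
  by (simp add: divide_inverse v_mult v_inverse)

lemma v_power: "v (x ^ k) = v x ^ k"
  by (induction k) (auto simp: v_mult)

lemma v_sum_le: "(\<And>i. i \<in> I \<Longrightarrow> v (f i) \<le> c) \<Longrightarrow> 0 \<le> c \<Longrightarrow> v (sum f I) \<le> c"
proof (induction I rule: infinite_finite_induct)
  case (insert i I)
  have "v (f i + sum f I) \<le> max (v (f i)) (v (sum f I))" by (rule v_add)
  also have "\<dots> \<le> c" using insert by simp
  finally show ?case using insert by simp
qed auto

lemma v_prod_le_1: "(\<And>i. i \<in> I \<Longrightarrow> v (f i) \<le> 1) \<Longrightarrow> v (prod f I) \<le> 1"
  by (induction I rule: infinite_finite_induct) (auto simp: v_mult mult_le_one)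

lemma v_mult_le: "v x \<le> a \<Longrightarrow> v y \<le> b \<Longrightarrow> v (x * y) \<le> a * b"
  unfolding v_mult by (rule mult_mono) (auto intro: order_trans[OF v_nonneg])

lemma v_mult_le_1: "v x \<le> 1 \<Longrightarrow> v y \<le> 1 \<Longrightarrow> v (x * y) \<le> 1"
  using v_mult_le[of x 1 y 1] by simp

lemma v_eq_1_of_diff: "v (x - 1) < 1 \<Longrightarrow> v x = 1"
  using v_add[of "x - 1" 1] v_diff[of x "x - 1"] by (simp add: max_def split: if_splits)

lemma eq_0_of_v_le_power:
  assumes "0 \<le> d" "d < 1" "\<And>k. v x \<le> d ^ k"
  shows "x = 0"
proof -
  have "(\<lambda>k. d ^ k) \<longlonglongrightarrow> 0" using assms by (intro LIMSEQ_power_zero) auto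
  then have "v x \<le> 0" by (rule LIMSEQ_le_const) (use assms in auto)
  then show ?thesis using v_nonneg[of x] v_eq_0_iff by (metis order_antisym)
qed

end

text \<open>M reduces to the idempotent \<open>p q\<^sup>T\<close>, so that the normalised power iteration is a contraction.\<close>
locale rank_one_residue = nonarchimedean v for v :: "'l::field \<Rightarrow> real" +
  fixes n :: nat and M :: "nat \<Rightarrow> nat \<Rightarrow> 'l" and p q :: "nat \<Rightarrow> 'l" and d :: real
  assumes M_int: "\<And>i j. i < n \<Longrightarrow> j < n \<Longrightarrow> v (M i j) \<le> 1"
    and p_int: "\<And>i. i < n \<Longrightarrow> v (p i) \<le> 1" and q_int: "\<And>i. i < n \<Longrightarrow> v (q i) \<le> 1"
    and qp: "(\<Sum>i<n. q i * p i) = 1"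
    and d: "0 \<le> d" "d < 1" and M_approx: "\<And>i j. i < n \<Longrightarrow> j < n \<Longrightarrow> v (M i j - p i * q j) \<le> d"
begin

definition app :: "(nat \<Rightarrow> 'l) \<Rightarrow> nat \<Rightarrow> 'l" where "app w i = (\<Sum>j<n. M i j * w j)"
definition form :: "(nat \<Rightarrow> 'l) \<Rightarrow> 'l" where "form w = (\<Sum>i<n. q i * w i)"
definition step :: "(nat \<Rightarrow> 'l) \<Rightarrow> nat \<Rightarrow> 'l" where "step w i = app w i / form (app w)"

lemma app_diff: "app w i - app w' i = app (\<lambda>j. w j - w' j) i"
  by (simp add: app_def right_diff_distrib sum_subtractf)

lemma form_diff: "form w - form w' = form (\<lambda>j. w j - w' j)"
  by (simp add: form_def right_diff_distrib sum_subtractf)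

lemma form_scale: "form (\<lambda>i. c * w i) = c * form w"
  by (simp add: form_def sum_distrib_left mult_ac)

lemma app_scale: "app (\<lambda>i. c * w i) i = c * app w i"
  by (simp add: app_def sum_distrib_left mult_ac)

lemma v_form_le: "(\<And>i. i < n \<Longrightarrow> v (w i) \<le> c) \<Longrightarrow> 0 \<le> c \<Longrightarrow> v (form w) \<le> c"
  unfolding form_def using q_int by (intro v_sum_le) (auto intro: order_trans[OF v_mult_le[of _ 1]])

lemma v_app_le: "(\<And>i. i < n \<Longrightarrow> v (w i) \<le> c) \<Longrightarrow> 0 \<le> c \<Longrightarrow> i < n \<Longrightarrow> v (app w i) \<le> c"
  unfolding app_def using M_int by (intro v_sum_le) (auto intro: order_trans[OF v_mult_le[of _ 1]])

text \<open>M is the product of p and the row q up to an error of size d, so applying M amounts to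
  taking \<open>form\<close> and multiplying by p.\<close>

lemma v_app_residual:
  assumes "\<And>i. i < n \<Longrightarrow> v (w i) \<le> c" "0 \<le> c" "i < n"
  shows "v (app w i - p i * form w) \<le> d * c"
proof -
  have "app w i - p i * form w = (\<Sum>j<n. (M i j - p i * q j) * w j)"
    by (simp add: app_def form_def sum_distrib_left sum_subtractf[symmetric] left_diff_distrib mult.assoc)
  also have "v \<dots> \<le> d * c" using assms M_approx d by (intro v_sum_le v_mult_le) auto
  finally show ?thesis .
qed

text \<open>The affine slice of the unit ball on which the iteration is normalised:
  \<open>step\<close> preserves it and contracts it by the factor d.\<close>

definition admissible :: "(nat \<Rightarrow> 'l) \<Rightarrow> bool" where
  "admissible w \<longleftrightarrow> form w = 1 \<and> (\<forall>i<n. v (w i) \<le> 1)"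

lemma v_app_admissible: "admissible w \<Longrightarrow> i < n \<Longrightarrow> v (app w i - p i) \<le> d"
  using v_app_residual[of w 1 i] by (simp add: admissible_def)

lemma v_form_app_admissible: assumes "admissible w" shows "v (form (app w) - 1) \<le> d" "v (form (app w)) = 1"
proof -
  have "form p = 1" using qp by (simp add: form_def)
  then have "form (app w) - 1 = form (\<lambda>i. app w i - p i)" using form_diff[of "app w" p] by simp
  also have "v \<dots> \<le> d" using v_app_admissible[OF assms] d by (intro v_form_le) auto
  finally show 1: "v (form (app w) - 1) \<le> d" .
  then show "v (form (app w)) = 1" using v_eq_1_of_diff d by simp
qed

lemma step_admissible: assumes w: "admissible w" shows "admissible (step w)"
proof -
  note u = v_form_app_admissible(2)[OF w]
  then have nz: "form (app w) \<noteq> 0" by auto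
  have "form (step w) = inverse (form (app w)) * form (app w)"
    using form_scale[of "inverse (form (app w))" "app w"] by (simp add: step_def[abs_def] field_simps)
  then have "form (step w) = 1" using nz by simp
  moreover have "v (step w i) \<le> 1" if "i < n" for i
    using w u that v_app_le[of w 1 i] by (simp add: step_def v_divide admissible_def)
  ultimately show ?thesis by (simp add: admissible_def)
qed

lemma step_near: assumes w: "admissible w" and i: "i < n" shows "v (step w i - p i) \<le> d"
proof -
  note u = v_form_app_admissible[OF w]
  then have nz: "form (app w) \<noteq> 0" by auto
  have "step w i - p i = ((app w i - p i) - p i * (form (app w) - 1)) / form (app w)"
    using nz by (simp add: step_def field_simps)
  then have "v (step w i - p i) = v ((app w i - p i) - p i * (form (app w) - 1))"
    using u by (simp add: v_divide)
  also have "\<dots> \<le> max (v (app w i - p i)) (v (p i * (form (app w) - 1)))" by (rule v_diff)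
  also have "\<dots> \<le> d"
    using v_app_admissible[OF w i] v_mult_le[OF p_int[OF i] u(1)] by simp
  finally show ?thesis .
qed

text \<open>Two vectors of the slice differ by a vector of \<open>form\<close> 0, on which the rank
  one part of M vanishes, so only the error of size d remains. The denominators are units and cost
  nothing.\<close>

lemma step_contraction:
  assumes w: "admissible w" "admissible w'" and c: "\<And>i. i < n \<Longrightarrow> v (w i - w' i) \<le> c" "0 \<le> c" and i: "i < n"
  shows "v (step w i - step w' i) \<le> d * c"
proof -
  define \<Delta> where "\<Delta> = (\<lambda>j. w j - w' j)"
  have "form \<Delta> = 0" using w form_diff[of w w'] by (simp add: admissible_def \<Delta>_def)
  then have A: "v (app \<Delta> j) \<le> d * c" if "j < n" for j
    using v_app_residual[of \<Delta> c j] c that by (simp add: \<Delta>_def)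
  have dc: "0 \<le> d * c" using c d by simp
  have F: "v (form (app \<Delta>)) \<le> d * c" using A dc by (rule v_form_le)
  note u = v_form_app_admissible(2)[OF w(1)] and u' = v_form_app_admissible(2)[OF w(2)]
  then have nz: "form (app w) \<noteq> 0" "form (app w') \<noteq> 0" by auto
  have a: "app w i = app w' i + app \<Delta> i" using app_diff[of w i w'] by (simp add: \<Delta>_def algebra_simps)
  have "form (app w) - form (app w') = form (app \<Delta>)"
    using form_diff[of "app w" "app w'"] app_diff[of w _ w'] by (simp add: \<Delta>_def)
  then have f: "form (app w) = form (app w') + form (app \<Delta>)" by (simp add: algebra_simps)
  have "step w i - step w' i
      = (form (app w') * app \<Delta> i - form (app \<Delta>) * app w' i) / (form (app w) * form (app w'))"
    using nz unfolding step_def by (simp add: diff_frac_eq) (simp add: a f algebra_simps)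
  then have "v (step w i - step w' i) = v (form (app w') * app \<Delta> i - form (app \<Delta>) * app w' i)"
    using u u' by (simp add: v_divide v_mult)
  also have "\<dots> \<le> max (v (form (app w') * app \<Delta> i)) (v (form (app \<Delta>) * app w' i))" by (rule v_diff)
  also have "\<dots> \<le> d * c"
    using v_mult_le[of "form (app w')" 1 "app \<Delta> i" "d * c"] A[OF i] u'
      v_mult_le[OF F, of "app w' i" 1] v_app_le[of w' 1 i] w i by (simp add: admissible_def)
  finally show ?thesis .
qed

lemma p_admissible: "admissible p"
  using qp p_int by (simp add: admissible_def form_def)

text \<open>An eigenvector with unit eigenvalue and nonzero \<open>form\<close> is, once normalised,
  a fixed point of \<open>step\<close>, and a contraction has only one. An eigenvector of
  \<open>form\<close> 0 is shrunk by d although its eigenvalue is a unit, so it is 0.\<close>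

lemma eigenvector_unique:
  assumes w: "admissible w" "\<And>i. i < n \<Longrightarrow> app w i = a * w i" "v a = 1"
    and w': "\<And>i. i < n \<Longrightarrow> app w' i = a' * w' i" "v a' = 1" and i: "i < n"
  shows "w' i = form w' * w i"
proof -
  have fixed: "step u j = u j"
    if u: "admissible u" "\<And>i. i < n \<Longrightarrow> app u i = b * u i" "v b = 1" and j: "j < n" for u b j
  proof -
    have "form (app u) = form (\<lambda>i. b * u i)" unfolding form_def using u by (intro sum.cong) auto
    then have "form (app u) = b" using u by (simp add: form_scale admissible_def)
    then show ?thesis using u j by (auto simp: step_def)
  qed
  define m where "m = Max (insert 0 ((\<lambda>i. v (w' i)) ` {..<n}))"
  have m: "v (w' i) \<le> m" if "i < n" for i unfolding m_def using that by (intro Max_ge) auto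
  have m0: "0 \<le> m" unfolding m_def by (intro Max_ge) auto
  have m_le: "m \<le> c" if "0 \<le> c" "\<And>i. i < n \<Longrightarrow> v (w' i) \<le> c" for c
    unfolding m_def using that by (subst Max_le_iff) auto
  have vapp: "v (w' i) = v (app w' i)" if "i < n" for i using w' that by (simp add: v_mult)
  show ?thesis
  proof (cases "form w' = 0")
    case True
    have "m \<le> d * m"
      using v_app_residual[of w' m] m m0 True vapp d by (intro m_le) auto
    then have "m * (1 - d) \<le> 0" by (simp add: algebra_simps)
    then have "m = 0" using d m0 by (simp add: mult_le_0_iff)
    then show ?thesis using m[OF i] True v_nonneg[of "w' i"] by (metis v_eq_0_iff order_antisym mult_zero_left)
  next
    case False
    define b where "b = form w'"
    define u where "u = (\<lambda>i. inverse b * w' i)"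
    have b: "b \<noteq> 0" using False by (simp add: b_def)
    have fu: "form u = 1" unfolding u_def form_scale using b by (simp add: b_def)
    have au: "app u i = a' * u i" if "i < n" for i unfolding u_def app_scale using w' that by simp
    \<comment> \<open>Every entry of w' is bounded by d m or by v b. As d < 1, the maximum m must
      satisfy the second bound, so division by b leaves an integral vector.\<close>
    have mb: "m \<le> max (d * m) (v b)"
    proof (rule m_le)
      show "0 \<le> max (d * m) (v b)" by (simp add: le_max_iff_disj)
      fix i assume i: "i < n"
      have "v (app w' i) = v ((app w' i - p i * form w') + p i * form w')" by simp
      also have "\<dots> \<le> max (v (app w' i - p i * form w')) (v (p i * form w'))" by (rule v_add)
      also have "\<dots> \<le> max (d * m) (v b)"
        using v_app_residual[of w' m i, OF m m0 i] v_mult_le[OF p_int[OF i], of "form w'" "v b"]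
        by (intro max.mono) (simp_all add: b_def)
      finally show "v (w' i) \<le> max (d * m) (v b)" using vapp i by simp
    qed
    have "m \<le> v b"
    proof (rule ccontr)
      assume "\<not> m \<le> v b"
      then have "m \<le> d * m" using mb by (auto simp: max_def split: if_splits)
      moreover have "0 < m" using \<open>\<not> m \<le> v b\<close> v_nonneg[of b] by linarith
      ultimately show False using d by (simp add: mult_le_cancel_right2)
    qed
    then have "v (u i) \<le> 1" if "i < n" for i
    proof -
      have "0 < v b" using b v_nonneg[of b] by (simp add: less_le)
      moreover have "v (u i) = v (w' i) / v b" by (simp add: u_def v_divide[symmetric] field_simps)
      ultimately show ?thesis using m[OF that] \<open>m \<le> v b\<close> by (simp add: divide_le_eq)
    qed
    then have adm: "admissible u" using fu by (simp add: admissible_def)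
    have close: "\<forall>i<n. v (u i - w i) \<le> d ^ k" for k
    proof (induction k)
      case 0
      then show ?case
        using adm w order_trans[OF v_diff] by (auto simp: admissible_def)
    next
      case (Suc k)
      have "v (step u j - step w j) \<le> d * d ^ k" if "j < n" for j
        by (rule step_contraction[OF adm w(1) _ _ that]) (use Suc d in auto)
      then show ?case using fixed[OF adm au w'(2)] fixed[OF w] by simp
    qed
    have "u i - w i = 0" by (rule eq_0_of_v_le_power[of d]) (use d close i in auto)
    then have "w' i = b * w i" using b by (simp add: u_def field_simps)
    then show ?thesis by (simp add: b_def)
  qed
qed

text \<open>Banach iteration starting at p. The iterates stay in any subfield that contains the
  data, so completeness of one such \<open>E\<close> is enough; the identities for the limit hold up
  to d^k for every k, hence exactly.\<close>

lemma eigenvector_exists: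
  assumes E: "subfield_set E" "complete_subset v E"
    and el: "\<And>i j. i < n \<Longrightarrow> j < n \<Longrightarrow> M i j \<in> E" "\<And>i. i < n \<Longrightarrow> p i \<in> E" "\<And>i. i < n \<Longrightarrow> q i \<in> E"
  shows "\<exists>w a. admissible w \<and> v a = 1 \<and> (\<forall>i<n. app w i = a * w i) \<and> (\<forall>i<n. v (w i - p i) < 1)"
proof -
  define W where "W k = (step ^^ k) p" for k
  have WS: "W (Suc k) = step (W k)" for k by (simp add: W_def)
  have adm: "admissible (W k)" for k by (induction k) (auto simp: W_def p_admissible step_admissible)
  have WE: "\<forall>i<n. W k i \<in> E" for k
  proof (induction k)
    case 0 then show ?case using el by (simp add: W_def)
  next
    case (Suc k)
    then have "app (W k) i \<in> E" if "i < n" for i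
      unfolding app_def using that el by (intro subfield_set_sum[OF E(1)] subfield_setD(4)[OF E(1)]) auto
    moreover from this have "form (app (W k)) \<in> E"
      unfolding form_def using el by (intro subfield_set_sum[OF E(1)] subfield_setD(4)[OF E(1)]) auto
    ultimately show ?case unfolding WS step_def using subfield_setD(8)[OF E(1)] by blast
  qed
  have near: "\<forall>i<n. v (W k i - p i) \<le> d" for k
    using step_near[OF adm] d by (cases k) (auto simp: WS, auto simp: W_def)
  have diff: "\<forall>i<n. v (W (Suc k) i - W k i) \<le> d ^ k" for k
  proof (induction k)
    case 0
    show ?case using near[of 1] d by (auto simp: W_def intro: order_trans less_imp_le)
  next
    case (Suc k)
    have "v (step (W (Suc k)) j - step (W k) j) \<le> d * d ^ k" if "j < n" for j
      by (rule step_contraction[OF adm adm _ _ that]) (use Suc d in auto)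
    then show ?case by (simp add: WS)
  qed
  have diff': "v (W (k + m) i - W k i) \<le> d ^ k" if "i < n" for k m i
  proof (induction m)
    case (Suc m)
    have "W (k + Suc m) i - W k i = (W (Suc (k + m)) i - W (k + m) i) + (W (k + m) i - W k i)" by simp
    also have "v \<dots> \<le> max (v (W (Suc (k + m)) i - W (k + m) i)) (v (W (k + m) i - W k i))" by (rule v_add)
    also have "\<dots> \<le> max (d ^ (k + m)) (d ^ k)" using diff Suc that by (intro max.mono) auto
    also have "\<dots> = d ^ k" using d power_decreasing[of k "k + m" d] by (simp add: max_def)
    finally show ?case .
  qed (use d in simp)
  have "\<exists>l\<in>E. (\<lambda>k. v (W k i - l)) \<longlonglongrightarrow> 0" if i: "i < n" for i
  proof -
    have "\<exists>N. \<forall>m\<ge>N. \<forall>k\<ge>N. v (W m i - W k i) < e" if "e > 0" for e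
    proof -
      have "(\<lambda>k. d ^ k) \<longlonglongrightarrow> 0" using d by (intro LIMSEQ_power_zero) auto
      then obtain N where N: "d ^ N < e" using \<open>e > 0\<close> d
        by (metis order_tendstoD(2) eventually_sequentially order_refl)
      have "v (W m i - W k i) < e" if "m \<ge> N" "k \<ge> N" for m k
      proof -
        have "W m i - W k i = (W m i - W N i) - (W k i - W N i)" by simp
        also have "v \<dots> \<le> max (v (W m i - W N i)) (v (W k i - W N i))" by (rule v_diff)
        also have "\<dots> \<le> d ^ N" using diff'[OF i, of N "m - N"] diff'[OF i, of N "k - N"] that by simp
        finally show ?thesis using N by simp
      qed
      then show ?thesis by blast
    qed
    moreover have "range (\<lambda>k. W k i) \<subseteq> E" using WE i by auto
    ultimately show ?thesis using E(2) unfolding complete_subset_def by blast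
  qed
  then have "\<forall>i. \<exists>l. i < n \<longrightarrow> (\<lambda>k. v (W k i - l)) \<longlonglongrightarrow> 0" by blast
  then obtain w where w: "\<And>i. i < n \<Longrightarrow> (\<lambda>k. v (W k i - w i)) \<longlonglongrightarrow> 0" by metis
  \<comment> \<open>Iterate k is compared with a later iterate that is as close to the limit as
    desired.\<close>
  have wW: "v (w i - W k i) \<le> d ^ k" if i: "i < n" for i k
  proof (rule field_le_epsilon)
    fix e :: real assume "e > 0"
    then obtain N where N: "\<And>m. m \<ge> N \<Longrightarrow> v (W m i - w i) < e"
      using order_tendstoD(2)[OF w[OF i]] by (auto simp: eventually_sequentially)
    have "w i - W k i = (W (k + N) i - W k i) - (W (k + N) i - w i)" by simp
    also have "v \<dots> \<le> max (v (W (k + N) i - W k i)) (v (W (k + N) i - w i))" by (rule v_diff)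
    also have "\<dots> \<le> max (d ^ k) e" using diff'[OF i, of k N] N[of "k + N"] by (intro max.mono) auto
    also have "\<dots> \<le> d ^ k + e" using d \<open>e > 0\<close> by (simp add: max_def)
    finally show "v (w i - W k i) \<le> d ^ k + e" .
  qed
  have "form w - 1 = 0"
  proof (rule eq_0_of_v_le_power[OF d])
    fix k
    have "form w - 1 = form (\<lambda>i. w i - W k i)" using adm[of k] form_diff[of w "W k"] by (simp add: admissible_def)
    also have "v \<dots> \<le> d ^ k" using wW d by (intro v_form_le) auto
    finally show "v (form w - 1) \<le> d ^ k" .
  qed
  moreover have "v (w i) \<le> 1" if "i < n" for i
    using wW[OF that, of 0] adm[of 0] that v_add[of "w i - W 0 i" "W 0 i"] by (auto simp: admissible_def)
  ultimately have wadm: "admissible w" by (simp add: admissible_def)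
  have fixed: "step w i = w i" if i: "i < n" for i
  proof -
    have "step w i - w i = 0"
    proof (rule eq_0_of_v_le_power[OF d])
      fix k
      have "step w i - w i = (step w i - step (W k) i) - (w i - W (Suc k) i)" by (simp add: WS)
      also have "v \<dots> \<le> max (v (step w i - step (W k) i)) (v (w i - W (Suc k) i))" by (rule v_diff)
      also have "\<dots> \<le> d ^ Suc k"
        using step_contraction[OF wadm adm wW _ i, of k] wW[OF i, of "Suc k"] d by simp
      also have "\<dots> \<le> d ^ k" using d by (simp add: mult_left_le_one_le)
      finally show "v (step w i - w i) \<le> d ^ k" .
    qed
    then show ?thesis by simp
  qed
  have nz: "form (app w) \<noteq> 0" using v_form_app_admissible(2)[OF wadm] by auto
  have "app w i = form (app w) * w i" if "i < n" for i
    using fixed[OF that] nz by (simp add: step_def field_simps)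
  moreover have "v (w i - p i) < 1" if "i < n" for i
    using step_near[OF wadm that] fixed[OF that] d by simp
  ultimately show ?thesis using wadm v_form_app_admissible(2)[OF wadm] by blast
qed

end

section \<open>A basis adapted to a residually absolutely irreducible representation\<close>

locale residue = nonarchimedean v for v :: "'l::field \<Rightarrow> real" +
  fixes red :: "'l \<Rightarrow> 'k::field"
  assumes residue_map: "residue_map v red"
begin

lemma red_1 [simp]: "red 1 = 1"
  and red_add: "v x \<le> 1 \<Longrightarrow> v y \<le> 1 \<Longrightarrow> red (x + y) = red x + red y"
  and red_mult: "v x \<le> 1 \<Longrightarrow> v y \<le> 1 \<Longrightarrow> red (x * y) = red x * red y"
  and red_eq_0_iff: "v x \<le> 1 \<Longrightarrow> red x = 0 \<longleftrightarrow> v x < 1"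
  using residue_map unfolding residue_map_def by auto

lemma red_surj: obtains x where "v x \<le> 1" "red x = y"
proof -
  have "y \<in> red ` {x. v x \<le> 1}" using residue_map unfolding residue_map_def by simp
  then show thesis using that by blast
qed

lemma red_0 [simp]: "red 0 = 0" by (simp add: red_eq_0_iff)

lemma red_minus: "v x \<le> 1 \<Longrightarrow> red (- x) = - red x"
  using red_add[of x "- x"] by (simp add: eq_neg_iff_add_eq_0 add.commute)

lemma red_diff: "v x \<le> 1 \<Longrightarrow> v y \<le> 1 \<Longrightarrow> red (x - y) = red x - red y"
  using red_add[of x "- y"] red_minus[of y] by simp

lemma red_eq_iff: "v x \<le> 1 \<Longrightarrow> v y \<le> 1 \<Longrightarrow> red x = red y \<longleftrightarrow> v (x - y) < 1"
  using red_eq_0_iff[of "x - y"] red_diff[of x y] v_diff[of x y] by simp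

lemma red_inverse: "v x = 1 \<Longrightarrow> red (inverse x) = inverse (red x)"
  using red_mult[of x "inverse x"] v_inverse[of x] v_eq_0_iff[of x]
  by (simp add: inverse_unique del: v_eq_0_iff) 

lemma red_sum: "(\<And>i. i \<in> I \<Longrightarrow> v (f i) \<le> 1) \<Longrightarrow> red (sum f I) = (\<Sum>i\<in>I. red (f i))"
proof (induction I rule: infinite_finite_induct)
  case (insert i I)
  have "v (sum f I) \<le> 1" using insert by (intro v_sum_le) auto
  then show ?case using insert by (simp add: red_add)
qed auto

lemma red_prod: "(\<And>i. i \<in> I \<Longrightarrow> v (f i) \<le> 1) \<Longrightarrow> red (prod f I) = (\<Prod>i\<in>I. red (f i))"
proof (induction I rule: infinite_finite_induct)
  case (insert i I)
  have "v (prod f I) \<le> 1" using insert by (intro v_prod_le_1) auto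
  then show ?case using insert by (simp add: red_mult)
qed auto

definition integral :: "nat \<Rightarrow> 'l mat \<Rightarrow> bool" where
  "integral n A \<longleftrightarrow> A \<in> carrier_mat n n \<and> (\<forall>i<n. \<forall>j<n. v (A $$ (i, j)) \<le> 1)"

lemma integral_mult:
  assumes A: "integral n A" and B: "integral n B"
  shows "integral n (A * B)" "map_mat red (A * B) = map_mat red A * map_mat red B"
proof -
  have c: "A \<in> carrier_mat n n" "B \<in> carrier_mat n n" using A B by (auto simp: integral_def)
  have vv: "v (A $$ (i, l) * B $$ (l, j)) \<le> 1" if "i < n" "l < n" "j < n" for i j l
    using A B that by (auto simp: integral_def intro: v_mult_le_1)
  then have "v ((A * B) $$ (i, j)) \<le> 1" if "i < n" "j < n" for i j
    using that unfolding index_mult_mat_sum[OF c that] by (intro v_sum_le) auto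
  then show "integral n (A * B)" using c by (auto simp: integral_def)
  have r: "map_mat red A \<in> carrier_mat n n" "map_mat red B \<in> carrier_mat n n" using c by auto
  show "map_mat red (A * B) = map_mat red A * map_mat red B"
  proof (rule eq_matI)
    fix i j assume "i < dim_row (map_mat red A * map_mat red B)" "j < dim_col (map_mat red A * map_mat red B)"
    then have ij: "i < n" "j < n" using c by auto
    have "map_mat red (A * B) $$ (i, j) = red ((A * B) $$ (i, j))" using c ij by simp
    also have "\<dots> = (\<Sum>l<n. red (A $$ (i, l) * B $$ (l, j)))"
      unfolding index_mult_mat_sum[OF c ij] using vv ij by (intro red_sum) auto
    also have "\<dots> = (\<Sum>l<n. red (A $$ (i, l)) * red (B $$ (l, j)))"
      using A B ij by (intro sum.cong refl red_mult) (auto simp: integral_def)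
    also have "\<dots> = (map_mat red A * map_mat red B) $$ (i, j)"
      unfolding index_mult_mat_sum[OF r ij] using c ij by (intro sum.cong) auto
    finally show "map_mat red (A * B) $$ (i, j) = (map_mat red A * map_mat red B) $$ (i, j)" .
  qed (use c in auto)
qed

lemma integral_add:
  assumes A: "integral n A" and B: "integral n B"
  shows "integral n (A + B)" "map_mat red (A + B) = map_mat red A + map_mat red B"
proof -
  show "integral n (A + B)" using A B order_trans[OF v_add] by (auto simp: integral_def)
  show "map_mat red (A + B) = map_mat red A + map_mat red B"
    using A B by (intro eq_matI) (auto simp: integral_def red_add)
qed

lemma integral_smult:
  assumes A: "integral n A" and c: "v c \<le> 1"
  shows "integral n (c \<cdot>\<^sub>m A)" "map_mat red (c \<cdot>\<^sub>m A) = red c \<cdot>\<^sub>m map_mat red A"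
proof -
  show "integral n (c \<cdot>\<^sub>m A)" using A c by (auto simp: integral_def intro!: v_mult_le_1)
  show "map_mat red (c \<cdot>\<^sub>m A) = red c \<cdot>\<^sub>m map_mat red A"
    using A c by (intro eq_matI) (auto simp: integral_def red_mult)
qed

lemma integral_det:
  assumes A: "integral n A"
  shows "v (det A) \<le> 1" "red (det A) = det (map_mat red A)"
proof -
  have c: "A \<in> carrier_mat n n" using A by (simp add: integral_def)
  let ?P = "{p. p permutes {0..<n}}"
  have s: "v (signof p) \<le> 1" "red (signof p) = signof p" for p :: "nat \<Rightarrow> nat"
    by (auto simp: sign_def red_minus)
  have e: "v (A $$ (i, p i)) \<le> 1" if "p \<in> ?P" "i \<in> {0..<n}" for p i
    using A that permutes_in_image[of p "{0..<n}" i] by (auto simp: integral_def)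
  have pr: "v (\<Prod>i = 0..<n. A $$ (i, p i)) \<le> 1" if "p \<in> ?P" for p
    using e[OF that] by (rule v_prod_le_1)
  have t: "v (signof p * (\<Prod>i = 0..<n. A $$ (i, p i))) \<le> 1" if "p \<in> ?P" for p
    using s(1) pr[OF that] by (rule v_mult_le_1)
  show "v (det A) \<le> 1" unfolding det_def'[OF c] using t by (intro v_sum_le) auto
  have "red (det A) = (\<Sum>p\<in>?P. red (signof p * (\<Prod>i = 0..<n. A $$ (i, p i))))"
    unfolding det_def'[OF c] using t by (rule red_sum)
  also have "\<dots> = (\<Sum>p\<in>?P. signof p * (\<Prod>i = 0..<n. map_mat red A $$ (i, p i)))"
  proof (intro sum.cong refl)
    fix p assume p: "p \<in> ?P"
    have "red (\<Prod>i = 0..<n. A $$ (i, p i)) = (\<Prod>i = 0..<n. red (A $$ (i, p i)))"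
      using e[OF p] by (rule red_prod)
    also have "\<dots> = (\<Prod>i = 0..<n. map_mat red A $$ (i, p i))"
      using p c permutes_in_image[of p "{0..<n}"] by (intro prod.cong refl) auto
    finally show "red (signof p * (\<Prod>i = 0..<n. A $$ (i, p i)))
        = signof p * (\<Prod>i = 0..<n. map_mat red A $$ (i, p i))"
      using red_mult[OF s(1) pr[OF p]] s(2) by simp
  qed
  also have "\<dots> = det (map_mat red A)" using c by (subst det_def'[of _ n]) auto
  finally show "red (det A) = det (map_mat red A)" .
qed

lemma integral_one: "integral n (1\<^sub>m n)" "map_mat red (1\<^sub>m n) = 1\<^sub>m n"
  by (auto simp: integral_def)

section \<open>Semilinear intertwiners and the twisted matrices\<close>

definition intertwiners :: "nat \<Rightarrow> 'g set \<Rightarrow> ('g \<Rightarrow> 'l mat) \<Rightarrow> (('l \<Rightarrow> 'l) \<times> 'l mat) set \<Rightarrow> bool" where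
  "intertwiners n H \<rho> S \<longleftrightarrow> (\<forall>(\<gamma>, C)\<in>S. comm_ring_hom \<gamma> \<and> (\<forall>x. v (\<gamma> x) = v x) \<and>
     C \<in> carrier_mat n n \<and> det C \<noteq> 0 \<and> (\<forall>h\<in>H. map_mat \<gamma> (\<rho> h) * C = C * \<rho> h))"

lemma intertwinersD:
  assumes "intertwiners n H \<rho> S" "(\<gamma>, C) \<in> S"
  shows "comm_ring_hom \<gamma>" "v (\<gamma> x) = v x" "C \<in> carrier_mat n n" "det C \<noteq> 0"
    "h \<in> H \<Longrightarrow> map_mat \<gamma> (\<rho> h) * C = C * \<rho> h"
  using assms unfolding intertwiners_def by blast+

text \<open>The X in the twisted form of the matrix algebra cut out by S: in the presence of S these are
  the elements that behave as if they had coefficients in the fixed field.\<close>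
definition twisted :: "nat \<Rightarrow> (('l \<Rightarrow> 'l) \<times> 'l mat) set \<Rightarrow> 'l mat set" where
  "twisted n S = {U. integral n U \<and> (\<forall>(\<gamma>, C)\<in>S. map_mat \<gamma> U * C = C * U)}"

text \<open>The reductions of the twisted matrices form a ring that contains those of all \<rho>(h)
  and inherits nondegeneracy from them. Twisting is conjugation by C, which preserves determinants,
  so det V is fixed by every \<gamma> and its residue lies in \<open>k\<close>.\<close>

lemma twisted_rank_one:
  fixes \<rho> :: "'g \<Rightarrow> 'l mat"
  assumes n: "n > 0" and S: "intertwiners n H \<rho> S"
    and \<rho>: "\<And>h. h \<in> H \<Longrightarrow> integral n (\<rho> h)" "e \<in> H" "\<rho> e = 1\<^sub>m n"
      "\<And>h h'. h \<in> H \<Longrightarrow> h' \<in> H \<Longrightarrow> \<exists>h''\<in>H. \<rho> h * \<rho> h' = \<rho> h''"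
    and nd: "nondegenerate ({..<n} \<times> {..<n}) ((\<lambda>h. ($$) (map_mat red (\<rho> h))) ` H)"
    and fin: "\<And>S::'k set. finite S \<Longrightarrow> \<exists>F. finite F \<and> subfield_set F \<and> S \<subseteq> F"
  obtains U p q where "U \<in> twisted n S" "q \<in> carrier_vec n" "p \<in> carrier_vec n" "scalar_prod q p = 1"
    "map_mat red U = mat n n (\<lambda>(i, j). p $ i * q $ j)"
proof -
  \<comment> \<open>Defined through fixed integral elements of the big field, so that every scalar
    in \<open>k\<close> lifts to one that preserves \<open>twisted n S\<close>.\<close>
  define k where "k = red ` {x. v x \<le> 1 \<and> (\<forall>(\<gamma>, C)\<in>S. \<gamma> x = x)}"
  define B where "B = map_mat red ` twisted n S"
  have tI: "U \<in> twisted n S"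
    if "integral n U" "\<And>\<gamma> C. (\<gamma>, C) \<in> S \<Longrightarrow> map_mat \<gamma> U * C = C * U" for U
    using that by (auto simp: twisted_def)
  have tD: "integral n U" "U \<in> carrier_mat n n" "(\<gamma>, C) \<in> S \<Longrightarrow> map_mat \<gamma> U * C = C * U"
    if "U \<in> twisted n S" for U \<gamma> C
    using that by (auto simp: twisted_def integral_def)
  have sum: "U + V \<in> twisted n S" if U: "U \<in> twisted n S" and V: "V \<in> twisted n S" for U V
  proof (rule tI)
    fix \<gamma> C assume g: "(\<gamma>, C) \<in> S"
    interpret \<gamma>: comm_ring_hom \<gamma> by (rule intertwinersD[OF S g])
    note C = intertwinersD(3)[OF S g]
    have "map_mat \<gamma> (U + V) = map_mat \<gamma> U + map_mat \<gamma> V"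
      using tD(2)[OF U] tD(2)[OF V] by (intro eq_matI) (auto simp: \<gamma>.hom_add)
    then show "map_mat \<gamma> (U + V) * C = C * (U + V)"
      using tD[OF U] tD[OF V] C g by (simp add: add_mult_distrib_mat[of _ n n] mult_add_distrib_mat[of _ n n])
  qed (use integral_add tD U V in blast)
  have prod: "U * V \<in> twisted n S" if U: "U \<in> twisted n S" and V: "V \<in> twisted n S" for U V
  proof (rule tI)
    fix \<gamma> C assume g: "(\<gamma>, C) \<in> S"
    interpret \<gamma>: comm_ring_hom \<gamma> by (rule intertwinersD[OF S g])
    note C = intertwinersD(3)[OF S g]
    have c: "map_mat \<gamma> U \<in> carrier_mat n n" "map_mat \<gamma> V \<in> carrier_mat n n" using tD[OF U] tD[OF V] by auto
    have "map_mat \<gamma> (U * V) * C = map_mat \<gamma> U * (map_mat \<gamma> V * C)"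
      using \<gamma>.mat_hom_mult[OF tD(2)[OF U] tD(2)[OF V]] c C by (simp add: mat_assoc)
    also have "\<dots> = map_mat \<gamma> U * C * V" using tD[OF V] g c C by (simp add: mat_assoc)
    also have "\<dots> = C * (U * V)" using tD[OF U] tD[OF V] g c C by (simp add: mat_assoc)
    finally show "map_mat \<gamma> (U * V) * C = C * (U * V)" .
  qed (use integral_mult tD U V in blast)
  have scale: "c \<cdot>\<^sub>m U \<in> twisted n S"
    if U: "U \<in> twisted n S" and c: "v c \<le> 1" "\<And>\<gamma> C. (\<gamma>, C) \<in> S \<Longrightarrow> \<gamma> c = c" for U c
  proof (rule tI)
    fix \<gamma> C assume g: "(\<gamma>, C) \<in> S"
    interpret \<gamma>: comm_ring_hom \<gamma> by (rule intertwinersD[OF S g])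
    note C = intertwinersD(3)[OF S g]
    have "map_mat \<gamma> (c \<cdot>\<^sub>m U) = c \<cdot>\<^sub>m map_mat \<gamma> U"
      using c(2)[OF g] by (intro eq_matI) (auto simp: \<gamma>.hom_mult)
    then show "map_mat \<gamma> (c \<cdot>\<^sub>m U) * C = C * (c \<cdot>\<^sub>m U)"
      using tD[OF U] C g by (simp add: mult_smult_assoc_mat[of _ n n] mult_smult_distrib[of _ n n])
  qed (use integral_smult tD U c in blast)
  have \<rho>t: "\<rho> h \<in> twisted n S" if "h \<in> H" for h
    using tI \<rho>(1)[OF that] intertwinersD(5)[OF S _ that] by blast
  have kE: thesis
    if y: "y \<in> k" and r: "\<And>x. v x \<le> 1 \<Longrightarrow> (\<And>\<gamma> C. (\<gamma>, C) \<in> S \<Longrightarrow> \<gamma> x = x) \<Longrightarrow> y = red x \<Longrightarrow> thesis" for y thesis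
  proof -
    obtain x where x: "v x \<le> 1" "\<forall>(\<gamma>, C)\<in>S. \<gamma> x = x" "y = red x" using y by (auto simp: k_def)
    then show thesis by (intro r[of x]) auto
  qed
  have kI: "red x \<in> k" if "v x \<le> 1" "\<And>\<gamma> C. (\<gamma>, C) \<in> S \<Longrightarrow> \<gamma> x = x" for x
    using that unfolding k_def by blast
  have k: "subfield_set k"
    unfolding subfield_set_def
  proof (intro conjI ballI)
    have h: "comm_ring_hom \<gamma>" if "(\<gamma>, C) \<in> S" for \<gamma> C using intertwinersD[OF S that] by blast
    have h01: "\<gamma> 0 = 0" "\<gamma> 1 = 1" if "(\<gamma>, C) \<in> S" for \<gamma> C
    proof -
      interpret \<gamma>: comm_ring_hom \<gamma> by (rule h[OF that])
      show "\<gamma> 0 = 0" "\<gamma> 1 = 1" by simp_all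
    qed
    show "0 \<in> k" using kI[of 0] h01 by auto
    show "1 \<in> k" using kI[of 1] h01 by auto
    {
      fix y z assume "y \<in> k" "z \<in> k"
      obtain a where a: "v a \<le> 1" "\<And>\<gamma> C. (\<gamma>, C) \<in> S \<Longrightarrow> \<gamma> a = a" "y = red a"
        using kE[OF \<open>y \<in> k\<close>] by blast
      obtain b where b: "v b \<le> 1" "\<And>\<gamma> C. (\<gamma>, C) \<in> S \<Longrightarrow> \<gamma> b = b" "z = red b"
        using kE[OF \<open>z \<in> k\<close>] by blast
      note ab = a b
      show "y + z \<in> k"
      proof -
        have "red (a + b) \<in> k"
        proof (rule kI)
          fix \<gamma> C assume g: "(\<gamma>, C) \<in> S"
          interpret \<gamma>: comm_ring_hom \<gamma> by (rule h[OF g])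
          show "\<gamma> (a + b) = a + b" using ab(2,5)[OF g] by (simp add: \<gamma>.hom_add)
        qed (use ab v_add[of a b] in auto)
        then show ?thesis using ab by (simp add: red_add)
      qed
      show "y * z \<in> k"
      proof -
        have "red (a * b) \<in> k"
        proof (rule kI)
          fix \<gamma> C assume g: "(\<gamma>, C) \<in> S"
          interpret \<gamma>: comm_ring_hom \<gamma> by (rule h[OF g])
          show "\<gamma> (a * b) = a * b" using ab(2,5)[OF g] by (simp add: \<gamma>.hom_mult)
        qed (use ab v_mult_le_1 in auto)
        then show ?thesis using ab by (simp add: red_mult)
      qed
    }
    fix y assume "y \<in> k"
    obtain a where a: "v a \<le> 1" "\<And>\<gamma> C. (\<gamma>, C) \<in> S \<Longrightarrow> \<gamma> a = a" "y = red a"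
      using kE[OF \<open>y \<in> k\<close>] by blast
    show "- y \<in> k"
    proof -
      have "red (- a) \<in> k"
      proof (rule kI)
        fix \<gamma> C assume g: "(\<gamma>, C) \<in> S"
        interpret \<gamma>: comm_ring_hom \<gamma> by (rule h[OF g])
        show "\<gamma> (- a) = - a" using a(2)[OF g] by (simp add: \<gamma>.hom_uminus)
      qed (use a in auto)
      then show ?thesis using a by (simp add: red_minus)
    qed
    \<comment> \<open>A unit has an integral fixed inverse; a nonunit has residue 0, whose inverse
      is 0 by convention.\<close>
    show "inverse y \<in> k"
    proof (cases "v a = 1")
      case True
      then have a0: "a \<noteq> 0" by auto
      have "red (inverse a) \<in> k"
      proof (rule kI)
        fix \<gamma> C assume g: "(\<gamma>, C) \<in> S"
        interpret \<gamma>: comm_ring_hom \<gamma> by (rule h[OF g])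
        have "a * \<gamma> (inverse a) = 1" using \<gamma>.hom_mult[of a "inverse a"] a(2)[OF g] a0 by simp
        then show "\<gamma> (inverse a) = inverse a" by (rule inverse_unique[symmetric])
      qed (use True v_inverse in auto)
      then show ?thesis using a True by (simp add: red_inverse)
    next
      case False
      then have "y = 0" using a red_eq_0_iff by simp
      then show ?thesis using \<open>y \<in> k\<close> by simp
    qed
  qed
  have "\<exists>p\<in>carrier_vec n. \<exists>q\<in>carrier_vec n. scalar_prod q p = 1 \<and> mat n n (\<lambda>(i, j). p $ i * q $ j) \<in> B"
  proof (rule rank_one_idempotent[OF n _ _ _ _ k _ _ _ fin])
    show "B \<subseteq> carrier_mat n n" using tD(2) by (auto simp: B_def)
    show "1\<^sub>m n \<in> B" unfolding B_def using \<rho>t[OF \<rho>(2)] \<rho>(3) integral_one(2) by (metis imageI)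
    show "U + V \<in> B" if "U \<in> B" "V \<in> B" for U V
    proof -
      obtain U' V' where "U' \<in> twisted n S" "U = map_mat red U'" "V' \<in> twisted n S" "V = map_mat red V'"
        using \<open>U \<in> B\<close> \<open>V \<in> B\<close> by (auto simp: B_def)
      then show ?thesis using sum[of U' V'] integral_add(2)[of n U' V'] tD(1) unfolding B_def by (metis imageI)
    qed
    show "U * V \<in> B" if "U \<in> B" "V \<in> B" for U V
    proof -
      obtain U' V' where "U' \<in> twisted n S" "U = map_mat red U'" "V' \<in> twisted n S" "V = map_mat red V'"
        using \<open>U \<in> B\<close> \<open>V \<in> B\<close> by (auto simp: B_def)
      then show ?thesis using prod[of U' V'] integral_mult(2)[of n U' V'] tD(1) unfolding B_def by (metis imageI)
    qed
    show "c \<cdot>\<^sub>m U \<in> B" if "c \<in> k" "U \<in> B" for c U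
    proof -
      obtain a where a: "v a \<le> 1" "\<And>\<gamma> C. (\<gamma>, C) \<in> S \<Longrightarrow> \<gamma> a = a" "c = red a"
        using kE[OF \<open>c \<in> k\<close>] by blast
      obtain V where V: "V \<in> twisted n S" "U = map_mat red V" using \<open>U \<in> B\<close> by (auto simp: B_def)
      have "c \<cdot>\<^sub>m U = map_mat red (a \<cdot>\<^sub>m V)" using integral_smult(2)[OF tD(1)[OF V(1)] a(1)] a V by simp
      moreover have "a \<cdot>\<^sub>m V \<in> twisted n S" by (rule scale[OF V(1) a(1)]) (rule a(2))
      ultimately show ?thesis unfolding B_def by blast
    qed
    show "det U \<in> k" if "U \<in> B" for U
    proof -
      obtain V where V: "V \<in> twisted n S" "U = map_mat red V" using \<open>U \<in> B\<close> by (auto simp: B_def)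
      have "red (det V) \<in> k"
      proof (rule kI)
        fix \<gamma> C assume g: "(\<gamma>, C) \<in> S"
        interpret \<gamma>: comm_ring_hom \<gamma> by (rule intertwinersD[OF S g])
        note C = intertwinersD(3,4)[OF S g]
        have "det (map_mat \<gamma> V) * det C = det C * det V"
          using tD(3)[OF V(1) g] tD(2)[OF V(1)] C(1) by (metis det_mult map_carrier_mat)
        then show "\<gamma> (det V) = det V" using C(2) by (simp add: \<gamma>.hom_det)
      qed (use integral_det tD V in blast)
      then show ?thesis using integral_det(2)[OF tD(1)[OF V(1)]] V by simp
    qed
    show "nondegenerate ({..<n} \<times> {..<n}) (($$) ` B)"
      by (rule nondegenerate_mono[OF nd]) (use \<rho>t in \<open>auto simp: B_def\<close>)
  qed
  then obtain p q where pq: "p \<in> carrier_vec n" "q \<in> carrier_vec n" "scalar_prod q p = 1"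
    "mat n n (\<lambda>(i, j). p $ i * q $ j) \<in> B" by blast
  then obtain U where "U \<in> twisted n S" "map_mat red U = mat n n (\<lambda>(i, j). p $ i * q $ j)"
    by (auto simp: B_def)
  then show thesis using that pq by blast
qed

text \<open>The columns of P are the \<open>\<rho> h *\<^sub>v w\<close> for an eigenvector w of a twisted matrix lifting a
  rank one idempotent. Its unit eigenvalue is simple, so \<gamma> moves w to a multiple of \<open>C *\<^sub>v w\<close>.\<close>
lemma adapted_basis:
  fixes \<rho> :: "'g \<Rightarrow> 'l mat"
  assumes n: "n > 0" and S: "intertwiners n H \<rho> S"
    and \<rho>: "\<And>h. h \<in> H \<Longrightarrow> integral n (\<rho> h)" "e \<in> H" "\<rho> e = 1\<^sub>m n"
      "\<And>h h'. h \<in> H \<Longrightarrow> h' \<in> H \<Longrightarrow> \<exists>h''\<in>H. \<rho> h * \<rho> h' = \<rho> h''"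
    and nd: "nondegenerate ({..<n} \<times> {..<n}) ((\<lambda>h. ($$) (map_mat red (\<rho> h))) ` H)"
    and fin: "\<And>S::'k set. finite S \<Longrightarrow> \<exists>F. finite F \<and> subfield_set F \<and> S \<subseteq> F"
    and compl: "\<And>S::'l set. finite S \<Longrightarrow> \<exists>E. subfield_set E \<and> complete_subset v E \<and> S \<subseteq> E"
  shows "\<exists>P\<in>carrier_mat n n. det P \<noteq> 0 \<and> (\<forall>(\<gamma>, C)\<in>S. \<exists>c. c \<noteq> 0 \<and> map_mat \<gamma> P = c \<cdot>\<^sub>m (C * P))"
proof -
  obtain U p0 q0 where U: "U \<in> twisted n S" and q0: "q0 \<in> carrier_vec n" and p0: "p0 \<in> carrier_vec n"
    and q0p0: "scalar_prod q0 p0 = 1" and Ur: "map_mat red U = mat n n (\<lambda>(i, j). p0 $ i * q0 $ j)"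
    using twisted_rank_one[OF n S \<rho> nd fin] by metis
  have Ui: "integral n U" and Uc: "U \<in> carrier_mat n n" using U by (auto simp: twisted_def integral_def)
  define lift where "lift y = (SOME x. v x \<le> 1 \<and> red x = y)" for y
  have lift: "v (lift y) \<le> 1" "red (lift y) = y" for y
    using someI_ex[of "\<lambda>x. v x \<le> 1 \<and> red x = y"] red_surj[of y] unfolding lift_def by blast+
  define q where "q i = lift (q0 $ i)" for i
  \<comment> \<open>The lifts pair to a unit u congruent to 1. Dividing by it makes the pairing
    exactly 1, as the iteration demands.\<close>
  define u where "u = (\<Sum>i<n. q i * lift (p0 $ i))"
  define p where "p i = lift (p0 $ i) / u" for i
  have q: "v (q i) \<le> 1" "red (q i) = q0 $ i" for i by (auto simp: q_def lift)
  have "red u = (\<Sum>i<n. q0 $ i * p0 $ i)"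
    unfolding u_def using lift q by (subst red_sum) (auto simp: red_mult intro: v_mult_le_1)
  also have "\<dots> = 1" using q0p0 p0 by (simp add: scalar_prod_def lessThan_atLeast0)
  finally have ru: "red u = 1" .
  have "v u \<le> 1" unfolding u_def using lift q by (intro v_sum_le) (auto intro: v_mult_le_1)
  then have vu: "v u = 1" using ru red_eq_0_iff[of u] by force
  have p: "v (p i) \<le> 1" "red (p i) = p0 $ i" for i
  proof -
    show "v (p i) \<le> 1" using lift vu by (simp add: p_def v_divide)
    have "red (p i) = red (lift (p0 $ i)) * red (inverse u)"
      unfolding p_def divide_inverse using lift vu by (intro red_mult) (auto simp: v_inverse)
    then show "red (p i) = p0 $ i" using lift ru vu by (simp add: red_inverse)
  qed
  have qp: "(\<Sum>i<n. q i * p i) = 1"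
  proof -
    have "(\<Sum>i<n. q i * p i) = (\<Sum>i<n. q i * lift (p0 $ i)) / u"
      by (simp only: p_def sum_divide_distrib times_divide_eq_right)
    also have "\<dots> = 1" using vu v_0 unfolding u_def[symmetric] by (metis div_self zero_neq_one)
    finally show ?thesis .
  qed
  \<comment> \<open>A maximum over finitely many entries, so that d < 1 even if the values of v are
    dense.\<close>
  define d where "d = Max (insert 0 ((\<lambda>(i, j). v (U $$ (i, j) - p i * q j)) ` ({..<n} \<times> {..<n})))"
  have close: "v (U $$ (i, j) - p i * q j) < 1" if "i < n" "j < n" for i j
  proof -
    have "red (U $$ (i, j)) = map_mat red U $$ (i, j)" using Uc that by simp
    also have "\<dots> = red (p i * q j)" unfolding Ur using that p q by (simp add: red_mult)
    finally show ?thesis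
      using Ui that p q by (subst (asm) red_eq_iff) (auto simp: integral_def intro: v_mult_le_1)
  qed
  have d: "0 \<le> d" "d < 1" "\<And>i j. i < n \<Longrightarrow> j < n \<Longrightarrow> v (U $$ (i, j) - p i * q j) \<le> d"
    unfolding d_def using close by (auto intro!: Max_ge simp: Max_less_iff)
  interpret rank_one_residue v n "\<lambda>i j. U $$ (i, j)" p q d
    using Ui p q qp d by unfold_locales (auto simp: integral_def)
  obtain E where E: "subfield_set E" "complete_subset v E"
      "(\<lambda>(i, j). U $$ (i, j)) ` ({..<n} \<times> {..<n}) \<union> p ` {..<n} \<union> q ` {..<n} \<subseteq> E"
    using compl[of "(\<lambda>(i, j). U $$ (i, j)) ` ({..<n} \<times> {..<n}) \<union> p ` {..<n} \<union> q ` {..<n}"] by auto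
  obtain w a where w: "admissible w" "v a = 1" "\<And>i. i < n \<Longrightarrow> app w i = a * w i" "\<And>i. i < n \<Longrightarrow> v (w i - p i) < 1"
    using eigenvector_exists[OF E(1,2)] E(3) by (auto simp: image_subset_iff)
  have wi: "v (w i) \<le> 1" if "i < n" for i using w(1) that by (simp add: admissible_def)
  have rw: "red (w i) = p0 $ i" if "i < n" for i
    using red_eq_iff[OF wi[OF that] p(1)] w(4) that p by simp
  have "\<exists>i<n. p0 $ i \<noteq> 0"
  proof (rule ccontr)
    assume "\<not> ?thesis"
    then have "scalar_prod q0 p0 = 0" using p0 by (auto simp: scalar_prod_def intro!: sum.neutral)
    then show False using q0p0 by simp
  qed
  then obtain l0 where l0: "l0 < n" "p0 $ l0 \<noteq> 0" by blast
  \<comment> \<open>The vectors \<rho>(h) p0 modulo the maximal ideal. They span: if f kills them,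
    the tensor product of f and p0 kills all reduced \<rho>(h), and p0 has a nonzero entry at
    \<open>l0\<close>.\<close>
  define col0 where "col0 h i = (\<Sum>l<n. red (\<rho> h $$ (i, l)) * p0 $ l)" for h i
  have "nondegenerate {..<n} (col0 ` H)"
    unfolding nondegenerate_def
  proof (intro allI impI ballI)
    fix f i assume f: "\<forall>s\<in>col0 ` H. (\<Sum>i<n. f i * s i) = 0" and i: "i \<in> {..<n}"
    have "f (fst (i, l0)) * p0 $ snd (i, l0) = 0"
    proof (rule nondegenerateD[OF nd])
      fix s assume "s \<in> (\<lambda>h. ($$) (map_mat red (\<rho> h))) ` H"
      then obtain h where h: "h \<in> H" "s = ($$) (map_mat red (\<rho> h))" by auto
      have "(\<Sum>x\<in>{..<n} \<times> {..<n}. f (fst x) * p0 $ snd x * s x)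
          = (\<Sum>i<n. \<Sum>l<n. f i * p0 $ l * red (\<rho> h $$ (i, l)))"
        unfolding h(2) sum_matrix_entries
        using \<rho>(1)[OF h(1)] by (intro sum.cong refl) (auto simp: integral_def)
      also have "\<dots> = (\<Sum>i<n. f i * col0 h i)" by (simp add: col0_def sum_distrib_left mult_ac)
      finally show "(\<Sum>x\<in>{..<n} \<times> {..<n}. f (fst x) * p0 $ snd x * s x) = 0" using f h by simp
    qed (use i l0 in auto)
    then show "f i = 0" using l0 by simp
  qed
  then obtain s where s: "\<And>j. j < n \<Longrightarrow> s j \<in> col0 ` H"
      "\<And>c. \<forall>i\<in>{..<n}. (\<Sum>j<n. c j * s j i) = 0 \<Longrightarrow> \<forall>j<n. c j = 0"
    using independent_selection[of "{..<n}" "col0 ` H" n] by auto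
  define \<eta> where "\<eta> j = (SOME h. h \<in> H \<and> s j = col0 h)" for j
  have \<eta>: "\<eta> j \<in> H" "s j = col0 (\<eta> j)" if "j < n" for j
    using someI_ex[of "\<lambda>h. h \<in> H \<and> s j = col0 h"] s(1)[OF that] unfolding \<eta>_def by blast+
  define P where "P = mat n n (\<lambda>(i, j). \<Sum>l<n. \<rho> (\<eta> j) $$ (i, l) * w l)"
  have P: "P \<in> carrier_mat n n" by (simp add: P_def)
  have vterm: "v (\<rho> (\<eta> j) $$ (i, l) * w l) \<le> 1" if "i < n" "j < n" "l < n" for i j l
    using that \<rho>(1)[OF \<eta>(1)] wi by (intro v_mult_le_1) (auto simp: integral_def)
  have Pint: "integral n P"
    unfolding integral_def
  proof (intro conjI allI impI)
    fix i j assume "i < n" "j < n"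
    then show "v (P $$ (i, j)) \<le> 1" unfolding P_def using vterm by (simp, intro v_sum_le) auto
  qed (rule P)
  have redP: "map_mat red P $$ (i, j) = s j i" if "i < n" "j < n" for i j
  proof -
    have "map_mat red P $$ (i, j) = (\<Sum>l<n. red (\<rho> (\<eta> j) $$ (i, l) * w l))"
      using that vterm by (auto simp: P_def intro!: red_sum)
    also have "\<dots> = s j i"
      unfolding \<eta>(2)[OF that(2)] col0_def using that \<rho>(1)[OF \<eta>(1)] wi
      by (intro sum.cong refl) (auto simp: integral_def red_mult rw)
    finally show ?thesis .
  qed
  \<comment> \<open>The columns of P reduce to the independent vectors s j, so even the reduced
    determinant is nonzero.\<close>
  have "det P \<noteq> 0"
  proof
    assume "det P = 0"
    then have "det (map_mat red P) = 0" using integral_det(2)[OF Pint] by simp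
    then obtain x where x: "x \<in> carrier_vec n" "x \<noteq> 0\<^sub>v n" "map_mat red P *\<^sub>v x = 0\<^sub>v n"
      using det_0_iff_vec_prod_zero_field[of "map_mat red P" n] P by auto
    have "(\<Sum>j<n. x $ j * s j i) = 0" if "i < n" for i
    proof -
      have "(map_mat red P *\<^sub>v x) $ i = (\<Sum>j<n. map_mat red P $$ (i, j) * x $ j)"
        using P x that by (intro index_mult_mat_vec_sum) auto
      then show ?thesis using x that redP by (simp add: mult.commute)
    qed
    then have "\<forall>j<n. x $ j = 0" by (intro s(2)) auto
    then show False using x by (auto simp: vec_eq_iff)
  qed
  moreover have "\<exists>c. c \<noteq> 0 \<and> map_mat \<gamma> P = c \<cdot>\<^sub>m (C * P)" if g: "(\<gamma>, C) \<in> S" for \<gamma> C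
  proof -
    interpret \<gamma>: comm_ring_hom \<gamma> by (rule intertwinersD[OF S g])
    note C = intertwinersD(3,4)[OF S g] and v\<gamma> = intertwinersD(2)[OF S g]
    obtain D where D: "D \<in> carrier_mat n n" "D * C = 1\<^sub>m n" "C * D = 1\<^sub>m n"
      using det_non_zero_imp_unit[OF C] by (auto simp: Units_def ring_mat_def)
    define W where "W = vec n w"
    have W: "W \<in> carrier_vec n" "dim_vec W = n" and Wi: "\<And>i. i < n \<Longrightarrow> W $ i = w i"
      by (simp_all add: W_def)
    note WU = index_mult_mat_vec_sum[OF _ W(1)]
    have UW: "U *\<^sub>v W = a \<cdot>\<^sub>v W"
      using Uc W w(3) by (intro eq_vecI) (auto simp: WU[OF Uc] Wi app_def simp del: index_mult_mat_vec)
    \<comment> \<open>The preimage of \<gamma>(W) under C. As U is twisted, it is an eigenvector of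
      the same U, for the eigenvalue \<gamma>(a), which is again a unit.\<close>
    define W' where "W' = D *\<^sub>v map_vec \<gamma> W"
    have W': "W' \<in> carrier_vec n" using D W by (auto simp: W'_def)
    have CW': "C *\<^sub>v W' = map_vec \<gamma> W"
      using D C W by (simp add: W'_def assoc_mult_mat_vec[symmetric, of C n n D n])
    have "U *\<^sub>v W' = \<gamma> a \<cdot>\<^sub>v W'"
    proof -
      have "C *\<^sub>v (U *\<^sub>v W') = (C * U) *\<^sub>v W'" using C Uc W' by simp
      also have "C * U = map_mat \<gamma> U * C" using U g by (auto simp: twisted_def)
      also have "(map_mat \<gamma> U * C) *\<^sub>v W' = map_mat \<gamma> U *\<^sub>v map_vec \<gamma> W"
        using C Uc W' CW' by (simp add: assoc_mult_mat_vec[of _ n n C n])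
      also have "\<dots> = map_vec \<gamma> (U *\<^sub>v W)" by (rule \<gamma>.mult_mat_vec_hom[OF Uc W(1), symmetric])
      also have "\<dots> = \<gamma> a \<cdot>\<^sub>v (C *\<^sub>v W')" unfolding UW CW' by (rule \<gamma>.vec_hom_smult)
      finally have "D *\<^sub>v (C *\<^sub>v (U *\<^sub>v W')) = D *\<^sub>v (\<gamma> a \<cdot>\<^sub>v (C *\<^sub>v W'))" by simp
      moreover have "D *\<^sub>v (C *\<^sub>v z) = z" if "z \<in> carrier_vec n" for z
        using D C that by (simp add: assoc_mult_mat_vec[symmetric, of D n n C n])
      ultimately show ?thesis using Uc W' C D by (simp add: mult_mat_vec[of _ n n])
    qed
    then have "app (\<lambda>i. W' $ i) i = \<gamma> a * W' $ i" if "i < n" for i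
      using index_mult_mat_vec_sum[OF Uc W' that] that W' by (simp add: app_def)
    then have W'w: "W' $ i = form (\<lambda>i. W' $ i) * w i" if "i < n" for i
      using eigenvector_unique[OF w(1,3,2), of "\<lambda>i. W' $ i" "\<gamma> a" i] that v\<gamma> w(2) by simp
    define c where "c = form (\<lambda>i. W' $ i)"
    have W'W: "W' = c \<cdot>\<^sub>v W" using W' W'w by (intro eq_vecI) (auto simp: W_def c_def)
    have "c \<noteq> 0"
    proof
      assume "c = 0"
      then have "W' = 0\<^sub>v n" using W'W W by (intro eq_vecI) auto
      moreover have "C *\<^sub>v 0\<^sub>v n = 0\<^sub>v n" using C by (intro eq_vecI) auto
      ultimately have z: "map_vec \<gamma> W = 0\<^sub>v n" using CW' by simp
      have "w i = 0" if "i < n" for i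
      proof -
        have "\<gamma> (w i) = 0" using arg_cong[OF z, of "\<lambda>z. z $ i"] that by (simp add: W_def)
        then show ?thesis using v\<gamma>[of "w i"] by simp
      qed
      then have "form w = 0" by (simp add: form_def)
      then show False using w(1) by (simp add: admissible_def)
    qed
    \<comment> \<open>The factor c comes from w alone, hence is common to all columns;
      \<gamma>(\<rho>(h)) C = C \<rho>(h) carries it through to each of them.\<close>
    moreover have "map_mat \<gamma> P = c \<cdot>\<^sub>m (C * P)"
    proof (rule eq_matI)
      fix i j assume "i < dim_row (c \<cdot>\<^sub>m (C * P))" "j < dim_col (c \<cdot>\<^sub>m (C * P))"
      then have ij: "i < n" "j < n" using C P by auto
      have Rc: "\<rho> (\<eta> j) \<in> carrier_mat n n" using \<rho>(1)[OF \<eta>(1)[OF ij(2)]] by (simp add: integral_def)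
      have colP: "col P j = \<rho> (\<eta> j) *\<^sub>v W"
        using ij Rc W P by (intro eq_vecI)
          (auto simp: P_def WU[OF Rc] Wi simp del: index_mult_mat_vec)
      have "map_vec \<gamma> (col P j) = map_mat \<gamma> (\<rho> (\<eta> j)) *\<^sub>v (C *\<^sub>v W')"
        unfolding colP CW' by (rule \<gamma>.mult_mat_vec_hom[OF Rc W(1)])
      also have "\<dots> = (map_mat \<gamma> (\<rho> (\<eta> j)) * C) *\<^sub>v W'" using Rc C W' by simp
      also have "\<dots> = (C * \<rho> (\<eta> j)) *\<^sub>v (c \<cdot>\<^sub>v W)"
        using intertwinersD(5)[OF S g \<eta>(1)[OF ij(2)]] W'W by simp
      also have "\<dots> = c \<cdot>\<^sub>v (C *\<^sub>v col P j)"
        unfolding colP using Rc C W by (simp add: mult_mat_vec[of _ n n])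
      finally have "map_vec \<gamma> (col P j) $ i = (c \<cdot>\<^sub>v (C *\<^sub>v col P j)) $ i" by simp
      then show "map_mat \<gamma> P $$ (i, j) = (c \<cdot>\<^sub>m (C * P)) $$ (i, j)" using ij C P by simp
    qed (use C P in auto)
    ultimately show ?thesis by blast
  qed
  ultimately show ?thesis using P by blast
qed

end

section \<open>Symplectic bases over a subfield\<close>

text \<open>The terms at (i, j) and (j, i) cancel. The diagonal is a separate assumption because
  antisymmetry does not make it vanish in characteristic 2.\<close>

lemma sum_alternating:
  fixes a :: "nat \<Rightarrow> nat \<Rightarrow> 'a::ab_group_add"
  assumes "\<And>i. i < n \<Longrightarrow> a i i = 0" "\<And>i j. i < n \<Longrightarrow> j < n \<Longrightarrow> a j i = - a i j"
  shows "(\<Sum>i<n. \<Sum>j<n. a i j) = 0"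
  using assms
proof (induction n)
  case 0
  show ?case by simp
next
  case (Suc n)
  have "(\<Sum>i<Suc n. \<Sum>j<Suc n. a i j)
      = (\<Sum>i<n. \<Sum>j<n. a i j) + ((\<Sum>i<n. a i n) + (\<Sum>j<n. a n j)) + a n n"
    by (simp add: sum.distrib algebra_simps)
  also have "(\<Sum>j<n. a n j) = - (\<Sum>i<n. a i n)"
    unfolding sum_negf[symmetric] by (rule sum.cong[OF refl], rule Suc.prems(2)) auto
  also have "(\<Sum>i<n. \<Sum>j<n. a i j) = 0"
  proof (rule Suc.IH)
    show "a i i = 0" if "i < n" for i using that by (intro Suc.prems(1)) simp
    show "a j i = - a i j" if "i < n" "j < n" for i j using that by (intro Suc.prems(2)) simp_all
  qed
  also have "a n n = 0" by (rule Suc.prems(1)) simp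
  finally show ?case by simp
qed

locale alternating_form =
  fixes n :: nat and J :: "nat \<Rightarrow> nat \<Rightarrow> 'l::field" and F :: "'l set"
  assumes F: "subfield_set F" and J_F: "\<And>i j. i < n \<Longrightarrow> j < n \<Longrightarrow> J i j \<in> F"
    and J_alt: "\<And>i. i < n \<Longrightarrow> J i i = 0" "\<And>i j. i < n \<Longrightarrow> j < n \<Longrightarrow> J j i = - J i j"
    and J_nondeg: "\<And>x. (\<And>j. j < n \<Longrightarrow> (\<Sum>i<n. x i * J i j) = 0) \<Longrightarrow> \<forall>i<n. x i = 0"
begin

definition b :: "(nat \<Rightarrow> 'l) \<Rightarrow> (nat \<Rightarrow> 'l) \<Rightarrow> 'l" where
  "b x y = (\<Sum>i<n. \<Sum>j<n. x i * J i j * y j)"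

lemma b_same: "b x x = 0"
  unfolding b_def
proof (rule sum_alternating)
  show "x i * J i i * x i = 0" if "i < n" for i using J_alt(1)[OF that] by simp
  show "x j * J j i * x i = - (x i * J i j * x j)" if "i < n" "j < n" for i j
    unfolding J_alt(2)[OF that] by simp
qed

lemma b_commute: "b y x = - b x y"
proof -
  have "b y x = (\<Sum>j<n. \<Sum>i<n. y i * J i j * x j)" unfolding b_def by (rule sum.swap)
  also have "\<dots> = (\<Sum>j<n. \<Sum>i<n. - (x j * J j i * y i))"
  proof (intro sum.cong refl)
    fix i j assume "j \<in> {..<n}" "i \<in> {..<n}"
    then have "J i j = - J j i" by (intro J_alt(2)) auto
    then show "y i * J i j * x j = - (x j * J j i * y i)" by simp
  qed
  also have "\<dots> = - b x y" by (simp add: b_def sum_negf)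
  finally show ?thesis .
qed

lemma b_comb: "b (\<lambda>i. x i - (\<Sum>a<k. c a * e a i) + (\<Sum>a<k. d a * f a i)) y
    = b x y - (\<Sum>a<k. c a * b (e a) y) + (\<Sum>a<k. d a * b (f a) y)" for k :: nat
proof -
  have s: "(\<Sum>a<k. c a * b (e a) y) = (\<Sum>i<n. \<Sum>j<n. (\<Sum>a<k. c a * e a i) * J i j * y j)" for c e
  proof -
    have "(\<Sum>a<k. c a * b (e a) y) = (\<Sum>a<k. \<Sum>i<n. \<Sum>j<n. c a * e a i * J i j * y j)"
      by (simp add: b_def sum_distrib_left mult.assoc)
    also have "\<dots> = (\<Sum>i<n. \<Sum>a<k. \<Sum>j<n. c a * e a i * J i j * y j)" by (rule sum.swap)
    also have "\<dots> = (\<Sum>i<n. \<Sum>j<n. \<Sum>a<k. c a * e a i * J i j * y j)"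
      by (intro sum.cong[OF refl] sum.swap)
    finally show ?thesis by (simp add: sum_distrib_right)
  qed
  show ?thesis unfolding s unfolding b_def
    by (simp add: sum.distrib[symmetric] sum_subtractf[symmetric] algebra_simps)
qed

lemma b_scale: "b x (\<lambda>i. c * y i) = c * b x y"
  by (simp add: b_def sum_distrib_left mult_ac)

lemma b_unit: "s < n \<Longrightarrow> b x (\<lambda>i. if i = s then 1 else 0) = (\<Sum>i<n. x i * J i s)"
  by (simp add: b_def if_distrib cong: if_cong)

definition rational :: "(nat \<Rightarrow> 'l) \<Rightarrow> bool" where "rational x \<longleftrightarrow> (\<forall>i<n. x i \<in> F)"

lemma b_rational: "rational x \<Longrightarrow> rational y \<Longrightarrow> b x y \<in> F"
  unfolding b_def rational_def using J_F
  by (intro subfield_set_sum[OF F] subfield_setD(4)[OF F]) auto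

definition hyperbolic :: "nat \<Rightarrow> (nat \<Rightarrow> nat \<Rightarrow> 'l) \<Rightarrow> (nat \<Rightarrow> nat \<Rightarrow> 'l) \<Rightarrow> bool" where
  "hyperbolic k e f \<longleftrightarrow> (\<forall>a<k. rational (e a) \<and> rational (f a) \<and>
     (\<forall>c<k. b (e a) (e c) = 0 \<and> b (f a) (f c) = 0 \<and> b (e a) (f c) = (if a = c then 1 else 0)))"

text \<open>Orthogonal projection away from the k hyperbolic planes. The signs differ because e a
  pairs with f a to 1, but f a with e a to -1.\<close>

definition project where
  "project k e f x = (\<lambda>i. x i - (\<Sum>a<k. b x (f a) * e a i) + (\<Sum>a<k. b x (e a) * f a i))"

lemma project_rational: "hyperbolic k e f \<Longrightarrow> rational x \<Longrightarrow> rational (project k e f x)"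
  using b_rational unfolding rational_def project_def hyperbolic_def
  by (auto intro!: subfield_setD(3,7)[OF F] subfield_set_sum[OF F] subfield_setD(4)[OF F])

lemma project_orthogonal:
  assumes h: "hyperbolic k e f" and c: "c < k"
  shows "b (project k e f x) (e c) = 0" "b (project k e f x) (f c) = 0"
proof -
  have fe: "b (f a) (e c) = (if a = c then - 1 else 0)" if "a < k" for a
    using h c that b_commute[of "f a" "e c"] by (auto simp: hyperbolic_def)
  have "b (project k e f x) (e c) = b x (e c) - (\<Sum>a<k. b x (f a) * b (e a) (e c)) + (\<Sum>a<k. b x (e a) * b (f a) (e c))"
    unfolding project_def by (rule b_comb)
  also have "(\<Sum>a<k. b x (f a) * b (e a) (e c)) = 0" using h c by (intro sum.neutral) (auto simp: hyperbolic_def)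
  also have "(\<Sum>a<k. b x (e a) * b (f a) (e c)) = (\<Sum>a<k. if a = c then - b x (e a) else 0)"
    using fe by (intro sum.cong) auto
  finally show "b (project k e f x) (e c) = 0" using c by simp
  have "b (project k e f x) (f c) = b x (f c) - (\<Sum>a<k. b x (f a) * b (e a) (f c)) + (\<Sum>a<k. b x (e a) * b (f a) (f c))"
    unfolding project_def by (rule b_comb)
  also have "(\<Sum>a<k. b x (e a) * b (f a) (f c)) = 0" using h c by (intro sum.neutral) (auto simp: hyperbolic_def)
  also have "(\<Sum>a<k. b x (f a) * b (e a) (f c)) = (\<Sum>a<k. if a = c then b x (f a) else 0)"
    using h c by (intro sum.cong) (auto simp: hyperbolic_def)
  finally show "b (project k e f x) (f c) = 0" using c by simp
qed

text \<open>Symplectic Gram-Schmidt over \<open>F\<close>. As 2 k < n, some unit vector has a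
  nonzero projection x; by nondegeneracy some unit vector pairs nontrivially with x, and its
  rescaled projection is the partner y. Unit vectors keep everything rational.\<close>

lemma hyperbolic_extend:
  assumes h: "hyperbolic k e f" and k: "2 * k < n"
  obtains x y where "hyperbolic (Suc k) (e(k := x)) (f(k := y))"
proof -
  define u :: "nat \<Rightarrow> nat \<Rightarrow> 'l" where "u t i = (if i = t then 1 else 0)" for t i
  have u: "rational (u t)" for t using subfield_setD(1,2)[OF F] by (simp add: rational_def u_def)
  have "\<exists>t<n. \<exists>i<n. project k e f (u t) i \<noteq> 0"
  proof (rule ccontr)
    assume "\<not> ?thesis"
    then have z: "project k e f (u t) i = 0" if "t < n" "i < n" for t i using that by blast
    \<comment> \<open>If every unit vector projected to 0, the 2 k vectors found so far would span;
      a functional killing all of them would then be 0.\<close>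
    obtain g where g: "\<exists>i\<in>{..<n}. g i \<noteq> (0::'l)"
        "\<forall>j<2 * k. (\<Sum>i<n. g i * (if j < k then e j i else f (j - k) i)) = 0"
      using exists_annihilator[of "{..<n}" "2 * k" "\<lambda>j i. if j < k then e j i else f (j - k) i"] k by auto
    have ge: "(\<Sum>i<n. g i * e a i) = 0" if "a < k" for a using g(2)[rule_format, of a] that by simp
    have gf: "(\<Sum>i<n. g i * f a i) = 0" if "a < k" for a using g(2)[rule_format, of "a + k"] that by simp
    have "g t = 0" if t: "t < n" for t
    proof -
      have ut: "u t i = (\<Sum>a<k. b (u t) (f a) * e a i) - (\<Sum>a<k. b (u t) (e a) * f a i)" if "i < n" for i
        using z[OF t that] by (simp add: project_def algebra_simps)
      have "g t = (\<Sum>i<n. g i * u t i)" using t by (simp add: u_def if_distrib cong: if_cong)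
      also have "\<dots> = (\<Sum>i<n. \<Sum>a<k. b (u t) (f a) * (g i * e a i)) - (\<Sum>i<n. \<Sum>a<k. b (u t) (e a) * (g i * f a i))"
        using ut by (simp add: right_diff_distrib sum_subtractf sum_distrib_left mult_ac)
      also have "\<dots> = (\<Sum>a<k. b (u t) (f a) * (\<Sum>i<n. g i * e a i)) - (\<Sum>a<k. b (u t) (e a) * (\<Sum>i<n. g i * f a i))"
        unfolding sum_distrib_left by (intro arg_cong2[of _ _ _ _ "(-)"] sum.swap)
      also have "\<dots> = 0" using ge gf by simp
      finally show ?thesis .
    qed
    then show False using g(1) by auto
  qed
  then obtain t i where t: "t < n" "i < n" "project k e f (u t) i \<noteq> 0" by blast
  define x where "x = project k e f (u t)"
  have x: "rational x" "\<And>c. c < k \<Longrightarrow> b x (e c) = 0" "\<And>c. c < k \<Longrightarrow> b x (f c) = 0"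
    using project_rational[OF h u] project_orthogonal[OF h] by (auto simp: x_def)
  have xe: "b (e c) x = 0" "b (f c) x = 0" if "c < k" for c
    using x that b_commute[of "e c" x] b_commute[of "f c" x] by simp_all
  obtain s where s: "s < n" "(\<Sum>i<n. x i * J i s) \<noteq> 0"
  proof -
    have "\<not> (\<forall>i<n. x i = 0)" using t by (auto simp: x_def)
    then show thesis using J_nondeg[of x] that by blast
  qed
  then have bs: "b x (u s) \<noteq> 0" using b_unit[of s x] by (simp add: u_def[abs_def])
  define y0 where "y0 = project k e f (u s)"
  have y0: "rational y0" "\<And>c. c < k \<Longrightarrow> b y0 (e c) = 0" "\<And>c. c < k \<Longrightarrow> b y0 (f c) = 0"
    using project_rational[OF h u] project_orthogonal[OF h] by (auto simp: y0_def)
  \<comment> \<open>x is orthogonal to the planes already split off, so projecting u s does not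
    change its pairing with x.\<close>
  have "b y0 x = b (u s) x - (\<Sum>a<k. b (u s) (f a) * b (e a) x) + (\<Sum>a<k. b (u s) (e a) * b (f a) x)"
    unfolding y0_def project_def by (rule b_comb)
  also have "\<dots> = b (u s) x" using xe by simp
  finally have bxy: "b x y0 = b x (u s)" by (simp only: b_commute[of y0 x] b_commute[of "u s" x] neg_equal_iff_equal)
  define y where "y = (\<lambda>i. inverse (b x y0) * y0 i)"
  have xy: "b x y = 1" using bs bxy by (simp add: y_def b_scale)
  have yr: "rational y"
    using y0(1) b_rational[OF x(1) y0(1)] unfolding rational_def y_def
    by (auto intro!: subfield_setD(4,6)[OF F])
  have ye: "b (e c) y = 0" "b (f c) y = 0" if "c < k" for c
    using y0 that b_commute[of "e c" y0] b_commute[of "f c" y0] by (simp_all add: y_def b_scale)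
  have yf: "b y (f c) = 0" if "c < k" for c
    using ye(2)[OF that] b_commute[of y "f c"] by simp
  have "hyperbolic (Suc k) (e(k := x)) (f(k := y))"
    unfolding hyperbolic_def
  proof (intro allI impI conjI)
    fix a assume a: "a < Suc k"
    then have a': "a < k" if "a \<noteq> k" using that by simp
    show "rational ((e(k := x)) a)" "rational ((f(k := y)) a)"
      using a' h x(1) yr by (auto simp: hyperbolic_def)
    fix c assume c: "c < Suc k"
    then have c': "c < k" if "c \<noteq> k" using that by simp
    have hh: "b (e a) (e c) = 0" "b (f a) (f c) = 0" "b (e a) (f c) = (if a = c then 1 else 0)"
      if "a \<noteq> k" "c \<noteq> k"
      using h a'[OF that(1)] c'[OF that(2)] by (auto simp: hyperbolic_def)
    show "b ((e(k := x)) a) ((e(k := x)) c) = 0"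
      using a' c' hh(1) x(2) xe(1) b_same by auto
    show "b ((f(k := y)) a) ((f(k := y)) c) = 0"
      using a' c' hh(2) yf ye(2) b_same by auto
    show "b ((e(k := x)) a) ((f(k := y)) c) = (if a = c then 1 else 0)"
      using a' c' hh(3) x(3) ye(1) xy by auto
  qed
  then show thesis by (rule that)
qed

lemma hyperbolic_exists: "2 * k \<le> n \<Longrightarrow> \<exists>e f. hyperbolic k e f"
proof (induction k)
  case 0
  show ?case by (intro exI) (simp add: hyperbolic_def)
next
  case (Suc k)
  then have k: "2 * k < n" by simp
  then obtain e f where "hyperbolic k e f" using Suc.IH by auto
  from hyperbolic_extend[OF this k] show ?case by blast
qed

end

section \<open>Reduction of a form to the standard symplectic matrix\<close>

lemma symp_mat_index:
  assumes "i < 2 * m" "j < 2 * m"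
  shows "symp_mat (2 * m) $$ (i, j) =
    (if i < m \<and> j = i + m then 1 else if j < m \<and> i = j + m then - 1 else (0::'a::field))"
  using assms by (auto simp: symp_mat_def Let_def)

lemma symp_mat_carrier: "even n \<Longrightarrow> (symp_mat n :: 'a::field mat) \<in> carrier_mat n n"
proof -
  assume "even n"
  then obtain m where "n = 2 * m" by (rule evenE)
  then have m: "n div 2 = m" "n = m + m" by simp_all
  have "four_block_mat (0\<^sub>m m m) (1\<^sub>m m) (- 1\<^sub>m m) (0\<^sub>m m m :: 'a mat) \<in> carrier_mat (m + m) (m + m)"
    by (rule four_block_carrier_mat) auto
  then show "(symp_mat n :: 'a mat) \<in> carrier_mat n n" unfolding symp_mat_def Let_def m(1) by (subst (1 2) m(2))
qed

text \<open>A hyperbolic basis is found without leaving the field of definition of the form. Listing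
  all e before all f gives the block shape of \<open>symp_mat\<close>.\<close>

lemma symplectic_basis:
  fixes J :: "'l::field mat"
  assumes F: "subfield_set F" and J: "J \<in> carrier_mat n n" "elements_mat J \<subseteq> F" "det J \<noteq> 0"
    and alt: "\<And>i. i < n \<Longrightarrow> J $$ (i, i) = 0" "\<And>i j. i < n \<Longrightarrow> j < n \<Longrightarrow> J $$ (j, i) = - J $$ (i, j)"
    and n: "even n"
  obtains Q where "Q \<in> carrier_mat n n" "elements_mat Q \<subseteq> F" "transpose_mat Q * J * Q = symp_mat n"
proof -
  interpret alternating_form n "\<lambda>i j. J $$ (i, j)" F
  proof
    show "J $$ (i, j) \<in> F" if "i < n" "j < n" for i j
      using that J(2) elements_mat_subset_iff[OF J(1), of F] by simp
    fix x assume x: "\<And>j. j < n \<Longrightarrow> (\<Sum>i<n. x i * J $$ (i, j)) = 0"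
    have "transpose_mat J *\<^sub>v vec n x = 0\<^sub>v n"
      using J x by (intro eq_vecI)
        (auto simp: index_mult_mat_vec_sum[of _ n n] mult.commute simp del: index_mult_mat_vec)
    moreover have "det (transpose_mat J) \<noteq> 0" using J by (simp add: det_transpose)
    ultimately have "vec n x = 0\<^sub>v n"
      using det_0_iff_vec_prod_zero_field[of "transpose_mat J" n] J(1) by (metis transpose_carrier_mat vec_carrier)
    then show "\<forall>i<n. x i = 0" by (metis index_vec index_zero_vec(1))
  qed (fact F alt)+
  obtain m where m: "n = 2 * m" using n by blast
  obtain e f where h: "hyperbolic m e f" using hyperbolic_exists[of m] m by auto
  define g where "g j = (if j < m then e j else f (j - m))" for j
  define Q where "Q = mat n n (\<lambda>(i, j). g j i)"
  have Q: "Q \<in> carrier_mat n n" by (simp add: Q_def)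
  have hr: "rational (e a)" "rational (f a)" if "a < m" for a using h that by (auto simp: hyperbolic_def)
  have bef: "b (e a) (e c) = 0" "b (f a) (f c) = 0" "b (e a) (f c) = (if a = c then 1 else 0)"
      "b (f a) (e c) = (if a = c then - 1 else 0)" if "a < m" "c < m" for a c
    using h that b_commute[of "f a" "e c"] by (auto simp: hyperbolic_def)
  have jm: "j - m < m" if "j < n" "\<not> j < m" for j using that m by simp
  have "g j i \<in> F" if "i < n" "j < n" for i j
    using hr jm that by (auto simp: rational_def g_def)
  then have "elements_mat Q \<subseteq> F" using elements_mat_subset_iff[OF Q] by (simp add: Q_def)
  moreover have "transpose_mat Q * J * Q = symp_mat n"
  proof (rule eq_matI)
    fix i j assume "i < dim_row (symp_mat n :: 'l mat)" "j < dim_col (symp_mat n :: 'l mat)"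
    then have ij: "i < n" "j < n" using symp_mat_carrier[OF n, where 'a='l] by auto
    have QJ: "transpose_mat Q * J \<in> carrier_mat n n" using Q J by simp
    have "(transpose_mat Q * J * Q) $$ (i, j) = (\<Sum>l<n. \<Sum>k<n. g i k * J $$ (k, l) * g j l)"
      unfolding index_mult_mat_sum[OF QJ Q ij] using ij Q J
      by (intro sum.cong refl) (auto simp: index_mult_mat_sum[of _ n n] Q_def sum_distrib_right simp del: index_mult_mat(1))
    also have "\<dots> = b (g i) (g j)" unfolding b_def by (rule sum.swap)
    also have "\<dots> = symp_mat n $$ (i, j)"
      unfolding symp_mat_index[of i m j, folded m, OF ij] g_def using bef jm[OF ij(1)] jm[OF ij(2)] by auto
    finally show "(transpose_mat Q * J * Q) $$ (i, j) = symp_mat n $$ (i, j)" .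
  qed (use Q J symp_mat_carrier[OF n, where 'a='l] in auto)
  ultimately show thesis using that Q by blast
qed

section \<open>Polynomials over a subfield\<close>

text \<open>Passage between the record-based notion of the statement and the elementwise closure
  conditions of the proofs.\<close>

lemma subfield_iff: "subfield F (class_ring :: 'l::field ring) \<longleftrightarrow> subfield_set F"
proof
  let ?R = "class_ring :: 'l ring"
  assume "subfield F ?R"
  then interpret subfield F ?R .
  have sub: "subring F ?R" by (rule subring_axioms)
  note e = subringE[OF sub]
  have inv: "inverse x \<in> F" if x: "x \<in> F" for x
  proof (cases "x = 0")
    case False
    then have "x \<in> Units (?R\<lparr>carrier := F\<rparr>)" using subfield_Units x by simp
    then obtain y where "y \<in> F" "x * y = 1" by (auto simp: Units_def)
    then show ?thesis using inverse_unique by metis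
  qed (use x in simp)
  show "subfield_set F"
    unfolding subfield_set_def using e(2,3,5,6,7) inv by (auto simp: class_ring_simps)
next
  let ?R = "class_ring :: 'l ring"
  assume F: "subfield_set F"
  have R: "ring ?R" "cring ?R" by unfold_locales
  have "subring F ?R"
    using subfield_setD[OF F] by (intro ring.subringI[OF R(1)]) (auto simp: class_ring_simps)
  then have "subcring F ?R" by (rule cring.subcringI'[OF R(2)])
  moreover have "Units (?R\<lparr>carrier := F\<rparr>) = F - {0}"
  proof (intro equalityI subsetI)
    fix x assume "x \<in> F - {0}"
    then show "x \<in> Units (?R\<lparr>carrier := F\<rparr>)"
      using subfield_setD(6)[OF F, of x] by (auto simp: Units_def intro!: bexI[of _ "inverse x"])
  qed (auto simp: Units_def)
  ultimately show "subfield F ?R" by (intro ring.subfieldI[OF R(1)]) auto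
qed

lemma poly_over_iff: "0 \<in> E \<Longrightarrow> p \<in> poly_over E \<longleftrightarrow> (\<forall>i. coeff p i \<in> E)"
proof
  assume "0 \<in> E" and p: "p \<in> poly_over E"
  show "\<forall>i. coeff p i \<in> E"
  proof
    fix i show "coeff p i \<in> E"
      using p \<open>0 \<in> E\<close> coeff_in_coeffs[of p i] coeff_eq_0[of p i]
      by (cases "p = 0"; cases "i \<le> degree p") (auto simp: poly_over_def not_le)
  qed
qed (auto simp: poly_over_def coeffs_def)

context
  fixes E :: "'l::field set"
  assumes E: "subfield_set E"
begin

lemma poly_over_coeff: "p \<in> poly_over E \<longleftrightarrow> (\<forall>i. coeff p i \<in> E)"
  by (rule poly_over_iff) (rule subfield_setD[OF E])

lemma poly_over_add: "p \<in> poly_over E \<Longrightarrow> q \<in> poly_over E \<Longrightarrow> p + q \<in> poly_over E"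
  and poly_over_diff: "p \<in> poly_over E \<Longrightarrow> q \<in> poly_over E \<Longrightarrow> p - q \<in> poly_over E"
  and poly_over_mult: "p \<in> poly_over E \<Longrightarrow> q \<in> poly_over E \<Longrightarrow> p * q \<in> poly_over E"
  and poly_over_smult: "c \<in> E \<Longrightarrow> p \<in> poly_over E \<Longrightarrow> smult c p \<in> poly_over E"
  and poly_over_monom: "c \<in> E \<Longrightarrow> monom c k \<in> poly_over E"
  and poly_over_const: "c \<in> E \<Longrightarrow> [:c:] \<in> poly_over E"
  and poly_over_linear: "c \<in> E \<Longrightarrow> [:c, 1:] \<in> poly_over E"
  unfolding poly_over_coeff
  using subfield_setD[OF E]
  by (auto simp: coeff_mult coeff_pCons split: nat.split intro!: subfield_set_sum[OF E])

text \<open>Long division by a monic polynomial never divides by a coefficient, and each leading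
  term is cancelled by a monomial over \<open>E\<close>.\<close>

lemma poly_over_division:
  assumes g: "g \<in> poly_over E" "lead_coeff g = 1" and p: "p \<in> poly_over E"
  shows "\<exists>q\<in>poly_over E. \<exists>r\<in>poly_over E. p = g * q + r \<and> (r = 0 \<or> degree r < degree g)"
  using p
proof (induction "degree p" arbitrary: p rule: less_induct)
  case less
  show ?case
  proof (cases "p = 0 \<or> degree p < degree g")
    case True
    then show ?thesis
      using less.prems subfield_setD(1)[OF E]
      by (intro bexI[of _ 0] bexI[of _ p]) (auto simp: poly_over_coeff)
  next
    case False
    define t where "t = monom (lead_coeff p) (degree p - degree g)"
    have t: "t \<in> poly_over E" 
      unfolding t_def by (rule poly_over_monom) (use less.prems in \<open>simp add: poly_over_coeff\<close>)
    define p' where "p' = p - g * t"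
    have p': "p' \<in> poly_over E" using less.prems t g by (simp add: p'_def poly_over_diff poly_over_mult)
    have g0: "g \<noteq> 0" using g by auto
    have t0: "t \<noteq> 0" using False by (simp add: t_def)
    have dgt: "degree (g * t) = degree p"
      using False g0 t0 by (simp add: degree_mult_eq t_def degree_monom_eq)
    have "lead_coeff (g * t) = lead_coeff p"
      unfolding lead_coeff_mult g(2) using False by (simp add: t_def degree_monom_eq)
    then have "coeff (g * t) (degree p) = lead_coeff p" unfolding dgt .
    then have c0: "coeff p' (degree p) = 0" by (simp add: p'_def)
    have dle: "degree p' \<le> degree p" unfolding p'_def by (rule degree_diff_le) (auto simp: dgt)
    have "\<exists>q\<in>poly_over E. \<exists>r\<in>poly_over E. p' = g * q + r \<and> (r = 0 \<or> degree r < degree g)"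
    proof (cases "p' = 0")
      case True
      then show ?thesis using subfield_setD(1)[OF E]
        by (intro bexI[of _ 0]) (auto simp: poly_over_coeff)
    next
      case False
      then have "degree p' \<noteq> degree p" using c0 leading_coeff_0_iff[of p'] by metis
      then show ?thesis using less.hyps[of p'] dle p' by simp
    qed
    then obtain q r where qr: "q \<in> poly_over E" "r \<in> poly_over E" "p' = g * q + r" "r = 0 \<or> degree r < degree g"
      by blast
    then have "p = g * (q + t) + r" by (simp add: p'_def algebra_simps)
    then show ?thesis using qr poly_over_add[OF qr(1) t] by blast
  qed
qed

lemma minimal_polynomial:
  assumes "\<exists>p\<in>poly_over E. p \<noteq> 0 \<and> poly p z = 0"
  obtains g where "g \<in> poly_over E" "lead_coeff g = 1" "poly g z = 0" "degree g > 0"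
    "\<And>p. p \<in> poly_over E \<Longrightarrow> poly p z = 0 \<Longrightarrow> \<exists>q\<in>poly_over E. p = g * q"
proof -
  define A where "A d \<longleftrightarrow> (\<exists>p\<in>poly_over E. p \<noteq> 0 \<and> poly p z = 0 \<and> degree p = d)" for d
  define d where "d = (LEAST d. A d)"
  have "\<exists>d. A d" using assms unfolding A_def by blast
  then have "A d" and min: "\<And>d'. d' < d \<Longrightarrow> \<not> A d'"
    unfolding d_def by (auto intro: LeastI_ex dest: not_less_Least)
  then obtain p where p: "p \<in> poly_over E" "p \<noteq> 0" "poly p z = 0" "degree p = d" by (auto simp: A_def)
  define g where "g = smult (inverse (lead_coeff p)) p"
  have g: "g \<in> poly_over E"
    using p(1) unfolding g_def by (intro poly_over_smult subfield_setD(6)[OF E]) (auto simp: poly_over_coeff)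
  have g1: "lead_coeff g = 1" using p(2) by (simp add: g_def)
  have gz: "poly g z = 0" using p(3) by (simp add: g_def)
  have dg: "degree g = d" unfolding p(4)[symmetric] using p(2) by (simp add: g_def)
  have "degree g > 0"
  proof (rule ccontr)
    assume "\<not> ?thesis"
    then have "g = 1" using g1 by (metis degree_0_id gr0I of_nat_0 one_pCons)
    then show False using gz by simp
  qed
  moreover have "\<exists>q\<in>poly_over E. f = g * q" if f: "f \<in> poly_over E" "poly f z = 0" for f
  proof -
    obtain q r where qr: "q \<in> poly_over E" "r \<in> poly_over E" "f = g * q + r" "r = 0 \<or> degree r < degree g"
      using poly_over_division[OF g g1 f(1)] by blast
    then have "poly r z = 0" using f gz by simp
    then have "r = 0" using qr min[of "degree r"] dg by (auto simp: A_def)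
    then show ?thesis using qr by auto
  qed
  ultimately show thesis using that g g1 gz by blast
qed

end

lemma poly_over_mono: "E \<subseteq> E' \<Longrightarrow> p \<in> poly_over E \<Longrightarrow> p \<in> poly_over E'"
  by (auto simp: poly_over_def)

text \<open>The minimal polynomial of x gives a relation c + x s(x) = 0 with c nonzero by
  minimality, so the inverse of x is - s(x) / c, a polynomial in x over \<open>K\<close>.\<close>

lemma subring_is_subfield:
  fixes K :: "'l::field set"
  assumes K_subfield: "subfield_set K" and alg: "\<And>z. \<exists>p\<in>poly_over K. p \<noteq> 0 \<and> poly p z = 0"
    and K: "K \<subseteq> E" and E: "\<And>x y. x \<in> E \<Longrightarrow> y \<in> E \<Longrightarrow> x + y \<in> E \<and> x * y \<in> E"
  shows "subfield_set E"
proof -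
  have 01: "0 \<in> E" "1 \<in> E" "- 1 \<in> E" using K subfield_setD(1,2,5)[OF K_subfield] by auto
  have neg: "- x \<in> E" if "x \<in> E" for x using E[OF 01(3) that] by simp
  have inv: "inverse x \<in> E" if x: "x \<in> E" "x \<noteq> 0" for x
  proof -
    obtain g where g: "g \<in> poly_over K" "lead_coeff g = 1" "poly g x = 0" "degree g > 0"
        and div: "\<And>p. p \<in> poly_over K \<Longrightarrow> poly p x = 0 \<Longrightarrow> \<exists>q\<in>poly_over K. p = g * q"
      using minimal_polynomial[OF K_subfield alg] by metis
    obtain c s where gs: "g = pCons c s" by (cases g)
    have cs: "c \<in> K" "s \<in> poly_over K"
      using g(1) unfolding poly_over_coeff[OF K_subfield] gs by (auto simp: coeff_pCons split: nat.splits)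
    have s: "s \<noteq> 0" "degree g = Suc (degree s)" using g(4) by (auto simp: gs split: if_splits)
    have c0: "c \<noteq> 0"
    proof
      assume "c = 0"
      then have "poly s x = 0" using g(3) x by (simp add: gs)
      then obtain q where "s = g * q" using div cs by blast
      then have "degree s \<ge> degree g" using s(1) by (simp add: degree_mult_eq)
      then show False using s by simp
    qed
    have "x * (- poly s x / c) = 1" using g(3) c0 by (simp add: gs add_eq_0_iff)
    then have "inverse x = - poly s x / c" by (rule inverse_unique)
    also have "\<dots> = (- 1) * (poly s x * inverse c)" by (simp add: field_simps)
    also have "\<dots> \<in> E"
    proof -
      have xk: "x ^ k \<in> E" for k using x 01 E by (induction k) auto
      have sm: "sum f I \<in> E" if "\<And>i. i \<in> I \<Longrightarrow> f i \<in> E" for f and I :: "nat set"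
        using that 01 E by (induction I rule: infinite_finite_induct) auto
      have cf: "coeff s i \<in> E" for i using cs K poly_over_coeff[OF K_subfield] by blast
      have "poly s x \<in> E" unfolding poly_altdef by (rule sm) (use E[OF cf xk] in blast)
      moreover have "inverse c \<in> E" using subfield_setD(6)[OF K_subfield cs(1)] K by blast
      ultimately show ?thesis using E 01 by blast
    qed
    finally show ?thesis .
  qed
  show ?thesis unfolding subfield_set_def using 01 E neg inv
    by (metis inverse_zero)
qed

section \<open>Automorphisms of infinite Galois extensions\<close>

lemma Gal_iff: "\<gamma> \<in> Gal K \<longleftrightarrow> bij \<gamma> \<and> (\<forall>x y. \<gamma> (x + y) = \<gamma> x + \<gamma> y) \<and>
    (\<forall>x y. \<gamma> (x * y) = \<gamma> x * \<gamma> y) \<and> \<gamma> 1 = 1 \<and> (\<forall>x\<in>K. \<gamma> x = x)"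
  unfolding Gal_def ring_iso_def Ring.ring_hom_def by auto

lemma field_hom_inj:
  fixes \<gamma> :: "'l::field \<Rightarrow> 'l"
  assumes "\<And>x y. \<gamma> (x + y) = \<gamma> x + \<gamma> y" "\<And>x y. \<gamma> (x * y) = \<gamma> x * \<gamma> y" "\<gamma> 1 = 1"
  shows "inj \<gamma>"
proof (rule injI)
  fix a b assume ab: "\<gamma> a = \<gamma> b"
  have 0: "\<gamma> 0 = 0" using assms(1)[of 0 0] by (metis add_cancel_right_right add_0)
  have "\<gamma> (a - b) = 0" using assms(1)[of "a - b" b] ab by simp
  then have "\<gamma> ((a - b) * inverse (a - b)) = 0" by (simp add: assms(2))
  then show "a = b" using assms(3) by (cases "a = b") auto
qed

text \<open>Homomorphisms are represented by their graphs, so that Zorn's lemma applies to inclusion.\<close>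
definition partial_hom :: "'l::field set \<Rightarrow> ('l \<times> 'l) set \<Rightarrow> bool" where
  "partial_hom F r \<longleftrightarrow> Id_on F \<subseteq> r \<and> single_valued r \<and>
     (\<forall>a a' b b'. (a, a') \<in> r \<longrightarrow> (b, b') \<in> r \<longrightarrow> (a + b, a' + b') \<in> r \<and> (a * b, a' * b') \<in> r)"

context
  fixes K :: "'l::field set"
  assumes galois: "galois_extension K"
begin

lemma K_subfield: "subfield_set K"
  using galois by (simp add: galois_extension_def subfield_iff)

lemma algebraic_over: "K \<subseteq> E \<Longrightarrow> \<exists>p\<in>poly_over E. p \<noteq> 0 \<and> poly p z = 0"
  using galois poly_over_mono unfolding galois_extension_def by blast

context
  fixes F :: "'l set" and r :: "('l \<times> 'l) set"
  assumes KF: "K \<subseteq> F" and r: "partial_hom F r"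
begin

definition hom_of :: "'l \<Rightarrow> 'l" where "hom_of a = (THE b. (a, b) \<in> r)"

lemma hom_of_eq: "(a, b) \<in> r \<Longrightarrow> hom_of a = b"
  using r unfolding partial_hom_def hom_of_def single_valued_def by blast

lemma hom_of_mem: "a \<in> Domain r \<Longrightarrow> (a, hom_of a) \<in> r"
  using hom_of_eq by blast

lemma Domain_subfield: "F \<subseteq> Domain r" "subfield_set (Domain r)"
proof -
  show F: "F \<subseteq> Domain r" using r by (auto simp: partial_hom_def)
  show "subfield_set (Domain r)"
  proof (rule subring_is_subfield[OF K_subfield algebraic_over[OF order_refl]])
    fix x y assume "x \<in> Domain r" "y \<in> Domain r"
    then obtain x' y' where "(x, x') \<in> r" "(y, y') \<in> r" by blast
    then have "(x + y, x' + y') \<in> r" "(x * y, x' * y') \<in> r" using r by (auto simp: partial_hom_def)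
    then show "x + y \<in> Domain r \<and> x * y \<in> Domain r" by blast
  qed (use F KF in blast)
qed

lemma hom_of_hom:
  assumes "a \<in> Domain r" "b \<in> Domain r"
  shows "hom_of (a + b) = hom_of a + hom_of b" "hom_of (a * b) = hom_of a * hom_of b"
proof -
  have "(a + b, hom_of a + hom_of b) \<in> r" "(a * b, hom_of a * hom_of b) \<in> r"
    using r hom_of_mem[OF assms(1)] hom_of_mem[OF assms(2)] unfolding partial_hom_def by blast+
  then show "hom_of (a + b) = hom_of a + hom_of b" "hom_of (a * b) = hom_of a * hom_of b"
    by (auto intro: hom_of_eq)
qed

lemma hom_of_fixes: "x \<in> F \<Longrightarrow> hom_of x = x"
  using r by (intro hom_of_eq) (auto simp: partial_hom_def)

lemma hom_of_0 [simp]: "hom_of 0 = 0" and hom_of_1 [simp]: "hom_of 1 = 1"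
  using hom_of_fixes subfield_setD(1,2)[OF K_subfield] KF by auto

lemma hom_of_sum: "(\<And>i. i \<in> I \<Longrightarrow> f i \<in> Domain r) \<Longrightarrow> hom_of (sum f I) = (\<Sum>i\<in>I. hom_of (f i))"
  by (induction I rule: infinite_finite_induct)
    (auto simp: hom_of_hom subfield_set_sum[OF Domain_subfield(2)])

lemma coeff_map_hom: "coeff (map_poly hom_of p) i = hom_of (coeff p i)"
  by (rule coeff_map_poly) simp

lemma map_hom_poly:
  assumes p: "p \<in> poly_over (Domain r)" and q: "q \<in> poly_over (Domain r)"
  shows "map_poly hom_of (p + q) = map_poly hom_of p + map_poly hom_of q"
    "map_poly hom_of (p * q) = map_poly hom_of p * map_poly hom_of q"
proof -
  have pq: "coeff p i \<in> Domain r" "coeff q i \<in> Domain r" for i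
    using p q poly_over_coeff[OF Domain_subfield(2)] by blast+
  show "map_poly hom_of (p + q) = map_poly hom_of p + map_poly hom_of q"
    by (rule poly_eqI) (simp add: coeff_map_hom hom_of_hom pq)
  show "map_poly hom_of (p * q) = map_poly hom_of p * map_poly hom_of q"
    by (rule poly_eqI)
      (simp add: coeff_map_hom coeff_mult hom_of_sum hom_of_hom pq subfield_setD(4)[OF Domain_subfield(2)])
qed

text \<open>The minimal polynomial f of z over \<open>K\<close> has deg f distinct roots. The
  homomorphism fixes f, so f is the product of the images of g and its cofactor q; the image of q
  accounts for at most deg q roots, and the remaining ones belong to the image of g. One root
  suffices to extend the homomorphism to z, two to move z.\<close>

lemma map_hom_roots:
  obtains g where "g \<in> poly_over (Domain r)" "lead_coeff g = 1" "poly g z = 0" "degree g > 0"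
    "\<And>p. p \<in> poly_over (Domain r) \<Longrightarrow> poly p z = 0 \<Longrightarrow> \<exists>q\<in>poly_over (Domain r). p = g * q"
    "degree g \<le> card {y. poly (map_poly hom_of g) y = 0}"
proof -
  let ?E = "Domain r"
  have KE: "K \<subseteq> ?E" using Domain_subfield(1) KF by blast
  note E = Domain_subfield(2)
  obtain g where g: "g \<in> poly_over ?E" "lead_coeff g = 1" "poly g z = 0" "degree g > 0"
      and div: "\<And>p. p \<in> poly_over ?E \<Longrightarrow> poly p z = 0 \<Longrightarrow> \<exists>q\<in>poly_over ?E. p = g * q"
    using minimal_polynomial[OF E algebraic_over[OF KE]] by metis
  obtain f where f: "f \<in> poly_over K" "lead_coeff f = 1" "poly f z = 0" "degree f > 0"
      and fdiv: "\<And>p. p \<in> poly_over K \<Longrightarrow> poly p z = 0 \<Longrightarrow> \<exists>q\<in>poly_over K. p = f * q"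
    using minimal_polynomial[OF K_subfield algebraic_over[OF order_refl]] by metis
  have "irreducible_over K f"
    unfolding irreducible_over_def
  proof (intro conjI ballI impI)
    fix p q assume pq: "p \<in> poly_over K" "q \<in> poly_over K" "f = p * q"
    then have nz: "p \<noteq> 0" "q \<noteq> 0" using f(4) by auto
    have "poly p z = 0 \<or> poly q z = 0" using f(3) pq by simp
    then show "degree p = 0 \<or> degree q = 0"
    proof
      assume "poly p z = 0"
      then obtain s where "p = f * s" using fdiv pq by blast
      then have "degree p \<ge> degree f" using nz by (simp add: degree_mult_eq)
      moreover have "degree f = degree p + degree q" using pq nz by (simp add: degree_mult_eq)
      ultimately show ?thesis by simp
    next
      assume "poly q z = 0"
      then obtain s where "q = f * s" using fdiv pq by blast
      then have "degree q \<ge> degree f" using nz by (simp add: degree_mult_eq)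
      moreover have "degree f = degree p + degree q" using pq nz by (simp add: degree_mult_eq)
      ultimately show ?thesis by simp
    qed
  qed (use f in auto)
  then obtain c A where A: "finite A" "f = Polynomial.smult c (\<Prod>a\<in>A. [:- a, 1:])"
    using galois f(3) unfolding galois_extension_def by blast
  have c: "c \<noteq> 0" using A f(4) by auto
  have cardA: "card A = degree f"
    using A c by (simp add: degree_prod_eq_sum_degree)
  have Aroots: "poly f a = 0" if "a \<in> A" for a
    using A that by (simp add: poly_prod prod_zero_iff)
  have fE: "f \<in> poly_over ?E" using f(1) KE by (rule poly_over_mono[rotated])
  obtain q where q: "q \<in> poly_over ?E" "f = g * q" using div[OF fE f(3)] by blast
  have "map_poly hom_of f = f"
    using f(1) hom_of_fixes KF
    by (intro poly_eqI) (auto simp: coeff_map_hom poly_over_coeff[OF K_subfield])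
  then have fgq: "f = map_poly hom_of g * map_poly hom_of q" using map_hom_poly(2)[OF g(1) q(1)] q by simp
  have f0: "f \<noteq> 0" using f(2) by auto
  then have nz: "map_poly hom_of g \<noteq> 0" "map_poly hom_of q \<noteq> 0" using fgq by auto
  have dg: "degree (map_poly hom_of g) = degree g"
    using g(2) by (intro antisym degree_map_poly_le le_degree) (simp_all add: coeff_map_hom)
  have "A \<subseteq> {y. poly (map_poly hom_of g) y = 0} \<union> {y. poly (map_poly hom_of q) y = 0}"
    using Aroots by (subst (asm) fgq) auto
  then have "card A \<le> card ({y. poly (map_poly hom_of g) y = 0} \<union> {y. poly (map_poly hom_of q) y = 0})"
    using poly_roots_finite nz by (intro card_mono) auto
  also have "\<dots> \<le> card {y. poly (map_poly hom_of g) y = 0} + card {y. poly (map_poly hom_of q) y = 0}"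
    by (rule card_Un_le)
  also have "\<dots> \<le> card {y. poly (map_poly hom_of g) y = 0} + degree (map_poly hom_of q)"
    using poly_roots_degree[OF nz(2)] by simp
  finally have "degree f \<le> card {y. poly (map_poly hom_of g) y = 0} + degree (map_poly hom_of q)"
    using cardA by simp
  moreover have "degree f = degree g + degree (map_poly hom_of q)"
    using fgq nz dg degree_mult_eq[OF nz] by simp
  ultimately show thesis using that g div by simp
qed

text \<open>Sending z to y forces the value at p(z). It is well defined because polynomials that
  agree at z differ by a multiple of g, and the image of g vanishes at y.\<close>

lemma partial_hom_extend:
  assumes g: "g \<in> poly_over (Domain r)" and y: "poly (map_poly hom_of g) y = 0"
    and div: "\<And>p. p \<in> poly_over (Domain r) \<Longrightarrow> poly p z = 0 \<Longrightarrow> \<exists>q\<in>poly_over (Domain r). p = g * q"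
  obtains r' where "partial_hom F r'" "r \<subseteq> r'" "(z, y) \<in> r'"
proof -
  let ?E = "Domain r"
  note E = Domain_subfield(2)
  define r' where "r' = {(poly p z, poly (map_poly hom_of p) y) | p. p \<in> poly_over ?E}"
  have mem: "(poly p z, poly (map_poly hom_of p) y) \<in> r'" if "p \<in> poly_over ?E" for p
    using that by (auto simp: r'_def)
  have map_hom_const: "map_poly hom_of [:a:] = [:hom_of a:]" for a
    by (intro poly_eqI) (simp add: coeff_map_hom coeff_pCons split: nat.split)
  have map_hom_linear: "map_poly hom_of [:0, 1:] = [:0, 1:]"
    by (intro poly_eqI) (simp add: coeff_map_hom coeff_pCons split: nat.split)
  have sub: "r \<subseteq> r'"
  proof (rule subrelI)
    fix a b assume ab: "(a, b) \<in> r"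
    then have "[:a:] \<in> poly_over ?E" by (intro poly_over_const[OF E]) auto
    from mem[OF this] show "(a, b) \<in> r'" 
      using hom_of_eq[OF ab] map_hom_const by simp
  qed
  have "[:0, 1:] \<in> poly_over ?E" by (rule poly_over_linear[OF E subfield_setD(1)[OF E]])
  from mem[OF this] have zy: "(z, y) \<in> r'" by (simp add: map_hom_linear)
  have "single_valued r'"
  proof (rule single_valuedI)
    fix a b c assume "(a, b) \<in> r'" "(a, c) \<in> r'"
    then obtain p q where pq: "p \<in> poly_over ?E" "q \<in> poly_over ?E" "a = poly p z" "a = poly q z"
        "b = poly (map_poly hom_of p) y" "c = poly (map_poly hom_of q) y"
      by (auto simp: r'_def)
    have d: "p - q \<in> poly_over ?E" by (rule poly_over_diff[OF E pq(1,2)])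
    then obtain s where s: "s \<in> poly_over ?E" "p - q = g * s" using div[OF d] pq by auto
    have "map_poly hom_of p = map_poly hom_of ((p - q) + q)" by simp
    also have "\<dots> = map_poly hom_of (p - q) + map_poly hom_of q" by (rule map_hom_poly(1)[OF d pq(2)])
    also have "map_poly hom_of (p - q) = map_poly hom_of g * map_poly hom_of s"
      unfolding s(2) by (rule map_hom_poly(2)[OF g s(1)])
    finally show "b = c" using pq y by simp
  qed
  moreover have "(a + b, a' + b') \<in> r' \<and> (a * b, a' * b') \<in> r'" if ab: "(a, a') \<in> r'" "(b, b') \<in> r'" for a a' b b'
  proof -
    obtain p q where pq: "p \<in> poly_over ?E" "q \<in> poly_over ?E" "a = poly p z" "b = poly q z"
        "a' = poly (map_poly hom_of p) y" "b' = poly (map_poly hom_of q) y"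
      using ab by (auto simp: r'_def)
    then show ?thesis
      using mem[OF poly_over_add[OF E pq(1,2)]] mem[OF poly_over_mult[OF E pq(1,2)]]
        map_hom_poly[OF pq(1,2)] by simp
  qed
  moreover have "Id_on F \<subseteq> r'" using sub r by (auto simp: partial_hom_def)
  ultimately have "partial_hom F r'" unfolding partial_hom_def by blast
  then show thesis using that sub zy by blast
qed

end

text \<open>The Galois correspondence for the fixed field, in possibly infinite degree: the minimal
  polynomial of x over \<open>F\<close> has a second root y, and the map x |-> y is extended by
  Zorn's lemma.\<close>

lemma galois_moves:
  assumes F: "subfield_set F" "K \<subseteq> F" and x: "x \<notin> F"
  obtains \<gamma> where "\<gamma> \<in> Gal F" "\<gamma> x \<noteq> x"
proof -
  have Id: "partial_hom F (Id_on F)"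
    using subfield_setD(3,4)[OF F(1)] by (auto simp: partial_hom_def single_valued_def)
  have hid: "hom_of (Id_on F) a = a" if "a \<in> F" for a by (rule hom_of_fixes[OF F(2) Id that])
  obtain g where g: "g \<in> poly_over F" "lead_coeff g = 1" "poly g x = 0" "degree g > 0"
      "\<And>p. p \<in> poly_over F \<Longrightarrow> poly p x = 0 \<Longrightarrow> \<exists>q\<in>poly_over F. p = g * q"
      "degree g \<le> card {y. poly (map_poly (hom_of (Id_on F)) g) y = 0}"
    using map_hom_roots[OF F(2) Id, of x, unfolded Domain_Id_on] by blast
  have "degree g \<noteq> 1"
  proof
    assume d: "degree g = 1"
    obtain a where a: "a = coeff g 0" by blast
    have "poly g x = a + x" using d g(2) by (simp add: poly_altdef a)
    then have "x = - a" using g(3) by (simp add: eq_neg_iff_add_eq_0 add.commute)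
    moreover have "a \<in> F" using g(1) poly_over_coeff[OF F(1)] a by blast
    ultimately show False using x subfield_setD(5)[OF F(1)] by blast
  qed
  then have "2 \<le> card {y. poly (map_poly (hom_of (Id_on F)) g) y = 0}" using g(4,6) by linarith
  moreover have "card Y \<le> 1" if "Y \<subseteq> {x}" for Y using card_mono[OF _ that] by simp
  ultimately have "\<not> {y. poly (map_poly (hom_of (Id_on F)) g) y = 0} \<subseteq> {x}"
    by (metis Suc_1 not_less_eq_eq)
  then obtain y where y: "poly (map_poly (hom_of (Id_on F)) g) y = 0" "y \<noteq> x" by blast
  obtain r0 where r0: "partial_hom F r0" "(x, y) \<in> r0"
  proof (rule partial_hom_extend[OF F(2) Id, of g y x, unfolded Domain_Id_on, OF g(1) y(1) g(5)])
    fix r' assume "partial_hom F r'" "(x, y) \<in> r'"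
    then show thesis by (rule that)
  qed
  define \<A> where "\<A> = {r. partial_hom F r \<and> r0 \<subseteq> r}"
  have "\<exists>M\<in>\<A>. \<forall>U\<in>\<A>. M \<subseteq> U \<longrightarrow> U = M"
  proof (rule subset_Zorn_nonempty)
    show "\<A> \<noteq> {}" using r0 by (auto simp: \<A>_def)
    fix \<C> assume ne: "\<C> \<noteq> {}" and ch: "subset.chain \<A> \<C>"
    have C: "partial_hom F r" "r0 \<subseteq> r" if "r \<in> \<C>" for r
      using ch that by (auto simp: subset_chain_def \<A>_def)
    have two: "\<exists>r\<in>\<C>. u \<in> r \<and> w \<in> r" if uw: "u \<in> \<Union>\<C>" "w \<in> \<Union>\<C>" for u w
    proof -
      obtain r1 r2 where "r1 \<in> \<C>" "u \<in> r1" "r2 \<in> \<C>" "w \<in> r2" using uw by blast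
      moreover have "r1 \<subseteq> r2 \<or> r2 \<subseteq> r1" using ch calculation by (auto simp: subset_chain_def)
      ultimately show ?thesis by blast
    qed
    have "Id_on F \<subseteq> \<Union>\<C>" "r0 \<subseteq> \<Union>\<C>" using ne C unfolding partial_hom_def by blast+
    moreover have "single_valued (\<Union>\<C>)"
    proof (rule single_valuedI)
      fix a b c assume "(a, b) \<in> \<Union>\<C>" "(a, c) \<in> \<Union>\<C>"
      from two[OF this] obtain r where r: "r \<in> \<C>" "(a, b) \<in> r" "(a, c) \<in> r" by blast
      have "single_valued r" using C(1)[OF r(1)] by (simp add: partial_hom_def)
      then show "b = c" using r(2,3) by (rule single_valuedD)
    qed
    moreover have "(a + b, a' + b') \<in> \<Union>\<C> \<and> (a * b, a' * b') \<in> \<Union>\<C>"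
      if ab: "(a, a') \<in> \<Union>\<C>" "(b, b') \<in> \<Union>\<C>" for a a' b b'
    proof -
      obtain r where r: "r \<in> \<C>" "(a, a') \<in> r" "(b, b') \<in> r" using two[OF ab] by blast
      then have "(a + b, a' + b') \<in> r \<and> (a * b, a' * b') \<in> r"
        using C(1)[OF r(1)] by (simp add: partial_hom_def)
      then show ?thesis using r(1) by blast
    qed
    ultimately have "partial_hom F (\<Union>\<C>)" unfolding partial_hom_def by simp
    then show "\<Union>\<C> \<in> \<A>" using \<open>r0 \<subseteq> \<Union>\<C>\<close> by (simp add: \<A>_def)
  qed
  then obtain M where M0: "M \<in> \<A>" "\<forall>U\<in>\<A>. M \<subseteq> U \<longrightarrow> U = M" by blast
  then have M: "partial_hom F M" "r0 \<subseteq> M" by (simp_all add: \<A>_def)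
  have max: "U = M" if "partial_hom F U" "M \<subseteq> U" for U
  proof -
    have "U \<in> \<A>" using that M(2) by (simp add: \<A>_def)
    then show ?thesis using M0(2) that(2) by blast
  qed
  \<comment> \<open>A maximal homomorphism is total: at any further z there is a root by which it
    could be extended.\<close>
  have dom: "z \<in> Domain M" for z
  proof -
    obtain g where g: "g \<in> poly_over (Domain M)" "lead_coeff g = 1" "poly g z = 0" "degree g > 0"
      "\<And>p. p \<in> poly_over (Domain M) \<Longrightarrow> poly p z = 0 \<Longrightarrow> \<exists>q\<in>poly_over (Domain M). p = g * q"
      "degree g \<le> card {y. poly (map_poly (hom_of M) g) y = 0}"
      using map_hom_roots[OF F(2) M(1), of z] by blast
    then have "0 < card {y. poly (map_poly (hom_of M) g) y = 0}" by linarith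
    then have "{y. poly (map_poly (hom_of M) g) y = 0} \<noteq> {}" by (metis card.empty less_numeral_extra(3))
    then obtain t where t: "poly (map_poly (hom_of M) g) t = 0" by blast
    show ?thesis
    proof (rule partial_hom_extend[OF F(2) M(1) g(1) t g(5)])
      fix M' assume M': "partial_hom F M'" "M \<subseteq> M'" "(z, t) \<in> M'"
      then have "M' = M" by (intro max)
      then show ?thesis using M'(3) by blast
    qed
  qed
  define \<gamma> where "\<gamma> = hom_of M"
  have hom: "\<gamma> (a + b) = \<gamma> a + \<gamma> b" "\<gamma> (a * b) = \<gamma> a * \<gamma> b" for a b
    using hom_of_hom[OF F(2) M(1) dom dom] by (auto simp: \<gamma>_def)
  have fixF: "\<gamma> a = a" if "a \<in> F" for a using hom_of_fixes[OF F(2) M(1) that] by (simp add: \<gamma>_def)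
  have one: "\<gamma> 1 = 1" and zero: "\<gamma> 0 = 0" using fixF subfield_setD(1,2)[OF F(1)] by auto
  have inj: "inj \<gamma>" using hom one by (intro field_hom_inj) auto
  interpret \<gamma>: comm_ring_hom \<gamma> using hom one zero by unfold_locales auto
  \<comment> \<open>\<gamma> maps the finite root set of a polynomial over \<open>K\<close>
    injectively into itself, hence onto itself, and every b is such a root.\<close>
  have "surj \<gamma>"
  proof (unfold surj_def, rule allI)
    fix b
    obtain f where f: "f \<in> poly_over K" "f \<noteq> 0" "poly f b = 0"
      using algebraic_over[OF order_refl] by blast
    define R where "R = {a. poly f a = 0}"
    have fin: "finite R" unfolding R_def by (rule poly_roots_finite[OF f(2)])
    have "\<gamma> (poly f a) = poly f (\<gamma> a)" for a
    proof -
      have "\<gamma> (poly f a) = (\<Sum>i\<le>degree f. \<gamma> (coeff f i) * \<gamma> a ^ i)"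
        by (simp add: poly_altdef \<gamma>.hom_sum \<gamma>.hom_mult \<gamma>.hom_power)
      moreover have "\<gamma> (coeff f i) = coeff f i" for i
        using f(1) F(2) fixF poly_over_coeff[OF K_subfield] by blast
      ultimately show ?thesis by (simp add: poly_altdef)
    qed
    then have "poly f (\<gamma> a) = \<gamma> (poly f a)" for a by simp
    then have "\<gamma> ` R \<subseteq> R" using zero by (auto simp: R_def)
    moreover have "inj_on \<gamma> R" using inj by (rule inj_on_subset) simp
    ultimately have "\<gamma> ` R = R" using endo_inj_surj[OF fin] by blast
    then show "\<exists>a. b = \<gamma> a" using f by (auto simp: R_def)
  qed
  then have "\<gamma> \<in> Gal F" using inj hom one fixF by (auto simp: Gal_iff bij_def)
  moreover have "\<gamma> x \<noteq> x"
    using hom_of_eq[OF F(2) M(1), of x y] M(2) r0(2) y(2) by (auto simp: \<gamma>_def)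
  ultimately show thesis by (rule that)
qed

end

section \<open>Finite extensions inside the big field\<close>

definition span_of :: "'l::field set \<Rightarrow> 'l set \<Rightarrow> 'l set" where
  "span_of Q B = {\<Sum>b\<in>B. c b * b | c. \<forall>b\<in>B. c b \<in> Q}"

text \<open>Finite dimension as the existence of a finite spanning set; a basis is extracted only
  where norms are compared.\<close>

definition finitely_spanned :: "'l::field set \<Rightarrow> 'l set \<Rightarrow> bool" where
  "finitely_spanned Q E \<longleftrightarrow> (\<exists>B. finite B \<and> B \<subseteq> E \<and> E = span_of Q B)"

lemma span_ofI: "(\<And>b. b \<in> B \<Longrightarrow> c b \<in> Q) \<Longrightarrow> (\<Sum>b\<in>B. c b * b) \<in> span_of Q B"
  by (auto simp: span_of_def)

lemma span_ofE:
  assumes "x \<in> span_of Q B"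
  obtains c where "\<And>b. b \<in> B \<Longrightarrow> c b \<in> Q" "x = (\<Sum>b\<in>B. c b * b)"
  using assms by (auto simp: span_of_def)

lemma span_of_subset: "subfield_set E \<Longrightarrow> Q \<subseteq> E \<Longrightarrow> B \<subseteq> E \<Longrightarrow> span_of Q B \<subseteq> E"
  by (auto simp: span_of_def intro!: subfield_set_sum subfield_setD(4))

lemma finitely_spanned_self: "subfield_set Q \<Longrightarrow> finitely_spanned Q Q"
  unfolding finitely_spanned_def
  using subfield_setD(2)[of Q]
  by (intro exI[of _ "{1}"]) (auto simp: span_of_def)

lemma finitely_spanned_finite:
  assumes "finitely_spanned Q E" "finite Q"
  shows "finite E"
proof -
  obtain B where B: "finite B" "E = span_of Q B" using assms by (auto simp: finitely_spanned_def)
  have "E \<subseteq> (\<lambda>c. \<Sum>b\<in>B. c b * b) ` (B \<rightarrow>\<^sub>E Q)"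
  proof
    fix x assume "x \<in> E"
    then obtain c where c: "\<And>b. b \<in> B \<Longrightarrow> c b \<in> Q" "x = (\<Sum>b\<in>B. c b * b)" unfolding B(2) by (rule span_ofE) blast
    have "x = (\<Sum>b\<in>B. restrict c B b * b)" unfolding c(2) by (intro sum.cong) auto
    moreover have "restrict c B \<in> B \<rightarrow>\<^sub>E Q" using c(1) by auto
    ultimately show "x \<in> (\<lambda>c. \<Sum>b\<in>B. c b * b) ` (B \<rightarrow>\<^sub>E Q)" by blast
  qed
  moreover have "finite (B \<rightarrow>\<^sub>E Q)" using B assms by (intro finite_PiE) auto
  ultimately show ?thesis by (rule finite_subset[OF _ finite_imageI])
qed

text \<open>Induction along the inductive definition of dimension: each line extension contributes
  one generator.\<close>

lemma finite_dimension_finitely_spanned: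
  fixes Q E :: "'l::field set"
  assumes Q: "subfield_set Q" and dim: "ring.finite_dimension (class_ring :: 'l ring) Q E"
  shows "finitely_spanned Q E"
proof -
  have R: "ring (class_ring :: 'l ring)" by unfold_locales
  obtain n where "ring.dimension (class_ring :: 'l ring) n Q E"
    using dim unfolding ring.finite_dimension_def[OF R] by blast
  then show ?thesis using Q
  proof (induction rule: ring.dimension.induct[OF R, consumes 1])
    case (1 K)
    then show ?case unfolding finitely_spanned_def by (intro exI[of _ "{}"]) (auto simp: span_of_def)
  next
    case (2 x E n K)
    then obtain B where B: "finite B" "B \<subseteq> E" "E = span_of K B" by (auto simp: finitely_spanned_def)
    let ?L = "ring.line_extension (class_ring :: 'l ring) K x E"
    have L: "u \<in> ?L \<longleftrightarrow> (\<exists>k\<in>K. \<exists>e\<in>E. u = k * x + e)" for u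
      using ring.line_extension_mem_iff[OF R, of u K x E] by simp
    have xB: "x \<notin> B" using 2 B by blast
    have "(\<Sum>b\<in>B. 0 * b) \<in> span_of K B" by (rule span_ofI) (rule subfield_setD(1)[OF 2(5)])
    then have 0: "0 \<in> E" using B(3) by simp
    have "?L = span_of K (insert x B)"
    proof (intro equalityI subsetI)
      fix u assume "u \<in> ?L"
      then obtain k e where ke: "k \<in> K" "e \<in> E" "u = k * x + e" using L by blast
      obtain c where c: "\<And>b. b \<in> B \<Longrightarrow> c b \<in> K" "e = (\<Sum>b\<in>B. c b * b)"
        using ke(2) unfolding B(3) by (rule span_ofE) blast
      have "u = (\<Sum>b\<in>insert x B. (c(x := k)) b * b)"
        using xB B(1) ke(3) unfolding c(2) by (auto intro!: arg_cong2[of _ _ _ _ "(+)"] sum.cong)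
      also have "\<dots> \<in> span_of K (insert x B)" by (rule span_ofI) (use c ke in auto)
      finally show "u \<in> span_of K (insert x B)" .
    next
      fix u assume "u \<in> span_of K (insert x B)"
      then obtain c where c: "\<And>b. b \<in> insert x B \<Longrightarrow> c b \<in> K" "u = (\<Sum>b\<in>insert x B. c b * b)"
        by (rule span_ofE) blast
      then have "u = c x * x + (\<Sum>b\<in>B. c b * b)" using xB B(1) by simp
      moreover have "(\<Sum>b\<in>B. c b * b) \<in> E" unfolding B(3) by (rule span_ofI) (use c in auto)
      ultimately show "u \<in> ?L" using L c(1) by blast
    qed
    moreover have "insert x B \<subseteq> ?L"
    proof
      fix b assume "b \<in> insert x B"
      then consider "b = 1 * x + 0" | "b \<in> E" "b = 0 * x + b" using B(2) by auto
      then show "b \<in> ?L" using L 0 subfield_setD(1,2)[OF 2(5)] by cases blast+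
    qed
    ultimately show ?case unfolding finitely_spanned_def using B(1) by blast
  qed
qed

text \<open>The ring E[x] is a field because x is algebraic, and remainders modulo g show that it is
  spanned by the b x^k with k below the degree of g.\<close>

lemma finitely_spanned_adjoin:
  assumes Q: "subfield_set Q" and E: "subfield_set E" "Q \<subseteq> E" "finitely_spanned Q E"
    and alg: "\<And>z. \<exists>p\<in>poly_over E. p \<noteq> 0 \<and> poly p z = 0"
  obtains E' where "subfield_set E'" "E \<subseteq> E'" "x \<in> E'" "finitely_spanned Q E'"
proof -
  obtain g where g: "g \<in> poly_over E" "lead_coeff g = 1" "poly g x = 0" "degree g > 0"
    using minimal_polynomial[OF E(1) alg] by metis
  define E' where "E' = (\<lambda>p. poly p x) ` poly_over E"
  have memE: "poly p x \<in> E'" if "p \<in> poly_over E" for p using that by (auto simp: E'_def)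
  have EE': "E \<subseteq> E'"
  proof
    fix c assume "c \<in> E"
    then show "c \<in> E'" using memE[OF poly_over_const[OF E(1)], of c] by simp
  qed
  have sub: "subfield_set E'"
  proof (rule subring_is_subfield[OF E(1) alg EE'])
    fix a b assume "a \<in> E'" "b \<in> E'"
    then obtain p q where "p \<in> poly_over E" "q \<in> poly_over E" "a = poly p x" "b = poly q x"
      by (auto simp: E'_def)
    then show "a + b \<in> E' \<and> a * b \<in> E'"
      using memE[OF poly_over_add[OF E(1)], of p q] memE[OF poly_over_mult[OF E(1)], of p q] by simp
  qed
  have x: "x \<in> E'" using memE[OF poly_over_linear[OF E(1) subfield_setD(1)[OF E(1)]]] by simp
  obtain B where B: "finite B" "B \<subseteq> E" "E = span_of Q B" using E(3) by (auto simp: finitely_spanned_def)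
  let ?d = "degree g"
  let ?J = "B \<times> {..<?d}"
  let ?f = "\<lambda>(b, k). b * x ^ k"
  define B' where "B' = ?f ` ?J"
  have B': "finite B'" "B' \<subseteq> E'"
    using B EE' x subfield_setD(4)[OF sub] subfield_set_power[OF sub] by (auto simp: B'_def)
  have "E' \<subseteq> span_of Q B'"
  proof
    fix u assume "u \<in> E'"
    then obtain p where p: "p \<in> poly_over E" "u = poly p x" by (auto simp: E'_def)
    obtain q r where r: "r \<in> poly_over E" "p = g * q + r" "r = 0 \<or> degree r < ?d"
      using poly_over_division[OF E(1) g(1,2) p(1)] by blast
    have "u = poly r x" using p r g by simp
    also have "\<dots> = (\<Sum>k<?d. coeff r k * x ^ k)"
      unfolding poly_altdef using r(3) g(4)
      by (intro sum.mono_neutral_left) (auto simp: coeff_eq_0)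
    finally have u: "u = (\<Sum>k<?d. coeff r k * x ^ k)" .
    have "\<exists>c. (\<forall>b\<in>B. c b \<in> Q) \<and> coeff r k = (\<Sum>b\<in>B. c b * b)" for k
    proof -
      have "coeff r k \<in> span_of Q B" using r(1) poly_over_coeff[OF E(1)] B(3) by blast
      then show ?thesis unfolding span_of_def by blast
    qed
    then obtain c where c: "\<And>k b. b \<in> B \<Longrightarrow> c k b \<in> Q" "\<And>k. coeff r k = (\<Sum>b\<in>B. c k b * b)" by metis
    have "u = (\<Sum>k<?d. \<Sum>b\<in>B. c k b * ?f (b, k))"
      unfolding u c(2) by (simp add: sum_distrib_right mult.assoc)
    also have "\<dots> = (\<Sum>b\<in>B. \<Sum>k<?d. c k b * ?f (b, k))" by (rule sum.swap)
    also have "\<dots> = (\<Sum>j\<in>?J. c (snd j) (fst j) * ?f j)"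
      by (simp add: sum.cartesian_product split_def)
    \<comment> \<open>Different pairs (b, k) may give the same product, so coefficients are
      collected by value.\<close>
    also have "\<dots> = (\<Sum>y\<in>B'. \<Sum>j\<in>{j \<in> ?J. ?f j = y}. c (snd j) (fst j) * ?f j)"
      using B(1) B'(1) by (intro sum.group[symmetric]) (auto simp: B'_def)
    also have "\<dots> = (\<Sum>y\<in>B'. (\<Sum>j\<in>{j \<in> ?J. ?f j = y}. c (snd j) (fst j)) * y)"
      unfolding sum_distrib_right by (intro sum.cong refl) auto
    also have "\<dots> \<in> span_of Q B'"
      using c(1) by (intro span_ofI subfield_set_sum[OF Q]) auto
    finally show "u \<in> span_of Q B'" .
  qed
  moreover have "span_of Q B' \<subseteq> E'" using span_of_subset[OF sub _ B'(2)] E(2) EE' by blast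
  ultimately have "finitely_spanned Q E'" unfolding finitely_spanned_def using B' by blast
  then show thesis using that sub EE' x by blast
qed

lemma finitely_spanned_adjoin_finite:
  assumes "finite S" and Q: "subfield_set Q" and E: "subfield_set E" "Q \<subseteq> E" "finitely_spanned Q E"
    and alg: "\<And>z. \<exists>p\<in>poly_over E. p \<noteq> 0 \<and> poly p z = 0"
  shows "\<exists>E'. subfield_set E' \<and> E \<subseteq> E' \<and> S \<subseteq> E' \<and> finitely_spanned Q E'"
  using assms(1)
proof (induction S)
  case empty
  then show ?case using E by blast
next
  case (insert x S)
  then obtain E1 where E1: "subfield_set E1" "E \<subseteq> E1" "S \<subseteq> E1" "finitely_spanned Q E1" by blast
  have "\<exists>p\<in>poly_over E1. p \<noteq> 0 \<and> poly p z = 0" for z using alg[of z] poly_over_mono[OF E1(2)] by blast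
  then obtain E2 where "subfield_set E2" "E1 \<subseteq> E2" "x \<in> E2" "finitely_spanned Q E2"
    using finitely_spanned_adjoin[OF Q E1(1) _ E1(4), of x] E(2) E1(2) by blast
  then show ?case using E1 by blast
qed

lemma finite_subfield_of_algebraic:
  fixes P S :: "'a::field set"
  assumes "subfield_set P" "finite P" "\<And>z. \<exists>p\<in>poly_over P. p \<noteq> 0 \<and> poly p z = 0" "finite S"
  shows "\<exists>F. finite F \<and> subfield_set F \<and> S \<subseteq> F"
proof -
  obtain F where "subfield_set F" "S \<subseteq> F" "finitely_spanned P F"
    using finitely_spanned_adjoin_finite[OF assms(4,1,1) order_refl finitely_spanned_self[OF assms(1)]] assms(3)
    by blast
  then show ?thesis using finitely_spanned_finite[OF _ assms(2)] by blast
qed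

section \<open>Norms over a complete non-archimedean field\<close>

lemma complete_subsetD:
  assumes "complete_subset v E" "\<And>k. x k \<in> E" "\<And>e. e > 0 \<Longrightarrow> \<exists>N. \<forall>m\<ge>N. \<forall>k\<ge>N. v (x m - x k) < e"
  obtains l where "l \<in> E" "(\<lambda>k. v (x k - l)) \<longlonglongrightarrow> 0"
  using assms unfolding complete_subset_def by (metis image_subsetI)

lemma mcomplete_complete_subset:
  fixes v :: "'l::field \<Rightarrow> real"
  assumes v: "nonarch_abs v" and Q: "Metric_space.mcomplete Q (\<lambda>x y. v (x - y))"
  shows "complete_subset v Q"
proof -
  interpret nonarchimedean v by unfold_locales (rule v)
  interpret Metric_space Q "\<lambda>x y. v (x - y)"
  proof
    show "v (x - z) \<le> v (x - y) + v (y - z)" for x y z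
    proof -
      have "v (x - z) \<le> max (v (x - y)) (v (y - z))" using v_add[of "x - y" "y - z"] by simp
      also have "\<dots> \<le> v (x - y) + v (y - z)" by (simp add: max_def)
      finally show ?thesis .
    qed
  qed (auto simp: v_diff_commute)
  show ?thesis unfolding complete_subset_def
  proof (intro allI impI)
    fix x :: "nat \<Rightarrow> 'l" assume x: "range x \<subseteq> Q \<and> (\<forall>e>0. \<exists>N. \<forall>m\<ge>N. \<forall>k\<ge>N. v (x m - x k) < e)"
    have "MCauchy x"
      unfolding MCauchy_def
    proof (intro conjI allI impI)
      fix e :: real assume "e > 0"
      then obtain N where N: "\<forall>m\<ge>N. \<forall>k\<ge>N. v (x m - x k) < e" using x by blast
      show "\<exists>N. \<forall>n n'. N \<le> n \<longrightarrow> N \<le> n' \<longrightarrow> v (x n - x n') < e"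
        using N by (intro exI[of _ N]) simp
    qed (use x in simp)
    then obtain l where l: "limitin mtopology x l sequentially" using Q unfolding mcomplete_def by blast
    then have "l \<in> Q" "\<And>e. e > 0 \<Longrightarrow> \<forall>\<^sub>F k in sequentially. x k \<in> Q \<and> v (x k - l) < e"
      unfolding limitin_metric by auto
    moreover have "(\<lambda>k. v (x k - l)) \<longlonglongrightarrow> 0"
    proof (rule tendstoI)
      fix e :: real assume "e > 0"
      from calculation(2)[OF this] show "\<forall>\<^sub>F k in sequentially. dist (v (x k - l)) 0 < e"
        by (rule eventually_mono) simp
    qed
    ultimately show "\<exists>l\<in>Q. (\<lambda>k. v (x k - l)) \<longlonglongrightarrow> 0" by blast
  qed
qed

section \<open>Equivalence of norms and invariance of the absolute value\<close>

context nonarchimedean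
begin

definition independent_over :: "'l set \<Rightarrow> 'l set \<Rightarrow> bool" where
  "independent_over Q B \<longleftrightarrow> (\<forall>c. (\<forall>b\<in>B. c b \<in> Q) \<longrightarrow> (\<Sum>b\<in>B. c b * b) = 0 \<longrightarrow> (\<forall>b\<in>B. c b = 0))"

text \<open>The nontrivial half of the equivalence of v with the maximum norm of the
  coordinates.\<close>

definition coordinate_bound :: "'l set \<Rightarrow> 'l set \<Rightarrow> real \<Rightarrow> bool" where
  "coordinate_bound Q B C \<longleftrightarrow> C > 0 \<and>
     (\<forall>c. (\<forall>b\<in>B. c b \<in> Q) \<longrightarrow> (\<forall>b\<in>B. v (c b) \<le> C * v (\<Sum>b\<in>B. c b * b)))"

lemma basis_exists:
  assumes Q: "subfield_set Q" and E: "finitely_spanned Q E"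
  obtains B where "finite B" "E = span_of Q B" "independent_over Q B"
proof -
  define A where "A k \<longleftrightarrow> (\<exists>B. finite B \<and> E = span_of Q B \<and> card B = k)" for k
  have "\<exists>k. A k" using E by (auto simp: A_def finitely_spanned_def)
  then have "A (LEAST k. A k)" by (rule LeastI_ex)
  then obtain B where B: "finite B" "E = span_of Q B" "card B = (LEAST k. A k)" by (auto simp: A_def)
  have "independent_over Q B"
    unfolding independent_over_def
  proof (intro allI impI ballI, rule ccontr)
    fix c a assume c: "\<forall>b\<in>B. c b \<in> Q" "(\<Sum>b\<in>B. c b * b) = 0" and a: "a \<in> B" "c a \<noteq> 0"
    define B' where "B' = B - {a}"
    have B': "finite B'" "B = insert a B'" "a \<notin> B'" using B a by (auto simp: B'_def)
    have "c a * a = - (\<Sum>b\<in>B'. c b * b)" using c(2) B' by (simp add: eq_neg_iff_add_eq_0)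
    then have aeq: "a = (\<Sum>b\<in>B'. - c b / c a * b)"
      using a(2) by (simp add: sum_negf sum_divide_distrib[symmetric] field_simps)
    have aB: "y * a = (\<Sum>b\<in>B'. y * (- c b / c a) * b)" for y
    proof -
      have "y * a = y * (\<Sum>b\<in>B'. - c b / c a * b)" by (rule arg_cong[OF aeq])
      then show ?thesis by (simp only: sum_distrib_left mult.assoc)
    qed
    have "span_of Q B \<subseteq> span_of Q B'"
    proof
      fix u assume "u \<in> span_of Q B"
      then obtain d where d: "\<And>b. b \<in> B \<Longrightarrow> d b \<in> Q" "u = (\<Sum>b\<in>B. d b * b)" by (rule span_ofE) blast
      have "u = d a * a + (\<Sum>b\<in>B'. d b * b)" unfolding d(2) using B' by simp
      also have "\<dots> = (\<Sum>b\<in>B'. (d a * (- c b / c a) + d b) * b)"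
        unfolding aB by (simp only: distrib_right sum.distrib)
      also have "\<dots> \<in> span_of Q B'"
        using d(1) c(1) a B'(2) by (intro span_ofI subfield_setD(3,4,5,8)[OF Q]) auto
      finally show "u \<in> span_of Q B'" .
    qed
    moreover have "span_of Q B' \<subseteq> span_of Q B"
    proof
      fix u assume "u \<in> span_of Q B'"
      then obtain d where d: "\<And>b. b \<in> B' \<Longrightarrow> d b \<in> Q" "u = (\<Sum>b\<in>B'. d b * b)" by (rule span_ofE) blast
      have "u = (\<Sum>b\<in>B. (d(a := 0)) b * b)" unfolding d(2) using B' by (auto intro!: sum.cong)
      also have "\<dots> \<in> span_of Q B" using d(1) B'(2) subfield_setD(1)[OF Q] by (intro span_ofI) auto
      finally show "u \<in> span_of Q B" .
    qed
    ultimately have "A (card B')" using B B' by (auto simp: A_def)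
    moreover have "card B' < (LEAST k. A k)" using B(3) B' by (metis card_insert_disjoint lessI)
    ultimately show False using not_less_Least by blast
  qed
  then show thesis using that B by blast
qed

lemma tendsto_v_add:
  assumes "(\<lambda>k. v (x k)) \<longlonglongrightarrow> 0" "(\<lambda>k. v (y k)) \<longlonglongrightarrow> 0"
  shows "(\<lambda>k. v (x k + y k)) \<longlonglongrightarrow> 0"
proof (rule tendsto_sandwich[of "\<lambda>_. 0"])
  show "(\<lambda>k. v (x k) + v (y k)) \<longlonglongrightarrow> 0" using tendsto_add[OF assms] by simp
  show "\<forall>\<^sub>F k in sequentially. v (x k + y k) \<le> v (x k) + v (y k)"
  proof (intro always_eventually allI)
    fix k show "v (x k + y k) \<le> v (x k) + v (y k)"
      using v_add[of "x k" "y k"] v_nonneg[of "x k"] v_nonneg[of "y k"] by linarith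
  qed
qed (auto intro: always_eventually)

lemma tendsto_v_sum:
  assumes "\<And>i. i \<in> I \<Longrightarrow> (\<lambda>k. v (f i k)) \<longlonglongrightarrow> 0"
  shows "(\<lambda>k. v (\<Sum>i\<in>I. f i k)) \<longlonglongrightarrow> 0"
  using assms by (induction I rule: infinite_finite_induct) (auto intro: tendsto_v_add)

text \<open>The bound makes the coordinates of a Cauchy sequence Cauchy in \<open>Q\<close>, where
  they converge.\<close>

lemma span_complete:
  assumes Q: "subfield_set Q" "complete_subset v Q" and B: "finite B" "coordinate_bound Q B C"
  shows "complete_subset v (span_of Q B)"
  unfolding complete_subset_def
proof (intro allI impI)
  fix x :: "nat \<Rightarrow> 'l"
  assume x: "range x \<subseteq> span_of Q B \<and> (\<forall>e>0. \<exists>N. \<forall>m\<ge>N. \<forall>k\<ge>N. v (x m - x k) < e)"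
  have "\<exists>c. (\<forall>b\<in>B. c b \<in> Q) \<and> x k = (\<Sum>b\<in>B. c b * b)" for k
  proof -
    have "x k \<in> span_of Q B" using x by blast
    then show ?thesis unfolding span_of_def by blast
  qed
  then obtain c where c: "\<And>k b. b \<in> B \<Longrightarrow> c k b \<in> Q" "\<And>k. x k = (\<Sum>b\<in>B. c k b * b)" by metis
  have C: "C > 0" using B by (simp add: coordinate_bound_def)
  have bnd: "v (c m b - c k b) \<le> C * v (x m - x k)" if b: "b \<in> B" for b m k
  proof -
    have "x m - x k = (\<Sum>b\<in>B. (c m b - c k b) * b)" by (simp add: c(2) sum_subtractf left_diff_distrib)
    moreover have "\<forall>b\<in>B. c m b - c k b \<in> Q" using c(1) subfield_setD(7)[OF Q(1)] by blast
    then have "v (c m b - c k b) \<le> C * v (\<Sum>b\<in>B. (c m b - c k b) * b)"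
      using B(2) b unfolding coordinate_bound_def by (elim conjE allE[of _ "\<lambda>b. c m b - c k b"]) simp
    ultimately show ?thesis by simp
  qed
  have "\<exists>l\<in>Q. (\<lambda>k. v (c k b - l)) \<longlonglongrightarrow> 0" if b: "b \<in> B" for b
  proof -
    have "\<exists>N. \<forall>m\<ge>N. \<forall>k\<ge>N. v (c m b - c k b) < e" if "e > 0" for e
    proof -
      have "e / C > 0" using that C by simp
      then obtain N where N: "\<forall>m\<ge>N. \<forall>k\<ge>N. v (x m - x k) < e / C" using x by blast
      have "v (c m b - c k b) < e" if "m \<ge> N" "k \<ge> N" for m k
      proof -
        have "C * v (x m - x k) < e" using N that C by (simp add: pos_less_divide_eq mult.commute)
        then show ?thesis using bnd[OF b, of m k] by linarith
      qed
      then show ?thesis by blast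
    qed
    moreover have "range (\<lambda>k. c k b) \<subseteq> Q" using c(1) b by auto
    ultimately show ?thesis using Q(2) unfolding complete_subset_def by blast
  qed
  then obtain l where l: "\<And>b. b \<in> B \<Longrightarrow> l b \<in> Q" "\<And>b. b \<in> B \<Longrightarrow> (\<lambda>k. v (c k b - l b)) \<longlonglongrightarrow> 0" by metis
  have "(\<lambda>k. v (\<Sum>b\<in>B. (c k b - l b) * b)) \<longlonglongrightarrow> 0"
    using l(2) by (intro tendsto_v_sum) (auto simp: v_mult intro!: tendsto_mult_left_zero)
  moreover have "x k - (\<Sum>b\<in>B. l b * b) = (\<Sum>b\<in>B. (c k b - l b) * b)" for k
    by (simp add: c(2) sum_subtractf left_diff_distrib)
  ultimately have "(\<lambda>k. v (x k - (\<Sum>b\<in>B. l b * b))) \<longlonglongrightarrow> 0" by simp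
  then show "\<exists>y\<in>span_of Q B. (\<lambda>k. v (x k - y)) \<longlonglongrightarrow> 0" using span_ofI[of B l Q] l(1) by blast
qed

text \<open>Induction on the basis. The span of the earlier vectors is complete, hence closed, so
  the new vector a has positive distance \<delta> from it. This bounds the coefficient of a, and the
  induction hypothesis bounds the others.\<close>

lemma coordinate_bound_exists:
  assumes Q: "subfield_set Q" "complete_subset v Q" and B: "finite B" "independent_over Q B"
  shows "\<exists>C. coordinate_bound Q B C"
  using B
proof (induction B)
  case empty
  then show ?case by (intro exI[of _ 1]) (auto simp: coordinate_bound_def)
next
  case (insert a B)
  have indB: "independent_over Q B"
    unfolding independent_over_def
  proof (intro allI impI)
    fix c assume c: "\<forall>b\<in>B. c b \<in> Q" "(\<Sum>b\<in>B. c b * b) = 0"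
    have "(\<Sum>b\<in>B. (c(a := 0)) b * b) = (\<Sum>b\<in>B. c b * b)" using insert by (intro sum.cong) auto
    then have "(\<Sum>b\<in>insert a B. (c(a := 0)) b * b) = 0" using insert c by simp
    moreover have "\<forall>b\<in>insert a B. (c(a := 0)) b \<in> Q" using c subfield_setD(1)[OF Q(1)] by auto
    ultimately have "\<forall>b\<in>insert a B. (c(a := 0)) b = 0"
      using insert.prems unfolding independent_over_def by blast
    then show "\<forall>b\<in>B. c b = 0" using insert by (metis fun_upd_apply insertCI)
  qed
  then obtain C where C: "coordinate_bound Q B C" using insert.IH by blast
  then have C0: "C > 0" by (simp add: coordinate_bound_def)
  have compl: "complete_subset v (span_of Q B)" by (rule span_complete[OF Q insert.hyps(1) C])
  have a: "a \<notin> span_of Q B"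
  proof
    assume "a \<in> span_of Q B"
    then obtain c where c: "\<And>b. b \<in> B \<Longrightarrow> c b \<in> Q" "a = (\<Sum>b\<in>B. c b * b)" by (rule span_ofE) blast
    have "(\<Sum>b\<in>B. (c(a := - 1)) b * b) = (\<Sum>b\<in>B. c b * b)" using insert by (intro sum.cong) auto
    then have "(\<Sum>b\<in>insert a B. (c(a := - 1)) b * b) = 0" using insert c(2) by simp
    moreover have "\<forall>b\<in>insert a B. (c(a := - 1)) b \<in> Q" using c(1) subfield_setD(2,5)[OF Q(1)] by auto
    ultimately have "(c(a := - 1)) a = 0" using insert.prems unfolding independent_over_def by blast
    then show False by simp
  qed
  have "\<exists>\<delta>>0. \<forall>w\<in>span_of Q B. \<delta> \<le> v (a - w)"
  proof (rule ccontr)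
    assume "\<not> ?thesis"
    then have neg: "\<exists>w\<in>span_of Q B. v (a - w) < \<delta>" if "\<delta> > 0" for \<delta> using that by (meson not_le)
    have "\<exists>w\<in>span_of Q B. v (a - w) < 1 / real (Suc k)" for k by (rule neg) simp
    then obtain w where w: "\<And>k. w k \<in> span_of Q B" "\<And>k. v (a - w k) < 1 / real (Suc k)" by metis
    have lim: "(\<lambda>k. v (a - w k)) \<longlonglongrightarrow> 0"
    proof (rule tendsto_sandwich[of "\<lambda>_. 0"])
      show "(\<lambda>k. 1 / real (Suc k)) \<longlonglongrightarrow> 0" using LIMSEQ_inverse_real_of_nat by (simp add: inverse_eq_divide)
    qed (use w in \<open>auto intro!: always_eventually less_imp_le\<close>)
    have "\<exists>N. \<forall>m\<ge>N. \<forall>k\<ge>N. v (w m - w k) < e" if "e > 0" for e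
    proof -
      obtain N where N: "\<And>k. k \<ge> N \<Longrightarrow> v (a - w k) < e"
        using order_tendstoD(2)[OF lim \<open>e > 0\<close>] by (auto simp: eventually_sequentially)
      have "v (w m - w k) < e" if "m \<ge> N" "k \<ge> N" for m k
        using v_diff[of "a - w k" "a - w m"] N[OF that(1)] N[OF that(2)] by simp
      then show ?thesis by blast
    qed
    with complete_subsetD[of v _ w, OF compl w(1)]
    obtain l where l: "l \<in> span_of Q B" "(\<lambda>k. v (w k - l)) \<longlonglongrightarrow> 0" by blast
    have "(\<lambda>k. v ((a - w k) + (w k - l))) \<longlonglongrightarrow> 0" by (rule tendsto_v_add[OF lim l(2)])
    then have "v (a - l) = 0" by (simp add: LIMSEQ_const_iff)
    then show False using a l(1) by simp
  qed
  then obtain \<delta> where \<delta>: "\<delta> > 0" "\<And>w. w \<in> span_of Q B \<Longrightarrow> \<delta> \<le> v (a - w)" by blast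
  \<comment> \<open>The first entry serves the coefficient of a. The second applies the constant C
    to x - c a * a, whose size is at most max 1 (v a / \<delta>) times that of x.\<close>
  define D where "D = max (1 / \<delta>) (C * max 1 (v a / \<delta>))"
  have D0: "D > 0" unfolding D_def using \<delta>(1) by (simp add: less_max_iff_disj)
  have "v (c b) \<le> D * v (\<Sum>b\<in>insert a B. c b * b)"
    if c: "\<forall>b\<in>insert a B. c b \<in> Q" and b: "b \<in> insert a B" for c b
  proof -
    define x where "x = (\<Sum>b\<in>insert a B. c b * b)"
    have x: "x = c a * a + (\<Sum>b\<in>B. c b * b)" using insert by (simp add: x_def)
    have ca: "v (c a) \<le> v x / \<delta>"
    proof (cases "c a = 0")
      case False
      have w: "(\<Sum>b\<in>B. - c b / c a * b) \<in> span_of Q B"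
        using c by (intro span_ofI subfield_setD(5,8)[OF Q(1)]) auto
      have "c a * (a - (\<Sum>b\<in>B. - c b / c a * b)) = c a * a - (\<Sum>b\<in>B. c a * (- c b / c a * b))"
        by (simp add: right_diff_distrib sum_distrib_left)
      also have "(\<Sum>b\<in>B. c a * (- c b / c a * b)) = - (\<Sum>b\<in>B. c b * b)"
        using False by (simp add: sum_negf)
      finally have "x = c a * (a - (\<Sum>b\<in>B. - c b / c a * b))" by (simp add: x)
      then have "v x = v (c a) * v (a - (\<Sum>b\<in>B. - c b / c a * b))" by (simp only: v_mult)
      also have "\<dots> \<ge> v (c a) * \<delta>" using \<delta>(2)[OF w] by (intro mult_left_mono) auto
      finally show ?thesis using \<delta>(1) by (simp add: pos_le_divide_eq)
    qed (use \<delta>(1) in simp)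
    show ?thesis
    proof (cases "b = a")
      case True
      have "v x / \<delta> \<le> D * v x" unfolding D_def using \<delta>(1)
        by (metis max.cobounded1 mult_right_mono times_divide_eq_left mult_1 v_nonneg)
      then show ?thesis using ca True by (simp add: x_def)
    next
      case False
      then have "v (c b) \<le> C * v (\<Sum>b\<in>B. c b * b)" using C c b unfolding coordinate_bound_def by blast
      also have "(\<Sum>b\<in>B. c b * b) = x - c a * a" by (simp add: x)
      also have "C * v (x - c a * a) \<le> C * (max 1 (v a / \<delta>) * v x)"
      proof (rule mult_left_mono)
        have "v (c a * a) \<le> v x / \<delta> * v a" unfolding v_mult by (rule mult_right_mono[OF ca]) simp
        then have "v (c a * a) \<le> v a / \<delta> * v x" by (simp add: mult.commute)
        moreover have "v (x - c a * a) \<le> max (v x) (v (c a * a))" by (rule v_diff)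
        moreover have "v x \<le> max 1 (v a / \<delta>) * v x" "v a / \<delta> * v x \<le> max 1 (v a / \<delta>) * v x"
          using mult_right_mono[of 1 "max 1 (v a / \<delta>)" "v x"]
            mult_right_mono[of "v a / \<delta>" "max 1 (v a / \<delta>)" "v x"] by auto
        ultimately show "v (x - c a * a) \<le> max 1 (v a / \<delta>) * v x" by linarith
      qed (use C0 in simp)
      also have "\<dots> = C * max 1 (v a / \<delta>) * v x" by (rule mult.assoc[symmetric])
      also have "\<dots> \<le> D * v x" by (rule mult_right_mono) (simp_all add: D_def)
      finally show ?thesis by (simp add: x_def)
    qed
  qed
  then have "coordinate_bound Q (insert a B) D" unfolding coordinate_bound_def using D0 by blast
  then show ?case by blast
qed

lemma finitely_spanned_complete:
  assumes Q: "subfield_set Q" "complete_subset v Q" and E: "finitely_spanned Q E"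
  shows "complete_subset v E"
  using basis_exists[OF Q(1) E] coordinate_bound_exists[OF Q] span_complete[OF Q] by metis

lemma le_1_of_bounded_powers:
  fixes t A :: real
  assumes "\<And>k. t ^ k \<le> A"
  shows "t \<le> 1"
proof (rule ccontr)
  assume "\<not> t \<le> 1"
  then obtain k where "A < t ^ k" using real_arch_pow[of t A] by auto
  then show False using assms[of k] by simp
qed

text \<open>\<gamma> is linear over \<open>Q\<close>, hence bounded on \<open>E\<close> by some
  constant. Applied to all powers of x, this bounds the powers of v (\<gamma> x) / v x, so that
  quotient is at most 1.\<close>

lemma automorphism_v_le:
  assumes Q: "subfield_set Q" "complete_subset v Q" and E: "subfield_set E" "finitely_spanned Q E" "x \<in> E"
    and hom: "\<And>x y. \<gamma> (x + y) = \<gamma> x + \<gamma> y" "\<And>x y. \<gamma> (x * y) = \<gamma> x * \<gamma> y" "\<gamma> 1 = 1"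
      "\<And>x. x \<in> Q \<Longrightarrow> \<gamma> x = x"
  shows "v (\<gamma> x) \<le> v x"
proof (cases "x = 0")
  case True
  then show ?thesis using hom(4)[OF subfield_setD(1)[OF Q(1)]] by simp
next
  case False
  have zero: "\<gamma> 0 = 0" using hom(4)[OF subfield_setD(1)[OF Q(1)]] .
  interpret \<gamma>: comm_ring_hom \<gamma> using hom(1-3) zero by unfold_locales auto
  obtain B where B: "finite B" "E = span_of Q B" "independent_over Q B" using basis_exists[OF Q(1) E(2)] by blast
  obtain C where C: "coordinate_bound Q B C" using coordinate_bound_exists[OF Q B(1,3)] by blast
  then have C0: "C > 0" by (simp add: coordinate_bound_def)
  define D where "D = Max (insert 0 ((\<lambda>b. v (\<gamma> b)) ` B))"
  have D: "v (\<gamma> b) \<le> D" if "b \<in> B" for b unfolding D_def using B(1) that by (intro Max_ge) auto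
  have D0: "0 \<le> D" unfolding D_def using B(1) by (intro Max_ge) auto
  have bound: "v (\<gamma> y) \<le> C * D * v y" if "y \<in> E" for y
  proof -
    obtain c where c: "\<And>b. b \<in> B \<Longrightarrow> c b \<in> Q" "y = (\<Sum>b\<in>B. c b * b)"
      using \<open>y \<in> E\<close> unfolding B(2) by (rule span_ofE) blast
    have "\<gamma> y = (\<Sum>b\<in>B. c b * \<gamma> b)"
      unfolding c(2) by (simp add: \<gamma>.hom_sum \<gamma>.hom_mult hom(4) c(1))
    also have "v \<dots> \<le> (C * v y) * D"
    proof (rule v_sum_le)
      fix b assume b: "b \<in> B"
      have "v (c b) \<le> C * v y" using C c b unfolding coordinate_bound_def by blast
      then show "v (c b * \<gamma> b) \<le> (C * v y) * D" using D[OF b] by (rule v_mult_le)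
    qed (use C0 D0 in simp)
    finally show ?thesis by (simp add: mult_ac)
  qed
  have vx: "v x > 0" using False v_nonneg[of x] by (simp add: less_le)
  have "(v (\<gamma> x) / v x) ^ k \<le> C * D" for k
  proof -
    have "v (\<gamma> x) ^ k \<le> C * D * v x ^ k"
      using bound[OF subfield_set_power[OF E(1,3)], of k] by (simp add: \<gamma>.hom_power v_power)
    then show ?thesis using vx by (simp add: power_divide pos_divide_le_eq)
  qed
  then have "v (\<gamma> x) / v x \<le> 1" by (rule le_1_of_bounded_powers)
  then show ?thesis using vx by (simp add: pos_divide_le_eq)
qed

end

section \<open>Coefficient fields\<close>

lemma Gal_inv: "\<gamma> \<in> Gal K \<Longrightarrow> inv_into UNIV \<gamma> \<in> Gal K"
proof -
  assume g: "\<gamma> \<in> Gal K"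
  then have b: "bij \<gamma>" and h: "\<And>x y. \<gamma> (x + y) = \<gamma> x + \<gamma> y" "\<And>x y. \<gamma> (x * y) = \<gamma> x * \<gamma> y"
      "\<gamma> 1 = 1" "\<And>x. x \<in> K \<Longrightarrow> \<gamma> x = x" by (auto simp: Gal_iff)
  let ?i = "inv_into UNIV \<gamma>"
  have r: "\<gamma> (?i x) = x" and l: "?i (\<gamma> x) = x" for x
    using b by (auto simp: bij_def surj_f_inv_f inv_f_f)
  have "?i (x + y) = ?i x + ?i y" "?i (x * y) = ?i x * ?i y" for x y
    by (metis h(1) r l) (metis h(2) r l)
  moreover have "?i 1 = 1" "\<And>x. x \<in> K \<Longrightarrow> ?i x = x" using h l by metis+
  ultimately show ?thesis using bij_imp_bij_inv[OF b] by (simp add: Gal_iff)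
qed

text \<open>All that the descent needs to know about K, L and the residue field of L. It also holds for
  finite K, with the trivial absolute value.\<close>
definition coefficient_field :: "('l::field \<Rightarrow> real) \<Rightarrow> ('l \<Rightarrow> 'k::field) \<Rightarrow> 'l set \<Rightarrow> bool" where
  "coefficient_field v red K \<longleftrightarrow> nonarch_abs v \<and> residue_map v red \<and>
     (\<forall>S. finite S \<longrightarrow> (\<exists>E. subfield_set E \<and> complete_subset v E \<and> S \<subseteq> E)) \<and>
     (\<forall>\<gamma>\<in>Gal K. \<forall>x. v (\<gamma> x) = v x) \<and>
     (\<forall>S :: 'k set. finite S \<longrightarrow> (\<exists>F. finite F \<and> subfield_set F \<and> S \<subseteq> F))"

definition trivial_abs :: "'l::field \<Rightarrow> real" where
  "trivial_abs x = (if x = 0 then 0 else 1)"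

lemma nonarch_trivial_abs: "nonarch_abs trivial_abs"
  by (auto simp: nonarch_abs_def trivial_abs_def)

text \<open>For the trivial absolute value everything is integral, the residue field is the big
  field with reduction \<open>id\<close>, and Cauchy sequences are eventually constant. Finite sets
  lie in finite subfields because the extension is algebraic over a finite field.\<close>

lemma coefficient_field_finite:
  fixes K :: "'l::field set"
  assumes K: "finite K" "galois_extension K"
  shows "coefficient_field trivial_abs (id :: 'l \<Rightarrow> 'l) K"
  unfolding coefficient_field_def
proof (intro conjI allI impI ballI)
  have "{x :: 'l. trivial_abs x \<le> 1} = UNIV" by (auto simp: trivial_abs_def)
  then show "residue_map trivial_abs (id :: 'l \<Rightarrow> 'l)"
    by (auto simp: residue_map_def trivial_abs_def)
  have "complete_subset trivial_abs (UNIV :: 'l set)"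
    unfolding complete_subset_def
  proof (intro allI impI)
    fix x :: "nat \<Rightarrow> 'l"
    assume x: "range x \<subseteq> UNIV \<and> (\<forall>e>0. \<exists>N. \<forall>m\<ge>N. \<forall>k\<ge>N. trivial_abs (x m - x k) < e)"
    have "\<exists>N. \<forall>m\<ge>N. \<forall>k\<ge>N. trivial_abs (x m - x k) < 1"
      by (rule conjunct2[OF x, THEN spec, THEN mp]) simp
    then obtain N where N: "\<forall>m\<ge>N. \<forall>k\<ge>N. trivial_abs (x m - x k) < 1" ..
    have "trivial_abs (x k - x N) = 0" if "k \<ge> N" for k
      using N[rule_format, OF that order_refl] by (auto simp: trivial_abs_def split: if_splits)
    then have "\<forall>\<^sub>F k in sequentially. trivial_abs (x k - x N) = 0"
      unfolding eventually_sequentially by blast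
    then have "(\<lambda>k. trivial_abs (x k - x N)) \<longlonglongrightarrow> 0" by (rule tendsto_eventually)
    then show "\<exists>l\<in>UNIV. (\<lambda>k. trivial_abs (x k - l)) \<longlonglongrightarrow> 0" by blast
  qed
  moreover have "subfield_set (UNIV :: 'l set)" by (simp add: subfield_set_def)
  ultimately show "\<exists>E. subfield_set E \<and> complete_subset trivial_abs E \<and> S \<subseteq> E" for S :: "'l set"
    by blast
  show "trivial_abs (\<gamma> x) = trivial_abs x" if "\<gamma> \<in> Gal K" for \<gamma> and x :: 'l
  proof -
    have "inj \<gamma>" "\<gamma> 0 = 0"
      using that subfield_setD(1)[OF K_subfield[OF K(2)]] by (auto simp: Gal_iff bij_def)
    then show ?thesis by (auto simp: trivial_abs_def inj_def)
  qed
  show "\<exists>F. finite F \<and> subfield_set F \<and> S \<subseteq> F" if "finite S" for S :: "'l set"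
    by (rule finite_subfield_of_algebraic[OF K_subfield[OF K(2)] K(1) algebraic_over[OF K(2) order_refl] that])
qed (rule nonarch_trivial_abs)

lemma metric_space_abs: "nonarch_abs v \<Longrightarrow> Metric_space UNIV (\<lambda>x y. v (x - y))"
proof -
  assume "nonarch_abs v"
  then interpret nonarchimedean v by unfold_locales
  show ?thesis
  proof
    show "v (x - z) \<le> v (x - y) + v (y - z)" for x y z
    proof -
      have "v (x - z) \<le> max (v (x - y)) (v (y - z))" using v_add[of "x - y" "y - z"] by simp
      also have "\<dots> \<le> v (x - y) + v (y - z)" by (simp add: max_def)
      finally show ?thesis .
    qed
  qed (auto simp: v_diff_commute)
qed

text \<open>Balls of radius 1/2 are singletons.\<close>

lemma abs_topology_trivial: "abs_topology trivial_abs = (discrete_topology UNIV :: 'l::field topology)"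
proof -
  interpret Metric_space "UNIV :: 'l set" "\<lambda>x y. trivial_abs (x - y)"
    by (rule metric_space_abs[OF nonarch_trivial_abs])
  have "y \<in> mball x (1/2) \<longleftrightarrow> y = x" for x y
    unfolding in_mball by (auto simp: trivial_abs_def)
  then have "mball x (1/2) = {x}" for x by blast
  then have "openin mtopology {x}" for x by (metis openin_mball)
  then have "openin mtopology S" for S
    using openin_Union[of "(\<lambda>x. {x}) ` S" mtopology] by auto
  then show ?thesis unfolding abs_topology_def by (intro topology_eq[THEN iffD2]) auto
qed

text \<open>The residue field of \<open>Q\<close> is the prime field. By density an integral x in
  \<open>Q\<close> is congruent to a fraction a / b; after cancelling powers of l the denominator is
  a unit, and the residue is a quotient of integers modulo l.\<close>

lemma (in residue) ladic_residues:
  assumes l: "prime l" and Q: "is_ladic_field l v Q"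
  shows "subfield_set (range of_int :: 'k set)" "finite (range of_int :: 'k set)"
    "\<And>x. x \<in> Q \<Longrightarrow> v x \<le> 1 \<Longrightarrow> red x \<in> range of_int"
proof -
  have v_int: "v (of_int m) = inverse (real l ^ multiplicity (int l) m)" if "m \<noteq> 0" for m
    using Q that by (simp add: is_ladic_field_def)
  have l1: "real l > 1" using prime_gt_1_nat[OF l] by simp
  have pl: "prime (int l)" using l by simp
  have v_int_le: "v (of_int m) \<le> 1" for m
    using v_int[of m] l1 by (cases "m = 0") (auto simp: inverse_le_1_iff)
  have "v (of_int (int l)) < 1"
    using v_int[of "int l"] l1 prime_gt_0_nat[OF l] by (simp add: multiplicity_self inverse_less_1_iff)
  have red_nat: "red (of_nat m) = of_nat m" for m
  proof (induction m)
    case (Suc m)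
    then show ?case using red_add[of 1 "of_nat m"] v_int_le[of "int m"] by simp
  qed simp
  have red_int: "red (of_int m) = of_int m" for m
  proof (cases "m \<ge> 0")
    case True
    then show ?thesis using red_nat[of "nat m"] by simp
  next
    case False
    then show ?thesis using red_nat[of "nat (- m)"] red_minus[of "of_int m"] v_int_le[of m] by simp
  qed
  have l0: "of_int (int l) = (0 :: 'k)"
    using red_int[of "int l"] red_eq_0_iff[of "of_int (int l)"] \<open>v (of_int (int l)) < 1\<close> by simp
  have period: "of_int m = (of_int (m mod int l) :: 'k)" for m
  proof -
    have "of_int m = (of_int (int l * (m div int l) + m mod int l) :: 'k)" by simp
    then show ?thesis unfolding of_int_add of_int_mult l0 by simp
  qed
  have "range of_int \<subseteq> (of_int ` {0..<int l} :: 'k set)"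
  proof
    fix y :: 'k assume "y \<in> range of_int"
    then obtain m where "y = of_int m" by blast
    then have "y = of_int (m mod int l)" using period by simp
    moreover have "m mod int l \<in> {0..<int l}" using prime_gt_0_nat[OF l] by simp
    ultimately show "y \<in> of_int ` {0..<int l}" by blast
  qed
  then show "finite (range of_int :: 'k set)" by (rule finite_subset) simp
  show sub: "subfield_set (range of_int :: 'k set)"
    unfolding subfield_set_def
  proof (intro conjI ballI)
    show "0 \<in> range (of_int :: int \<Rightarrow> 'k)" by (metis of_int_0 rangeI)
    show "1 \<in> range (of_int :: int \<Rightarrow> 'k)" by (metis of_int_1 rangeI)
    fix x :: 'k assume "x \<in> range of_int"
    then obtain a where a: "x = of_int a" by blast
    show "- x \<in> range of_int" by (metis a of_int_minus rangeI)
    show "inverse x \<in> range of_int"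
    proof (cases "x = 0")
      case False
      have "\<not> int l dvd a"
      proof
        assume "int l dvd a"
        then have "a mod int l = 0" by simp
        then show False using period[of a] a False by simp
      qed
      then have "coprime (int l) a" using pl prime_imp_coprime by blast
      then have "gcd a (int l) = 1" by (simp add: coprime_iff_gcd_eq_1 gcd.commute)
      then obtain u w where "u * a + w * int l = 1" using bezout_int[of a "int l"] by auto
      then have "(of_int (u * a + w * int l) :: 'k) = 1" by simp
      then have "x * of_int u = 1" unfolding of_int_add of_int_mult l0 a by (simp add: mult.commute)
      then have "inverse x = of_int u" by (rule inverse_unique)
      then show ?thesis by simp
    qed (metis inverse_zero of_int_0 rangeI)
    fix y :: 'k assume "y \<in> range of_int"
    then obtain b where b: "y = of_int b" by blast
    show "x + y \<in> range of_int" by (metis a b of_int_add rangeI)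
    show "x * y \<in> range of_int" by (metis a b of_int_mult rangeI)
  qed
  fix x assume x: "x \<in> Q" "v x \<le> 1"
  interpret Metric_space UNIV "\<lambda>x y. v (x - y)" by (rule metric_space_abs[OF nonarch_abs])
  have "x \<in> mtopology closure_of {of_int a / of_int b | a b. b \<noteq> 0}"
    using Q x unfolding is_ladic_field_def abs_topology_def by blast
  then obtain a b where ab: "b \<noteq> 0" "v (x - of_int a / of_int b) < 1"
    unfolding metric_closure_of by (auto simp: mball_def dest!: spec[of _ 1])
  define r where "r = (of_int a / of_int b :: 'l)"
  have "v r \<le> 1" using v_diff[of x "x - r"] ab x by (simp add: r_def)
  then have redx: "red x = red r" using red_eq_iff[of x r] x ab by (simp add: r_def)
  show "red x \<in> range of_int"
  proof (cases "a = 0")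
    case True
    then show ?thesis using redx subfield_setD(1)[OF sub] by (simp add: r_def)
  next
    case False
    \<comment> \<open>Integrality of a / b means that l divides a at least as often as b, so this
      power of l cancels.\<close>
    let ?m = "multiplicity (int l) b"
    have bv: "v (of_int b) \<noteq> 0" using v_int[OF ab(1)] l1 by simp
    then have "v (of_int a) \<le> v (of_int b)"
      using \<open>v r \<le> 1\<close> v_nonneg[of "of_int b"] by (simp add: r_def v_divide divide_le_eq less_le)
    then have "real l ^ ?m \<le> real l ^ multiplicity (int l) a"
      using v_int[OF False] v_int[OF ab(1)] l1 by simp
    then have "?m \<le> multiplicity (int l) a" using l1 by simp
    then obtain a' where a': "a = int l ^ ?m * a'" using multiplicity_dvd'[of ?m "int l" a] by (auto elim: dvdE)
    obtain b' where b': "b = int l ^ ?m * b'" using multiplicity_dvd[of "int l" b] by (auto elim: dvdE)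
    have b'0: "b' \<noteq> 0" using b' ab(1) by auto
    have "multiplicity (int l) b = ?m + multiplicity (int l) b'"
      by (subst (1) b') (use pl b'0 in \<open>simp add: prime_elem_multiplicity_mult_distrib multiplicity_same_power\<close>)
    then have vb': "v (of_int b') = 1" using v_int[OF b'0] by simp
    then have "of_int b' \<noteq> (0::'l)" by auto
    have "of_int (int l ^ ?m) \<noteq> (0 :: 'l)"
    proof
      assume "of_int (int l ^ ?m) = (0 :: 'l)"
      then have "v (of_int (int l ^ ?m)) = 0" by (simp only: v_0)
      moreover have "v (of_int (int l ^ ?m)) = inverse (real l ^ multiplicity (int l) (int l ^ ?m))"
        by (rule v_int) (use l1 in simp)
      moreover have "inverse (real l ^ multiplicity (int l) (int l ^ ?m)) \<noteq> 0" using l1 by simp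
      ultimately show False by metis
    qed
    moreover define c where "c = (of_int (int l ^ ?m) :: 'l)"
    moreover have "of_int a = c * of_int a'" "of_int b = c * of_int b'"
      unfolding c_def of_int_mult[symmetric] by (rule arg_cong[OF a'], rule arg_cong[OF b'])
    ultimately have "r = of_int a' * inverse (of_int b')" unfolding r_def by (simp only:) (simp add: field_simps)
    then have "red r = red (of_int a') * inverse (red (of_int b'))"
      using vb' v_int_le[of a'] by (simp add: red_mult v_inverse red_inverse)
    also have "\<dots> \<in> range of_int"
      unfolding red_int by (intro subfield_setD(4,6)[OF sub]) auto
    finally show ?thesis using redx by simp
  qed
qed

text \<open>The powers of x with exponents 0, ..., \<open>card B\<close> are linearly dependent over
  \<open>Q\<close>. Dividing the relation by its coefficient of largest absolute value makes it
  integral with one coefficient equal to 1, so the reduced polynomial is not 0.\<close>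

lemma (in residue) residue_algebraic:
  assumes Q: "subfield_set Q" and E: "finitely_spanned Q E" "subfield_set E" "x \<in> E" "v x \<le> 1"
    and P: "subfield_set P" "\<And>x. x \<in> Q \<Longrightarrow> v x \<le> 1 \<Longrightarrow> red x \<in> P"
  shows "\<exists>p\<in>poly_over P. p \<noteq> 0 \<and> poly p (red x) = 0"
proof -
  obtain B where B: "finite B" "E = span_of Q B" using E(1) by (auto simp: finitely_spanned_def)
  let ?N = "card B"
  have "\<exists>c. (\<forall>b\<in>B. c b \<in> Q) \<and> x ^ i = (\<Sum>b\<in>B. c b * b)" for i
  proof -
    have "x ^ i \<in> span_of Q B" using subfield_set_power[OF E(2,3)] B by blast
    then show ?thesis unfolding span_of_def by blast
  qed
  then obtain c where c: "\<And>i b. b \<in> B \<Longrightarrow> c i b \<in> Q" "\<And>i. x ^ i = (\<Sum>b\<in>B. c i b * b)" by metis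
  obtain \<beta> where \<beta>: "bij_betw \<beta> {..<?N} B" using ex_bij_betw_nat_finite[OF B(1)] by (auto simp: lessThan_atLeast0)
  have \<beta>B: "\<beta> j \<in> B" if "j < ?N" for j using bij_betwE[OF \<beta>] that by auto
  obtain f where f0: "\<forall>i\<in>{..?N}. f i \<in> Q" "\<exists>i\<in>{..?N}. f i \<noteq> 0"
      "\<forall>j<?N. (\<Sum>i\<le>?N. f i * c i (\<beta> j)) = 0"
    using exists_annihilator_over[OF Q, of "{..?N}" ?N "\<lambda>j i. c i (\<beta> j)"] c(1) \<beta>B by auto
  have f: "f i \<in> Q" if "i \<le> ?N" for i using f0(1) that by simp
  have f3: "(\<Sum>i\<le>?N. f i * c i (\<beta> j)) = 0" if "j < ?N" for j using f0(3) that by blast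
  have rel: "(\<Sum>i\<le>?N. f i * x ^ i) = 0"
  proof -
    have "(\<Sum>i\<le>?N. f i * c i b) = 0" if b: "b \<in> B" for b
    proof -
      obtain j where "j < ?N" "b = \<beta> j" using \<beta> b by (metis bij_betw_iff_bijections lessThan_iff)
      then show ?thesis using f3 by simp
    qed
    moreover have "(\<Sum>i\<le>?N. f i * x ^ i) = (\<Sum>b\<in>B. (\<Sum>i\<le>?N. f i * c i b) * b)"
      unfolding c(2) sum_distrib_left sum_distrib_right by (subst sum.swap) (simp add: mult.assoc)
    ultimately show ?thesis by simp
  qed
  define m where "m = Max ((\<lambda>i. v (f i)) ` {..?N})"
  have "m \<in> (\<lambda>i. v (f i)) ` {..?N}" unfolding m_def by (intro Max_in) auto
  then obtain k where k: "k \<le> ?N" "v (f k) = m" by auto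
  have le: "v (f i) \<le> v (f k)" if "i \<le> ?N" for i unfolding k(2) m_def using that by (intro Max_ge) auto
  have fk: "f k \<noteq> 0"
  proof
    assume "f k = 0"
    then have "v (f i) = 0" if "i \<le> ?N" for i using le[OF that] v_nonneg[of "f i"] by simp
    then show False using f0(2) by simp
  qed
  then have vfk: "v (f k) > 0" using v_nonneg[of "f k"] by (simp add: less_le)
  define g where "g i = f i / f k" for i
  have g: "g i \<in> Q" "v (g i) \<le> 1" if "i \<le> ?N" for i
    using f[OF that] f[OF k(1)] le[OF that] vfk subfield_setD(8)[OF Q]
    by (auto simp: g_def v_divide divide_le_eq)
  have xi: "v (x ^ i) \<le> 1" for i using E(4) by (simp add: v_power power_le_one)
  have "(\<Sum>i\<le>?N. g i * x ^ i) = (\<Sum>i\<le>?N. f i * x ^ i) / f k"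
    by (simp add: g_def sum_divide_distrib)
  then have "red (\<Sum>i\<le>?N. g i * x ^ i) = 0" using rel by simp
  moreover have redpow: "red (x ^ i) = red x ^ i" for i
  proof (induction i)
    case (Suc i)
    then show ?case using red_mult[OF E(4) xi] by simp
  qed simp
  have "red (\<Sum>i\<le>?N. g i * x ^ i) = (\<Sum>i\<le>?N. red (g i * x ^ i))"
    using g xi by (intro red_sum v_mult_le_1) auto
  also have "\<dots> = (\<Sum>i\<le>?N. red (g i) * red x ^ i)"
    using g(2) xi redpow by (intro sum.cong refl) (simp add: red_mult)
  ultimately have rel': "(\<Sum>i\<le>?N. red (g i) * red x ^ i) = 0" by simp
  define p where "p = (\<Sum>i\<le>?N. monom (red (g i)) i)"
  have coeff: "coeff p i = (if i \<le> ?N then red (g i) else 0)" for i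
    by (simp add: p_def coeff_sum)
  have "p \<in> poly_over P"
    using P(2) g subfield_setD(1)[OF P(1)] by (auto simp: poly_over_coeff[OF P(1)] coeff)
  moreover have "p \<noteq> 0"
  proof
    assume "p = 0"
    then have "red (g k) = 0" using coeff[of k] k(1) by simp
    then show False using fk by (simp add: g_def)
  qed
  moreover have "poly p (red x) = 0" using rel' by (simp add: p_def poly_sum poly_monom)
  ultimately show ?thesis by blast
qed

text \<open>Every finite subset of the big field lies in a field finitely spanned over
  \<open>Q\<close>, where completeness and the behaviour of v under automorphisms are known. The
  residue field is algebraic over the prime field, hence locally finite.\<close>

lemma coefficient_field_ladic:
  assumes l: "prime l" and K: "finite_ext_of_ladic l v K" and red: "residue_map v red"
    and gal: "galois_extension K"
  shows "coefficient_field v red K"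
proof -
  have v: "nonarch_abs v" using K by (simp add: finite_ext_of_ladic_def)
  interpret residue v red using v red by unfold_locales
  obtain Q where Q: "is_ladic_field l v Q" "Q \<subseteq> K"
      and dim: "ring.finite_dimension (class_ring :: 'a ring) Q K"
    using K by (auto simp: finite_ext_of_ladic_def)
  have Qs: "subfield_set Q" using Q(1) by (simp add: is_ladic_field_def subfield_iff)
  have Qc: "complete_subset v Q"
    using Q(1) by (intro mcomplete_complete_subset[OF v]) (simp add: is_ladic_field_def)
  have Ks: "finitely_spanned Q K" by (rule finite_dimension_finitely_spanned[OF Qs dim])
  note Kf = K_subfield[OF gal]
  have ext: "\<exists>E. subfield_set E \<and> K \<subseteq> E \<and> S \<subseteq> E \<and> finitely_spanned Q E" if "finite S" for S
    by (rule finitely_spanned_adjoin_finite[OF that Qs Kf Q(2) Ks algebraic_over[OF gal order_refl]])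
  have v_le: "v (\<gamma> x) \<le> v x" if \<gamma>: "\<gamma> \<in> Gal K" for \<gamma> x
  proof -
    obtain E where E: "subfield_set E" "K \<subseteq> E" "x \<in> E" "finitely_spanned Q E" using ext[of "{x}"] by auto
    show ?thesis
      using \<gamma> Q(2) by (intro automorphism_v_le[OF Qs Qc E(1,4,3)]) (auto simp: Gal_iff)
  qed
  note P = ladic_residues[OF l Q(1)]
  have alg: "\<exists>p\<in>poly_over (range of_int). p \<noteq> 0 \<and> poly p y = 0" for y :: 'b
  proof -
    obtain x where x: "v x \<le> 1" "red x = y" by (rule red_surj)
    obtain E where E: "subfield_set E" "x \<in> E" "finitely_spanned Q E" using ext[of "{x}"] by auto
    show ?thesis using residue_algebraic[OF Qs E(3,1,2) x(1) P(1) P(3)] x(2) by blast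
  qed
  show "coefficient_field v red K"
    unfolding coefficient_field_def
  proof (intro conjI allI impI ballI)
    show "\<exists>E. subfield_set E \<and> complete_subset v E \<and> S \<subseteq> E" if "finite S" for S
      using ext[OF that] finitely_spanned_complete[OF Qs Qc] by blast
    show "v (\<gamma> x) = v x" if "\<gamma> \<in> Gal K" for \<gamma> x
    \<comment> \<open>The reverse inequality is the same one for the inverse automorphism.\<close>
    proof (rule antisym[OF v_le[OF that]])
      have "v (inv_into UNIV \<gamma> (\<gamma> x)) \<le> v (\<gamma> x)" by (rule v_le[OF Gal_inv[OF that]])
      moreover have "inv_into UNIV \<gamma> (\<gamma> x) = x" using that by (simp add: Gal_iff bij_def inv_f_f)
      ultimately show "v x \<le> v (\<gamma> x)" by simp
    qed
    show "\<exists>F. finite F \<and> subfield_set F \<and> S \<subseteq> F" if "finite S" for S :: "'b set"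
      by (rule finite_subfield_of_algebraic[OF P(1,2) alg that])
  qed (use v red in auto)
qed

section \<open>Matrix groups and projective classes\<close>

lemma mat_group_simps [simp]: "carrier (mat_group n S) = S" "monoid.mult (mat_group n S) = (*)"
  "\<one>\<^bsub>mat_group n S\<^esub> = 1\<^sub>m n"
  by (simp_all add: mat_group_def)

lemma GL_iff: "A \<in> GL n F \<longleftrightarrow> A \<in> carrier_mat n n \<and> (\<forall>i<n. \<forall>j<n. A $$ (i, j) \<in> F) \<and> det A \<noteq> 0"
  using elements_mat_subset_iff[of A n n F] by (auto simp: GL_def)

lemma GL_one: "subfield_set F \<Longrightarrow> 1\<^sub>m n \<in> GL n F"
  using subfield_setD(1,2)[of F] by (auto simp: GL_iff)

lemma GL_mult:
  assumes F: "subfield_set F" and A: "A \<in> GL n F" and B: "B \<in> GL n F"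
  shows "A * B \<in> GL n F"
proof -
  have c: "A \<in> carrier_mat n n" "B \<in> carrier_mat n n" using A B by (auto simp: GL_iff)
  have "(A * B) $$ (i, j) \<in> F" if "i < n" "j < n" for i j
    unfolding index_mult_mat_sum[OF c that] using A B that
    by (intro subfield_set_sum[OF F] subfield_setD(4)[OF F]) (auto simp: GL_iff)
  then show ?thesis using A B c det_mult[OF c] by (auto simp: GL_iff)
qed

text \<open>The adjugate formula keeps the entries of the inverse in \<open>F\<close>.\<close>

lemma GL_inverse:
  fixes F :: "'l::field set"
  assumes F: "subfield_set F" and A: "A \<in> GL n F"
  obtains B where "B \<in> GL n F" "A * B = 1\<^sub>m n" "B * A = 1\<^sub>m n"
proof -
  have c: "A \<in> carrier_mat n n" and d: "det A \<noteq> 0" using A by (auto simp: GL_iff)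
  define B where "B = inverse (det A) \<cdot>\<^sub>m adj_mat A"
  have Bc: "B \<in> carrier_mat n n" using adj_mat(1)[OF c] by (simp add: B_def)
  have "A * B = inverse (det A) \<cdot>\<^sub>m (A * adj_mat A)"
    unfolding B_def by (rule mult_smult_distrib[OF c adj_mat(1)[OF c]])
  then have AB: "A * B = 1\<^sub>m n" using d adj_mat(2)[OF c] by (intro eq_matI) auto
  have "B * A = inverse (det A) \<cdot>\<^sub>m (adj_mat A * A)"
    unfolding B_def by (rule mult_smult_assoc_mat[OF adj_mat(1)[OF c] c])
  then have BA: "B * A = 1\<^sub>m n" using d adj_mat(3)[OF c] by (intro eq_matI) auto
  have "det A * det B = 1" using AB det_mult[OF c Bc] by simp
  then have "det B \<noteq> 0" by auto
  moreover have "B $$ (i, j) \<in> F" if ij: "i < n" "j < n" for i j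
  proof -
    have "mat_delete A j i \<in> carrier_mat (n - 1) (n - 1)" using mat_delete_carrier[OF c] .
    moreover have "mat_delete A j i $$ (a, b) \<in> F" if "a < n - 1" "b < n - 1" for a b
      using that A c ij by (auto simp: mat_delete_def GL_iff)
    ultimately have "det (mat_delete A j i) \<in> F" by (rule subfield_set_det[OF F])
    then have "cofactor A j i \<in> F"
      unfolding cofactor_def
      by (intro subfield_setD(4)[OF F] subfield_set_power[OF F] subfield_setD(2,5)[OF F])
    moreover have "det A \<in> F" by (rule subfield_set_det[OF F c]) (use A in \<open>auto simp: GL_iff\<close>)
    ultimately show ?thesis
      using ij c by (auto simp: B_def adj_mat_def intro!: subfield_setD(4,6)[OF F])
  qed
  ultimately have "B \<in> GL n F" using Bc by (auto simp: GL_iff)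
  then show thesis using that AB BA by blast
qed

text \<open>The standard symplectic matrix has square -1.\<close>

lemma det_symp_mat: "even n \<Longrightarrow> det (symp_mat n :: 'l::field mat) \<noteq> 0"
proof -
  assume "even n"
  then obtain m where n: "n = 2 * m" by (rule evenE)
  have c: "(symp_mat n :: 'l mat) \<in> carrier_mat n n" by (rule symp_mat_carrier) fact
  have "symp_mat n * symp_mat n = - (1\<^sub>m n :: 'l mat)"
  proof -
    have "symp_mat n * symp_mat n = four_block_mat (- 1\<^sub>m m) (0\<^sub>m m m) (0\<^sub>m m m) (- 1\<^sub>m m :: 'l mat)"
      unfolding symp_mat_def Let_def n
      by (subst mult_four_block_mat[of _ m m _ m _ m _ _ m _ m]) (auto intro!: cong_four_block_mat eq_matI)
    also have "\<dots> = - (1\<^sub>m n)" unfolding n by (intro eq_matI) auto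
    finally show ?thesis .
  qed
  then have "det (symp_mat n :: 'l mat) * det (symp_mat n :: 'l mat) = det (- (1\<^sub>m n :: 'l mat))"
    using det_mult[OF c c] by simp
  moreover have "- (1\<^sub>m n) = (- 1) \<cdot>\<^sub>m (1\<^sub>m n :: 'l mat)" by (intro eq_matI) auto
  ultimately show ?thesis by auto
qed

lemma symp_mat_alternating:
  assumes "even n" "i < n" "j < n"
  shows "symp_mat n $$ (i, i) = (0 :: 'l::field)" "symp_mat n $$ (j, i) = - (symp_mat n $$ (i, j) :: 'l)"
proof -
  obtain m where n: "n = 2 * m" using assms(1) by (rule evenE)
  show "symp_mat n $$ (i, i) = (0 :: 'l)" "symp_mat n $$ (j, i) = - (symp_mat n $$ (i, j) :: 'l)"
    using assms(2,3) unfolding n by (auto simp: symp_mat_index)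
qed

lemma alternating_congruence:
  fixes J P :: "'l::field mat"
  assumes J: "J \<in> carrier_mat n n" "\<And>i. i < n \<Longrightarrow> J $$ (i, i) = 0"
      "\<And>i j. i < n \<Longrightarrow> j < n \<Longrightarrow> J $$ (j, i) = - J $$ (i, j)"
    and P: "P \<in> carrier_mat n n" and ij: "i < n" "j < n"
  shows "(P\<^sup>T * J * P) $$ (i, i) = 0" "(P\<^sup>T * J * P) $$ (j, i) = - (P\<^sup>T * J * P) $$ (i, j)"
proof -
  have PJ: "P\<^sup>T * J \<in> carrier_mat n n" using P J(1) by simp
  have e: "(P\<^sup>T * J * P) $$ (a, b) = (\<Sum>k<n. \<Sum>l<n. P $$ (k, a) * J $$ (k, l) * P $$ (l, b))"
    if "a < n" "b < n" for a b
  proof -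
    have "(P\<^sup>T * J * P) $$ (a, b) = (\<Sum>l<n. (\<Sum>k<n. P $$ (k, a) * J $$ (k, l)) * P $$ (l, b))"
      unfolding index_mult_mat_sum[OF PJ P that] using that P J(1)
      by (intro sum.cong refl arg_cong2[of _ _ _ _ "(*)"])
        (simp add: index_mult_mat_sum[of _ n n] del: index_mult_mat(1))
    also have "\<dots> = (\<Sum>l<n. \<Sum>k<n. P $$ (k, a) * J $$ (k, l) * P $$ (l, b))"
      by (simp add: sum_distrib_right)
    also have "\<dots> = (\<Sum>k<n. \<Sum>l<n. P $$ (k, a) * J $$ (k, l) * P $$ (l, b))" by (rule sum.swap)
    finally show ?thesis .
  qed
  have J3: "P $$ (l, a) * J $$ (l, k) * P $$ (k, b) = - (P $$ (k, b) * J $$ (k, l) * P $$ (l, a))"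
    if "k < n" "l < n" for k l a b
    unfolding J(3)[OF that] by simp
  show "(P\<^sup>T * J * P) $$ (i, i) = 0"
    unfolding e[OF ij(1,1)] by (rule sum_alternating) (simp add: J(2), rule J3)
  have "(P\<^sup>T * J * P) $$ (j, i) = (\<Sum>l<n. \<Sum>k<n. P $$ (k, j) * J $$ (k, l) * P $$ (l, i))"
    unfolding e[OF ij(2,1)] by (rule sum.swap)
  also have "\<dots> = (\<Sum>l<n. \<Sum>k<n. - (P $$ (l, i) * J $$ (l, k) * P $$ (k, j)))"
    by (intro sum.cong refl J3) auto
  also have "\<dots> = - (P\<^sup>T * J * P) $$ (i, j)" unfolding e[OF ij] by (simp add: sum_negf)
  finally show "(P\<^sup>T * J * P) $$ (j, i) = - (P\<^sup>T * J * P) $$ (i, j)" .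
qed

text \<open>Treats both groups at once. Apart from the construction of the adapted basis, the
  descent relies on closure under products, inverses, scalars and automorphisms, and on testing
  membership over \<open>F\<close> by the entries.\<close>

locale matrix_functor =
  fixes n :: nat and M :: "'l::field set \<Rightarrow> 'l mat set"
  assumes n: "n > 0" and M: "M = GL n \<or> (even n \<and> M = GSp n)"
begin

lemma M_GL: "A \<in> M F \<Longrightarrow> A \<in> GL n F"
  using M by (auto simp: GSp_def)

lemma M_carrier: "A \<in> M F \<Longrightarrow> A \<in> carrier_mat n n"
  using M_GL by (auto simp: GL_iff)

lemma GSp_I: "A \<in> GL n F \<Longrightarrow> A\<^sup>T * symp_mat n * A = c \<cdot>\<^sub>m symp_mat n \<Longrightarrow> c \<in> F \<Longrightarrow> c \<noteq> 0 \<Longrightarrow> A \<in> GSp n F"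
  by (auto simp: GSp_def)

lemma GSp_E:
  assumes "A \<in> GSp n F"
  obtains c where "A \<in> GL n F" "A\<^sup>T * symp_mat n * A = c \<cdot>\<^sub>m symp_mat n" "c \<in> F" "c \<noteq> 0"
  using assms by (auto simp: GSp_def)

lemma M_one: "subfield_set F \<Longrightarrow> 1\<^sub>m n \<in> M F"
proof -
  assume F: "subfield_set F"
  have "1\<^sub>m n \<in> GSp n F" if "even n"
    by (rule GSp_I[OF GL_one[OF F], of 1])
      (use symp_mat_carrier[OF that, where 'a='l] subfield_setD(2)[OF F] in \<open>auto intro!: eq_matI\<close>)
  then show ?thesis using M GL_one[OF F] by auto
qed

lemma M_mult:
  assumes F: "subfield_set F" and A: "A \<in> M F" and B: "B \<in> M F"
  shows "A * B \<in> M F"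
proof (cases "M = GL n")
  case True
  then show ?thesis using GL_mult[OF F] A B by simp
next
  case False
  then have e: "even n" "M = GSp n" using M by auto
  let ?J = "symp_mat n :: 'l mat"
  have J: "?J \<in> carrier_mat n n" by (rule symp_mat_carrier[OF e(1)])
  obtain a where a: "A\<^sup>T * ?J * A = a \<cdot>\<^sub>m ?J" "a \<in> F" "a \<noteq> 0" using A e GSp_E by metis
  obtain b where b: "B\<^sup>T * ?J * B = b \<cdot>\<^sub>m ?J" "b \<in> F" "b \<noteq> 0" using B e GSp_E by metis
  have c: "A \<in> carrier_mat n n" "B \<in> carrier_mat n n" using A B M_carrier by auto
  have "(A * B)\<^sup>T * ?J * (A * B) = B\<^sup>T * (A\<^sup>T * ?J * A) * B"
    using c J by (simp add: transpose_mult[OF c] mat_assoc)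
  also have "\<dots> = a \<cdot>\<^sub>m (B\<^sup>T * ?J * B)"
    unfolding a(1) using c J mult_smult_distrib[of "B\<^sup>T" n n ?J n a] mult_smult_assoc_mat[of "B\<^sup>T * ?J" n n B n a]
    by simp
  also have "\<dots> = (a * b) \<cdot>\<^sub>m ?J" unfolding b(1) using J by (intro eq_matI) auto
  finally show ?thesis
    using GSp_I[of "A * B" F "a * b"] GL_mult[OF F M_GL[OF A] M_GL[OF B]] a b subfield_setD(4)[OF F] e by auto
qed

lemma M_inverse:
  assumes F: "subfield_set F" and A: "A \<in> M F"
  obtains B where "B \<in> M F" "A * B = 1\<^sub>m n" "B * A = 1\<^sub>m n"
proof -
  obtain B where B: "B \<in> GL n F" "A * B = 1\<^sub>m n" "B * A = 1\<^sub>m n" by (rule GL_inverse[OF F M_GL[OF A]])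
  have "B \<in> M F"
  proof (cases "M = GL n")
    case False
    then have e: "even n" "M = GSp n" using M by auto
    let ?J = "symp_mat n :: 'l mat"
    have J: "?J \<in> carrier_mat n n" by (rule symp_mat_carrier[OF e(1)])
    obtain a where a: "A\<^sup>T * ?J * A = a \<cdot>\<^sub>m ?J" "a \<in> F" "a \<noteq> 0" using A e GSp_E by metis
    have c: "A \<in> carrier_mat n n" "B \<in> carrier_mat n n" using A M_carrier B by (auto simp: GL_iff)
    have "B\<^sup>T * A\<^sup>T = 1\<^sub>m n" using transpose_mult[OF c] B by simp
    then have BA: "B\<^sup>T * (A\<^sup>T * Z) = Z" if "Z \<in> carrier_mat n n" for Z
      using that c by (simp add: mat_assoc[symmetric])
    have "?J = B\<^sup>T * (A\<^sup>T * (?J * (A * B)))" using BA J B(2) by simp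
    also have "\<dots> = B\<^sup>T * (A\<^sup>T * ?J * A) * B" using c J by (simp add: mat_assoc)
    also have "\<dots> = a \<cdot>\<^sub>m (B\<^sup>T * ?J * B)"
      unfolding a(1) using c J mult_smult_distrib[of "B\<^sup>T" n n ?J n a] mult_smult_assoc_mat[of "B\<^sup>T * ?J" n n B n a]
      by simp
    finally have Ja: "?J = a \<cdot>\<^sub>m (B\<^sup>T * ?J * B)" .
    have "B\<^sup>T * ?J * B = inverse a \<cdot>\<^sub>m (a \<cdot>\<^sub>m (B\<^sup>T * ?J * B))"
      using a by (intro eq_matI) auto
    then have "B\<^sup>T * ?J * B = inverse a \<cdot>\<^sub>m ?J" using Ja by simp
    then show ?thesis using GSp_I[OF B(1)] a subfield_setD(6)[OF F] e by simp
  qed (use B in simp)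
  then show thesis using that B by blast
qed

lemma group_M: "subfield_set F \<Longrightarrow> group (mat_group n (M F))"
proof (rule groupI)
  assume F: "subfield_set F"
  show "\<exists>y\<in>carrier (mat_group n (M F)). y \<otimes>\<^bsub>mat_group n (M F)\<^esub> x = \<one>\<^bsub>mat_group n (M F)\<^esub>"
    if "x \<in> carrier (mat_group n (M F))" for x
    using M_inverse[OF F, of x] that by (metis mat_group_simps)
  show "x \<otimes>\<^bsub>mat_group n (M F)\<^esub> y \<otimes>\<^bsub>mat_group n (M F)\<^esub> z
      = x \<otimes>\<^bsub>mat_group n (M F)\<^esub> (y \<otimes>\<^bsub>mat_group n (M F)\<^esub> z)"
    if "x \<in> carrier (mat_group n (M F))" "y \<in> carrier (mat_group n (M F))" "z \<in> carrier (mat_group n (M F))"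
    for x y z
    using M_carrier[of x F] M_carrier[of y F] M_carrier[of z F] that by simp
  show "\<one>\<^bsub>mat_group n (M F)\<^esub> \<otimes>\<^bsub>mat_group n (M F)\<^esub> x = x"
    if "x \<in> carrier (mat_group n (M F))" for x
    using M_carrier[of x F] that by simp
qed (use M_mult M_one in auto)

lemma UNIV_field: "subfield_set (UNIV :: 'l set)"
  by (simp add: subfield_set_def)

lemma M_inv:
  assumes A: "A \<in> M UNIV"
  shows "inv\<^bsub>mat_group n (M UNIV)\<^esub> A \<in> M UNIV" "A * inv\<^bsub>mat_group n (M UNIV)\<^esub> A = 1\<^sub>m n"
    "inv\<^bsub>mat_group n (M UNIV)\<^esub> A * A = 1\<^sub>m n"
proof -
  interpret group "mat_group n (M UNIV)" by (rule group_M[OF UNIV_field])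
  show "inv\<^bsub>mat_group n (M UNIV)\<^esub> A \<in> M UNIV" "A * inv\<^bsub>mat_group n (M UNIV)\<^esub> A = 1\<^sub>m n"
    "inv\<^bsub>mat_group n (M UNIV)\<^esub> A * A = 1\<^sub>m n"
    using inv_closed[of A] r_inv[of A] l_inv[of A] A by simp_all
qed

lemma M_smult:
  assumes "A \<in> M F" "c \<in> F" "c \<noteq> 0" "subfield_set F"
  shows "c \<cdot>\<^sub>m A \<in> M F"
proof -
  have A: "A \<in> carrier_mat n n" using assms M_carrier by blast
  have GL: "c \<cdot>\<^sub>m A \<in> GL n F"
    using M_GL[OF assms(1)] assms subfield_setD(4)[OF assms(4)] by (auto simp: GL_iff)
  show ?thesis
  proof (cases "M = GL n")
    case False
    then have e: "even n" "M = GSp n" using M by auto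
    let ?J = "symp_mat n :: 'l mat"
    have J: "?J \<in> carrier_mat n n" by (rule symp_mat_carrier[OF e(1)])
    obtain a where a: "A\<^sup>T * ?J * A = a \<cdot>\<^sub>m ?J" "a \<in> F" "a \<noteq> 0" using assms e GSp_E by metis
    have t: "(c \<cdot>\<^sub>m A)\<^sup>T = c \<cdot>\<^sub>m A\<^sup>T" by (intro eq_matI) auto
    have "(c \<cdot>\<^sub>m A)\<^sup>T * ?J * (c \<cdot>\<^sub>m A) = c \<cdot>\<^sub>m (c \<cdot>\<^sub>m (A\<^sup>T * ?J * A))"
      unfolding t using A J mult_smult_assoc_mat[of "A\<^sup>T" n n ?J n c]
        mult_smult_distrib[of "c \<cdot>\<^sub>m (A\<^sup>T * ?J)" n n A n c] mult_smult_assoc_mat[of "A\<^sup>T * ?J" n n A n c] by simp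
    also have "\<dots> = (c * (c * a)) \<cdot>\<^sub>m ?J" unfolding a(1) using J by (intro eq_matI) auto
    finally show ?thesis
      using GSp_I[OF GL, of "c * (c * a)"] a assms subfield_setD(4)[OF assms(4)] e by auto
  qed (use GL in simp)
qed

text \<open>The multiplier of a symplectic similitude is rational over the field of its entries:
  with n = 2 m it is entry (0, m) of \<open>A\<^sup>T * symp_mat n * A\<close>, since that entry of
  \<open>symp_mat n\<close> is 1.\<close>

lemma M_descend:
  assumes "A \<in> M UNIV" "\<And>i j. i < n \<Longrightarrow> j < n \<Longrightarrow> A $$ (i, j) \<in> F" "subfield_set F"
  shows "A \<in> M F"
proof -
  have A: "A \<in> carrier_mat n n" using assms M_carrier by blast
  have GL: "A \<in> GL n F" using M_GL[OF assms(1)] assms(2) by (auto simp: GL_iff)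
  show ?thesis
  proof (cases "M = GL n")
    case False
    then have e: "even n" "M = GSp n" using M by auto
    then obtain m where m: "n = 2 * m" by blast
    let ?J = "symp_mat n :: 'l mat"
    have J: "?J \<in> carrier_mat n n" by (rule symp_mat_carrier[OF e(1)])
    have JF: "?J $$ (i, j) \<in> F" if "i < n" "j < n" for i j
      using that subfield_setD(1,2,5)[OF assms(3)] unfolding m by (auto simp: symp_mat_index)
    obtain a where a: "A\<^sup>T * ?J * A = a \<cdot>\<^sub>m ?J" "a \<noteq> 0" using assms(1) e GSp_E by metis
    have "m > 0" using n m by simp
    have "a = (a \<cdot>\<^sub>m ?J) $$ (0, m)" using J \<open>m > 0\<close> unfolding m by (simp add: symp_mat_index)
    also have "\<dots> = (A\<^sup>T * ?J * A) $$ (0, m)" using a by simp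
    also have "\<dots> = (\<Sum>l<n. (\<Sum>k<n. A $$ (k, 0) * ?J $$ (k, l)) * A $$ (l, m))"
    proof -
      have "A\<^sup>T * ?J \<in> carrier_mat n n" "(0::nat) < n" "m < n" using A J n m \<open>m > 0\<close> by auto
      note ind = index_mult_mat_sum[OF this(1) A this(2,3)]
      have "(A\<^sup>T * ?J) $$ (0, l) = (\<Sum>k<n. A $$ (k, 0) * ?J $$ (k, l))" if "l < n" for l
        using A J n that by (simp add: index_mult_mat_sum[of _ n n] del: index_mult_mat(1))
      then show ?thesis unfolding ind by (intro sum.cong) auto
    qed
    also have "\<dots> \<in> F" using assms(2) JF \<open>m > 0\<close> m
      by (intro subfield_set_sum[OF assms(3)] subfield_setD(4)[OF assms(3)]) auto
    finally show ?thesis using GSp_I[OF GL a(1) _ a(2)] e by simp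
  qed (use GL in simp)
qed

lemma M_mono: "A \<in> M F \<Longrightarrow> A \<in> M UNIV"
proof (cases "M = GL n")
  case False
  assume "A \<in> M F"
  then obtain c where "A \<in> GL n F" "A\<^sup>T * symp_mat n * A = c \<cdot>\<^sub>m symp_mat n" "c \<noteq> 0"
    using False M by (auto elim: GSp_E)
  then show ?thesis using GSp_I[of A UNIV c] False M by (auto simp: GL_iff)
qed (auto simp: GL_iff)

lemma map_symp_mat:
  fixes \<gamma> :: "'l \<Rightarrow> 'l"
  assumes "comm_ring_hom \<gamma>" "even n"
  shows "map_mat \<gamma> (symp_mat n) = (symp_mat n :: 'l mat)"
proof -
  interpret comm_ring_hom \<gamma> by fact
  obtain m where m: "n = 2 * m" using assms(2) by blast
  have J: "(symp_mat n :: 'l mat) \<in> carrier_mat n n" by (rule symp_mat_carrier[OF assms(2)])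
  have "\<gamma> (symp_mat n $$ (i, j)) = symp_mat n $$ (i, j)" if "i < n" "j < n" for i j
    using that unfolding m by (simp add: symp_mat_index hom_uminus)
  then show ?thesis using J by (intro eq_matI) auto
qed

lemma M_map:
  assumes A: "A \<in> M UNIV" and \<gamma>: "comm_ring_hom \<gamma>" "inj \<gamma>"
  shows "map_mat \<gamma> A \<in> M UNIV"
proof -
  interpret comm_ring_hom \<gamma> by fact
  have c: "A \<in> carrier_mat n n" using A M_carrier by blast
  have \<gamma>0: "\<gamma> x \<noteq> 0" if "x \<noteq> 0" for x using \<gamma>(2) that hom_zero by (metis injD)
  have GL: "map_mat \<gamma> A \<in> GL n UNIV" using M_GL[OF A] \<gamma>0 by (auto simp: GL_iff)
  show ?thesis
  proof (cases "M = GL n")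
    case False
    then have e: "even n" "M = GSp n" using M by auto
    let ?J = "symp_mat n :: 'l mat"
    have J: "?J \<in> carrier_mat n n" by (rule symp_mat_carrier[OF e(1)])
    obtain a where a: "A\<^sup>T * ?J * A = a \<cdot>\<^sub>m ?J" "a \<noteq> 0" using A e GSp_E by metis
    have t: "(map_mat \<gamma> A)\<^sup>T = map_mat \<gamma> (A\<^sup>T)" using c by (intro eq_matI) auto
    have "(map_mat \<gamma> A)\<^sup>T * ?J * map_mat \<gamma> A = map_mat \<gamma> (A\<^sup>T * ?J * A)"
    proof -
      have "map_mat \<gamma> (A\<^sup>T * ?J * A) = map_mat \<gamma> (A\<^sup>T * ?J) * map_mat \<gamma> A"
        by (rule mat_hom_mult[of _ n n]) (use c J in auto)
      also have "map_mat \<gamma> (A\<^sup>T * ?J) = map_mat \<gamma> (A\<^sup>T) * map_mat \<gamma> ?J"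
        by (rule mat_hom_mult[of _ n n]) (use c J in auto)
      finally show ?thesis unfolding t map_symp_mat[OF \<gamma>(1) e(1)] by simp
    qed
    also have "\<dots> = \<gamma> a \<cdot>\<^sub>m map_mat \<gamma> ?J" unfolding a(1) by (intro eq_matI) (auto simp: hom_mult)
    finally show ?thesis
      using GSp_I[OF GL, of "\<gamma> a"] \<gamma>0[OF a(2)] e map_symp_mat[OF \<gamma>(1) e(1)] by simp
  qed (use GL in simp)
qed

lemma M_nonzero_entry:
  assumes "A \<in> M UNIV"
  obtains i j where "i < n" "j < n" "A $$ (i, j) \<noteq> 0"
proof -
  have c: "A \<in> carrier_mat n n" "det A \<noteq> 0" using M_GL[OF assms] by (auto simp: GL_iff)
  have "\<exists>i<n. \<exists>j<n. A $$ (i, j) \<noteq> 0"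
  proof (rule ccontr)
    assume "\<not> ?thesis"
    then have "A = 0\<^sub>m n n" using c(1) by (intro eq_matI) auto
    then show False using c(2) n by simp
  qed
  then show thesis using that by blast
qed

section \<open>Matrices modulo scalars\<close>

lemma scalar_ratio:
  assumes "A \<in> M UNIV" "c \<cdot>\<^sub>m A = d \<cdot>\<^sub>m A"
  shows "c = d"
proof -
  obtain i j where ij: "i < n" "j < n" "A $$ (i, j) \<noteq> 0" by (rule M_nonzero_entry[OF assms(1)])
  have "A \<in> carrier_mat n n" using assms M_carrier by blast
  then show ?thesis using arg_cong[OF assms(2), of "\<lambda>A. A $$ (i, j)"] ij by simp
qed

lemma scalar_mats_subset: "subfield_set F \<Longrightarrow> scalar_mats n F \<subseteq> M F"
  using M_smult[OF M_one] by (auto simp: scalar_mats_def)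

lemma scalar_mult:
  "A \<in> carrier_mat n n \<Longrightarrow> (c \<cdot>\<^sub>m 1\<^sub>m n) * A = c \<cdot>\<^sub>m A" "A \<in> carrier_mat n n \<Longrightarrow> A * (c \<cdot>\<^sub>m 1\<^sub>m n) = c \<cdot>\<^sub>m (A :: 'l mat)"
  using mult_smult_assoc_mat[OF one_carrier_mat, of A n n c] mult_smult_distrib[OF _ one_carrier_mat, of A n n c]
  by auto

lemma normal_scalars: "subfield_set F \<Longrightarrow> scalar_mats n F \<lhd> mat_group n (M F)"
proof -
  assume F: "subfield_set F"
  interpret group "mat_group n (M F)" by (rule group_M[OF F])
  have smm: "(c \<cdot>\<^sub>m 1\<^sub>m n) * (d \<cdot>\<^sub>m 1\<^sub>m n) = (c * d) \<cdot>\<^sub>m (1\<^sub>m n :: 'l mat)" for c d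
    by (subst scalar_mult(1)) (auto intro!: eq_matI)
  have sub: "subgroup (scalar_mats n F) (mat_group n (M F))"
  proof (rule subgroupI)
    show "scalar_mats n F \<subseteq> carrier (mat_group n (M F))" using scalar_mats_subset[OF F] by simp
    show "scalar_mats n F \<noteq> {}" using subfield_setD(2)[OF F] by (auto simp: scalar_mats_def)
    fix a assume a: "a \<in> scalar_mats n F"
    then obtain c where c: "c \<in> F" "c \<noteq> 0" "a = c \<cdot>\<^sub>m 1\<^sub>m n" by (auto simp: scalar_mats_def)
    have b: "inverse c \<cdot>\<^sub>m 1\<^sub>m n \<in> scalar_mats n F"
      using c subfield_setD(6)[OF F] by (auto simp: scalar_mats_def)
    have "1 \<cdot>\<^sub>m 1\<^sub>m n = (1\<^sub>m n :: 'l mat)" by (intro eq_matI) auto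
    then have "(inverse c \<cdot>\<^sub>m 1\<^sub>m n) * a = 1\<^sub>m n" using c smm by simp
    then have "inv\<^bsub>mat_group n (M F)\<^esub> a = inverse c \<cdot>\<^sub>m 1\<^sub>m n"
      using scalar_mats_subset[OF F] a b by (intro inv_equality) auto
    then show "inv\<^bsub>mat_group n (M F)\<^esub> a \<in> scalar_mats n F" using b by simp
    fix b assume "b \<in> scalar_mats n F"
    then obtain d where d: "d \<in> F" "d \<noteq> 0" "b = d \<cdot>\<^sub>m 1\<^sub>m n" by (auto simp: scalar_mats_def)
    have "a * b = (c * d) \<cdot>\<^sub>m 1\<^sub>m n" using c d smm by simp
    then show "a \<otimes>\<^bsub>mat_group n (M F)\<^esub> b \<in> scalar_mats n F"
      using c d subfield_setD(4)[OF F] by (auto simp: scalar_mats_def)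
  qed
  show ?thesis
  proof (rule normalI[OF sub], rule ballI)
    fix x assume "x \<in> carrier (mat_group n (M F))"
    then have "x \<in> carrier_mat n n" using M_carrier by simp
    then show "scalar_mats n F #>\<^bsub>mat_group n (M F)\<^esub> x = x <#\<^bsub>mat_group n (M F)\<^esub> scalar_mats n F"
      using scalar_mult unfolding r_coset_def l_coset_def scalar_mats_def by auto
  qed
qed

lemma proj_class_eq: "A \<in> carrier_mat n n \<Longrightarrow> proj_class n M F A = {c \<cdot>\<^sub>m A | c. c \<in> F - {0}}"
  using scalar_mult(1)[of A] by (auto simp: proj_class_def r_coset_def scalar_mats_def)

lemma proj_class_eq_iff:
  assumes "subfield_set F" "A \<in> carrier_mat n n" "B \<in> carrier_mat n n"
  shows "proj_class n M F A = proj_class n M F B \<longleftrightarrow> (\<exists>c\<in>F - {0}. A = c \<cdot>\<^sub>m B)"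
proof
  assume "proj_class n M F A = proj_class n M F B"
  moreover have "A \<in> proj_class n M F A"
    unfolding proj_class_eq[OF assms(2)] using subfield_setD(2)[OF assms(1)] by (auto intro!: exI[of _ 1] eq_matI)
  ultimately show "\<exists>c\<in>F - {0}. A = c \<cdot>\<^sub>m B" unfolding proj_class_eq[OF assms(3)] by auto
next
  assume "\<exists>c\<in>F - {0}. A = c \<cdot>\<^sub>m B"
  then obtain c where c: "c \<in> F" "c \<noteq> 0" "A = c \<cdot>\<^sub>m B" by auto
  have sm: "a \<cdot>\<^sub>m (b \<cdot>\<^sub>m B) = (a * b) \<cdot>\<^sub>m B" for a b by (intro eq_matI) auto
  have "y \<in> proj_class n M F A \<longleftrightarrow> y \<in> proj_class n M F B" for y
  proof
    assume "y \<in> proj_class n M F A"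
    then obtain a where a: "a \<in> F" "a \<noteq> 0" "y = a \<cdot>\<^sub>m A" unfolding proj_class_eq[OF assms(2)] by auto
    have "y = (a * c) \<cdot>\<^sub>m B" unfolding a(3) c(3) by (rule sm)
    moreover have "a * c \<in> F - {0}" using a c subfield_setD(4)[OF assms(1)] by auto
    ultimately show "y \<in> proj_class n M F B" unfolding proj_class_eq[OF assms(3)] by blast
  next
    assume "y \<in> proj_class n M F B"
    then obtain a where a: "a \<in> F" "a \<noteq> 0" "y = a \<cdot>\<^sub>m B" unfolding proj_class_eq[OF assms(3)] by auto
    have "y = (a / c) \<cdot>\<^sub>m A" unfolding a(3) c(3) sm using c by simp
    moreover have "a / c \<in> F - {0}" using a c subfield_setD(8)[OF assms(1)] by auto
    ultimately show "y \<in> proj_class n M F A" unfolding proj_class_eq[OF assms(2)] by blast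
  qed
  then show "proj_class n M F A = proj_class n M F B" by blast
qed

lemma proj_mult:
  assumes "subfield_set F" "A \<in> M F" "B \<in> M F"
  shows "proj_class n M F A \<otimes>\<^bsub>proj_group n M F\<^esub> proj_class n M F B = proj_class n M F (A * B)"
proof -
  interpret normal "scalar_mats n F" "mat_group n (M F)" by (rule normal_scalars[OF assms(1)])
  show ?thesis using rcos_sum[of A B] assms by (simp add: proj_class_def proj_group_def)
qed

lemma proj_carrier: "carrier (proj_group n M F) = proj_class n M F ` M F"
  by (simp add: proj_group_def proj_class_def carrier_FactGroup image_def)

lemma proj_inv:
  assumes "A \<in> M UNIV"
  shows "inv\<^bsub>proj_group n M UNIV\<^esub> (proj_class n M UNIV A) = proj_class n M UNIV (inv\<^bsub>mat_group n (M UNIV)\<^esub> A)"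
proof -
  interpret normal "scalar_mats n UNIV" "mat_group n (M UNIV)" by (rule normal_scalars[OF UNIV_field])
  have "proj_class n M UNIV A \<in> carrier (mat_group n (M UNIV) Mod scalar_mats n UNIV)"
    using assms by (simp add: proj_class_def carrier_FactGroup)
  then show ?thesis
    using inv_FactGroup rcos_inv[of A] assms by (simp add: proj_class_def proj_group_def)
qed

lemma proj_incl_class:
  assumes "B \<in> M F" "subfield_set F"
  shows "proj_incl n M (proj_class n M F B) = proj_class n M UNIV B"
proof -
  have B: "B \<in> carrier_mat n n" using assms M_carrier by blast
  have sm: "a \<cdot>\<^sub>m (b \<cdot>\<^sub>m B) = (a * b) \<cdot>\<^sub>m B" for a b by (intro eq_matI) auto
  have cd: "(c \<cdot>\<^sub>m 1\<^sub>m n) * (d \<cdot>\<^sub>m B) = (c * d) \<cdot>\<^sub>m B" for c d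
    using B by (simp add: scalar_mult(1) sm)
  show ?thesis
    unfolding proj_incl_def set_mult_def proj_class_eq[OF B] scalar_mats_def mat_group_simps
  proof (intro equalityI subsetI)
    fix y assume "y \<in> (\<Union>h\<in>{c \<cdot>\<^sub>m 1\<^sub>m n |c. c \<in> UNIV - {0}}. \<Union>k\<in>{c \<cdot>\<^sub>m B |c. c \<in> F - {0}}. {h * k})"
    then obtain c d where "c \<noteq> 0" "d \<noteq> 0" "y = (c \<cdot>\<^sub>m 1\<^sub>m n) * (d \<cdot>\<^sub>m B)" by auto
    then show "y \<in> {c \<cdot>\<^sub>m B |c. c \<in> UNIV - {0}}" unfolding cd by auto
  next
    fix y assume "y \<in> {c \<cdot>\<^sub>m B |c. c \<in> UNIV - {0}}"
    then obtain c where c: "c \<noteq> 0" "y = c \<cdot>\<^sub>m B" by auto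
    have "y = (c \<cdot>\<^sub>m 1\<^sub>m n) * (1 \<cdot>\<^sub>m B)" unfolding cd c by simp
    moreover have "1 \<in> F - {0}" using subfield_setD(2)[OF assms(2)] by simp
    ultimately show "y \<in> (\<Union>h\<in>{c \<cdot>\<^sub>m 1\<^sub>m n |c. c \<in> UNIV - {0}}. \<Union>k\<in>{c \<cdot>\<^sub>m B |c. c \<in> F - {0}}. {h * k})"
      using c(1) by blast
  qed
qed

end

section \<open>Continuity\<close>

context nonarchimedean
begin

text \<open>Continuity at one point, in epsilon form: the formulas for characters and for normalised
  matrices hold only near a point, where a chosen entry does not vanish.\<close>

definition cont_at :: "'g topology \<Rightarrow> ('g \<Rightarrow> 'l) \<Rightarrow> 'g \<Rightarrow> bool" where
  "cont_at T f x \<longleftrightarrow> (\<forall>e>0. \<exists>U. openin T U \<and> x \<in> U \<and> (\<forall>y\<in>U. v (f y - f x) < e))"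

lemma continuous_map_abs_topology:
  "continuous_map T (abs_topology v) f \<longleftrightarrow> (\<forall>x\<in>topspace T. cont_at T f x)"
proof -
  interpret Metric_space UNIV "\<lambda>x y. v (x - y)" by (rule metric_space_abs[OF nonarch_abs])
  have "f y \<in> mball (f x) e \<longleftrightarrow> v (f y - f x) < e" for x y e
    by (simp add: v_diff_commute)
  then show ?thesis unfolding abs_topology_def continuous_map_to_metric cont_at_def by simp
qed

lemma topspace_abs_topology [simp]: "topspace (abs_topology v) = UNIV"
proof -
  interpret Metric_space UNIV "\<lambda>x y. v (x - y)" by (rule metric_space_abs[OF nonarch_abs])
  show ?thesis by (simp add: abs_topology_def)
qed

lemma cont_atD:
  assumes "cont_at T f x" "e > 0"
  obtains U where "openin T U" "x \<in> U" "\<And>y. y \<in> U \<Longrightarrow> v (f y - f x) < e"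
proof -
  from assms have "\<exists>U. openin T U \<and> x \<in> U \<and> (\<forall>y\<in>U. v (f y - f x) < e)"
    unfolding cont_at_def by (elim allE[of _ e] impE)
  then show thesis using that by (elim exE conjE) (rule that, auto)
qed

lemma cont_at_const: "x \<in> topspace T \<Longrightarrow> cont_at T (\<lambda>_. c) x"
  unfolding cont_at_def by (auto intro!: exI[of _ "topspace T"])

lemma cont_at_add:
  assumes "cont_at T f x" "cont_at T g x"
  shows "cont_at T (\<lambda>y. f y + g y) x"
  unfolding cont_at_def
proof (intro allI impI)
  fix e :: real assume e: "e > 0"
  obtain U where U: "openin T U" "x \<in> U" "\<And>y. y \<in> U \<Longrightarrow> v (f y - f x) < e" using cont_atD[OF assms(1) e] by blast
  obtain V where V: "openin T V" "x \<in> V" "\<And>y. y \<in> V \<Longrightarrow> v (g y - g x) < e" using cont_atD[OF assms(2) e] by blast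
  have "v (f y + g y - (f x + g x)) < e" if "y \<in> U \<inter> V" for y
  proof -
    have "f y + g y - (f x + g x) = (f y - f x) + (g y - g x)" by simp
    also have "v \<dots> \<le> max (v (f y - f x)) (v (g y - g x))" by (rule v_add)
    also have "\<dots> < e" using U(3) V(3) that by simp
    finally show ?thesis .
  qed
  then show "\<exists>U. openin T U \<and> x \<in> U \<and> (\<forall>y\<in>U. v (f y + g y - (f x + g x)) < e)"
    using U V by (intro exI[of _ "U \<inter> V"]) auto
qed

lemma cont_at_mult:
  assumes "cont_at T f x" "cont_at T g x"
  shows "cont_at T (\<lambda>y. f y * g y) x"
  unfolding cont_at_def
proof (intro allI impI)
  fix e :: real assume e: "e > 0"
  define c where "c = max (v (g x)) 1"
  have c: "c > 0" "v (g x) \<le> c" "1 \<le> c" by (auto simp: c_def)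
  have d: "v (f x) + 1 > 0" using v_nonneg[of "f x"] by linarith
  obtain U where U: "openin T U" "x \<in> U" "\<And>y. y \<in> U \<Longrightarrow> v (f y - f x) < e / c"
    using cont_atD[OF assms(1), of "e / c"] e c by auto
  obtain V where V: "openin T V" "x \<in> V" "\<And>y. y \<in> V \<Longrightarrow> v (g y - g x) < 1"
    using cont_atD[OF assms(2), of 1] by auto
  obtain W where W: "openin T W" "x \<in> W" "\<And>y. y \<in> W \<Longrightarrow> v (g y - g x) < e / (v (f x) + 1)"
    using cont_atD[OF assms(2), of "e / (v (f x) + 1)"] e d by auto
  have "v (f y * g y - f x * g x) < e" if y: "y \<in> U \<inter> V \<inter> W" for y
  proof -
    have "v (g y) \<le> max (v (g y - g x)) (v (g x))" using v_add[of "g y - g x" "g x"] by simp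
    also have "\<dots> \<le> c" using V(3)[of y] y c by simp
    finally have gy: "v (g y) \<le> c" .
    have "v (f y - f x) * v (g y) \<le> v (f y - f x) * c" using gy by (intro mult_left_mono) auto
    also have "\<dots> < e" using U(3)[of y] y c by (simp add: pos_less_divide_eq)
    finally have 1: "v ((f y - f x) * g y) < e" by (simp add: v_mult)
    have "v (f x) * v (g y - g x) \<le> (v (f x) + 1) * v (g y - g x)" by (intro mult_right_mono) auto
    also have "\<dots> < e" using W(3)[of y] y d by (simp add: pos_less_divide_eq mult.commute)
    finally have 2: "v (f x * (g y - g x)) < e" by (simp add: v_mult)
    have "f y * g y - f x * g x = (f y - f x) * g y + f x * (g y - g x)" by (simp add: algebra_simps)
    also have "v \<dots> \<le> max (v ((f y - f x) * g y)) (v (f x * (g y - g x)))" by (rule v_add)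
    also have "\<dots> < e" using 1 2 by simp
    finally show ?thesis .
  qed
  then show "\<exists>U. openin T U \<and> x \<in> U \<and> (\<forall>y\<in>U. v (f y * g y - f x * g x) < e)"
    using U V W by (intro exI[of _ "U \<inter> V \<inter> W"]) auto
qed

lemma cont_at_sum:
  "x \<in> topspace T \<Longrightarrow> (\<And>i. i \<in> I \<Longrightarrow> cont_at T (f i) x) \<Longrightarrow> cont_at T (\<lambda>y. \<Sum>i\<in>I. f i y) x"
  by (induction I rule: infinite_finite_induct) (auto intro: cont_at_const cont_at_add)

text \<open>By the ultrametric inequality the absolute value of f is constant near x, so division by
  f is possible in a whole neighbourhood.\<close>

lemma cont_at_nonzero:
  assumes "cont_at T f x" "f x \<noteq> 0"
  shows "\<exists>U. openin T U \<and> x \<in> U \<and> (\<forall>y\<in>U. v (f y) = v (f x))"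
proof -
  have "v (f x) > 0" using assms(2) v_nonneg[of "f x"] by (simp add: less_le)
  then obtain U where U: "openin T U" "x \<in> U" "\<And>y. y \<in> U \<Longrightarrow> v (f y - f x) < v (f x)"
    using cont_atD[OF assms(1)] by blast
  have "v (f y) = v (f x)" if "y \<in> U" for y
    using U(3)[OF that] v_add[of "f y - f x" "f x"] v_diff[of "f y" "f y - f x"]
    by (simp add: max_def split: if_splits)
  then show ?thesis using U(1,2) by blast
qed

lemma cont_at_inverse:
  assumes f: "cont_at T f x" "f x \<noteq> 0"
  shows "cont_at T (\<lambda>y. inverse (f y)) x"
  unfolding cont_at_def
proof (intro allI impI)
  fix e :: real assume e: "e > 0"
  have v0: "v (f x) > 0" using f(2) v_nonneg[of "f x"] by (simp add: less_le)
  obtain U where U: "openin T U" "x \<in> U" "\<And>y. y \<in> U \<Longrightarrow> v (f y) = v (f x)"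
    using cont_at_nonzero[OF f] by blast
  obtain V where V: "openin T V" "x \<in> V" "\<And>y. y \<in> V \<Longrightarrow> v (f y - f x) < e * (v (f x) * v (f x))"
    using cont_atD[OF f(1), of "e * (v (f x) * v (f x))"] e v0 by auto
  have "v (inverse (f y) - inverse (f x)) < e" if y: "y \<in> U \<inter> V" for y
  proof -
    have vy: "v (f y) = v (f x)" using U(3) y by simp
    then have nz: "f y \<noteq> 0" using v0 by auto
    have "inverse (f y) - inverse (f x) = (f x - f y) / (f y * f x)"
      using nz f(2) by (simp add: field_simps)
    then have "v (inverse (f y) - inverse (f x)) = v (f y - f x) / (v (f x) * v (f x))"
      by (simp add: v_divide v_mult vy v_diff_commute)
    also have "\<dots> < e" using V(3)[of y] y v0 by (simp add: pos_divide_less_eq)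
    finally show ?thesis .
  qed
  then show "\<exists>U. openin T U \<and> x \<in> U \<and> (\<forall>y\<in>U. v (inverse (f y) - inverse (f x)) < e)"
    using U(1,2) V by (intro exI[of _ "U \<inter> V"]) auto
qed

lemma cont_at_cong:
  assumes "cont_at T f x" "openin T W" "x \<in> W" "\<And>y. y \<in> W \<Longrightarrow> g y = f y"
  shows "cont_at T g x"
  unfolding cont_at_def
proof (intro allI impI)
  fix e :: real assume "e > 0"
  then obtain U where U: "openin T U" "x \<in> U" "\<And>y. y \<in> U \<Longrightarrow> v (f y - f x) < e"
    using cont_atD[OF assms(1)] by blast
  then show "\<exists>U. openin T U \<and> x \<in> U \<and> (\<forall>y\<in>U. v (g y - g x) < e)"
    using assms by (intro exI[of _ "U \<inter> W"]) auto
qed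

lemma cont_at_automorphism:
  assumes f: "cont_at T f x" and \<gamma>: "\<And>x y. \<gamma> (x + y) = \<gamma> x + \<gamma> y" "\<And>x. v (\<gamma> x) = v x"
  shows "cont_at T (\<lambda>y. \<gamma> (f y)) x"
proof -
  have "\<gamma> (a - b) = \<gamma> a - \<gamma> b" for a b using \<gamma>(1)[of "a - b" b] by simp
  then have "v (\<gamma> a - \<gamma> b) = v (a - b)" for a b using \<gamma>(2)[of "a - b"] by simp
  then show ?thesis using f unfolding cont_at_def by simp
qed

lemma cont_at_subtopology:
  assumes "cont_at T f x" "x \<in> W"
  shows "cont_at (subtopology T W) f x"
  unfolding cont_at_def
proof (intro allI impI)
  fix e :: real assume "e > 0"
  then obtain U where U: "openin T U" "x \<in> U" "\<And>y. y \<in> U \<Longrightarrow> v (f y - f x) < e"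
    using cont_atD[OF assms(1)] by blast
  then show "\<exists>U. openin (subtopology T W) U \<and> x \<in> U \<and> (\<forall>y\<in>U. v (f y - f x) < e)"
    using assms(2) by (intro exI[of _ "U \<inter> W"]) (auto simp: openin_subtopology)
qed

end

section \<open>Topologies on sets of matrices and on quotients\<close>

lemma topspace_mat_topology: "topspace TL = UNIV \<Longrightarrow> topspace (mat_topology TL n S) = S"
  by (auto simp: mat_topology_def topspace_pullback_topology)

lemma continuous_map_mat_topology:
  assumes "topspace TL = UNIV"
  shows "continuous_map T (mat_topology TL n S) r \<longleftrightarrow>
    r ` topspace T \<subseteq> S \<and> (\<forall>i<n. \<forall>j<n. continuous_map T TL (\<lambda>g. r g $$ (i, j)))"
proof -
  let ?I = "{..<n} \<times> {..<n}"
  let ?f = "\<lambda>A. \<lambda>p\<in>?I. A $$ p"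
  let ?P = "product_topology (\<lambda>_. TL) ?I"
  show ?thesis
  proof (intro iffI conjI allI impI)
    assume r: "continuous_map T (mat_topology TL n S) r"
    then show "r ` topspace T \<subseteq> S"
      using topspace_mat_topology[OF assms, of n S] continuous_map_image_subset_topspace[OF r] by simp
    fix i j assume ij: "i < n" "j < n"
    have "continuous_map ?P TL (\<lambda>x. x (i, j))" using ij by (intro continuous_map_product_projection) auto
    then have "continuous_map (mat_topology TL n S) TL ((\<lambda>x. x (i, j)) \<circ> ?f)"
      unfolding mat_topology_def by (rule continuous_map_pullback)
    from continuous_map_compose[OF r this] show "continuous_map T TL (\<lambda>g. r g $$ (i, j))"
      using ij by (simp add: o_def)
  next
    assume r: "r ` topspace T \<subseteq> S \<and> (\<forall>i<n. \<forall>j<n. continuous_map T TL (\<lambda>g. r g $$ (i, j)))"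
    have "continuous_map T ?P (?f \<circ> r)"
      unfolding continuous_map_componentwise using r by (auto simp: o_def)
    then show "continuous_map T (mat_topology TL n S) r"
      unfolding mat_topology_def by (rule continuous_map_pullback') (use r in auto)
  qed
qed

lemma topspace_quot_topology: "topspace (quot_topology Y f) = f ` topspace Y"
proof
  show "topspace (quot_topology Y f) \<subseteq> f ` topspace Y"
    using openin_topspace[of "quot_topology Y f"] unfolding openin_quot_topology by blast
  have "openin (quot_topology Y f) (f ` topspace Y)"
  proof -
    have "{x \<in> topspace Y. f x \<in> f ` topspace Y} = topspace Y" by auto
    then show ?thesis unfolding openin_quot_topology by simp
  qed
  then show "f ` topspace Y \<subseteq> topspace (quot_topology Y f)" by (rule openin_subset)
qed

lemma continuous_map_quot_topology: "continuous_map Y (quot_topology Y f) f"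
  unfolding continuous_map_def topspace_quot_topology by (auto simp: openin_quot_topology)

section \<open>Galois descent of the projective representation\<close>

locale galois_rep = residue v red + matrix_functor n M
  for v :: "'l::field \<Rightarrow> real" and red :: "'l \<Rightarrow> 'k::field" and n :: nat and M :: "'l set \<Rightarrow> 'l mat set" +
  fixes K :: "'l set" and G :: "'g monoid" and T :: "'g topology" and \<rho> :: "'g \<Rightarrow> 'l mat"
  assumes coefficients: "coefficient_field v red K" and galois: "galois_extension K"
    and G: "topological_group G T" and rep: "representation G T (abs_topology v) n M \<rho>"
begin

abbreviation "TL \<equiv> abs_topology v"
abbreviation "St \<equiv> stab G T TL K n M \<rho>"
abbreviation "minv A \<equiv> inv\<^bsub>mat_group n (M UNIV)\<^esub> A"

lemma group_G: "group G" and topspace_T: "topspace T = carrier G"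
  using G by (auto simp: topological_group_def)

lemma rho_M: "g \<in> carrier G \<Longrightarrow> \<rho> g \<in> M UNIV"
  and rho_mult: "g \<in> carrier G \<Longrightarrow> h \<in> carrier G \<Longrightarrow> \<rho> (g \<otimes>\<^bsub>G\<^esub> h) = \<rho> g * \<rho> h"
  and rho_continuous: "i < n \<Longrightarrow> j < n \<Longrightarrow> g \<in> carrier G \<Longrightarrow> cont_at T (\<lambda>g. \<rho> g $$ (i, j)) g"
proof -
  show "g \<in> carrier G \<Longrightarrow> \<rho> g \<in> M UNIV" "g \<in> carrier G \<Longrightarrow> h \<in> carrier G \<Longrightarrow> \<rho> (g \<otimes>\<^bsub>G\<^esub> h) = \<rho> g * \<rho> h"
    using rep by (auto simp: representation_def hom_def)
  have "continuous_map T (mat_topology TL n (M UNIV)) \<rho>" using rep by (simp add: representation_def)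
  then show "i < n \<Longrightarrow> j < n \<Longrightarrow> g \<in> carrier G \<Longrightarrow> cont_at T (\<lambda>g. \<rho> g $$ (i, j)) g"
    unfolding continuous_map_mat_topology[OF topspace_abs_topology] continuous_map_abs_topology topspace_T by blast
qed

lemma rho_carrier: "g \<in> carrier G \<Longrightarrow> \<rho> g \<in> carrier_mat n n"
  using rho_M M_carrier by blast

lemma rho_one: "\<rho> \<one>\<^bsub>G\<^esub> = 1\<^sub>m n"
proof -
  interpret G: group G by (rule group_G)
  have m: "\<rho> \<one>\<^bsub>G\<^esub> \<in> M UNIV" by (simp add: rho_M)
  have c: "\<rho> \<one>\<^bsub>G\<^esub> \<in> carrier_mat n n" by (simp add: rho_carrier)
  obtain B where B: "B \<in> M UNIV" "B * \<rho> \<one>\<^bsub>G\<^esub> = 1\<^sub>m n" using M_inverse[OF UNIV_field m] .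
  have "\<rho> \<one>\<^bsub>G\<^esub> * \<rho> \<one>\<^bsub>G\<^esub> = \<rho> \<one>\<^bsub>G\<^esub>" using rho_mult[of "\<one>\<^bsub>G\<^esub>" "\<one>\<^bsub>G\<^esub>"] by simp
  then have "B * (\<rho> \<one>\<^bsub>G\<^esub> * \<rho> \<one>\<^bsub>G\<^esub>) = 1\<^sub>m n" using B by simp
  moreover have "B * (\<rho> \<one>\<^bsub>G\<^esub> * \<rho> \<one>\<^bsub>G\<^esub>) = (B * \<rho> \<one>\<^bsub>G\<^esub>) * \<rho> \<one>\<^bsub>G\<^esub>"
    using c M_carrier[OF B(1)] by (simp add: mat_assoc)
  ultimately show ?thesis using B c by simp
qed

lemma Gal_hom:
  assumes "\<gamma> \<in> Gal K"
  shows "comm_ring_hom \<gamma>" "inj \<gamma>" "v (\<gamma> x) = v x" "\<gamma> x = 0 \<longleftrightarrow> x = 0"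
proof -
  have h: "bij \<gamma>" "\<And>x y. \<gamma> (x + y) = \<gamma> x + \<gamma> y" "\<And>x y. \<gamma> (x * y) = \<gamma> x * \<gamma> y" "\<gamma> 1 = 1"
    and z: "\<gamma> 0 = 0"
    using assms subfield_setD(1)[OF K_subfield[OF galois]] by (auto simp: Gal_iff)
  show "comm_ring_hom \<gamma>" using h z by unfold_locales auto
  show "inj \<gamma>" using h(1) by (simp add: bij_def)
  then show "\<gamma> x = 0 \<longleftrightarrow> x = 0" using z by (metis injD)
  show "v (\<gamma> x) = v x" using coefficients assms by (simp add: coefficient_field_def)
qed

text \<open>Trades conjugacy for an intertwining relation, which contains no inverse and composes
  well.\<close>

lemma conj_iff:
  assumes A: "A \<in> M UNIV" and U: "U \<in> carrier_mat n n" and Y: "Y \<in> carrier_mat n n"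
  shows "Y = A * U * minv A \<longleftrightarrow> Y * A = A * U"
proof -
  note i = M_inv[OF A] and c = M_carrier[OF A] M_carrier[OF M_inv(1)[OF A]]
  show ?thesis
  proof
    assume e: "Y = A * U * minv A"
    have "Y * A = A * U * (minv A * A)"
      unfolding e using c U by (intro assoc_mult_mat[of _ n n _ n]) auto
    then show "Y * A = A * U" using i c U by simp
  next
    assume e: "Y * A = A * U"
    have "A * U * minv A = Y * (A * minv A)"
      unfolding e[symmetric] using c Y by (intro assoc_mult_mat[of _ n n _ n]) auto
    then show "Y = A * U * minv A" using i Y by simp
  qed
qed

lemma intertwine_sym:
  assumes A: "A \<in> M UNIV" and U: "U \<in> carrier_mat n n" and Y: "Y \<in> carrier_mat n n" and eq: "Y * A = A * U"
  shows "U * minv A = minv A * Y"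
proof -
  note i = M_inv[OF A] and c = M_carrier[OF A] M_carrier[OF M_inv(1)[OF A]]
  have "minv A * Y = minv A * (Y * A) * minv A" using i c Y by (simp add: mat_assoc)
  also have "\<dots> = (minv A * A) * U * minv A" unfolding eq using c U by (simp add: mat_assoc)
  finally show ?thesis using i c U by simp
qed

text \<open>\<rho> lies in its own class, hence in that of the twist; the conjugating matrix,
  inverted, is the intertwiner C.\<close>

lemma stabD:
  assumes "(\<gamma>, \<epsilon>) \<in> St"
  shows "\<gamma> \<in> Gal K" "\<epsilon> \<in> chars G T TL" "\<And>g. g \<in> carrier G \<Longrightarrow> \<epsilon> g \<noteq> 0"
    "\<exists>C\<in>M UNIV. \<forall>g\<in>carrier G. map_mat \<gamma> (\<rho> g) * C = \<epsilon> g \<cdot>\<^sub>m (C * \<rho> g)"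
proof -
  show \<gamma>: "\<gamma> \<in> Gal K" and \<epsilon>: "\<epsilon> \<in> chars G T TL" using assms by (auto simp: stab_def)
  then show \<epsilon>0: "\<epsilon> g \<noteq> 0" if "g \<in> carrier G" for g
    using that by (auto simp: chars_def hom_def)
  have tw: "twist \<gamma> \<epsilon> \<rho> g \<in> carrier_mat n n" if "g \<in> carrier G" for g
    using rho_carrier[OF that] by (simp add: twist_def)
  have one: "1\<^sub>m n \<in> M UNIV" by (rule M_one[OF UNIV_field])
  have "\<rho> g = 1\<^sub>m n * \<rho> g * minv (1\<^sub>m n)" if "g \<in> carrier G" for g
    using conj_iff[OF one rho_carrier[OF that] rho_carrier[OF that]] rho_carrier[OF that] by simp
  then have "\<rho> \<in> rep_class G T TL n M \<rho>" using rep one by (auto simp: rep_class_def rep_equiv_def)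
  then have "\<rho> \<in> rep_class G T TL n M (twist \<gamma> \<epsilon> \<rho>)" using assms by (auto simp: stab_def)
  then obtain A where A: "A \<in> M UNIV" "\<And>g. g \<in> carrier G \<Longrightarrow> \<rho> g = A * twist \<gamma> \<epsilon> \<rho> g * minv A"
    by (auto simp: rep_class_def rep_equiv_def)
  have "map_mat \<gamma> (\<rho> g) * minv A = \<epsilon> g \<cdot>\<^sub>m (minv A * \<rho> g)" if g: "g \<in> carrier G" for g
  proof -
    have "\<rho> g * A = A * twist \<gamma> \<epsilon> \<rho> g"
      using A(2)[OF g] conj_iff[OF A(1) tw[OF g] rho_carrier[OF g]] by blast
    then have eq: "twist \<gamma> \<epsilon> \<rho> g * minv A = minv A * \<rho> g"
      by (rule intertwine_sym[OF A(1) tw[OF g] rho_carrier[OF g]])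
    have "map_mat \<gamma> (\<rho> g) = \<epsilon> g \<cdot>\<^sub>m twist \<gamma> \<epsilon> \<rho> g"
      using \<epsilon>0[OF g] unfolding twist_def by (intro eq_matI) auto
    then have "map_mat \<gamma> (\<rho> g) * minv A = \<epsilon> g \<cdot>\<^sub>m (twist \<gamma> \<epsilon> \<rho> g * minv A)"
      using mult_smult_assoc_mat[OF tw[OF g] M_carrier[OF M_inv(1)[OF A(1)]]] by simp
    then show ?thesis using eq by simp
  qed
  then show "\<exists>C\<in>M UNIV. \<forall>g\<in>carrier G. map_mat \<gamma> (\<rho> g) * C = \<epsilon> g \<cdot>\<^sub>m (C * \<rho> g)"
    using M_inv(1)[OF A(1)] by blast
qed

text \<open>The two classes are compared member by member: composition with C and its inverse
  matches the intertwiners from \<rho> to a given \<sigma> with those from the twist to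
  \<sigma>.\<close>

lemma stabI:
  assumes \<gamma>: "\<gamma> \<in> Gal K" and \<epsilon>: "\<epsilon> \<in> chars G T TL" and C: "C \<in> M UNIV"
    and eq: "\<And>g. g \<in> carrier G \<Longrightarrow> map_mat \<gamma> (\<rho> g) * C = \<epsilon> g \<cdot>\<^sub>m (C * \<rho> g)"
  shows "(\<gamma>, \<epsilon>) \<in> St"
proof -
  have \<epsilon>0: "\<epsilon> g \<noteq> 0" if "g \<in> carrier G" for g using \<epsilon> that by (auto simp: chars_def hom_def)
  have tw: "twist \<gamma> \<epsilon> \<rho> g \<in> carrier_mat n n" if "g \<in> carrier G" for g
    using rho_carrier[OF that] by (simp add: twist_def)
  have twC: "twist \<gamma> \<epsilon> \<rho> g * C = C * \<rho> g" if g: "g \<in> carrier G" for g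
  proof -
    have "twist \<gamma> \<epsilon> \<rho> g * C = inverse (\<epsilon> g) \<cdot>\<^sub>m (map_mat \<gamma> (\<rho> g) * C)"
      unfolding twist_def using rho_carrier[OF g] M_carrier[OF C] by (intro mult_smult_assoc_mat) auto
    then show ?thesis unfolding eq[OF g] using \<epsilon>0[OF g] by (auto intro!: eq_matI)
  qed
  have trans: "Z * (B * A) = (B * A) * U"
    if "B \<in> carrier_mat n n" "A \<in> carrier_mat n n" "U \<in> carrier_mat n n" "Y \<in> carrier_mat n n" "Z \<in> carrier_mat n n"
      "Y * A = A * U" "Z * B = B * Y" for A B U Y Z
  proof -
    have "Z * (B * A) = (Z * B) * A" using that(1-5) by (simp add: mat_assoc)
    also have "\<dots> = B * (Y * A)" unfolding that(7) using that(1-5) by (simp add: mat_assoc)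
    also have "\<dots> = (B * A) * U" unfolding that(6) using that(1-5) by (simp add: mat_assoc)
    finally show ?thesis .
  qed
  have "rep_equiv G n M (twist \<gamma> \<epsilon> \<rho>) \<sigma> \<longleftrightarrow> rep_equiv G n M \<rho> \<sigma>"
    if \<sigma>: "representation G T TL n M \<sigma>" for \<sigma>
  proof -
    have sc: "\<sigma> g \<in> carrier_mat n n" if "g \<in> carrier G" for g
      using \<sigma> that M_carrier by (auto simp: representation_def hom_def)
    have iff: "(\<forall>g\<in>carrier G. \<sigma> g = A * \<tau> g * minv A) \<longleftrightarrow> (\<forall>g\<in>carrier G. \<sigma> g * A = A * \<tau> g)"
      if "A \<in> M UNIV" "\<And>g. g \<in> carrier G \<Longrightarrow> \<tau> g \<in> carrier_mat n n" for A \<tau>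
      using conj_iff[OF that(1) that(2) sc] by blast
    show ?thesis unfolding rep_equiv_def
    proof
      assume "\<exists>A\<in>M UNIV. \<forall>g\<in>carrier G. \<sigma> g = A * twist \<gamma> \<epsilon> \<rho> g * minv A"
      then obtain A where A: "A \<in> M UNIV" "\<forall>g\<in>carrier G. \<sigma> g * A = A * twist \<gamma> \<epsilon> \<rho> g"
        using iff tw by blast
      have "\<forall>g\<in>carrier G. \<sigma> g * (A * C) = (A * C) * \<rho> g"
        using trans[OF M_carrier[OF A(1)] M_carrier[OF C] rho_carrier tw sc twC] A(2) by blast
      then have "\<forall>g\<in>carrier G. \<sigma> g = (A * C) * \<rho> g * minv (A * C)"
        using conj_iff[OF M_mult[OF UNIV_field A(1) C] rho_carrier sc] by simp
      then show "\<exists>A\<in>M UNIV. \<forall>g\<in>carrier G. \<sigma> g = A * \<rho> g * minv A"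
        using M_mult[OF UNIV_field A(1) C] by blast
    next
      assume "\<exists>A\<in>M UNIV. \<forall>g\<in>carrier G. \<sigma> g = A * \<rho> g * minv A"
      then obtain A where A: "A \<in> M UNIV" "\<forall>g\<in>carrier G. \<sigma> g * A = A * \<rho> g"
        using iff rho_carrier by blast
      note C' = M_inv(1)[OF C]
      have "\<rho> g * minv C = minv C * twist \<gamma> \<epsilon> \<rho> g" if "g \<in> carrier G" for g
        by (rule intertwine_sym[OF C rho_carrier[OF that] tw[OF that] twC[OF that]])
      then have "\<forall>g\<in>carrier G. \<sigma> g * (A * minv C) = (A * minv C) * twist \<gamma> \<epsilon> \<rho> g"
        using trans[OF M_carrier[OF A(1)] M_carrier[OF C'] tw rho_carrier sc] A(2) by blast
      then have "\<forall>g\<in>carrier G. \<sigma> g = (A * minv C) * twist \<gamma> \<epsilon> \<rho> g * minv (A * minv C)"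
        using conj_iff[OF M_mult[OF UNIV_field A(1) C'] tw sc] by simp
      then show "\<exists>A\<in>M UNIV. \<forall>g\<in>carrier G. \<sigma> g = A * twist \<gamma> \<epsilon> \<rho> g * minv A"
        using M_mult[OF UNIV_field A(1) C'] by blast
    qed
  qed
  then have "rep_class G T TL n M (twist \<gamma> \<epsilon> \<rho>) = rep_class G T TL n M \<rho>"
    unfolding rep_class_def by blast
  then show ?thesis using \<gamma> \<epsilon> by (simp add: stab_def)
qed

abbreviation "KR \<equiv> K_rep G T TL K n M \<rho>"

lemma KR_iff: "x \<in> KR \<longleftrightarrow> (\<forall>\<gamma> \<epsilon>. (\<gamma>, \<epsilon>) \<in> St \<longrightarrow> \<gamma> x = x)"
  by (auto simp: K_rep_def Gamma_rep_def)

lemma KR_field: "subfield_set KR" "K \<subseteq> KR"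
proof -
  show KKR: "K \<subseteq> KR"
  proof
    fix x assume "x \<in> K"
    then show "x \<in> KR" unfolding KR_iff using stabD(1) by (auto simp: Gal_iff)
  qed
  have g: "\<gamma> (x + y) = \<gamma> x + \<gamma> y" "\<gamma> (x * y) = \<gamma> x * \<gamma> y" if "(\<gamma>, \<epsilon>) \<in> St" for \<gamma> \<epsilon> x y
    using stabD(1)[OF that] by (auto simp: Gal_iff)
  have fixed: "\<gamma> x = x" if "x \<in> KR" "(\<gamma>, \<epsilon>) \<in> St" for \<gamma> \<epsilon> x
    using that KR_iff by blast
  show "subfield_set KR"
  proof (rule subring_is_subfield[OF K_subfield[OF galois] algebraic_over[OF galois order_refl] KKR])
    fix x y assume "x \<in> KR" "y \<in> KR"
    then have "\<gamma> (x + y) = x + y" "\<gamma> (x * y) = x * y" if "(\<gamma>, \<epsilon>) \<in> St" for \<gamma> \<epsilon>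
      using g[OF that, of x y] fixed[OF _ that, of x] fixed[OF _ that, of y] by simp_all
    then show "x + y \<in> KR \<and> x * y \<in> KR" using KR_iff[of "x + y"] KR_iff[of "x * y"] by blast
  qed
qed

end

lemma smult_mat_simps:
  fixes A B :: "'a::field mat"
  assumes "dim_col A = dim_row B"
  shows "(c \<cdot>\<^sub>m A) * B = c \<cdot>\<^sub>m (A * B)" "A * (c \<cdot>\<^sub>m B) = c \<cdot>\<^sub>m (A * B)"
proof -
  have c: "A \<in> carrier_mat (dim_row A) (dim_row B)" "B \<in> carrier_mat (dim_row B) (dim_col B)"
    using assms by (auto intro!: carrier_matI)
  show "(c \<cdot>\<^sub>m A) * B = c \<cdot>\<^sub>m (A * B)" by (rule mult_smult_assoc_mat[OF c])
  show "A * (c \<cdot>\<^sub>m B) = c \<cdot>\<^sub>m (A * B)" by (rule mult_smult_distrib[OF c])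
qed

lemma smult_smult_mat: "c \<cdot>\<^sub>m (d \<cdot>\<^sub>m A) = (c * d) \<cdot>\<^sub>m (A :: 'a::field mat)"
  by (intro eq_matI) auto

text \<open>Change of basis for a semilinear intertwiner. In the application a, b and r are the
  \<gamma>-conjugates of A, B and R, so C turns into \<gamma>(A) C B.\<close>

lemma conjugate_intertwiner:
  fixes A B a b C R r :: "'a::field mat"
  assumes "A \<in> carrier_mat n n" "B \<in> carrier_mat n n" "a \<in> carrier_mat n n" "b \<in> carrier_mat n n"
    "C \<in> carrier_mat n n" "R \<in> carrier_mat n n" "r \<in> carrier_mat n n"
    and "B * A = 1\<^sub>m n" "b * a = 1\<^sub>m n" "r * C = C * R"
  shows "(a * r * b) * (a * C * B) = (a * C * B) * (A * R * B)"
proof -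
  have "(a * r * b) * (a * C * B) = a * r * (b * a) * C * B" using assms(1-7) by (simp add: mat_assoc)
  also have "\<dots> = a * (r * C) * B" unfolding assms(9) using assms(1-7) by (simp add: mat_assoc)
  also have "\<dots> = a * C * (B * A) * R * B" unfolding assms(8,10) using assms(1-7) by (simp add: mat_assoc)
  also have "\<dots> = (a * C * B) * (A * R * B)" using assms(1-7) by (simp add: mat_assoc)
  finally show ?thesis .
qed

context galois_rep
begin

abbreviation "I \<equiv> I_group G T TL K n M \<rho>"

section \<open>Bases adapted to the stabiliser\<close>

lemma char_mult:
  assumes "\<epsilon> \<in> chars G T TL" "g \<in> carrier G" "h \<in> carrier G"
  shows "\<epsilon> (g \<otimes>\<^bsub>G\<^esub> h) = \<epsilon> g * \<epsilon> h"
  using assms by (simp add: chars_def hom_def class_ring_simps)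

lemma char_one:
  assumes "(\<gamma>, \<epsilon>) \<in> St"
  shows "\<epsilon> \<one>\<^bsub>G\<^esub> = 1"
proof -
  interpret G: group G by (rule group_G)
  have "\<epsilon> \<one>\<^bsub>G\<^esub> = \<epsilon> \<one>\<^bsub>G\<^esub> * \<epsilon> \<one>\<^bsub>G\<^esub>"
    using char_mult[OF stabD(2)[OF assms], of "\<one>\<^bsub>G\<^esub>" "\<one>\<^bsub>G\<^esub>"] by simp
  then show ?thesis using stabD(3)[OF assms, of "\<one>\<^bsub>G\<^esub>"] by simp
qed

lemma I_carrier: "h \<in> I \<Longrightarrow> h \<in> carrier G"
  by (simp add: I_group_def)

lemma I_char: "h \<in> I \<Longrightarrow> (\<gamma>, \<epsilon>) \<in> St \<Longrightarrow> \<epsilon> h = 1"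
  unfolding I_group_def by blast

lemma I_one: "\<one>\<^bsub>G\<^esub> \<in> I"
proof -
  interpret G: group G by (rule group_G)
  show ?thesis unfolding I_group_def using char_one by blast
qed

lemma I_mult:
  assumes "g \<in> I" "h \<in> I"
  shows "g \<otimes>\<^bsub>G\<^esub> h \<in> I"
proof -
  interpret G: group G by (rule group_G)
  have "\<epsilon> (g \<otimes>\<^bsub>G\<^esub> h) = 1" if "(\<gamma>, \<epsilon>) \<in> St" for \<gamma> \<epsilon>
    using char_mult[OF stabD(2)[OF that] I_carrier[OF assms(1)] I_carrier[OF assms(2)]]
      I_char[OF assms(1) that] I_char[OF assms(2) that] by simp
  moreover have "g \<otimes>\<^bsub>G\<^esub> h \<in> carrier G" using assms I_carrier by blast
  ultimately show ?thesis unfolding I_group_def by blast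
qed

definition intertwines :: "('l \<Rightarrow> 'l) \<Rightarrow> ('g \<Rightarrow> 'l) \<Rightarrow> 'l mat \<Rightarrow> bool" where
  "intertwines \<gamma> \<epsilon> C \<longleftrightarrow> (\<gamma>, \<epsilon>) \<in> St \<and> C \<in> M UNIV \<and>
     (\<forall>g\<in>carrier G. map_mat \<gamma> (\<rho> g) * C = \<epsilon> g \<cdot>\<^sub>m (C * \<rho> g))"

text \<open>P exhibits the family of all C as a coboundary modulo scalars, for the whole stabiliser
  simultaneously.\<close>

definition adapted :: "'l mat \<Rightarrow> bool" where
  "adapted P \<longleftrightarrow> (\<forall>\<gamma> \<epsilon> C. intertwines \<gamma> \<epsilon> C \<longrightarrow> (\<exists>c. c \<noteq> 0 \<and> map_mat \<gamma> P = c \<cdot>\<^sub>m (C * P)))"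

lemma adaptedD: "adapted P \<Longrightarrow> intertwines \<gamma> \<epsilon> C \<Longrightarrow> \<exists>c. c \<noteq> 0 \<and> map_mat \<gamma> P = c \<cdot>\<^sub>m (C * P)"
  unfolding adapted_def by blast

text \<open>The residual hypothesis gives an integral conjugate r of \<rho> on \<open>I\<close>.
  Intertwiners are transported to r by A, and the basis found there is transported back by
  B.\<close>

lemma linear_adapted_basis:
  assumes irr: "resid_abs_irreducible v red n I \<rho>"
  shows "\<exists>P\<in>GL n UNIV. adapted P"
proof -
  interpret GL: matrix_functor n "GL n :: 'l set \<Rightarrow> 'l mat set" using n by unfold_locales auto
  obtain A where A: "A \<in> GL n UNIV"
    and int: "\<And>h. h \<in> I \<Longrightarrow> elements_mat (A * \<rho> h * inv\<^bsub>mat_group n (GL n UNIV)\<^esub> A) \<subseteq> {x. v x \<le> 1}"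
    and irr': "abs_irreducible n I (\<lambda>h. map_mat red (A * \<rho> h * inv\<^bsub>mat_group n (GL n UNIV)\<^esub> A))"
    using irr unfolding resid_abs_irreducible_def Let_def by blast
  define B where "B = inv\<^bsub>mat_group n (GL n UNIV)\<^esub> A"
  define r where "r h = A * \<rho> h * B" for h
  have B: "B \<in> GL n UNIV" "A * B = 1\<^sub>m n" "B * A = 1\<^sub>m n" using GL.M_inv[OF A] by (auto simp: B_def)
  note c = GL.M_carrier[OF A] GL.M_carrier[OF B(1)]
  have rho_c: "\<rho> h \<in> carrier_mat n n" if "h \<in> I" for h using rho_carrier[OF I_carrier[OF that]] .
  have rc: "r h \<in> carrier_mat n n" if "h \<in> I" for h using c rho_c[OF that] by (simp add: r_def)
  have rint: "integral n (r h)" if "h \<in> I" for h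
    using int[OF that] elements_mat_subset_iff[OF rc[OF that], of "{x. v x \<le> 1}"] rc[OF that]
    by (simp add: integral_def r_def B_def)
  have r1: "r \<one>\<^bsub>G\<^esub> = 1\<^sub>m n" using c B by (simp add: r_def rho_one)
  have rm: "r g * r h = r (g \<otimes>\<^bsub>G\<^esub> h)" if "g \<in> I" "h \<in> I" for g h
  proof -
    have "r g * r h = A * \<rho> g * (B * A) * \<rho> h * B"
      using c rho_c[OF that(1)] rho_c[OF that(2)] by (simp add: r_def mat_assoc)
    also have "\<dots> = A * (\<rho> g * \<rho> h) * B"
      unfolding B using c rho_c[OF that(1)] rho_c[OF that(2)] by (simp add: mat_assoc)
    finally show ?thesis using rho_mult[OF I_carrier[OF that(1)] I_carrier[OF that(2)]] by (simp add: r_def)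
  qed
  have rmI: "\<exists>k\<in>I. r g * r h = r k" if "g \<in> I" "h \<in> I" for g h
    using rm[OF that] I_mult[OF that] by blast
  define S where "S = {(\<gamma>, map_mat \<gamma> A * C * B) | \<gamma> \<epsilon> C. intertwines \<gamma> \<epsilon> C}"
  have S: "intertwiners n I r S"
    unfolding intertwiners_def
  proof (intro ballI, clarify)
    fix \<gamma> D assume "(\<gamma>, D) \<in> S"
    then obtain \<epsilon> C where D: "D = map_mat \<gamma> A * C * B" and C: "intertwines \<gamma> \<epsilon> C" unfolding S_def by blast
    have st: "(\<gamma>, \<epsilon>) \<in> St" and CM: "C \<in> M UNIV" using C by (auto simp: intertwines_def)
    note \<gamma> = Gal_hom[OF stabD(1)[OF st]]
    interpret \<gamma>: comm_ring_hom \<gamma> by (rule \<gamma>(1))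
    have aG: "map_mat \<gamma> A \<in> GL n UNIV" "map_mat \<gamma> B \<in> GL n UNIV" using GL.M_map \<gamma> A B by blast+
    have DG: "D \<in> GL n UNIV" unfolding D using GL.M_mult[OF UNIV_field] aG M_GL[OF CM] B by blast
    have ba: "map_mat \<gamma> B * map_mat \<gamma> A = 1\<^sub>m n" 
      using \<gamma>.mat_hom_mult[OF c(2,1)] B(3) \<gamma>.mat_hom_one by simp
    have "map_mat \<gamma> (r h) * D = D * r h" if h: "h \<in> I" for h
    proof -
      have Ar: "A * \<rho> h \<in> carrier_mat n n" using c rho_c[OF h] by simp
      have "map_mat \<gamma> (r h) = map_mat \<gamma> A * map_mat \<gamma> (\<rho> h) * map_mat \<gamma> B"
        unfolding r_def \<gamma>.mat_hom_mult[OF Ar c(2)] \<gamma>.mat_hom_mult[OF c(1) rho_c[OF h]] ..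
      moreover have "map_mat \<gamma> (\<rho> h) * C = C * \<rho> h"
        using C I_carrier[OF h] I_char[OF h st] by (auto simp: intertwines_def intro!: eq_matI)
      ultimately show ?thesis unfolding D r_def
        using conjugate_intertwiner[OF c GL.M_carrier[OF aG(1)] GL.M_carrier[OF aG(2)] M_carrier[OF CM] rho_c[OF h] _ B(3) ba]
          rho_c[OF h] by simp
    qed
    then show "comm_ring_hom \<gamma> \<and> (\<forall>x. v (\<gamma> x) = v x) \<and> D \<in> carrier_mat n n \<and> det D \<noteq> 0 \<and>
      (\<forall>h\<in>I. map_mat \<gamma> (r h) * D = D * r h)"
      using \<gamma> DG by (simp add: GL_iff)
  qed
  have nd: "nondegenerate ({..<n} \<times> {..<n}) ((\<lambda>h. ($$) (map_mat red (r h))) ` I)"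
  proof (rule abs_irreducible_nondegenerate)
    show "abs_irreducible n I (\<lambda>h. map_mat red (r h))" using irr' by (simp add: r_def B_def)
    show "map_mat red (r h) \<in> carrier_mat n n" if "h \<in> I" for h using rc[OF that] by simp
    show "\<one>\<^bsub>G\<^esub> \<in> I" by (rule I_one)
    show "map_mat red (r \<one>\<^bsub>G\<^esub>) = 1\<^sub>m n" unfolding r1 by (rule integral_one(2))
    show "\<exists>k\<in>I. map_mat red (r g) * map_mat red (r h) = map_mat red (r k)" if "g \<in> I" "h \<in> I" for g h
      using integral_mult(2)[OF rint[OF that(1)] rint[OF that(2)]] rm[OF that] I_mult[OF that] by metis
  qed
  have fin: "\<exists>F. finite F \<and> subfield_set F \<and> W \<subseteq> F" if "finite W" for W :: "'k set"
    using coefficients that by (simp add: coefficient_field_def)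
  have compl: "\<exists>E. subfield_set E \<and> complete_subset v E \<and> W \<subseteq> E" if "finite W" for W :: "'l set"
    using coefficients that by (simp add: coefficient_field_def)
  obtain P where P: "P \<in> carrier_mat n n" "det P \<noteq> 0"
    "\<forall>(\<gamma>, D)\<in>S. \<exists>c. c \<noteq> 0 \<and> map_mat \<gamma> P = c \<cdot>\<^sub>m (D * P)"
    using adapted_basis[OF n S rint I_one r1 rmI nd fin compl] by blast
  have PG: "P \<in> GL n UNIV" using P by (simp add: GL_iff)
  have "\<exists>c. c \<noteq> 0 \<and> map_mat \<gamma> (B * P) = c \<cdot>\<^sub>m (C * (B * P))" if C: "intertwines \<gamma> \<epsilon> C" for \<gamma> \<epsilon> C
  proof -
    have st: "(\<gamma>, \<epsilon>) \<in> St" and CM: "C \<in> M UNIV" using C by (auto simp: intertwines_def)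
    interpret \<gamma>: comm_ring_hom \<gamma> by (rule Gal_hom(1)[OF stabD(1)[OF st]])
    have "(\<gamma>, map_mat \<gamma> A * C * B) \<in> S" using C unfolding S_def by blast
    then obtain k where k: "k \<noteq> 0" "map_mat \<gamma> P = k \<cdot>\<^sub>m (map_mat \<gamma> A * C * B * P)" using P(3) by blast
    have ba: "map_mat \<gamma> B * map_mat \<gamma> A = 1\<^sub>m n" 
      using \<gamma>.mat_hom_mult[OF c(2,1)] B(3) \<gamma>.mat_hom_one by simp
    have "map_mat \<gamma> (B * P) = map_mat \<gamma> B * (k \<cdot>\<^sub>m (map_mat \<gamma> A * C * B * P))"
      unfolding \<gamma>.mat_hom_mult[OF c(2) P(1)] k(2) ..
    also have "\<dots> = k \<cdot>\<^sub>m ((map_mat \<gamma> B * map_mat \<gamma> A) * (C * (B * P)))"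
      using c P(1) M_carrier[OF CM] by (simp add: smult_mat_simps mat_assoc)
    also have "\<dots> = k \<cdot>\<^sub>m (C * (B * P))" unfolding ba using c P(1) M_carrier[OF CM] by simp
    finally show ?thesis using k(1) by blast
  qed
  then have "adapted (B * P)" by (simp add: adapted_def)
  then show ?thesis using GL.M_mult[OF UNIV_field B(1) PG] by (rule bexI)
qed

text \<open>The factor k in \<gamma>(A) = k A cancels in a quotient of two entries.\<close>

lemma fixed_by_stabilizer:
  assumes "A \<in> carrier_mat n n" "i < n" "j < n" "A $$ (i, j) \<noteq> 0" "a < n" "b < n"
    and "\<And>\<gamma> \<epsilon>. (\<gamma>, \<epsilon>) \<in> St \<Longrightarrow> \<exists>k. map_mat \<gamma> A = k \<cdot>\<^sub>m A"
  shows "inverse (A $$ (i, j)) * A $$ (a, b) \<in> KR"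
  unfolding KR_iff
proof (intro allI impI)
  fix \<gamma> \<epsilon> assume st: "(\<gamma>, \<epsilon>) \<in> St"
  have hom: "\<gamma> (x * y) = \<gamma> x * \<gamma> y" "\<gamma> x = 0 \<longleftrightarrow> x = 0" for x y
    using stabD(1)[OF st] Gal_hom(4) by (auto simp: Gal_iff)
  obtain k where k: "map_mat \<gamma> A = k \<cdot>\<^sub>m A" using assms(7)[OF st] by blast
  have e: "\<gamma> (A $$ p) = k * A $$ p" if "p \<in> {..<n} \<times> {..<n}" for p
    using arg_cong[OF k, of "\<lambda>A. A $$ p"] that assms(1) by auto
  let ?u = "A $$ (i, j)" and ?w = "inverse (A $$ (i, j)) * A $$ (a, b)"
  have "\<gamma> ?u * \<gamma> ?w = \<gamma> (A $$ (a, b))" using assms(4) by (simp add: hom(1)[symmetric] field_simps)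
  also have "\<dots> = k * A $$ (a, b)" using e[of "(a, b)"] assms(5,6) by simp
  also have "\<dots> = (k * ?u) * ?w" using assms(4) by simp
  also have "k * ?u = \<gamma> ?u" using e[of "(i, j)"] assms(2,3) by simp
  finally have "\<gamma> ?u * \<gamma> ?w = \<gamma> ?u * ?w" .
  moreover have "\<gamma> ?u \<noteq> 0" using hom(2) assms(4) by simp
  ultimately show "\<gamma> ?w = ?w" using mult_left_cancel by blast
qed

text \<open>The linear construction need not produce a similitude. But \<gamma> moves the
  transported form by c^2 a, with a the multiplier of C, so the form has entries in
  \<open>KR\<close> once divided by one of them. Correcting P by a matrix Q over \<open>KR\<close>
  keeps it adapted because \<gamma>(Q) = Q.\<close>

lemma adapted_basis_in_M:
  assumes irr: "resid_abs_irreducible v red n I \<rho>"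
  shows "\<exists>P\<in>M UNIV. adapted P"
proof (cases "M = GL n")
  case True
  then show ?thesis using linear_adapted_basis[OF irr] by simp
next
  case False
  then have e: "even n" "M = GSp n" using M by auto
  interpret GL: matrix_functor n "GL n :: 'l set \<Rightarrow> 'l mat set" using n by unfold_locales auto
  obtain P where PG: "P \<in> GL n UNIV" and "adapted P"
    using linear_adapted_basis[OF irr] by (elim bexE)
  note P = adaptedD[OF this(2)]
  have Pc: "P \<in> carrier_mat n n" and Pd: "det P \<noteq> 0" using PG by (auto simp: GL_iff)
  let ?J = "symp_mat n :: 'l mat"
  have Jc: "?J \<in> carrier_mat n n" by (rule symp_mat_carrier[OF e(1)])
  define J where "J = P\<^sup>T * ?J * P"
  have J: "J \<in> carrier_mat n n" using Jc Pc by (simp add: J_def)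
  have PJc: "P\<^sup>T * ?J \<in> carrier_mat n n" and PTc: "P\<^sup>T \<in> carrier_mat n n" using Jc Pc by auto
  have "det J = det P * det ?J * det P"
    unfolding J_def det_mult[OF PJc Pc] det_mult[OF PTc Jc] det_transpose[OF Pc] ..
  then have dJ: "det J \<noteq> 0" using Pd det_symp_mat[OF e(1)] by simp
  have JG: "J \<in> GL n UNIV" using J dJ by (simp add: GL_iff)
  have \<gamma>J: "\<exists>k. map_mat \<gamma> J = k \<cdot>\<^sub>m J" if st: "(\<gamma>, \<epsilon>) \<in> St" for \<gamma> \<epsilon>
  proof -
    note \<gamma> = Gal_hom[OF stabD(1)[OF st]]
    interpret \<gamma>: comm_ring_hom \<gamma> by (rule \<gamma>(1))
    obtain C where C: "intertwines \<gamma> \<epsilon> C" using stabD(4)[OF st] st by (auto simp: intertwines_def)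
    then have CM: "C \<in> M UNIV" by (simp add: intertwines_def)
    then obtain a where a: "C\<^sup>T * ?J * C = a \<cdot>\<^sub>m ?J" using e GSp_E by metis
    obtain c where c: "map_mat \<gamma> P = c \<cdot>\<^sub>m (C * P)" using P[OF C] by blast
    note Cc = M_carrier[OF CM]
    have t: "map_mat \<gamma> (P\<^sup>T) = c \<cdot>\<^sub>m (P\<^sup>T * C\<^sup>T)"
    proof -
      have "map_mat \<gamma> (P\<^sup>T) = (map_mat \<gamma> P)\<^sup>T" by (intro eq_matI) auto
      also have "\<dots> = c \<cdot>\<^sub>m (C * P)\<^sup>T" unfolding c by (intro eq_matI) auto
      finally show ?thesis unfolding transpose_mult[OF Cc Pc] .
    qed
    have "map_mat \<gamma> J = map_mat \<gamma> (P\<^sup>T) * map_mat \<gamma> ?J * map_mat \<gamma> P"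
      unfolding J_def \<gamma>.mat_hom_mult[OF PJc Pc] \<gamma>.mat_hom_mult[OF PTc Jc] ..
    also have "\<dots> = (c \<cdot>\<^sub>m (P\<^sup>T * C\<^sup>T)) * ?J * (c \<cdot>\<^sub>m (C * P))"
      unfolding t c map_symp_mat[OF \<gamma>(1) e(1)] ..
    also have "\<dots> = (c * c) \<cdot>\<^sub>m (P\<^sup>T * (C\<^sup>T * ?J * C) * P)"
      using Cc Pc Jc by (simp add: smult_mat_simps smult_smult_mat mat_assoc)
    also have "\<dots> = (c * c * a) \<cdot>\<^sub>m J"
      unfolding a J_def using Pc Jc by (simp add: smult_mat_simps smult_smult_mat)
    finally show ?thesis by blast
  qed
  obtain p q where pq: "p < n" "q < n" "J $$ (p, q) \<noteq> 0" by (rule GL.M_nonzero_entry[OF JG])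
  define u where "u = J $$ (p, q)"
  have u: "u \<noteq> 0" using pq by (simp add: u_def)
  let ?F = "inverse u \<cdot>\<^sub>m J"
  have F: "?F \<in> carrier_mat n n" "det ?F \<noteq> 0" using J dJ u by auto
  have FK: "?F $$ (i, j) \<in> KR" if "i < n" "j < n" for i j
    using fixed_by_stabilizer[OF J pq that \<gamma>J] that J by (simp add: u_def)
  have FK': "elements_mat ?F \<subseteq> KR" using FK elements_mat_subset_iff[OF F(1)] by blast
  have s0: "?J $$ (i, i) = 0" if "i < n" for i by (rule symp_mat_alternating(1)[OF e(1) that that])
  have s1: "?J $$ (j, i) = - ?J $$ (i, j)" if "i < n" "j < n" for i j
    by (rule symp_mat_alternating(2)[OF e(1) that])
  have F1: "?F $$ (i, i) = 0" if "i < n" for i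
    using alternating_congruence(1)[OF Jc s0 s1 Pc that that, folded J_def] that J by simp
  have F2: "?F $$ (j, i) = - ?F $$ (i, j)" if "i < n" "j < n" for i j
  proof -
    have "J $$ (j, i) = - J $$ (i, j)" unfolding J_def by (rule alternating_congruence(2)[OF Jc s0 s1 Pc that])
    then have "inverse u * J $$ (j, i) = - (inverse u * J $$ (i, j))" by simp
    then show ?thesis using that J by simp
  qed
  obtain Q where Q: "Q \<in> carrier_mat n n" "elements_mat Q \<subseteq> KR" "Q\<^sup>T * ?F * Q = ?J"
    using symplectic_basis[OF KR_field(1) F(1) FK' F(2) F1 F2 e(1)] by blast
  have QTc: "Q\<^sup>T \<in> carrier_mat n n" and QFc: "Q\<^sup>T * ?F \<in> carrier_mat n n" using Q(1) F(1) by auto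
  have "det ?J = det Q * det ?F * det Q"
    unfolding Q(3)[symmetric] det_mult[OF QFc Q(1)] det_mult[OF QTc F(1)] det_transpose[OF Q(1)] ..
  then have dQ: "det Q \<noteq> 0" using det_symp_mat[OF e(1), where 'l='l] by auto
  have QG: "Q \<in> GL n UNIV" using Q(1) dQ by (simp add: GL_iff)
  have "u \<cdot>\<^sub>m ?F = J" using u by (simp add: smult_smult_mat) (intro eq_matI, auto)
  \<comment> \<open>The multiplier of \<open>P * Q\<close> is the entry u by which the form was
    divided.\<close>
  then have "(P * Q)\<^sup>T * ?J * (P * Q) = Q\<^sup>T * (u \<cdot>\<^sub>m ?F) * Q"
    using Pc Q(1) Jc by (simp add: transpose_mult[OF Pc Q(1)] mat_assoc J_def)
  also have "\<dots> = u \<cdot>\<^sub>m (Q\<^sup>T * ?F * Q)" using Q(1) J by (simp add: smult_mat_simps smult_smult_mat)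
  finally have "(P * Q)\<^sup>T * ?J * (P * Q) = u \<cdot>\<^sub>m ?J" unfolding Q(3) .
  then have PQ: "P * Q \<in> M UNIV" using GSp_I[OF GL.M_mult[OF UNIV_field PG QG]] u e by simp
  have "\<exists>c. c \<noteq> 0 \<and> map_mat \<gamma> (P * Q) = c \<cdot>\<^sub>m (C * (P * Q))" if C: "intertwines \<gamma> \<epsilon> C" for \<gamma> \<epsilon> C
  proof -
    have st: "(\<gamma>, \<epsilon>) \<in> St" and CM: "C \<in> M UNIV" using C by (auto simp: intertwines_def)
    interpret \<gamma>: comm_ring_hom \<gamma> by (rule Gal_hom(1)[OF stabD(1)[OF st]])
    obtain c where c: "c \<noteq> 0" "map_mat \<gamma> P = c \<cdot>\<^sub>m (C * P)" using P[OF C] by blast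
    have "Q $$ (i, j) \<in> KR" if "i < n" "j < n" for i j
      using Q(2) elements_mat_subset_iff[OF Q(1)] that by blast
    then have "\<gamma> (Q $$ (i, j)) = Q $$ (i, j)" if "i < n" "j < n" for i j
      using that st KR_iff by blast
    then have "map_mat \<gamma> Q = Q" using Q(1) by (intro eq_matI) auto
    then have "map_mat \<gamma> (P * Q) = c \<cdot>\<^sub>m (C * (P * Q))"
      unfolding \<gamma>.mat_hom_mult[OF Pc Q(1)] c(2)
      using Pc Q(1) M_carrier[OF CM] by (simp add: smult_mat_simps mat_assoc)
    then show ?thesis using c(1) by blast
  qed
  then have "adapted (P * Q)" by (simp add: adapted_def)
  then show ?thesis using PQ by (rule bexI)
qed

lemma projective_descent:
  assumes irr: "resid_abs_irreducible v red n I \<rho>"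
  shows "\<exists>A\<in>M UNIV. \<forall>g\<in>carrier G. \<exists>c h. c \<noteq> 0 \<and> h \<in> M KR \<and> A * \<rho> g * minv A = c \<cdot>\<^sub>m h"
proof -
  obtain P where PM: "P \<in> M UNIV" and "adapted P"
    using adapted_basis_in_M[OF irr] by (elim bexE)
  note P = adaptedD[OF this(2)]
  note Pi = M_inv[OF PM]
  note c = M_carrier[OF PM] M_carrier[OF Pi(1)]
  interpret Gr: group "mat_group n (M UNIV)" by (rule group_M[OF UNIV_field])
  have inv_inv: "minv (minv P) = P" using Gr.inv_inv[of P] PM by simp
  have "\<exists>c h. c \<noteq> 0 \<and> h \<in> M KR \<and> minv P * \<rho> g * P = c \<cdot>\<^sub>m h" if g: "g \<in> carrier G" for g
  proof -
    let ?R = "minv P * \<rho> g * P"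
    note rc = rho_carrier[OF g]
    have RM: "?R \<in> M UNIV" by (intro M_mult[OF UNIV_field] Pi PM rho_M g)
    note Rc = M_carrier[OF RM]
    have \<gamma>R: "\<exists>k. map_mat \<gamma> ?R = k \<cdot>\<^sub>m ?R" if st: "(\<gamma>, \<epsilon>) \<in> St" for \<gamma> \<epsilon>
    proof -
      note \<gamma> = Gal_hom[OF stabD(1)[OF st]]
      interpret \<gamma>: comm_ring_hom \<gamma> by (rule \<gamma>(1))
      obtain C where C: "intertwines \<gamma> \<epsilon> C" using stabD(4)[OF st] st by (auto simp: intertwines_def)
      then have CM: "C \<in> M UNIV" and Cr: "map_mat \<gamma> (\<rho> g) * C = \<epsilon> g \<cdot>\<^sub>m (C * \<rho> g)"
        using g by (auto simp: intertwines_def)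
      note Cc = M_carrier[OF CM]
      obtain a where a: "a \<noteq> 0" "map_mat \<gamma> P = a \<cdot>\<^sub>m (C * P)" using P[OF C] by blast
      let ?p = "map_mat \<gamma> P" and ?r = "map_mat \<gamma> (\<rho> g)" and ?q = "map_mat \<gamma> (minv P)"
      have rP: "minv P * \<rho> g \<in> carrier_mat n n" using c rc by simp
      \<comment> \<open>Rewriting \<rho>(g) P as P R brings back the factor a C P = \<gamma>(P),
        which cancels against its inverse.\<close>
      have PR: "P * ?R = \<rho> g * P"
      proof -
        have "P * ?R = (P * minv P) * (\<rho> g * P)" using c rc by (simp add: mat_assoc)
        then show ?thesis unfolding Pi(2) using c rc by simp
      qed
      have qp: "?q * ?p = 1\<^sub>m n" using \<gamma>.mat_hom_mult[OF c(2,1)] Pi(3) \<gamma>.mat_hom_one by simp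
      have "map_mat \<gamma> ?R = ?q * ?r * ?p"
        unfolding \<gamma>.mat_hom_mult[OF rP c(1)] \<gamma>.mat_hom_mult[OF c(2) rc] ..
      also have "\<dots> = a \<cdot>\<^sub>m (?q * (?r * C) * P)"
        unfolding a(2) using c rc Cc by (simp add: smult_mat_simps mat_assoc)
      also have "\<dots> = (a * \<epsilon> g) \<cdot>\<^sub>m (?q * (C * (\<rho> g * P)))"
        unfolding Cr using c rc Cc by (simp add: smult_mat_simps smult_smult_mat mat_assoc)
      also have "\<dots> = \<epsilon> g \<cdot>\<^sub>m (?q * (a \<cdot>\<^sub>m (C * P)) * ?R)"
        unfolding PR[symmetric] using c Rc Cc
        by (simp add: smult_mat_simps smult_smult_mat mat_assoc mult.commute del: assoc_mult_mat)
      also have "\<dots> = \<epsilon> g \<cdot>\<^sub>m ?R" unfolding a(2)[symmetric] qp left_mult_one_mat[OF Rc] ..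
      finally show ?thesis by blast
    qed
    obtain i j where ij: "i < n" "j < n" "?R $$ (i, j) \<noteq> 0" by (rule M_nonzero_entry[OF RM])
    let ?u = "?R $$ (i, j)"
    have h: "inverse ?u \<cdot>\<^sub>m ?R \<in> M UNIV" by (rule M_smult[OF RM _ _ UNIV_field]) (use ij in auto)
    have "(inverse ?u \<cdot>\<^sub>m ?R) $$ (a, b) \<in> KR" if "a < n" "b < n" for a b
    proof -
      have "(inverse ?u \<cdot>\<^sub>m ?R) $$ (a, b) = inverse ?u * ?R $$ (a, b)"
        using that Rc by (intro index_smult_mat) auto
      then show ?thesis using fixed_by_stabilizer[OF Rc ij that \<gamma>R] by simp
    qed
    then have "inverse ?u \<cdot>\<^sub>m ?R \<in> M KR" by (rule M_descend[OF h _ KR_field(1)])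
    moreover have "?R = ?u \<cdot>\<^sub>m (inverse ?u \<cdot>\<^sub>m ?R)"
      unfolding smult_smult_mat using ij(3) by (intro eq_matI) auto
    ultimately show ?thesis using ij(3) by blast
  qed
  then show ?thesis using Pi(1) inv_inv by (intro bexI[of _ "minv P"]) auto
qed

section \<open>Projective representations with rational representatives\<close>

abbreviation (input) descends_via :: "'l set \<Rightarrow> 'l mat \<Rightarrow> bool" where
  "descends_via F A \<equiv> A \<in> M UNIV \<and>
     (\<forall>g\<in>carrier G. \<exists>c h. c \<noteq> 0 \<and> h \<in> M F \<and> A * \<rho> g * minv A = c \<cdot>\<^sub>m h)"

lemma conj_in_M: "A \<in> M UNIV \<Longrightarrow> g \<in> carrier G \<Longrightarrow> A * \<rho> g * minv A \<in> M UNIV"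
  by (intro M_mult[OF UNIV_field] M_inv(1) rho_M)

lemma conj_mult:
  assumes A: "A \<in> M UNIV" and g: "g \<in> carrier G" and h: "h \<in> carrier G"
  shows "A * \<rho> (g \<otimes>\<^bsub>G\<^esub> h) * minv A = (A * \<rho> g * minv A) * (A * \<rho> h * minv A)"
proof -
  note c = M_carrier[OF A] M_carrier[OF M_inv(1)[OF A]] rho_carrier[OF g] rho_carrier[OF h]
  have "(A * \<rho> g * minv A) * (A * \<rho> h * minv A) = A * \<rho> g * (minv A * A) * \<rho> h * minv A"
    using c by (simp add: mat_assoc)
  also have "\<dots> = A * (\<rho> g * \<rho> h) * minv A" unfolding M_inv(3)[OF A] using c by (simp add: mat_assoc)
  finally show ?thesis using rho_mult[OF g h] by simp
qed

lemma conj_continuous: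
  assumes A: "A \<in> M UNIV" and ij: "i < n" "j < n" and g: "g \<in> carrier G"
  shows "cont_at T (\<lambda>g. (A * \<rho> g * minv A) $$ (i, j)) g"
proof (rule cont_at_cong)
  note c = M_carrier[OF A] M_carrier[OF M_inv(1)[OF A]]
  have gT: "g \<in> topspace T" using g by (simp add: topspace_T)
  show "cont_at T (\<lambda>g. \<Sum>l<n. (\<Sum>k<n. A $$ (i, k) * \<rho> g $$ (k, l)) * minv A $$ (l, j)) g"
    by (intro cont_at_sum[OF gT] cont_at_mult cont_at_const[OF gT] rho_continuous) (use g in auto)
  show "openin T (carrier G)" using openin_topspace[of T] by (simp add: topspace_T)
  fix h assume h: "h \<in> carrier G"
  have Ar: "A * \<rho> h \<in> carrier_mat n n" using c rho_carrier[OF h] by simp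
  have e: "(A * \<rho> h) $$ (i, l) = (\<Sum>k<n. A $$ (i, k) * \<rho> h $$ (k, l))" if "l < n" for l
    by (rule index_mult_mat_sum[OF c(1) rho_carrier[OF h] ij(1) that])
  show "(A * \<rho> h * minv A) $$ (i, j) = (\<Sum>l<n. (\<Sum>k<n. A $$ (i, k) * \<rho> h $$ (k, l)) * minv A $$ (l, j))"
    unfolding index_mult_mat_sum[OF Ar c(2) ij] by (intro sum.cong refl) (simp only: e lessThan_iff)
qed (use g in auto)

lemma proj_conj:
  assumes A: "A \<in> M UNIV" and g: "g \<in> carrier G"
  shows "proj_class n M UNIV A \<otimes>\<^bsub>proj_group n M UNIV\<^esub> proj_class n M UNIV (\<rho> g)
      \<otimes>\<^bsub>proj_group n M UNIV\<^esub> inv\<^bsub>proj_group n M UNIV\<^esub> (proj_class n M UNIV A)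
    = proj_class n M UNIV (A * \<rho> g * minv A)"
  using proj_mult[OF UNIV_field A rho_M[OF g]] proj_inv[OF A]
    proj_mult[OF UNIV_field M_mult[OF UNIV_field A rho_M[OF g]] M_inv(1)[OF A]] by simp

lemma descends_viaI:
  assumes F: "subfield_set F" and d: "proj_descends_to G T TL n M \<rho> F"
  shows "\<exists>A. descends_via F A"
proof -
  obtain \<tau> where eq: "proj_equiv G n M (\<lambda>g. proj_class n M UNIV (\<rho> g)) \<tau>"
    and fac: "factors_through G T TL n M F \<tau>"
    using d unfolding proj_descends_to_def by (elim exE conjE)
  obtain A where A: "A \<in> M UNIV" and \<tau>: "\<And>g. g \<in> carrier G \<Longrightarrow> \<tau> g = proj_class n M UNIV (A * \<rho> g * minv A)"
    using eq proj_conj unfolding proj_equiv_def by auto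
  obtain \<sigma> where \<sigma>: "proj_rep G T TL n M F \<sigma>" "\<And>g. g \<in> carrier G \<Longrightarrow> \<tau> g = proj_incl n M (\<sigma> g)"
    using fac unfolding factors_through_def by auto
  have "\<exists>c h. c \<noteq> 0 \<and> h \<in> M F \<and> A * \<rho> g * minv A = c \<cdot>\<^sub>m h" if g: "g \<in> carrier G" for g
  proof -
    have "\<sigma> g \<in> proj_class n M F ` M F"
      using \<sigma>(1) g by (auto simp: proj_rep_def hom_def simp flip: proj_carrier)
    then obtain h where h: "h \<in> M F" "\<sigma> g = proj_class n M F h" by blast
    have "proj_class n M UNIV (A * \<rho> g * minv A) = proj_class n M UNIV h"
      using \<tau>[OF g] \<sigma>(2)[OF g] h(2) proj_incl_class[OF h(1) F] by simp
    then obtain c where "c \<in> UNIV - {0}" "A * \<rho> g * minv A = c \<cdot>\<^sub>m h"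
      using proj_class_eq_iff[OF UNIV_field M_carrier[OF conj_in_M[OF A g]] M_carrier[OF h(1)]] by blast
    then show ?thesis using h(1) by blast
  qed
  then show ?thesis using A by blast
qed

lemma ratio_in_field:
  assumes F: "subfield_set F" and U: "U \<in> M F" and V: "V \<in> M F" and d: "U = d \<cdot>\<^sub>m V"
  shows "d \<in> F"
proof -
  obtain i j where ij: "i < n" "j < n" "V $$ (i, j) \<noteq> 0" by (rule M_nonzero_entry[OF M_mono[OF V]])
  have "U $$ (i, j) = d * V $$ (i, j)" unfolding d using ij M_carrier[OF V] by simp
  then have "d = U $$ (i, j) / V $$ (i, j)" using ij(3) by simp
  moreover have "U $$ (i, j) \<in> F" "V $$ (i, j) \<in> F"
    using M_GL[OF U] M_GL[OF V] ij by (auto simp: GL_iff)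
  ultimately show ?thesis using subfield_setD(8)[OF F] by simp
qed

text \<open>The rational multiples k(g) are chosen one by one and need not vary continuously. Their
  classes are multiplicative since the scalar between k(g h) and k(g) k(h) lies in \<open>F\<close>.
  Continuity is local: near a point, dividing R by an entry that does not vanish there gives a
  continuous rational choice.\<close>

lemma proj_descendsI:
  assumes F: "subfield_set F" and d: "descends_via F A"
  shows "proj_descends_to G T TL n M \<rho> F"
proof -
  have A: "A \<in> M UNIV" using d by (rule conjunct1)
  define R where "R g = A * \<rho> g * minv A" for g
  have RM: "R g \<in> M UNIV" if "g \<in> carrier G" for g unfolding R_def by (rule conj_in_M[OF A that])
  have Rm: "R (g \<otimes>\<^bsub>G\<^esub> h) = R g * R h" if "g \<in> carrier G" "h \<in> carrier G" for g h
    unfolding R_def by (rule conj_mult[OF A that])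
  have Rc: "cont_at T (\<lambda>g. R g $$ (i, j)) g" if "i < n" "j < n" "g \<in> carrier G" for i j g
    unfolding R_def by (rule conj_continuous[OF A that])
  have "\<forall>g\<in>carrier G. \<exists>h. h \<in> M F \<and> (\<exists>c. c \<noteq> 0 \<and> R g = c \<cdot>\<^sub>m h)"
    using conjunct2[OF d] unfolding R_def by blast
  from bchoice[OF this] obtain k where k: "\<And>g. g \<in> carrier G \<Longrightarrow> k g \<in> M F"
      "\<And>g. g \<in> carrier G \<Longrightarrow> \<exists>c. c \<noteq> 0 \<and> R g = c \<cdot>\<^sub>m k g" by blast
  interpret G: group G by (rule group_G)
  define \<tau> where "\<tau> g = proj_class n M UNIV (R g)" for g
  define \<sigma> where "\<sigma> g = proj_class n M F (k g)" for g
  let ?Y = "mat_topology TL n (M F)"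
  have "continuous_map T (mat_topology TL n (M UNIV)) R"
    unfolding continuous_map_mat_topology[OF topspace_abs_topology] continuous_map_abs_topology topspace_T
    using RM Rc by auto
  from continuous_map_compose[OF this continuous_map_quot_topology[of _ "proj_class n M UNIV"]]
  have \<tau>c: "continuous_map T (proj_topology TL n M UNIV) \<tau>"
    by (simp add: \<tau>_def[abs_def] o_def proj_topology_def)
  have \<tau>h: "\<tau> \<in> hom G (proj_group n M UNIV)"
    unfolding hom_def proj_carrier \<tau>_def using RM Rm proj_mult[OF UNIV_field] by auto
  have \<sigma>h: "\<sigma> \<in> hom G (proj_group n M F)"
    unfolding hom_def proj_carrier
  proof (intro CollectI conjI ballI)
    show "\<sigma> \<in> carrier G \<rightarrow> proj_class n M F ` M F" using k(1) by (auto simp: \<sigma>_def)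
    fix g h assume g: "g \<in> carrier G" and h: "h \<in> carrier G"
    have gh: "g \<otimes>\<^bsub>G\<^esub> h \<in> carrier G" using g h by simp
    obtain a where a: "a \<noteq> 0" "R g = a \<cdot>\<^sub>m k g" using k(2)[OF g] by blast
    obtain b where b: "b \<noteq> 0" "R h = b \<cdot>\<^sub>m k h" using k(2)[OF h] by blast
    obtain c where c: "c \<noteq> 0" "R (g \<otimes>\<^bsub>G\<^esub> h) = c \<cdot>\<^sub>m k (g \<otimes>\<^bsub>G\<^esub> h)" using k(2)[OF gh] by blast
    note cc = M_carrier[OF k(1)[OF g]] M_carrier[OF k(1)[OF h]]
    have kk: "k g * k h \<in> M F" by (intro M_mult[OF F] k g h)
    have "k (g \<otimes>\<^bsub>G\<^esub> h) = inverse c \<cdot>\<^sub>m R (g \<otimes>\<^bsub>G\<^esub> h)" unfolding c(2) using c(1) by (intro eq_matI) auto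
    also have "R (g \<otimes>\<^bsub>G\<^esub> h) = (a \<cdot>\<^sub>m k g) * (b \<cdot>\<^sub>m k h)" unfolding Rm[OF g h] a(2) b(2) ..
    also have "\<dots> = a \<cdot>\<^sub>m (k g * (b \<cdot>\<^sub>m k h))" by (rule mult_smult_assoc_mat[OF cc(1)]) (use cc in auto)
    also have "k g * (b \<cdot>\<^sub>m k h) = b \<cdot>\<^sub>m (k g * k h)" by (rule mult_smult_distrib[OF cc])
    also have "inverse c \<cdot>\<^sub>m (a \<cdot>\<^sub>m (b \<cdot>\<^sub>m (k g * k h))) = (inverse c * a * b) \<cdot>\<^sub>m (k g * k h)"
      by (intro eq_matI) auto
    finally have e: "k (g \<otimes>\<^bsub>G\<^esub> h) = (inverse c * a * b) \<cdot>\<^sub>m (k g * k h)" .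
    have "inverse c * a * b \<in> F - {0}"
      using ratio_in_field[OF F k(1)[OF gh] kk e] a b c by simp
    then have "proj_class n M F (k (g \<otimes>\<^bsub>G\<^esub> h)) = proj_class n M F (k g * k h)"
      using proj_class_eq_iff[OF F M_carrier[OF k(1)[OF gh]] M_carrier[OF kk]] e by blast
    then show "\<sigma> (g \<otimes>\<^bsub>G\<^esub> h) = \<sigma> g \<otimes>\<^bsub>proj_group n M F\<^esub> \<sigma> h"
      unfolding \<sigma>_def proj_mult[OF F k(1)[OF g] k(1)[OF h]] .
  qed
  have local: "\<exists>W. openin T W \<and> g0 \<in> W \<and> continuous_map (subtopology T W) (proj_topology TL n M F) \<sigma>"
    if g0: "g0 \<in> carrier G" for g0
  proof -
    obtain p q where pq: "p < n" "q < n" "R g0 $$ (p, q) \<noteq> 0" by (rule M_nonzero_entry[OF RM[OF g0]])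
    obtain W where W: "openin T W" "g0 \<in> W" "\<forall>g\<in>W. v (R g $$ (p, q)) = v (R g0 $$ (p, q))"
      using cont_at_nonzero[OF Rc[OF pq(1,2) g0] pq(3)] by (elim exE conjE)
    have WG: "g \<in> carrier G" if "g \<in> W" for g using openin_subset[OF W(1)] that by (auto simp: topspace_T)
    have nz: "R g $$ (p, q) \<noteq> 0" if "g \<in> W" for g using bspec[OF W(3) that] pq(3) v_eq_0_iff by metis
    \<comment> \<open>R and k are proportional, so dividing either by its (p, q) entry gives the
      same matrix: continuous by the first description, rational by the second.\<close>
    define k' where "k' g = inverse (R g $$ (p, q)) \<cdot>\<^sub>m R g" for g
    have k': "k' g = inverse (k g $$ (p, q)) \<cdot>\<^sub>m k g" "inverse (k g $$ (p, q)) \<in> F - {0}" if g: "g \<in> W" for g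
    proof -
      obtain c where c: "c \<noteq> 0" "R g = c \<cdot>\<^sub>m k g" using k(2)[OF WG[OF g]] by blast
      note kc = M_carrier[OF k(1)[OF WG[OF g]]]
      have e: "R g $$ (p, q) = c * k g $$ (p, q)" unfolding c(2) using kc pq by simp
      show "k' g = inverse (k g $$ (p, q)) \<cdot>\<^sub>m k g"
        unfolding k'_def e unfolding c(2) using c(1) by (intro eq_matI) auto
      have "k g $$ (p, q) \<noteq> 0" using nz[OF g] e by auto
      moreover have "k g $$ (p, q) \<in> F" using M_GL[OF k(1)[OF WG[OF g]]] pq by (simp add: GL_iff)
      ultimately show "inverse (k g $$ (p, q)) \<in> F - {0}" using subfield_setD(6)[OF F] by simp
    qed
    have k'M: "k' g \<in> M F" if g: "g \<in> W" for g
      unfolding k'(1)[OF g] by (rule M_smult[OF k(1)[OF WG[OF g]] _ _ F]) (use k'(2)[OF g] in auto)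
    have \<sigma>k': "\<sigma> g = proj_class n M F (k' g)" if g: "g \<in> W" for g
      using proj_class_eq_iff[OF F M_carrier[OF k'M[OF g]] M_carrier[OF k(1)[OF WG[OF g]]]] k'[OF g]
      unfolding \<sigma>_def by blast
    have tW: "topspace (subtopology T W) = W" using openin_subset[OF W(1)] by auto
    have "cont_at (subtopology T W) (\<lambda>g. k' g $$ (i, j)) g" if ij: "i < n" "j < n" and g: "g \<in> W" for i j g
    proof (rule cont_at_subtopology[OF _ g], rule cont_at_cong[OF _ W(1) g])
      show "cont_at T (\<lambda>g. inverse (R g $$ (p, q)) * R g $$ (i, j)) g"
        by (intro cont_at_mult cont_at_inverse Rc pq ij WG g nz)
      fix h assume "h \<in> W"
      then have "R h \<in> carrier_mat n n" using RM WG M_carrier by blast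
      then show "k' h $$ (i, j) = inverse (R h $$ (p, q)) * R h $$ (i, j)" using ij by (simp add: k'_def)
    qed
    then have "continuous_map (subtopology T W) ?Y k'"
      unfolding continuous_map_mat_topology[OF topspace_abs_topology] continuous_map_abs_topology tW
      using k'M by auto
    from continuous_map_compose[OF this continuous_map_quot_topology[of _ "proj_class n M F"]]
    have "continuous_map (subtopology T W) (proj_topology TL n M F) (proj_class n M F \<circ> k')"
      by (simp add: proj_topology_def)
    then have "continuous_map (subtopology T W) (proj_topology TL n M F) \<sigma>"
      by (rule continuous_map_eq) (use \<sigma>k' tW in auto)
    then show ?thesis using W(1,2) by blast
  qed
  have \<sigma>c: "continuous_map T (proj_topology TL n M F) \<sigma>"
  proof (rule pasting_lemma[where I = "{W. openin T W \<and> continuous_map (subtopology T W) (proj_topology TL n M F) \<sigma>}"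
        and T = "\<lambda>W. W" and f = "\<lambda>_. \<sigma>"])
    fix g assume "g \<in> topspace T"
    then show "\<exists>W. W \<in> {W. openin T W \<and> continuous_map (subtopology T W) (proj_topology TL n M F) \<sigma>} \<and> g \<in> W \<and> \<sigma> g = \<sigma> g"
      using local[of g] by (simp add: topspace_T conj_ac)
  qed auto
  have "\<tau> g = proj_incl n M (\<sigma> g)" if g: "g \<in> carrier G" for g
  proof -
    obtain c where c: "c \<noteq> 0" "R g = c \<cdot>\<^sub>m k g" using k(2)[OF g] by blast
    then have "proj_class n M UNIV (R g) = proj_class n M UNIV (k g)"
      using proj_class_eq_iff[OF UNIV_field M_carrier[OF RM[OF g]] M_carrier[OF k(1)[OF g]]] by blast
    then show ?thesis using proj_incl_class[OF k(1)[OF g] F] by (simp add: \<tau>_def \<sigma>_def)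
  qed
  then have "factors_through G T TL n M F \<tau>"
    unfolding factors_through_def proj_rep_def using \<sigma>h \<sigma>c by blast
  moreover have "proj_equiv G n M (\<lambda>g. proj_class n M UNIV (\<rho> g)) \<tau>"
    unfolding proj_equiv_def using A proj_conj[OF A] by (intro bexI[of _ A]) (simp_all add: \<tau>_def R_def)
  ultimately show ?thesis
    unfolding proj_descends_to_def proj_rep_def using \<tau>h \<tau>c by blast
qed

text \<open>If the conjugate at g is c h with h rational, \<gamma> multiplies it by \<gamma>(c) / c,
  which is \<epsilon>(g). It is multiplicative because a nonzero matrix determines its scalar; the
  intertwiner is the inverse of \<gamma>(A) times A.\<close>

lemma fixing_automorphism_in_stab:
  assumes F: "subfield_set F" "K \<subseteq> F" and d: "descends_via F A" and \<gamma>F: "\<gamma> \<in> Gal F"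
  shows "\<exists>\<epsilon>. (\<gamma>, \<epsilon>) \<in> St"
proof -
  have A: "A \<in> M UNIV" using d by (rule conjunct1)
  have \<gamma>K: "\<gamma> \<in> Gal K" and fixed: "\<And>x. x \<in> F \<Longrightarrow> \<gamma> x = x" using \<gamma>F F(2) by (auto simp: Gal_iff)
  note \<gamma> = Gal_hom[OF \<gamma>K]
  interpret \<gamma>: comm_ring_hom \<gamma> by (rule \<gamma>(1))
  interpret G: group G by (rule group_G)
  define R where "R g = A * \<rho> g * minv A" for g
  have RM: "R g \<in> M UNIV" if "g \<in> carrier G" for g unfolding R_def by (rule conj_in_M[OF A that])
  note Rcar = M_carrier[OF RM]
  have "\<forall>g\<in>carrier G. \<exists>e. e \<noteq> 0 \<and> map_mat \<gamma> (R g) = e \<cdot>\<^sub>m R g"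
  proof
    fix g assume g: "g \<in> carrier G"
    then obtain c h where c: "c \<noteq> 0" and h: "h \<in> M F" and e: "R g = c \<cdot>\<^sub>m h"
      using conjunct2[OF d] unfolding R_def by blast
    have hF: "\<gamma> (h $$ (i, j)) = h $$ (i, j)" if "i < n" "j < n" for i j
      by (rule fixed) (use M_GL[OF h] that in \<open>simp add: GL_iff\<close>)
    have "map_mat \<gamma> (R g) = (\<gamma> c / c) \<cdot>\<^sub>m R g"
      unfolding e using M_carrier[OF h] c hF by (intro eq_matI) (auto simp: \<gamma>.hom_mult)
    moreover have "\<gamma> c / c \<noteq> 0" using c \<gamma>(4)[of c] by simp
    ultimately show "\<exists>e. e \<noteq> 0 \<and> map_mat \<gamma> (R g) = e \<cdot>\<^sub>m R g" by blast
  qed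
  from bchoice[OF this] obtain \<epsilon> where \<epsilon>: "\<And>g. g \<in> carrier G \<Longrightarrow> \<epsilon> g \<noteq> 0"
    "\<And>g. g \<in> carrier G \<Longrightarrow> map_mat \<gamma> (R g) = \<epsilon> g \<cdot>\<^sub>m R g" by blast
  have mult: "\<epsilon> (g \<otimes>\<^bsub>G\<^esub> h) = \<epsilon> g * \<epsilon> h" if g: "g \<in> carrier G" and h: "h \<in> carrier G" for g h
  proof -
    have gh: "g \<otimes>\<^bsub>G\<^esub> h \<in> carrier G" using g h by simp
    have Rm: "R (g \<otimes>\<^bsub>G\<^esub> h) = R g * R h" unfolding R_def by (rule conj_mult[OF A g h])
    have "\<epsilon> (g \<otimes>\<^bsub>G\<^esub> h) \<cdot>\<^sub>m R (g \<otimes>\<^bsub>G\<^esub> h) = map_mat \<gamma> (R (g \<otimes>\<^bsub>G\<^esub> h))"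
      by (rule \<epsilon>(2)[OF gh, symmetric])
    also have "\<dots> = map_mat \<gamma> (R g) * map_mat \<gamma> (R h)"
      unfolding Rm by (rule \<gamma>.mat_hom_mult[OF Rcar[OF g] Rcar[OF h]])
    also have "\<dots> = (\<epsilon> g \<cdot>\<^sub>m R g) * (\<epsilon> h \<cdot>\<^sub>m R h)" unfolding \<epsilon>(2)[OF g] \<epsilon>(2)[OF h] ..
    also have "\<dots> = \<epsilon> g \<cdot>\<^sub>m (R g * (\<epsilon> h \<cdot>\<^sub>m R h))"
      by (rule mult_smult_assoc_mat[OF Rcar[OF g]]) (use Rcar[OF h] in auto)
    also have "R g * (\<epsilon> h \<cdot>\<^sub>m R h) = \<epsilon> h \<cdot>\<^sub>m (R g * R h)" by (rule mult_smult_distrib[OF Rcar[OF g] Rcar[OF h]])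
    also have "\<epsilon> g \<cdot>\<^sub>m (\<epsilon> h \<cdot>\<^sub>m (R g * R h)) = (\<epsilon> g * \<epsilon> h) \<cdot>\<^sub>m R (g \<otimes>\<^bsub>G\<^esub> h)"
      unfolding Rm by (intro eq_matI) auto
    finally show ?thesis by (rule scalar_ratio[OF RM[OF gh]])
  qed
  have cont: "cont_at T \<epsilon> g0" if g0: "g0 \<in> carrier G" for g0
  proof -
    have Rc: "cont_at T (\<lambda>g. R g $$ (i, j)) g0" if "i < n" "j < n" for i j
      unfolding R_def by (rule conj_continuous[OF A that g0])
    obtain p q where pq: "p < n" "q < n" "R g0 $$ (p, q) \<noteq> 0" by (rule M_nonzero_entry[OF RM[OF g0]])
    obtain W where W: "openin T W" "g0 \<in> W" "\<forall>g\<in>W. v (R g $$ (p, q)) = v (R g0 $$ (p, q))"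
      using cont_at_nonzero[OF Rc[OF pq(1,2)] pq(3)] by (elim exE conjE)
    show ?thesis
    proof (rule cont_at_cong[OF _ W(1,2)])
      \<comment> \<open>Near g0 the character is a quotient of matrix entries, and \<gamma>
        preserves continuity because it is an isometry.\<close>
      show "cont_at T (\<lambda>g. \<gamma> (R g $$ (p, q)) * inverse (R g $$ (p, q))) g0"
        by (rule cont_at_mult[OF cont_at_automorphism[OF Rc[OF pq(1,2)] \<gamma>.hom_add \<gamma>(3)]
              cont_at_inverse[OF Rc[OF pq(1,2)] pq(3)]])
      fix g assume g: "g \<in> W"
      have gG: "g \<in> carrier G" using openin_subset[OF W(1)] g by (auto simp: topspace_T)
      have "R g $$ (p, q) \<noteq> 0" using bspec[OF W(3) g] pq(3) v_eq_0_iff by metis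
      moreover have "\<gamma> (R g $$ (p, q)) = \<epsilon> g * R g $$ (p, q)"
        using arg_cong[OF \<epsilon>(2)[OF gG], of "\<lambda>A. A $$ (p, q)"] pq Rcar[OF gG] by simp
      ultimately show "\<epsilon> g = \<gamma> (R g $$ (p, q)) * inverse (R g $$ (p, q))" by simp
    qed
  qed
  have \<epsilon>c: "\<epsilon> \<in> chars G T TL"
    unfolding chars_def hom_def continuous_map_abs_topology topspace_T
    using \<epsilon>(1) mult cont by (simp add: class_ring_simps)
  define C where "C = minv (map_mat \<gamma> A) * A"
  have aM: "map_mat \<gamma> A \<in> M UNIV" by (rule M_map[OF A \<gamma>(1,2)])
  have CM: "C \<in> M UNIV" unfolding C_def by (intro M_mult[OF UNIV_field] M_inv(1) aM A)
  have "map_mat \<gamma> (\<rho> g) * C = \<epsilon> g \<cdot>\<^sub>m (C * \<rho> g)" if g: "g \<in> carrier G" for g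
  proof -
    let ?a = "map_mat \<gamma> A" and ?b = "minv (map_mat \<gamma> A)" and ?r = "map_mat \<gamma> (\<rho> g)"
    have ac: "?a \<in> carrier_mat n n" and bc: "?b \<in> carrier_mat n n" and Ac: "A \<in> carrier_mat n n"
      using M_carrier aM M_inv(1)[OF aM] A by blast+
    have rc: "\<rho> g \<in> carrier_mat n n" and mc: "?r \<in> carrier_mat n n" using rho_carrier[OF g] by auto
    have RA: "R g * A = A * \<rho> g" using conj_iff[OF A rc Rcar[OF g]] by (simp add: R_def)
    have gR: "map_mat \<gamma> (R g) * ?a = ?a * ?r"
      unfolding \<gamma>.mat_hom_mult[OF Rcar[OF g] Ac, symmetric] RA by (rule \<gamma>.mat_hom_mult[OF Ac rc])
    have "?r * ?b = ?b * map_mat \<gamma> (R g)"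
      by (rule intertwine_sym[OF aM mc _ gR]) (use Rcar[OF g] in simp)
    then have rb: "?r * ?b = \<epsilon> g \<cdot>\<^sub>m (?b * R g)"
      unfolding \<epsilon>(2)[OF g] mult_smult_distrib[OF bc Rcar[OF g]] .
    have "?r * C = (?r * ?b) * A" unfolding C_def by (rule assoc_mult_mat[OF mc bc Ac, symmetric])
    also have "\<dots> = \<epsilon> g \<cdot>\<^sub>m (?b * R g * A)"
      unfolding rb by (rule mult_smult_assoc_mat[OF mult_carrier_mat[OF bc Rcar[OF g]] Ac])
    also have "?b * R g * A = C * \<rho> g"
      unfolding C_def assoc_mult_mat[OF bc Rcar[OF g] Ac] RA assoc_mult_mat[OF bc Ac rc] ..
    finally show ?thesis .
  qed
  then show ?thesis using stabI[OF \<gamma>K \<epsilon>c CM] by blast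
qed

lemma KR_minimal:
  assumes F: "subfield_set F" "K \<subseteq> F" and d: "proj_descends_to G T TL n M \<rho> F"
  shows "KR \<subseteq> F"
proof
  fix x assume x: "x \<in> KR"
  obtain A where A: "descends_via F A" using descends_viaI[OF F(1) d] by blast
  show "x \<in> F"
  proof (rule ccontr)
    assume "x \<notin> F"
    then obtain \<gamma> where \<gamma>: "\<gamma> \<in> Gal F" "\<gamma> x \<noteq> x" by (rule galois_moves[OF galois F])
    obtain \<epsilon> where "(\<gamma>, \<epsilon>) \<in> St" using fixing_automorphism_in_stab[OF F A \<gamma>(1)] by blast
    then show False using x \<gamma>(2) KR_iff by blast
  qed
qed

end

section \<open>Conclusion for both kinds of base field\<close>

lemma (in galois_rep) smallest_descent_field:
  assumes irr: "resid_abs_irreducible v red n I \<rho>"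
  shows "subfield KR class_ring \<and> K \<subseteq> KR \<and> proj_descends_to G T TL n M \<rho> KR \<and>
    (\<forall>F. subfield F class_ring \<and> K \<subseteq> F \<and> proj_descends_to G T TL n M \<rho> F \<longrightarrow> KR \<subseteq> F)"
proof -
  obtain A where A: "A \<in> M UNIV"
    "\<forall>g\<in>carrier G. \<exists>c h. c \<noteq> 0 \<and> h \<in> M KR \<and> A * \<rho> g * minv A = c \<cdot>\<^sub>m h"
    using projective_descent[OF irr] by (elim bexE)
  have "proj_descends_to G T TL n M \<rho> KR" by (rule proj_descendsI[OF KR_field(1) conjI[OF A]])
  then show ?thesis using KR_field KR_minimal unfolding subfield_iff by simp
qed

text \<open>Every matrix is integral for the trivial absolute value, so the identity serves as the
  conjugating matrix and reduction changes nothing.\<close>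

lemma resid_abs_irreducible_trivial:
  fixes \<rho> :: "'g \<Rightarrow> 'l::field mat"
  assumes irr: "abs_irreducible n H \<rho>" and \<rho>: "\<And>h. h \<in> H \<Longrightarrow> \<rho> h \<in> carrier_mat n n"
  shows "resid_abs_irreducible trivial_abs id n H \<rho>"
proof -
  have n: "n > 0" using irr by (simp add: abs_irreducible_def irreducible_rep_def)
  interpret GL: matrix_functor n "GL n :: 'l set \<Rightarrow> 'l mat set" using n by unfold_locales auto
  let ?i = "inv\<^bsub>mat_group n (GL n UNIV)\<^esub> (1\<^sub>m n :: 'l mat)"
  have one: "(1\<^sub>m n :: 'l mat) \<in> GL n UNIV" by (rule GL.M_one[OF GL.UNIV_field])
  have i: "?i = 1\<^sub>m n"
    using GL.M_inv(2)[OF one] left_mult_one_mat[OF GL.M_carrier[OF GL.M_inv(1)[OF one]]] by simp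
  have e: "1\<^sub>m n * \<rho> h * ?i = \<rho> h" if "h \<in> H" for h unfolding i using \<rho>[OF that] by simp
  have "elements_mat (1\<^sub>m n * \<rho> h * ?i) \<subseteq> {x. trivial_abs x \<le> 1}" if "h \<in> H" for h
    by (auto simp: trivial_abs_def)
  moreover have "map_mat to_ac (map_mat id (1\<^sub>m n * \<rho> h * ?i)) = map_mat to_ac (\<rho> h)" if "h \<in> H" for h
    unfolding e[OF that] by (intro eq_matI) auto
  then have "abs_irreducible n H (\<lambda>h. map_mat id (1\<^sub>m n * \<rho> h * ?i))"
    using irr unfolding abs_irreducible_def irreducible_rep_def by (simp cong: ball_cong)
  ultimately show ?thesis unfolding resid_abs_irreducible_def Let_def using one by blast
qed

theorem theorem2p15:
  fixes K :: "'l::field set" and v :: "'l \<Rightarrow> real" and red :: "'l \<Rightarrow> 'k::field"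
    and G :: "'g monoid" and T :: "'g topology" and TL :: "'l topology"
    and n :: nat and M :: "'l set \<Rightarrow> 'l mat set" and \<rho> :: "'g \<Rightarrow> 'l mat"
  assumes K: "finite K \<or> (\<exists>l. prime l \<and> finite_ext_of_ladic l v K \<and> residue_map v red)"
    and L: "galois_extension K"
    and TL: "TL = coeff_topology K v"
    and G: "topological_group G T" "compact_space T"
    and M: "M = GL n \<or> (even n \<and> M = GSp n)"
    and rho: "representation G T TL n M \<rho>"
    and irr: "if finite K then abs_irreducible n (I_group G T TL K n M \<rho>) \<rho>
              else resid_abs_irreducible v red n (I_group G T TL K n M \<rho>) \<rho>"
  shows "subfield (K_rep G T TL K n M \<rho>) class_ring \<and> K \<subseteq> K_rep G T TL K n M \<rho> \<and>
         proj_descends_to G T TL n M \<rho> (K_rep G T TL K n M \<rho>) \<and>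
         (\<forall>F. subfield F class_ring \<and> K \<subseteq> F \<and> proj_descends_to G T TL n M \<rho> F
              \<longrightarrow> K_rep G T TL K n M \<rho> \<subseteq> F)"
proof -
  \<comment> \<open>Both notions of irreducibility include n > 0, which the common locale
    requires.\<close>
  have n: "n > 0"
    using irr by (auto simp: resid_abs_irreducible_def Let_def abs_irreducible_def irreducible_rep_def split: if_splits)
  show ?thesis
  proof (cases "finite K")
    case True
    \<comment> \<open>For finite K the given v and \<open>red\<close> give way to the trivial
      absolute value and \<open>id\<close>; the topology stays discrete.\<close>
    have TL': "TL = abs_topology trivial_abs"
      unfolding TL coeff_topology_def abs_topology_trivial using True by simp
    have cf: "coefficient_field trivial_abs (id :: 'l \<Rightarrow> 'l) K" by (rule coefficient_field_finite[OF True L])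
    interpret galois_rep trivial_abs "id :: 'l \<Rightarrow> 'l" n M K G T \<rho>
      using cf n M L G(1) rho TL' by unfold_locales (auto simp: coefficient_field_def)
    have "resid_abs_irreducible trivial_abs (id :: 'l \<Rightarrow> 'l) n (I_group G T TL K n M \<rho>) \<rho>"
      by (rule resid_abs_irreducible_trivial)
        (use irr True in \<open>simp_all add: rho_carrier I_group_def\<close>)
    then show ?thesis using smallest_descent_field unfolding TL' by blast
  next
    case False
    then obtain l where l: "prime l" "finite_ext_of_ladic l v K" "residue_map v red" using K by blast
    have TL': "TL = abs_topology v" unfolding TL coeff_topology_def using False by simp
    have cf: "coefficient_field v red K" by (rule coefficient_field_ladic[OF l L])
    interpret galois_rep v red n M K G T \<rho>
      using cf n M L G(1) rho TL' by unfold_locales (auto simp: coefficient_field_def)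
    show ?thesis using smallest_descent_field irr False unfolding TL' by simp
  qed
qed

end
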